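(* Let $B$ be a basic, connected, finite dimensional $\Bbbk$-algebra with a complete and irredundant set $\{e_1,\dots,e_n\}$ of primitive, pairwise orthogonal idempotents, let $\mathscr{C}_B$ be the $2$-category of projective bimodules defined in the context, and let $G_{ij}$ denote the $1$-morphism of $\mathscr{C}_B$ corresponding to tensoring with $Be_i\otimes_\Bbbk e_jB$. For every $1\leq j\leq n$, the $1$-morphism $G_{jj}$ is the Duflo involution in (that is, it belongs to and is the Duflo involution for) the left cell $\mathcal{L}_j=\{[G_{ij}] \mid 1\leq i\leq n\}$.
   Context: $\Bbbk$ is an algebraically closed field; all categories and functors are $\Bbbk$-linear; modules are finitely generated left modules. The finitary $2$-category $\mathscr{C}_B$ has one object $\mathtt{i}$ (identified with a small category $\mathcal{B}$ equivalent to $B$-mod); its $1$-morphisms are the functors given, up to equivalence with $B$-mod, by functors from the additive closure of ${}_BB\otimes_\Bbbk B_B\otimes_B{}_-$ and the identity functor; its $2$-morphisms are all natural transformations of functors. $\mathbb{1}_{\mathtt{i}}$ is the identity functor. Indecomposable $1$-morphisms are identified with their isomorphism classes. Left cells: for indecomposable $1$-morphisms $F,G$, write $G\geq_L F$ if $G$ is isomorphic to a direct summand of $H\circ F$ for some $1$-morphism $H$; left cells are the equivalence classes of $F\sim_L G$ ($F\ge_L G$ and $G\ge_L F$). Each $\mathcal{L}_j$ is a left cell of $\mathscr{C}_B$. Abelianized principal $2$-representation (one-object finitary $2$-category $\mathscr{C}$ with object $\mathtt{i}$): $\overline{\mathbf{P}}_{\mathtt{i}}(\mathtt{i})$ is the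 abelian category whose objects are diagrams $X\overset{\alpha}{\to}Y$ in $\mathscr{C}(\mathtt{i},\mathtt{i})$; morphisms from $X\overset{\alpha}{\to}Y$ to $X'\overset{\alpha'}{\to}Y'$ are pairs $(f:X\to X',\,g:Y\to Y')$ with $g\alpha=\alpha' f$, modulo those pairs for which $g=\alpha' h$ for some $h:Y\to X'$. A $1$-morphism $F$ acts on it componentwise by left composition, sending $X\overset{\alpha}{\to}Y$ to $F\circ X\overset{F(\alpha)}{\to}F\circ Y$. For an indecomposable $1$-morphism $F$, $P_F$ denotes the indecomposable projective object $0\to F$ and $L_F$ its simple top. Duflo involution: let $\mathcal{L}$ be a left cell of $\mathscr{C}$. An indecomposable $1$-morphism $G$ (not necessarily in $\mathcal{L}$) is a Duflo involution for $\mathcal{L}$ if there is a subobject $K\subset P_{\mathbb{1}_{\mathtt{i}}}$ in $\overline{\mathbf{P}}_{\mathtt{i}}(\mathtt{i})$ such that (1) $F L_H=0$ for all $F\in\mathcal{L}$ and all simple subquotients $L_H$ of $P_{\mathbb{1}_{\mathtt{i}}}/K$; (2) $K$ has a simple top isomorphic to $L_G$; (3) $F L_G\neq 0$ for all $F\in\mathcal{L}$. *)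

theory Defs
  imports
    "HOL-Computational_Algebra.Computational_Algebra"
    "HOL-Computational_Algebra.Group_Closure"
    "HOL-Library.FuncSet"
    "HOL-Library.Poly_Mapping"
begin

section \<open>Linear categories\<close>

text \<open>An arrow determines its source and target; \<open>cmp C g f\<close> is ``\<open>g\<close> after \<open>f\<close>''.\<close>

record ('k, 'o, 'a) lincat =
  obj :: "'o set"
  arr :: "'a set"
  src :: "'a \<Rightarrow> 'o"
  tgt :: "'a \<Rightarrow> 'o"
  idt :: "'o \<Rightarrow> 'a"
  cmp :: "'a \<Rightarrow> 'a \<Rightarrow> 'a"
  zro :: "'o \<Rightarrow> 'o \<Rightarrow> 'a"
  add :: "'a \<Rightarrow> 'a \<Rightarrow> 'a"
  scl :: "'k \<Rightarrow> 'a \<Rightarrow> 'a"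

definition hom :: "('k, 'o, 'a, 'z) lincat_scheme \<Rightarrow> 'o \<Rightarrow> 'o \<Rightarrow> 'a set" where
  "hom C X Y = {f \<in> arr C. src C f = X \<and> tgt C f = Y}"

definition is_iso :: "('k, 'o, 'a, 'z) lincat_scheme \<Rightarrow> 'a \<Rightarrow> bool" where
  "is_iso C f \<longleftrightarrow> f \<in> arr C \<and>
     (\<exists>g \<in> hom C (tgt C f) (src C f).
        cmp C g f = idt C (src C f) \<and> cmp C f g = idt C (tgt C f))"

definition isomorphic :: "('k, 'o, 'a, 'z) lincat_scheme \<Rightarrow> 'o \<Rightarrow> 'o \<Rightarrow> bool" where
  "isomorphic C X Y \<longleftrightarrow> X \<in> obj C \<and> Y \<in> obj C \<and> (\<exists>f \<in> hom C X Y. is_iso C f)"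

definition is_zero :: "('k, 'o, 'a, 'z) lincat_scheme \<Rightarrow> 'o \<Rightarrow> bool" where
  "is_zero C Z \<longleftrightarrow> Z \<in> obj C \<and>
     (\<forall>X \<in> obj C. (\<exists>!f. f \<in> hom C X Z) \<and> (\<exists>!f. f \<in> hom C Z X))"

definition zero_object :: "('k, 'o, 'a, 'z) lincat_scheme \<Rightarrow> 'o" where
  "zero_object C = (SOME Z. is_zero C Z)"

definition is_mono :: "('k, 'o, 'a, 'z) lincat_scheme \<Rightarrow> 'a \<Rightarrow> bool" where
  "is_mono C m \<longleftrightarrow> m \<in> arr C \<and>
     (\<forall>f \<in> arr C. \<forall>g \<in> arr C. src C f = src C g \<and> tgt C f = src C m \<and> tgt C g = src C m \<and>
        cmp C m f = cmp C m g \<longrightarrow> f = g)"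

definition is_epi :: "('k, 'o, 'a, 'z) lincat_scheme \<Rightarrow> 'a \<Rightarrow> bool" where
  "is_epi C q \<longleftrightarrow> q \<in> arr C \<and>
     (\<forall>f \<in> arr C. \<forall>g \<in> arr C. tgt C f = tgt C g \<and> src C f = tgt C q \<and> src C g = tgt C q \<and>
        cmp C f q = cmp C g q \<longrightarrow> f = g)"

definition is_cokernel :: "('k, 'o, 'a, 'z) lincat_scheme \<Rightarrow> 'a \<Rightarrow> 'a \<Rightarrow> bool" where
  "is_cokernel C f q \<longleftrightarrow> f \<in> arr C \<and> q \<in> arr C \<and> src C q = tgt C f \<and>
     cmp C q f = zro C (src C f) (tgt C q) \<and>
     (\<forall>g \<in> arr C. src C g = tgt C f \<and> cmp C g f = zro C (src C f) (tgt C g) \<longrightarrow>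
        (\<exists>!u. u \<in> hom C (tgt C q) (tgt C g) \<and> cmp C u q = g))"

text \<open>Finite biproducts; the empty list gives a zero object.\<close>

definition is_biproduct :: "('k, 'o, 'a, 'z) lincat_scheme \<Rightarrow> 'o list \<Rightarrow> 'o \<Rightarrow> bool" where
  "is_biproduct C Xs S \<longleftrightarrow> set Xs \<subseteq> obj C \<and> S \<in> obj C \<and>
     (\<exists>\<iota> \<pi>. (\<forall>i < length Xs. \<iota> i \<in> hom C (Xs ! i) S \<and> \<pi> i \<in> hom C S (Xs ! i)) \<and>
        (\<forall>i < length Xs. \<forall>l < length Xs.
           cmp C (\<pi> l) (\<iota> i) = (if i = l then idt C (Xs ! i) else zro C (Xs ! i) (Xs ! l))) \<and>
        foldr (\<lambda>i. add C (cmp C (\<iota> i) (\<pi> i))) [0..<length Xs] (zro C S S) = idt C S)"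

text \<open>``\<open>X\<close> is isomorphic to a direct summand of \<open>S\<close>''.\<close>

definition direct_summand :: "('k, 'o, 'a, 'z) lincat_scheme \<Rightarrow> 'o \<Rightarrow> 'o \<Rightarrow> bool" where
  "direct_summand C X S \<longleftrightarrow> (\<exists>Y. is_biproduct C [X, Y] S)"

definition indecomposable :: "('k, 'o, 'a, 'z) lincat_scheme \<Rightarrow> 'o \<Rightarrow> bool" where
  "indecomposable C S \<longleftrightarrow> S \<in> obj C \<and> \<not> is_zero C S \<and>
     (\<forall>X Y. is_biproduct C [X, Y] S \<longrightarrow> is_zero C X \<or> is_zero C Y)"

definition additive_closure :: "('k, 'o, 'a, 'z) lincat_scheme \<Rightarrow> 'o set \<Rightarrow> 'o set" where
  "additive_closure C A =
     {X. \<exists>Xs S. set Xs \<subseteq> A \<and> is_biproduct C Xs S \<and> direct_summand C X S}"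

definition full_subcat ::
  "('k, 'o, 'a, 'z) lincat_scheme \<Rightarrow> 'o set \<Rightarrow> ('k, 'o, 'a, 'z) lincat_scheme" where
  "full_subcat C A = C\<lparr>obj := A, arr := {f \<in> arr C. src C f \<in> A \<and> tgt C f \<in> A}\<rparr>"

text \<open>
  A subobject of \<open>X\<close> is represented by a monomorphism into \<open>X\<close>, and \<open>sub_le\<close> is the
  inclusion preorder on subobjects.
\<close>

definition sub_le :: "('k, 'o, 'a, 'z) lincat_scheme \<Rightarrow> 'a \<Rightarrow> 'a \<Rightarrow> bool" where
  "sub_le C m m' \<longleftrightarrow> (\<exists>u \<in> hom C (src C m) (src C m'). cmp C m' u = m)"

definition is_subobject :: "('k, 'o, 'a, 'z) lincat_scheme \<Rightarrow> 'o \<Rightarrow> 'a \<Rightarrow> bool" where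
  "is_subobject C X m \<longleftrightarrow> X \<in> obj C \<and> is_mono C m \<and> tgt C m = X"

definition is_maximal_subobject :: "('k, 'o, 'a, 'z) lincat_scheme \<Rightarrow> 'o \<Rightarrow> 'a \<Rightarrow> bool" where
  "is_maximal_subobject C X m \<longleftrightarrow> is_subobject C X m \<and> \<not> is_iso C m \<and>
     (\<forall>m'. is_subobject C X m' \<and> sub_le C m m' \<longrightarrow> is_iso C m' \<or> sub_le C m' m)"

text \<open>The radical is the intersection of the maximal subobjects, and the top is its quotient.\<close>

definition is_radical :: "('k, 'o, 'a, 'z) lincat_scheme \<Rightarrow> 'o \<Rightarrow> 'a \<Rightarrow> bool" where
  "is_radical C X r \<longleftrightarrow> is_subobject C X r \<and>
     (\<forall>m. is_maximal_subobject C X m \<longrightarrow> sub_le C r m) \<and>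
     (\<forall>s. is_subobject C X s \<and> (\<forall>m. is_maximal_subobject C X m \<longrightarrow> sub_le C s m) \<longrightarrow>
        sub_le C s r)"

definition is_top :: "('k, 'o, 'a, 'z) lincat_scheme \<Rightarrow> 'o \<Rightarrow> 'o \<Rightarrow> bool" where
  "is_top C X T \<longleftrightarrow> (\<exists>r q. is_radical C X r \<and> is_cokernel C r q \<and> tgt C q = T)"

definition is_simple :: "('k, 'o, 'a, 'z) lincat_scheme \<Rightarrow> 'o \<Rightarrow> bool" where
  "is_simple C S \<longleftrightarrow> S \<in> obj C \<and> \<not> is_zero C S \<and>
     (\<forall>m. is_subobject C S m \<longrightarrow> is_zero C (src C m) \<or> is_iso C m)"

definition is_subquotient :: "('k, 'o, 'a, 'z) lincat_scheme \<Rightarrow> 'o \<Rightarrow> 'o \<Rightarrow> bool" where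
  "is_subquotient C X S \<longleftrightarrow>
     (\<exists>m q. is_subobject C X m \<and> is_epi C q \<and> src C q = src C m \<and> tgt C q = S)"


section \<open>Abelianization\<close>

text \<open>
  An object is an arrow \<open>\<alpha>\<close> of \<open>C\<close>, seen as a diagram. A morphism is a triple
  \<open>(\<alpha>, A, \<alpha>')\<close> where \<open>A\<close> is the class of a commuting pair \<open>(f, g)\<close> modulo the pairs whose second
  component is \<open>\<alpha>' h\<close> for some \<open>h\<close>.
\<close>

definition square :: "('k, 'o, 'a, 'z) lincat_scheme \<Rightarrow> 'a \<Rightarrow> 'a \<Rightarrow> ('a \<times> 'a) set" where
  "square C \<alpha> \<alpha>' = {(f, g). f \<in> hom C (src C \<alpha>) (src C \<alpha>') \<and> g \<in> hom C (tgt C \<alpha>) (tgt C \<alpha>') \<and>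
     cmp C g \<alpha> = cmp C \<alpha>' f}"

definition square_class ::
  "('k, 'o, 'a, 'z) lincat_scheme \<Rightarrow> 'a \<Rightarrow> 'a \<Rightarrow> 'a \<times> 'a \<Rightarrow> ('a \<times> 'a) set" where
  "square_class C \<alpha> \<alpha>' p = {p' \<in> square C \<alpha> \<alpha>'.
     \<exists>h \<in> hom C (tgt C \<alpha>) (src C \<alpha>'). snd p' = add C (snd p) (cmp C \<alpha>' h)}"

definition abelianization ::
  "('k, 'o, 'a, 'z) lincat_scheme \<Rightarrow> ('k, 'a, 'a \<times> ('a \<times> 'a) set \<times> 'a) lincat" where
  "abelianization C = \<lparr>
     obj = arr C,
     arr = {(\<alpha>, A, \<alpha>'). \<alpha> \<in> arr C \<and> \<alpha>' \<in> arr C \<and> A \<in> square_class C \<alpha> \<alpha>' ` square C \<alpha> \<alpha>'},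
     src = (\<lambda>(\<alpha>, A, \<alpha>'). \<alpha>),
     tgt = (\<lambda>(\<alpha>, A, \<alpha>'). \<alpha>'),
     idt = (\<lambda>\<alpha>. (\<alpha>, square_class C \<alpha> \<alpha> (idt C (src C \<alpha>), idt C (tgt C \<alpha>)), \<alpha>)),
     cmp = (\<lambda>(\<alpha>1, A', \<alpha>2) (\<alpha>0, A, \<alpha>1').
       (\<alpha>0, \<Union>(f', g') \<in> A'. \<Union>(f, g) \<in> A. square_class C \<alpha>0 \<alpha>2 (cmp C f' f, cmp C g' g), \<alpha>2)),
     zro = (\<lambda>\<alpha> \<alpha>'. (\<alpha>, square_class C \<alpha> \<alpha>'
       (zro C (src C \<alpha>) (src C \<alpha>'), zro C (tgt C \<alpha>) (tgt C \<alpha>')), \<alpha>')),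
     add = (\<lambda>(\<alpha>, A, \<alpha>') (\<beta>, A', \<beta>').
       (\<alpha>, \<Union>(f, g) \<in> A. \<Union>(f', g') \<in> A'. square_class C \<alpha> \<alpha>' (add C f f', add C g g'), \<alpha>')),
     scl = (\<lambda>c (\<alpha>, A, \<alpha>'). (\<alpha>, \<Union>(f, g) \<in> A. square_class C \<alpha> \<alpha>' (scl C c f, scl C c g), \<alpha>'))\<rparr>"


section \<open>Linear 2-categories with one object\<close>

text \<open>
  The underlying linear category has the 1-morphisms as objects and the 2-morphisms as arrows.
  \<open>hcmp\<close> composes 1-morphisms and \<open>lwh F \<alpha>\<close> is the whiskering \<open>F(\<alpha>)\<close>.
\<close>

record ('k, 'o, 'a) one_obj_2cat = "('k, 'o, 'a) lincat" +
  one :: "'o"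
  hcmp :: "'o \<Rightarrow> 'o \<Rightarrow> 'o"
  lwh :: "'o \<Rightarrow> 'a \<Rightarrow> 'a"

definition left_ge :: "('k, 'o, 'a, 'z) one_obj_2cat_scheme \<Rightarrow> 'o \<Rightarrow> 'o \<Rightarrow> bool" where
  "left_ge C G F \<longleftrightarrow> (\<exists>H \<in> obj C. direct_summand C G (hcmp C H F))"

text \<open>A set of isomorphism classes of 1-morphisms is represented by the union of these classes.\<close>

definition left_cell :: "('k, 'o, 'a, 'z) one_obj_2cat_scheme \<Rightarrow> 'o set \<Rightarrow> bool" where
  "left_cell C L \<longleftrightarrow> (\<exists>F. indecomposable C F \<and>
     L = {G. indecomposable C G \<and> left_ge C G F \<and> left_ge C F G})"

text \<open>The projective object \<open>0 \<rightarrow> F\<close>.\<close>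

definition proj_obj :: "('k, 'o, 'a, 'z) one_obj_2cat_scheme \<Rightarrow> 'o \<Rightarrow> 'a" where
  "proj_obj C F = zro C (zero_object C) F"

definition is_simple_top_of :: "('k, 'o, 'a, 'z) one_obj_2cat_scheme \<Rightarrow> 'o \<Rightarrow> 'a \<Rightarrow> bool" where
  "is_simple_top_of C F S \<longleftrightarrow>
     is_top (abelianization C) (proj_obj C F) S \<and> is_simple (abelianization C) S"

text \<open>
  \<open>k\<close> is the inclusion of \<open>K\<close> into the projective object of the identity, \<open>q\<close> the projection onto
  the quotient by \<open>K\<close>, \<open>T\<close> the top of \<open>K\<close>, and \<open>LG\<close> the simple top of the projective object of
  \<open>G\<close>. Every simple object is of the form \<open>L\<^sub>H\<close>, so simple subquotients need no label \<open>H\<close>.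
\<close>

definition is_duflo_involution ::
  "('k, 'o, 'a, 'z) one_obj_2cat_scheme \<Rightarrow> 'o set \<Rightarrow> 'o \<Rightarrow> bool" where
  "is_duflo_involution C L G \<longleftrightarrow> left_cell C L \<and> indecomposable C G \<and>
     (\<exists>k q T LG.
        is_subobject (abelianization C) (proj_obj C (one C)) k \<and>
        is_cokernel (abelianization C) k q \<and>
        (\<forall>F \<in> L. \<forall>S. is_simple (abelianization C) S \<and>
           is_subquotient (abelianization C) (tgt (abelianization C) q) S \<longrightarrow>
           is_zero (abelianization C) (lwh C F S)) \<and>
        is_top (abelianization C) (src (abelianization C) k) T \<and>
        is_simple_top_of C G LG \<and>
        isomorphic (abelianization C) T LG \<and>
        (\<forall>F \<in> L. \<not> is_zero (abelianization C) (lwh C F LG)))"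


section \<open>Endofunctors of a linear category\<close>

text \<open>Functors and transformations are extensional, so that composition is strict.\<close>

record ('o, 'a) endofun =
  fobj :: "'o \<Rightarrow> 'o"
  farr :: "'a \<Rightarrow> 'a"

definition linear_endofunctor ::
  "('k, 'o, 'a, 'z) lincat_scheme \<Rightarrow> ('o, 'a) endofun \<Rightarrow> bool" where
  "linear_endofunctor D F \<longleftrightarrow>
     fobj F \<in> obj D \<rightarrow>\<^sub>E obj D \<and> farr F \<in> arr D \<rightarrow>\<^sub>E arr D \<and>
     (\<forall>f \<in> arr D. src D (farr F f) = fobj F (src D f) \<and> tgt D (farr F f) = fobj F (tgt D f)) \<and>
     (\<forall>X \<in> obj D. farr F (idt D X) = idt D (fobj F X)) \<and>
     (\<forall>f \<in> arr D. \<forall>g \<in> arr D. src D g = tgt D f \<longrightarrow>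
        farr F (cmp D g f) = cmp D (farr F g) (farr F f)) \<and>
     (\<forall>f \<in> arr D. \<forall>g \<in> arr D. src D g = src D f \<and> tgt D g = tgt D f \<longrightarrow>
        farr F (add D f g) = add D (farr F f) (farr F g)) \<and>
     (\<forall>c. \<forall>f \<in> arr D. farr F (scl D c f) = scl D c (farr F f))"

definition id_endofun :: "('k, 'o, 'a, 'z) lincat_scheme \<Rightarrow> ('o, 'a) endofun" where
  "id_endofun D = \<lparr>fobj = (\<lambda>X \<in> obj D. X), farr = (\<lambda>f \<in> arr D. f)\<rparr>"

definition comp_endofun ::
  "('k, 'o, 'a, 'z) lincat_scheme \<Rightarrow> ('o, 'a) endofun \<Rightarrow> ('o, 'a) endofun \<Rightarrow> ('o, 'a) endofun" where
  "comp_endofun D F G =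
     \<lparr>fobj = (\<lambda>X \<in> obj D. fobj F (fobj G X)), farr = (\<lambda>f \<in> arr D. farr F (farr G f))\<rparr>"

type_synonym ('o, 'a) transf = "('o, 'a) endofun \<times> ('o \<Rightarrow> 'a) \<times> ('o, 'a) endofun"

definition natural_transformations ::
  "('k, 'o, 'a, 'z) lincat_scheme \<Rightarrow> ('o, 'a) transf set" where
  "natural_transformations D = {(F, \<eta>, G).
     linear_endofunctor D F \<and> linear_endofunctor D G \<and> \<eta> \<in> extensional (obj D) \<and>
     (\<forall>X \<in> obj D. \<eta> X \<in> hom D (fobj F X) (fobj G X)) \<and>
     (\<forall>f \<in> arr D. cmp D (farr G f) (\<eta> (src D f)) = cmp D (\<eta> (tgt D f)) (farr F f))}"

definition endo_2cat ::
  "('k, 'o, 'a, 'z) lincat_scheme \<Rightarrow> ('k, ('o, 'a) endofun, ('o, 'a) transf) one_obj_2cat" where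
  "endo_2cat D = \<lparr>
     obj = {F. linear_endofunctor D F},
     arr = natural_transformations D,
     src = (\<lambda>(F, \<eta>, G). F),
     tgt = (\<lambda>(F, \<eta>, G). G),
     idt = (\<lambda>F. (F, \<lambda>X \<in> obj D. idt D (fobj F X), F)),
     cmp = (\<lambda>(G, \<epsilon>, H) (F, \<eta>, G'). (F, \<lambda>X \<in> obj D. cmp D (\<epsilon> X) (\<eta> X), H)),
     zro = (\<lambda>F G. (F, \<lambda>X \<in> obj D. zro D (fobj F X) (fobj G X), G)),
     add = (\<lambda>(F, \<eta>, G) (F', \<epsilon>, G'). (F, \<lambda>X \<in> obj D. add D (\<eta> X) (\<epsilon> X), G)),
     scl = (\<lambda>c (F, \<eta>, G). (F, \<lambda>X \<in> obj D. scl D c (\<eta> X), G)),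
     one = id_endofun D,
     hcmp = comp_endofun D,
     lwh = (\<lambda>H (F, \<eta>, G).
       (comp_endofun D H F, \<lambda>X \<in> obj D. farr H (\<eta> X), comp_endofun D H G))\<rparr>"


section \<open>Modules, bimodules and tensor products\<close>

record 'm abgrp =
  carr :: "'m set"
  zer :: "'m"
  pls :: "'m \<Rightarrow> 'm \<Rightarrow> 'm"

record ('b, 'm) lmod = "'m abgrp" +
  act :: "'b \<Rightarrow> 'm \<Rightarrow> 'm"

record ('b, 'm) bimod = "('b, 'm) lmod" +
  ract :: "'m \<Rightarrow> 'b \<Rightarrow> 'm"

definition abelian_grp :: "('m, 'z) abgrp_scheme \<Rightarrow> bool" where
  "abelian_grp M \<longleftrightarrow> zer M \<in> carr M \<and>
     (\<forall>x \<in> carr M. \<forall>y \<in> carr M. pls M x y \<in> carr M \<and> pls M x y = pls M y x) \<and>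
     (\<forall>x \<in> carr M. \<forall>y \<in> carr M. \<forall>z \<in> carr M. pls M (pls M x y) z = pls M x (pls M y z)) \<and>
     (\<forall>x \<in> carr M. pls M (zer M) x = x \<and> (\<exists>y \<in> carr M. pls M x y = zer M))"

definition left_module :: "('b::ring_1, 'm, 'z) lmod_scheme \<Rightarrow> bool" where
  "left_module M \<longleftrightarrow> abelian_grp M \<and>
     (\<forall>a. \<forall>x \<in> carr M. act M a x \<in> carr M) \<and>
     (\<forall>x \<in> carr M. act M 1 x = x) \<and>
     (\<forall>a b. \<forall>x \<in> carr M. act M (a * b) x = act M a (act M b x)) \<and>
     (\<forall>a b. \<forall>x \<in> carr M. act M (a + b) x = pls M (act M a x) (act M b x)) \<and>
     (\<forall>a. \<forall>x \<in> carr M. \<forall>y \<in> carr M. act M a (pls M x y) = pls M (act M a x) (act M a y))"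

definition submodule :: "('b, 'm, 'z) lmod_scheme \<Rightarrow> 'm set \<Rightarrow> bool" where
  "submodule M N \<longleftrightarrow> N \<subseteq> carr M \<and> zer M \<in> N \<and>
     (\<forall>x \<in> N. \<forall>y \<in> N. pls M x y \<in> N) \<and> (\<forall>a. \<forall>x \<in> N. act M a x \<in> N)"

definition finitely_generated :: "('b, 'm, 'z) lmod_scheme \<Rightarrow> bool" where
  "finitely_generated M \<longleftrightarrow>
     (\<exists>S. finite S \<and> S \<subseteq> carr M \<and> (\<forall>N. submodule M N \<and> S \<subseteq> N \<longrightarrow> N = carr M))"

definition module_hom :: "('b, 'm, 'y) lmod_scheme \<Rightarrow> ('b, 'n, 'z) lmod_scheme \<Rightarrow> ('m \<Rightarrow> 'n) \<Rightarrow> bool" where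
  "module_hom M N f \<longleftrightarrow> f \<in> carr M \<rightarrow> carr N \<and>
     (\<forall>x \<in> carr M. \<forall>y \<in> carr M. f (pls M x y) = pls N (f x) (f y)) \<and>
     (\<forall>a. \<forall>x \<in> carr M. f (act M a x) = act N a (f x))"

definition module_iso :: "('b, 'm, 'y) lmod_scheme \<Rightarrow> ('b, 'n, 'z) lmod_scheme \<Rightarrow> ('m \<Rightarrow> 'n) \<Rightarrow> bool" where
  "module_iso M N f \<longleftrightarrow> module_hom M N f \<and> bij_betw f (carr M) (carr N)"

text \<open>
  The tensor product of \<open>X\<close> (right action \<open>ra\<close>) and \<open>Y\<close> (left action \<open>la\<close>) over a common ring is
  the free abelian group on pairs modulo the usual relations; its elements are cosets.
\<close>

definition tensor_relators ::
  "('x, 'y) abgrp_scheme \<Rightarrow> ('x \<Rightarrow> 'r \<Rightarrow> 'x) \<Rightarrow> ('m, 'z) abgrp_scheme \<Rightarrow> ('r \<Rightarrow> 'm \<Rightarrow> 'm) \<Rightarrow>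
   ('x \<times> 'm \<Rightarrow>\<^sub>0 int) set" where
  "tensor_relators X ra Y la =
     {frag_of (pls X x x', y) - frag_of (x, y) - frag_of (x', y) |x x' y.
        x \<in> carr X \<and> x' \<in> carr X \<and> y \<in> carr Y} \<union>
     {frag_of (x, pls Y y y') - frag_of (x, y) - frag_of (x, y') |x y y'.
        x \<in> carr X \<and> y \<in> carr Y \<and> y' \<in> carr Y} \<union>
     {frag_of (ra x r, y) - frag_of (x, la r y) |x r y. x \<in> carr X \<and> y \<in> carr Y}"

definition tensor_coset ::
  "('x, 'y) abgrp_scheme \<Rightarrow> ('x \<Rightarrow> 'r \<Rightarrow> 'x) \<Rightarrow> ('m, 'z) abgrp_scheme \<Rightarrow> ('r \<Rightarrow> 'm \<Rightarrow> 'm) \<Rightarrow>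
   ('x \<times> 'm \<Rightarrow>\<^sub>0 int) \<Rightarrow> ('x \<times> 'm \<Rightarrow>\<^sub>0 int) set" where
  "tensor_coset X ra Y la p = (+) p ` group_closure (tensor_relators X ra Y la)"

definition tensor_carr ::
  "('x, 'y) abgrp_scheme \<Rightarrow> ('x \<Rightarrow> 'r \<Rightarrow> 'x) \<Rightarrow> ('m, 'z) abgrp_scheme \<Rightarrow> ('r \<Rightarrow> 'm \<Rightarrow> 'm) \<Rightarrow>
   ('x \<times> 'm \<Rightarrow>\<^sub>0 int) set set" where
  "tensor_carr X ra Y la =
     tensor_coset X ra Y la ` {p. Poly_Mapping.keys p \<subseteq> carr X \<times> carr Y}"

definition tensor_pls ::
  "('x, 'y) abgrp_scheme \<Rightarrow> ('x \<Rightarrow> 'r \<Rightarrow> 'x) \<Rightarrow> ('m, 'z) abgrp_scheme \<Rightarrow> ('r \<Rightarrow> 'm \<Rightarrow> 'm) \<Rightarrow>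
   ('x \<times> 'm \<Rightarrow>\<^sub>0 int) set \<Rightarrow> ('x \<times> 'm \<Rightarrow>\<^sub>0 int) set \<Rightarrow> ('x \<times> 'm \<Rightarrow>\<^sub>0 int) set" where
  "tensor_pls X ra Y la P Q = (\<Union>p \<in> P. \<Union>q \<in> Q. tensor_coset X ra Y la (p + q))"

text \<open>The map induced by \<open>(x, y) \<mapsto> (u x, v y)\<close> into the tensor product of \<open>X\<close> and \<open>Y\<close>.\<close>

definition tensor_map ::
  "('x, 'y) abgrp_scheme \<Rightarrow> ('x \<Rightarrow> 'r \<Rightarrow> 'x) \<Rightarrow> ('m, 'z) abgrp_scheme \<Rightarrow> ('r \<Rightarrow> 'm \<Rightarrow> 'm) \<Rightarrow>
   ('w \<Rightarrow> 'x) \<Rightarrow> ('n \<Rightarrow> 'm) \<Rightarrow> ('w \<times> 'n \<Rightarrow>\<^sub>0 int) set \<Rightarrow> ('x \<times> 'm \<Rightarrow>\<^sub>0 int) set" where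
  "tensor_map X ra Y la u v P =
     (\<Union>p \<in> P. tensor_coset X ra Y la (frag_extend (\<lambda>(x, y). frag_of (u x, v y)) p))"

text \<open>The left module \<open>X \<otimes>\<^sub>B M\<close> for a bimodule \<open>X\<close>.\<close>

definition bimod_tensor ::
  "('b, 'x, 'y) bimod_scheme \<Rightarrow> ('b, 'm, 'z) lmod_scheme \<Rightarrow> ('b, ('x \<times> 'm \<Rightarrow>\<^sub>0 int) set) lmod" where
  "bimod_tensor X M = \<lparr>
     carr = tensor_carr X (ract X) M (act M),
     zer = tensor_coset X (ract X) M (act M) 0,
     pls = tensor_pls X (ract X) M (act M),
     act = (\<lambda>b. tensor_map X (ract X) M (act M) (act X b) (\<lambda>m. m))\<rparr>"

definition left_ideal_of :: "'b::ring_1 \<Rightarrow> ('b, 'b) lmod" where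
  "left_ideal_of e = \<lparr>carr = {b * e |b. True}, zer = 0, pls = (+), act = (*)\<rparr>"

definition right_ideal_of :: "'b::ring_1 \<Rightarrow> 'b abgrp" where
  "right_ideal_of f = \<lparr>carr = {f * b |b. True}, zer = 0, pls = (+)\<rparr>"

text \<open>The bimodule \<open>Be \<otimes> fB\<close> over the ground field, which acts on \<open>B\<close> through \<open>sc\<close>.\<close>

definition proj_bimod ::
  "('k \<Rightarrow> 'b::ring_1 \<Rightarrow> 'b) \<Rightarrow> 'b \<Rightarrow> 'b \<Rightarrow> ('b, ('b \<times> 'b \<Rightarrow>\<^sub>0 int) set) bimod" where
  "proj_bimod sc e f = (let X = left_ideal_of e; Y = right_ideal_of f; ra = (\<lambda>x c. sc c x) in \<lparr>
     carr = tensor_carr X ra Y sc,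
     zer = tensor_coset X ra Y sc 0,
     pls = tensor_pls X ra Y sc,
     act = (\<lambda>b. tensor_map X ra Y sc (\<lambda>x. b * x) (\<lambda>y. y)),
     ract = (\<lambda>P b. tensor_map X ra Y sc (\<lambda>x. x) (\<lambda>y. y * b) P)\<rparr>)"


section \<open>Finite dimensional algebras\<close>

definition fd_algebra :: "('k::field \<Rightarrow> 'b::ring_1 \<Rightarrow> 'b) \<Rightarrow> bool" where
  "fd_algebra sc \<longleftrightarrow> (\<exists>Basis. finite_dimensional_vector_space sc Basis) \<and>
     (\<forall>c x y. sc c x * y = sc c (x * y) \<and> x * sc c y = sc c (x * y))"

definition primitive_idempotent :: "'b::ring_1 \<Rightarrow> bool" where
  "primitive_idempotent e \<longleftrightarrow> e \<noteq> 0 \<and> e * e = e \<and>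
     (\<forall>f g. f * f = f \<and> g * g = g \<and> f * g = 0 \<and> g * f = 0 \<and> e = f + g \<longrightarrow> f = 0 \<or> g = 0)"

definition iso_left_ideals :: "'b::ring_1 \<Rightarrow> 'b \<Rightarrow> bool" where
  "iso_left_ideals e f \<longleftrightarrow> (\<exists>\<phi>. module_iso (left_ideal_of e) (left_ideal_of f) \<phi>)"

text \<open>
  Basic: the regular module is multiplicity free, that is, orthogonal primitive idempotents
  generate non-isomorphic projective modules.
\<close>

definition basic_algebra :: "'b::ring_1 itself \<Rightarrow> bool" where
  "basic_algebra _ \<longleftrightarrow> (\<forall>e f :: 'b. primitive_idempotent e \<and> primitive_idempotent f \<and>
     e * f = 0 \<and> f * e = 0 \<longrightarrow> \<not> iso_left_ideals e f)"

definition two_sided_ideal :: "'b::ring_1 set \<Rightarrow> bool" where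
  "two_sided_ideal I \<longleftrightarrow> 0 \<in> I \<and> (\<forall>x \<in> I. \<forall>y \<in> I. x + y \<in> I) \<and>
     (\<forall>b. \<forall>x \<in> I. b * x \<in> I \<and> x * b \<in> I)"

text \<open>Connected: not a direct product of two nonzero algebras.\<close>

definition connected_algebra :: "'b::ring_1 itself \<Rightarrow> bool" where
  "connected_algebra _ \<longleftrightarrow> (\<forall>I J :: 'b set. two_sided_ideal I \<and> two_sided_ideal J \<and>
     I \<inter> J = {0} \<and> {x + y |x y. x \<in> I \<and> y \<in> J} = UNIV \<longrightarrow> I = {0} \<or> J = {0})"

definition complete_irredundant_idempotents :: "nat \<Rightarrow> (nat \<Rightarrow> 'b::ring_1) \<Rightarrow> bool" where
  "complete_irredundant_idempotents n e \<longleftrightarrow>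
     (\<forall>i \<in> {1..n}. primitive_idempotent (e i)) \<and>
     (\<forall>i \<in> {1..n}. \<forall>l \<in> {1..n}. i \<noteq> l \<longrightarrow> e i * e l = 0) \<and>
     (\<Sum>i = 1..n. e i) = 1 \<and>
     (\<forall>i \<in> {1..n}. \<forall>l \<in> {1..n}. i \<noteq> l \<longrightarrow> \<not> iso_left_ideals (e i) (e l))"


section \<open>The 2-category of projective bimodules\<close>

text \<open>
  A small category equivalent to the category of finitely generated left modules over a finite
  dimensional algebra: the finitely generated modules whose underlying set consists of sequences
  over the ground field. Every finite dimensional module is isomorphic to one of these.
\<close>

type_synonym ('k, 'b) smod = "('b, nat \<Rightarrow> 'k) lmod"
type_synonym ('k, 'b) smor = "('k, 'b) smod \<times> ((nat \<Rightarrow> 'k) \<Rightarrow> (nat \<Rightarrow> 'k)) \<times> ('k, 'b) smod"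

definition small_modules :: "('k, 'b::ring_1) smod set" where
  "small_modules = {M. left_module M \<and> finitely_generated M}"

definition module_cat ::
  "('k \<Rightarrow> 'b::ring_1 \<Rightarrow> 'b) \<Rightarrow> ('k, ('k, 'b) smod, ('k, 'b) smor) lincat" where
  "module_cat sc = \<lparr>
     obj = small_modules,
     arr = {(M, f, N). M \<in> small_modules \<and> N \<in> small_modules \<and>
              f \<in> extensional (carr M) \<and> module_hom M N f},
     src = (\<lambda>(M, f, N). M),
     tgt = (\<lambda>(M, f, N). N),
     idt = (\<lambda>M. (M, \<lambda>x \<in> carr M. x, M)),
     cmp = (\<lambda>(N, g, P) (M, f, N'). (M, \<lambda>x \<in> carr M. g (f x), P)),
     zro = (\<lambda>M N. (M, \<lambda>x \<in> carr M. zer N, N)),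
     add = (\<lambda>(M, f, N) (M', g, N'). (M, \<lambda>x \<in> carr M. pls N (f x) (g x), N)),
     scl = (\<lambda>c (M, f, N). (M, \<lambda>x \<in> carr M. act N (sc c 1) (f x), N))\<rparr>"

text \<open>A chosen copy of the module \<open>T\<close> in the small category, with an isomorphism onto it.\<close>

definition small_copy :: "('b::ring_1, 't) lmod \<Rightarrow> ('k, 'b) smod \<times> ('t \<Rightarrow> nat \<Rightarrow> 'k)" where
  "small_copy T = (SOME (N, \<phi>). N \<in> small_modules \<and> module_iso T N \<phi>)"

text \<open>The functor \<open>X \<otimes>\<^sub>B _\<close>, with values moved into the small category.\<close>

definition tensor_functor ::
  "('k \<Rightarrow> 'b::ring_1 \<Rightarrow> 'b) \<Rightarrow> ('b, 'x) bimod \<Rightarrow> (('k, 'b) smod, ('k, 'b) smor) endofun" where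
  "tensor_functor sc X = \<lparr>
     fobj = (\<lambda>M \<in> obj (module_cat sc). fst (small_copy (bimod_tensor X M))),
     farr = (\<lambda>(M, f, N) \<in> arr (module_cat sc).
       let (M', \<phi>) = small_copy (bimod_tensor X M); (N', \<psi>) = small_copy (bimod_tensor X N) in
       (M', \<lambda>z \<in> carr M'.
          \<psi> (tensor_map X (ract X) N (act N) (\<lambda>x. x) f
                (inv_into (carr (bimod_tensor X M)) \<phi> z)), N'))\<rparr>"

text \<open>The 1-morphisms: the additive closure of the identity and of tensoring with \<open>B \<otimes> B\<close>.\<close>

definition one_morphisms ::
  "('k \<Rightarrow> 'b::ring_1 \<Rightarrow> 'b) \<Rightarrow> (('k, 'b) smod, ('k, 'b) smor) endofun set" where
  "one_morphisms sc = additive_closure (endo_2cat (module_cat sc))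
     {id_endofun (module_cat sc), tensor_functor sc (proj_bimod sc 1 1)}"

definition CB :: "('k \<Rightarrow> 'b::ring_1 \<Rightarrow> 'b) \<Rightarrow>
    ('k, (('k, 'b) smod, ('k, 'b) smor) endofun, (('k, 'b) smod, ('k, 'b) smor) transf) one_obj_2cat" where
  "CB sc = full_subcat (endo_2cat (module_cat sc)) (one_morphisms sc)"

definition G_mor :: "('k \<Rightarrow> 'b::ring_1 \<Rightarrow> 'b) \<Rightarrow> (nat \<Rightarrow> 'b) \<Rightarrow> nat \<Rightarrow> nat \<Rightarrow>
    (('k, 'b) smod, ('k, 'b) smor) endofun" where
  "G_mor sc e i j = tensor_functor sc (proj_bimod sc (e i) (e j))"

definition L_cell :: "('k \<Rightarrow> 'b::ring_1 \<Rightarrow> 'b) \<Rightarrow> nat \<Rightarrow> (nat \<Rightarrow> 'b) \<Rightarrow> nat \<Rightarrow>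
    (('k, 'b) smod, ('k, 'b) smor) endofun set" where
  "L_cell sc n e j = {F. \<exists>i \<in> {1..n}. isomorphic (CB sc) F (G_mor sc e i j)}"

end

theory Submission
  imports "HOL-Algebra.Free_Abelian_Groups" Defs
begin

text \<open>
 The simple objects of the abelianization are diagrams, so every condition on Duflo involutions is
 about arrows of the 2-category: a diagram is zero iff its arrow is a split epimorphism, and
 \<open>F\<close> kills the diagram \<open>a\<close>, for \<open>F\<close> in the cell, iff every arrow from the functor \<open>Be\<^sub>j \<otimes> _\<close> into
 the target of \<open>a\<close> factors through \<open>a\<close>. The multiplication \<open>Be\<^sub>j \<otimes> e\<^sub>jB \<rightarrow> B\<close> is an
 arrow \<open>G\<^sub>j\<^sub>j \<rightarrow> 1\<close> through which all arrows \<open>Be\<^sub>j \<otimes> _ \<rightarrow> 1\<close> factor; its image is \<open>K\<close>, and the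
 top of \<open>K\<close> is the diagram of a sink map onto \<open>G\<^sub>j\<^sub>j\<close>. Weak kernels and sink maps exist because all
 morphism spaces are finite dimensional, by a Yoneda lemma that describes the transformations out of
 \<open>Be \<otimes> fB \<otimes> _\<close> by elements. The endomorphism ring of \<open>G\<^sub>i\<^sub>j\<close> is local because the corners
 \<open>e\<^sub>iBe\<^sub>i\<close> are scalars plus a nilpotent ideal; hence a nonzero object that splits off sums of
 the \<open>G\<^sub>i\<^sub>j\<close> has one of them as a retract, which determines the left cell.
\<close>

text \<open>The abelianization is never shown to be abelian. Weak pullbacks and joins of arrows take
  the place of kernels and cokernels, and mono, epi and zero become statements about factoring
  through arrows. The test functor Be_j \<otimes> _ is \<open>TF (e j) 1\<close>, as B \<otimes>_B M
  is M. Transformations from it to Y are the elements of e_j Y(B). Applying Be_i \<otimes> e_jB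
  \<otimes> _ to an arrow retains only its effect on e_j Y(M), and a functional with value 1 at e_i
  recovers it; so the criterion is the same for all i. Surjectivity at B already splits the
  whiskered arrow, because Be_i \<otimes> e_jB \<otimes> Y is built from functors Be_i \<otimes> fB
  \<otimes> _, which lift along maps surjective at B. Locality rests on algebraic closure: the
  endomorphisms of Be \<otimes> fB come from eBe and fBf, and a tensor product of local algebras can
  fail to be local when residue fields are larger than the ground field. For uniqueness, condition
  (1) forces the image of the counit into every admissible K, and condition (3) makes it nonzero in
  the top of K, so G_jj is a retract of the competing 1-morphism.\<close>

abbreviation "SM == small_modules"
abbreviation "ntr == natural_transformations"
abbreviation "lnf == linear_endofunctor"
abbreviation "cef == comp_endofun"
abbreviation "LI == left_ideal_of"
abbreviation "RI == right_ideal_of"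

section \<open>Preadditive categories\<close>

text \<open>Typing is stated by equations on \<open>src\<close> and \<open>tgt\<close> rather than
  by membership in \<open>hom\<close>, so that the simplifier can discharge it while rewriting
  composites.\<close>

locale precat =
 fixes C :: "('k::field, 'o, 'a, 'z) lincat_scheme"
 assumes src_obj [simp]: "f : arr C ==> src C f : obj C"
  and tgt_obj [simp]: "f : arr C ==> tgt C f : obj C"
  and idt [simp]: "X : obj C ==> idt C X : arr C"
   "X : obj C ==> src C (idt C X) = X" "X : obj C ==> tgt C (idt C X) = X"
  and cmp [simp]: "[|g : arr C; f : arr C; src C g = tgt C f|] ==> cmp C g f : arr C"
   "[|g : arr C; f : arr C; src C g = tgt C f|] ==> src C (cmp C g f) = src C f"
   "[|g : arr C; f : arr C; src C g = tgt C f|] ==> tgt C (cmp C g f) = tgt C g"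
  and cmp_assoc: "[|h : arr C; g : arr C; f : arr C; src C h = tgt C g; src C g = tgt C f|] ==>
    cmp C (cmp C h g) f = cmp C h (cmp C g f)"
  and cmp_idt [simp]: "[|f : arr C; src C f = X|] ==> cmp C f (idt C X) = f"
  and idt_cmp [simp]: "[|f : arr C; tgt C f = X|] ==> cmp C (idt C X) f = f"
  and zro [simp]: "[|X : obj C; Y : obj C|] ==> zro C X Y : arr C"
   "[|X : obj C; Y : obj C|] ==> src C (zro C X Y) = X"
   "[|X : obj C; Y : obj C|] ==> tgt C (zro C X Y) = Y"
  and add [simp]: "[|f : arr C; g : arr C; src C f = src C g; tgt C f = tgt C g|] ==> add C f g : arr C"
   "[|f : arr C; g : arr C; src C f = src C g; tgt C f = tgt C g|] ==> src C (add C f g) = src C g"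
   "[|f : arr C; g : arr C; src C f = src C g; tgt C f = tgt C g|] ==> tgt C (add C f g) = tgt C g"
  and add_assoc: "[|f : arr C; g : arr C; h : arr C; src C f = src C g; tgt C f = tgt C g;
    src C g = src C h; tgt C g = tgt C h|] ==> add C (add C f g) h = add C f (add C g h)"
  and add_commute: "[|f : arr C; g : arr C; src C f = src C g; tgt C f = tgt C g|] ==>
    add C f g = add C g f"
  and zro_add [simp]: "[|f : arr C; src C f = X; tgt C f = Y|] ==> add C (zro C X Y) f = f"
  and cmp_add: "[|h : arr C; f : arr C; g : arr C; src C f = src C g; tgt C f = tgt C g; src C h = tgt C g|] ==>
    cmp C h (add C f g) = add C (cmp C h f) (cmp C h g)"
  and add_cmp: "[|h : arr C; f : arr C; g : arr C; src C f = src C g; tgt C f = tgt C g; tgt C h = src C g|] ==>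
    cmp C (add C f g) h = add C (cmp C f h) (cmp C g h)"
  and scl [simp]: "f : arr C ==> scl C c f : arr C" "f : arr C ==> src C (scl C c f) = src C f"
   "f : arr C ==> tgt C (scl C c f) = tgt C f"
  and scl_add: "[|f : arr C; g : arr C; src C f = src C g; tgt C f = tgt C g|] ==>
    scl C c (add C f g) = add C (scl C c f) (scl C c g)"
  and add_scl: "f : arr C ==> scl C (c + d) f = add C (scl C c f) (scl C d f)"
  and scl_scl: "f : arr C ==> scl C c (scl C d f) = scl C (c * d) f"
  and scl_0 [simp]: "f : arr C ==> scl C 0 f = zro C (src C f) (tgt C f)"
  and scl_1 [simp]: "f : arr C ==> scl C 1 f = f"
  and cmp_scl: "[|g : arr C; f : arr C; src C g = tgt C f|] ==> cmp C g (scl C c f) = scl C c (cmp C g f)"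
  and scl_cmp: "[|g : arr C; f : arr C; src C g = tgt C f|] ==> cmp C (scl C c g) f = scl C c (cmp C g f)"

text \<open>The arrows X \<rightarrow> Y that factor through a finite sum of objects of H, as an
  ideal and without mentioning biproducts. An identity in this ideal stands for X being a summand of
  such a sum.\<close>

inductive_set thru :: "('k, 'o, 'a, 'z) lincat_scheme \<Rightarrow> 'o set \<Rightarrow> 'o \<Rightarrow> 'o \<Rightarrow> 'a set"
 for C H X Y where
 zero: "zro C X Y : thru C H X Y"
| step: "[|f : thru C H X Y; i : hom C X W; p : hom C W Y; W : H|] ==> add C f (cmp C p i) : thru C H X Y"

text \<open>X has a local endomorphism ring. The form with two summands is the one that a
  decomposition of the identity provides.\<close>

definition is_loc :: "('k, 'o, 'a, 'z) lincat_scheme \<Rightarrow> 'o \<Rightarrow> bool" where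
 "is_loc C X \<longleftrightarrow> X : obj C & ~ is_zero C X &
   (ALL a : hom C X X. ALL b : hom C X X. add C a b = idt C X \<longrightarrow> is_iso C a \<or> is_iso C b)"

definition retract :: "('k, 'o, 'a, 'z) lincat_scheme \<Rightarrow> 'o \<Rightarrow> 'o \<Rightarrow> bool" where
 "retract C X Y \<longleftrightarrow> (EX i : hom C X Y. EX p : hom C Y X. cmp C p i = idt C X)"

definition split_epi :: "('k, 'o, 'a, 'z) lincat_scheme \<Rightarrow> 'a \<Rightarrow> bool" where
 "split_epi C f \<longleftrightarrow> (EX s : hom C (tgt C f) (src C f). cmp C f s = idt C (tgt C f))"

context precat begin

abbreviation comp (infixr "*." 70) where "g *. f \<equiv> cmp C g f"
abbreviation plus (infixl "+." 65) where "f +. g \<equiv> add C f g"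
abbreviation neg ("-._" [81] 80) where "-.f \<equiv> scl C (-1) f"

lemma add_zro [simp]: "[|f : arr C; src C f = X; tgt C f = Y|] ==> f +. zro C X Y = f"
 by (subst add_commute) auto

lemma add_left_commute: "[|f : arr C; g : arr C; h : arr C; src C f = src C g; tgt C f = tgt C g;
  src C g = src C h; tgt C g = tgt C h|] ==> f +. (g +. h) = g +. (f +. h)"
 using add_assoc[of f g h] add_assoc[of g f h] add_commute[of f g] by simp

lemmas add_ac = add_assoc add_commute add_left_commute

lemma add_neg: "[|f : arr C; src C f = X; tgt C f = Y|] ==> f +. -.f = zro C X Y"
 using add_scl[of f 1 "-1"] by simp

lemma add_left_cancel:
 assumes "f +. g = f +. h" "f : arr C" "g : arr C" "h : arr C" "src C f = src C g" "tgt C f = tgt C g"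
  "src C h = src C g" "tgt C h = tgt C g"
 shows "g = h"
proof -
 have "-.f +. (f +. g) = g" "-.f +. (f +. h) = h"
  using assms(2-) by (simp_all add: add_assoc[symmetric] add_commute[of "-.f"] add_neg)
 with assms(1) show ?thesis by metis
qed

lemma idem_zero:
 assumes "f +. f = f" "f : arr C" shows "f = zro C (src C f) (tgt C f)"
 using add_left_cancel[of f f "zro C (src C f) (tgt C f)"] assms by simp

lemma cmp_zro [simp]:
 assumes "g : arr C" "src C g = Y" "X : obj C" shows "g *. zro C X Y = zro C X (tgt C g)"
proof -
 have "Y : obj C" using assms by auto
 then have "g *. zro C X Y +. g *. zro C X Y = g *. zro C X Y"
  using assms by (subst cmp_add[symmetric]) auto
 from idem_zero[OF this] show ?thesis using assms \<open>Y : obj C\<close> by simp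
qed

lemma zro_cmp [simp]:
 assumes "g : arr C" "tgt C g = X" "Y : obj C" shows "zro C X Y *. g = zro C (src C g) Y"
proof -
 have "X : obj C" using assms by auto
 then have "zro C X Y *. g +. zro C X Y *. g = zro C X Y *. g"
  using assms by (subst add_cmp[symmetric]) auto
 from idem_zero[OF this] show ?thesis using assms \<open>X : obj C\<close> by simp
qed

lemma scl_zro [simp]: "[|X : obj C; Y : obj C|] ==> scl C c (zro C X Y) = zro C X Y"
 using scl_scl[of "zro C X Y" c 0] by simp

lemma is_isoI:
 "[|f : arr C; g : arr C; src C g = tgt C f; tgt C g = src C f; g *. f = idt C (src C f);
  f *. g = idt C (tgt C f)|] ==> is_iso C f"
 unfolding is_iso_def hom_def by blast

lemma is_isoE:
 assumes "is_iso C f"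
 obtains g where "f : arr C" "g : arr C" "src C g = tgt C f" "tgt C g = src C f"
  "g *. f = idt C (src C f)" "f *. g = idt C (tgt C f)"
 using assms unfolding is_iso_def hom_def by blast

lemma cmp_reassoc:
 assumes "g *. f = k" "h : arr C" "g : arr C" "f : arr C" "src C f = tgt C h" "src C g = tgt C f"
 shows "g *. (f *. h) = k *. h"
 using assms cmp_assoc[of g f h] by simp

lemma is_iso_cmp:
 assumes "is_iso C f" "is_iso C g" "src C g = tgt C f" shows "is_iso C (g *. f)"
proof -
 obtain f' where f: "f : arr C" "f' : arr C" "src C f' = tgt C f" "tgt C f' = src C f"
  "f' *. f = idt C (src C f)" "f *. f' = idt C (tgt C f)" using assms(1) by (rule is_isoE)
 obtain g' where g: "g : arr C" "g' : arr C" "src C g' = tgt C g" "tgt C g' = src C g"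
  "g' *. g = idt C (src C g)" "g *. g' = idt C (tgt C g)" using assms(2) by (rule is_isoE)
 show ?thesis
  by (rule is_isoI[of _ "f' *. g'"])
   (use f g assms(3) in "simp_all add: cmp_assoc cmp_reassoc[OF g(5)] cmp_reassoc[OF f(6)]")
qed

lemma is_zeroI:
 assumes X: "X : obj C" and id: "idt C X = zro C X X" shows "is_zero C X"
proof -
 have "f = zro C Y X" if "f : hom C Y X" for f Y
  using that idt_cmp[of f X] id X zro_cmp[of f X X] by (simp add: hom_def)
 moreover have "f = zro C X Y" if "f : hom C X Y" for f Y
  using that cmp_idt[of f X] id X cmp_zro[of f X X] by (simp add: hom_def)
 moreover have "zro C Y X : hom C Y X" "zro C X Y : hom C X Y" if "Y : obj C" for Y
  using X that by (auto simp: hom_def)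
 ultimately show ?thesis unfolding is_zero_def using X by blast
qed

lemma is_zeroD:
 assumes "is_zero C X" shows "idt C X = zro C X X"
proof -
 from assms have X: "X : obj C" and "\<exists>!f. f : hom C X X" unfolding is_zero_def by auto
 moreover have "idt C X : hom C X X" "zro C X X : hom C X X" using X by (auto simp: hom_def)
 ultimately show ?thesis by blast
qed

lemma is_zero_iff: "is_zero C X \<longleftrightarrow> X : obj C & idt C X = zro C X X"
 using is_zeroI is_zeroD is_zero_def by metis

lemma is_zero_src:
 assumes "is_zero C X" "f : arr C" "src C f = X" shows "f = zro C X (tgt C f)"
 using assms cmp_idt[of f X] is_zeroD[OF assms(1)] by (metis cmp_zro src_obj)

lemma ex_add: "[|f : arr C; g : arr C; src C f = src C g; tgt C f = tgt C g|] ==>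
  EX h : arr C. src C h = src C g & tgt C h = tgt C g & f +. h = g"
 by (rule bexI[of _ "g +. -.f"]) (auto simp: add_left_commute[of f] add_neg)

lemma is_locD:
 "[|is_loc C X; add C a b = idt C X; a : arr C; src C a = X; tgt C a = X;
  b : arr C; src C b = X; tgt C b = X|] ==> is_iso C a \<or> is_iso C b"
 unfolding is_loc_def hom_def by blast

subsection \<open>Biproducts\<close>

lemma foldr_biproduct_typing:
 assumes "ALL i : set ns. io i : arr C & tgt C (io i) = S & pj i : arr C & src C (pj i) = S
   & src C (io i) = tgt C (pj i)" "S : obj C"
 shows "foldr (%i. add C (io i *. pj i)) ns (zro C S S) : hom C S S"
 using assms by (induction ns) (auto simp: hom_def)

text \<open>Moves the sum in the definition of \<open>is_biproduct\<close> through a composite on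
  both sides, as needed when a biproduct is embedded into a larger object.\<close>

lemma foldr_biproduct_cmp:
 assumes "ALL i : set ns. io i : arr C & tgt C (io i) = S & pj i : arr C & src C (pj i) = S
   & src C (io i) = tgt C (pj i)" "S : obj C"
  "g : arr C" "src C g = S" "f : arr C" "tgt C f = S" "tgt C g = T" "src C f = T"
 shows "foldr (%i. add C ((g *. io i) *. (pj i *. f))) ns (zro C T T)
   = g *. foldr (%i. add C (io i *. pj i)) ns (zro C S S) *. f"
 using assms(1)
proof (induction ns)
 case Nil
 have "T : obj C" using assms by auto
 then show ?case using assms by simp
next
 case (Cons n ns)
 have t: "foldr (%i. add C (io i *. pj i)) ns (zro C S S) : hom C S S"
  by (rule foldr_biproduct_typing) (use Cons.prems assms(2) in auto)
 have IH: "foldr (%i. add C ((g *. io i) *. (pj i *. f))) ns (zro C T T)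
   = g *. foldr (%i. add C (io i *. pj i)) ns (zro C S S) *. f"
  using Cons by simp
 show ?case
  using t Cons.prems assms(2-) by (simp add: IH hom_def cmp_add add_cmp cmp_assoc)
qed

lemma biproduct_Nil: "is_zero C Z ==> is_biproduct C [] Z"
 by (simp add: is_biproduct_def is_zero_iff)

lemma biproduct2_iff:
 "is_biproduct C [X, Y] S \<longleftrightarrow> X : obj C & Y : obj C & S : obj C &
  (EX i1 i2 p1 p2. i1 : hom C X S & i2 : hom C Y S & p1 : hom C S X & p2 : hom C S Y &
   p1 *. i1 = idt C X & p2 *. i2 = idt C Y & p1 *. i2 = zro C Y X & p2 *. i1 = zro C X Y &
   i1 *. p1 +. i2 *. p2 = idt C S)" (is "?L \<longleftrightarrow> ?R")
proof
 assume ?L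
 then obtain io pj where o: "X : obj C" "Y : obj C" "S : obj C"
  and 1: "\<forall>i < 2. io i : hom C ([X, Y] ! i) S & pj i : hom C S ([X, Y] ! i)"
  and 2: "\<forall>i < 2. \<forall>l < 2. pj l *. io i = (if i = l then idt C ([X, Y] ! i) else zro C ([X, Y] ! i) ([X, Y] ! l))"
  and 3: "foldr (%i. add C (io i *. pj i)) [0..<2] (zro C S S) = idt C S"
  unfolding is_biproduct_def by (auto simp: numeral_2_eq_2)
 have t: "io 0 : hom C X S" "pj 0 : hom C S X" "io 1 : hom C Y S" "pj 1 : hom C S Y"
  using 1[rule_format, of 0] 1[rule_format, of 1] by auto
 show ?R
  apply (rule conjI[OF o(1)], rule conjI[OF o(2)], rule conjI[OF o(3)])
  apply (rule exI[of _ "io 0"], rule exI[of _ "io 1"], rule exI[of _ "pj 0"], rule exI[of _ "pj 1"])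
  using 2[rule_format, of 0 0] 2[rule_format, of 1 1] 2[rule_format, of 1 0] 2[rule_format, of 0 1] 3 t
  by (simp_all add: upt_rec hom_def)
next
 assume ?R
 then obtain i1 i2 p1 p2 where o: "X : obj C" "Y : obj C" "S : obj C"
  and t: "i1 : hom C X S" "i2 : hom C Y S" "p1 : hom C S X" "p2 : hom C S Y"
  and e: "p1 *. i1 = idt C X" "p2 *. i2 = idt C Y" "p1 *. i2 = zro C Y X" "p2 *. i1 = zro C X Y"
   "i1 *. p1 +. i2 *. p2 = idt C S" by blast
 let ?io = "case_nat i1 (%_. i2)" and ?pj = "case_nat p1 (%_. p2)"
 have "\<forall>i < 2. ?io i : hom C ([X, Y] ! i) S & ?pj i : hom C S ([X, Y] ! i)"
  using t by (auto simp: less_2_cases_iff)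
 moreover have "\<forall>i < 2. \<forall>l < 2. ?pj l *. ?io i =
   (if i = l then idt C ([X, Y] ! i) else zro C ([X, Y] ! i) ([X, Y] ! l))"
  using e by (auto simp: less_2_cases_iff)
 moreover have "foldr (%i. add C (?io i *. ?pj i)) [0..<2] (zro C S S) = idt C S"
  using e t o by (simp add: upt_rec hom_def)
 moreover have l: "length [X, Y] = 2" by simp
 ultimately show ?L unfolding is_biproduct_def l using o
  by (intro conjI exI[where x = ?io] exI[where x = ?pj]) auto
qed

text \<open>Only binary sums are constructed, while \<open>is_biproduct\<close> speaks of lists;
  this is the step that builds lists.\<close>

lemma biproduct_Cons:
 assumes "is_biproduct C Xs S" and "is_biproduct C [X, S] S'"
 shows "is_biproduct C (X # Xs) S'"
proof -
 obtain io pj where o: "set Xs <= obj C" "S : obj C"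
  and 1: "!!i. i < length Xs ==> io i : hom C (Xs ! i) S & pj i : hom C S (Xs ! i)"
  and 2: "!!i l. i < length Xs ==> l < length Xs ==>
   pj l *. io i = (if i = l then idt C (Xs ! i) else zro C (Xs ! i) (Xs ! l))"
  and 3: "foldr (%i. add C (io i *. pj i)) [0..<length Xs] (zro C S S) = idt C S"
  using assms(1) unfolding is_biproduct_def by (elim conjE exE) (rule that, simp_all)
 obtain i1 i2 p1 p2 where o': "X : obj C" "S' : obj C"
  and t: "i1 : hom C X S'" "i2 : hom C S S'" "p1 : hom C S' X" "p2 : hom C S' S"
  and e: "p1 *. i1 = idt C X" "p2 *. i2 = idt C S" "p1 *. i2 = zro C S X" "p2 *. i1 = zro C X S"
   "i1 *. p1 +. i2 *. p2 = idt C S'" using assms(2) unfolding biproduct2_iff by blast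
 define I where "I = case_nat i1 (%i. i2 *. io i)"
 define P where "P = case_nat p1 (%i. pj i *. p2)"
 have nth: "Xs ! i : obj C" if "i < length Xs" for i using o that by (meson nth_mem subsetD)
 have ty: "I i : hom C ((X # Xs) ! i) S' & P i : hom C S' ((X # Xs) ! i)" if "i < length (X # Xs)" for i
  using that t 1 by (cases i) (auto simp: I_def P_def hom_def)
 have orth: "P l *. I i = (if i = l then idt C ((X # Xs) ! i) else zro C ((X # Xs) ! i) ((X # Xs) ! l))"
  if "i < length (X # Xs)" "l < length (X # Xs)" for i l
 proof (cases i)
  case 0
  show ?thesis
  proof (cases l)
   case 0 with \<open>i = 0\<close> show ?thesis by (simp add: I_def P_def e)
  next
   case (Suc m)
   with that 1[of m] \<open>i = 0\<close> t o' show ?thesis by (simp add: I_def P_def e hom_def cmp_assoc)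
  qed
 next
  case i: (Suc n)
  then have n: "n < length Xs" using that by simp
  show ?thesis
  proof (cases l)
   case 0 with i n 1[of n] t o' cmp_reassoc[OF e(3), of "io n"] show ?thesis
    by (simp add: I_def P_def hom_def)
  next
   case (Suc m)
   then have m: "m < length Xs" using that by simp
   have "p2 *. (i2 *. io n) = io n" using 1[OF n] t cmp_reassoc[OF e(2), of "io n"] by (simp add: hom_def)
   with Suc i n m 1[of n] 1[of m] t o' 2[of n m] show ?thesis
    by (simp add: I_def P_def hom_def cmp_assoc)
  qed
 qed
 have "foldr (%i. add C (I i *. P i)) [0..<length (X # Xs)] (zro C S' S')
   = i1 *. p1 +. foldr (%i. add C ((i2 *. io i) *. (pj i *. p2))) [0..<length Xs] (zro C S' S')"
 proof -
  have "[0..<length (X # Xs)] = 0 # map Suc [0..<length Xs]" by (simp only: list.size map_Suc_upt upt_conv_Cons) (simp add: upt_conv_Cons)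
  then show ?thesis by (simp add: foldr_map I_def P_def o_def del: upt_Suc)
 qed
 also have "foldr (%i. add C ((i2 *. io i) *. (pj i *. p2))) [0..<length Xs] (zro C S' S')
   = i2 *. idt C S *. p2"
  unfolding 3[symmetric] by (rule foldr_biproduct_cmp) (use 1 t o in "auto simp: hom_def")
 also have "i1 *. p1 +. i2 *. idt C S *. p2 = idt C S'" using e t by (simp add: hom_def)
 finally have "foldr (%i. add C (I i *. P i)) [0..<length (X # Xs)] (zro C S' S') = idt C S'" .
 moreover have "set (X # Xs) <= obj C" using o o' by simp
 ultimately show ?thesis unfolding is_biproduct_def using o'(2)
  apply (intro conjI)
   apply assumption
   apply assumption
  apply (rule exI[of _ I], rule exI[of _ P])
  using ty orth by (intro conjI allI impI; assumption?) blast+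
qed

subsection \<open>Morphisms factoring through a set of objects\<close>

lemma thru_hom: "[|f : thru C H X Y; X : obj C; Y : obj C|] ==> f : hom C X Y"
 by (induction rule: thru.induct) (auto simp: hom_def)

lemma thru_factor:
 assumes "i : hom C X W" "p : hom C W Y" "W : H" shows "p *. i : thru C H X Y"
proof -
 have "zro C X Y +. p *. i = p *. i" using assms by (auto simp: hom_def)
 then show ?thesis using thru.step[OF thru.zero assms] by metis
qed

lemma thru_add:
 assumes "f : thru C H X Y" "g : thru C H X Y" "X : obj C" "Y : obj C" shows "f +. g : thru C H X Y"
 using assms(2)
proof induction
 case zero
 then show ?case using assms(1) thru_hom[OF assms(1,3,4)] by (simp add: hom_def)
next
 case (step g i W p)
 have "f +. (g +. p *. i) = (f +. g) +. p *. i"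
  using step thru_hom[OF assms(1,3,4)] thru_hom[OF step.hyps(1) assms(3,4)]
  by (subst add_assoc) (auto simp: hom_def)
 then show ?case using thru.step step by metis
qed

lemma thru_cmp:
 assumes "f : thru C H X Y" "h : hom C X' X" "g : hom C Y Y'" shows "g *. f *. h : thru C H X' Y'"
 using assms(1)
proof induction
 case zero
 then show ?case using assms thru.zero[of C X' Y'] by (auto simp: hom_def)
next
 case (step f i W p)
 have o: "X : obj C" "Y : obj C" using assms by (auto simp: hom_def)
 have "g *. (f +. p *. i) *. h = g *. f *. h +. (g *. p) *. (i *. h)"
  using step assms thru_hom[OF step.hyps(1) o] by (auto simp: hom_def cmp_assoc cmp_add add_cmp)
 moreover have "i *. h : hom C X' W" "g *. p : hom C W Y'" using step assms by (auto simp: hom_def)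
 ultimately show ?case using thru.step[OF step.IH] step by metis
qed

lemma thru_trans:
 assumes "f : thru C H X Y" "!!W. W : H ==> idt C W : thru C H' W W" "X : obj C" "Y : obj C"
 shows "f : thru C H' X Y"
 using assms(1)
proof induction
 case zero
 then show ?case by (rule thru.zero)
next
 case (step f i W p)
 have "p *. idt C W *. i : thru C H' X Y" by (rule thru_cmp) (use step assms in auto)
 then have "p *. i : thru C H' X Y" using step by (simp add: hom_def)
 then show ?case using step thru_add assms by blast
qed

lemma foldr_thru:
 assumes "ALL i : set ns. EX W : H. io i : hom C W S & pj i : hom C S W" "S : obj C"
 shows "foldr (%i. add C (io i *. pj i)) ns (zro C S S) : thru C H S S"
 using assms(1)
proof (induction ns)
 case Nil
 show ?case using thru.zero by simp
next
 case (Cons n ns)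
 then have "io n *. pj n : thru C H S S" using thru_factor by auto
 then show ?case using Cons thru_add assms(2) by simp
qed

lemma biproduct_thru:
 assumes "is_biproduct C Xs S" shows "idt C S : thru C (set Xs) S S"
proof -
 obtain io pj where o: "set Xs <= obj C" "S : obj C"
  and 1: "!!i. i < length Xs ==> io i : hom C (Xs ! i) S & pj i : hom C S (Xs ! i)"
  and 3: "foldr (%i. add C (io i *. pj i)) [0..<length Xs] (zro C S S) = idt C S"
  using assms(1) unfolding is_biproduct_def by (elim conjE exE) (rule that, simp_all)
 show ?thesis unfolding 3[symmetric]
  by (rule foldr_thru) (use o 1 nth_mem in "fastforce+")
qed

lemma retract_thru:
 assumes "idt C Y : thru C H Y Y" "retract C X Y" shows "idt C X : thru C H X X"
proof -
 obtain i p where "i : hom C X Y" "p : hom C Y X" "p *. i = idt C X"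
  using assms(2) unfolding retract_def by auto
 moreover from this have "p *. idt C Y *. i = idt C X" by (simp add: hom_def)
 ultimately show ?thesis using thru_cmp[OF assms(1), of i X p X] by simp
qed

lemma direct_summand_retract: "direct_summand C X S ==> retract C X S"
 unfolding direct_summand_def biproduct2_iff retract_def by blast

lemma isomorphicE:
 assumes "isomorphic C X Y"
 obtains f g where "f : hom C X Y" "g : hom C Y X" "g *. f = idt C X" "f *. g = idt C Y" "is_iso C f" "is_iso C g"
proof -
 obtain f where f: "f : hom C X Y" "is_iso C f" using assms unfolding isomorphic_def by blast
 obtain g where g: "f : arr C" "g : arr C" "src C g = tgt C f" "tgt C g = src C f"
  "g *. f = idt C (src C f)" "f *. g = idt C (tgt C f)" using f(2) by (rule is_isoE)
 have "is_iso C g" by (rule is_isoI[of _ f]) (use g in simp_all)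
 with f g that show ?thesis by (auto simp: hom_def)
qed

lemma isomorphic_retract: "isomorphic C X Y ==> retract C X Y"
 unfolding retract_def by (elim isomorphicE) blast

lemma isomorphic_obj: "isomorphic C X Y ==> X : obj C & Y : obj C"
 unfolding isomorphic_def by blast

lemma isomorphic_sym:
 assumes "isomorphic C X Y" shows "isomorphic C Y X"
proof -
 obtain f g where "g : hom C Y X" "is_iso C g" using assms by (rule isomorphicE)
 then show ?thesis using isomorphic_obj[OF assms] unfolding isomorphic_def by blast
qed

lemma retract_obj: "retract C X Y ==> X : obj C & Y : obj C"
 unfolding retract_def hom_def by auto

lemma isomorphic_refl: "X : obj C ==> isomorphic C X X"
 using is_isoI[of "idt C X" "idt C X"] unfolding isomorphic_def
 by (intro conjI bexI[of _ "idt C X"]) (simp_all add: hom_def)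

lemma retract_trans:
 assumes "retract C X Y" "retract C Y Z" shows "retract C X Z"
proof -
 obtain i p where 1: "i : hom C X Y" "p : hom C Y X" "p *. i = idt C X"
  using assms(1) unfolding retract_def by auto
 obtain j q where 2: "j : hom C Y Z" "q : hom C Z Y" "q *. j = idt C Y"
  using assms(2) unfolding retract_def by auto
 have "(p *. q) *. (j *. i) = idt C X" using 1 2 cmp_reassoc[OF 2(3), of i] by (simp add: hom_def cmp_assoc)
 moreover have "j *. i : hom C X Z" "p *. q : hom C Z X" using 1 2 by (auto simp: hom_def)
 ultimately show ?thesis unfolding retract_def by blast
qed

subsection \<open>Local objects\<close>

text \<open>
 The inverse of \<open>w\<close> is computed from that of \<open>w\<^sub>0 = p i + w\<close> by the formula relating
 \<open>(1 - a b)\<inverse>\<close> and \<open>(1 - b a)\<inverse>\<close>.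
\<close>

lemma iso_complement_of_thru:
 assumes "u : thru C H X X" "X : obj C" "!!W. W : H ==> is_loc C W & ~ retract C W X"
  "w : hom C X X" "u +. w = idt C X"
 shows "is_iso C w"
 using assms(1,4,5)
proof (induction arbitrary: w)
 case zero
 then have "w = idt C X" using assms(2) by (simp add: hom_def)
 then show ?case using assms(2) by (intro is_isoI[of _ "idt C X"]) simp_all
next
 case (step u i W p)
 have u: "u : arr C" "src C u = X" "tgt C u = X" using thru_hom[OF step.hyps(1)] assms(2) by (auto simp: hom_def)
 have t: "i : arr C" "src C i = X" "tgt C i = W" "p : arr C" "src C p = W" "tgt C p = X"
  "w : arr C" "src C w = X" "tgt C w = X" using step by (auto simp: hom_def)
 then have W: "W : obj C" by auto
 define w0 where "w0 = p *. i +. w"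
 have w0: "w0 : arr C" "src C w0 = X" "tgt C w0 = X" using t by (auto simp: w0_def)
 have "u +. w0 = idt C X" using step.prems(2) t u by (simp add: w0_def add_assoc)
 then have "is_iso C w0" using step.IH w0 by (simp add: hom_def)
 then obtain v where v: "v : arr C" "src C v = X" "tgt C v = X" "v *. w0 = idt C X" "w0 *. v = idt C X"
  using w0 by (auto elim: is_isoE)
 \<comment> \<open>\<open>r\<close> cannot be invertible, since its inverse after
   \<open>i *. v\<close> would be a left inverse of p and exhibit W as a retract of X. As W is
   local, 1 - r then has an inverse s.\<close>
 define r where "r = i *. v *. p"
 have r: "r : arr C" "src C r = W" "tgt C r = W" using t v by (auto simp: r_def)
 obtain s0 where s0: "s0 : arr C" "src C s0 = W" "tgt C s0 = W" "r +. s0 = idt C W"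
  using ex_add[of r "idt C W"] r W by auto
 have "~ is_iso C r"
 proof
  assume "is_iso C r"
  then obtain r' where "r' : arr C" "src C r' = W" "tgt C r' = W" "r' *. r = idt C W"
   using r by (auto elim: is_isoE)
  then have "(r' *. i *. v) *. p = idt C W" "r' *. i *. v : hom C X W" "p : hom C W X"
   using t v by (auto simp: r_def cmp_assoc hom_def)
  then have "retract C W X" unfolding retract_def by blast
  with assms(3) step.hyps show False by blast
 qed
 then have "is_iso C s0" using is_locD[of W r s0] assms(3)[of W] step.hyps r s0 by blast
 then obtain s where s: "s : arr C" "src C s = W" "tgt C s = W" "s *. s0 = idt C W" "s0 *. s = idt C W"
  using s0 by (auto elim: is_isoE)
 have rs: "r *. s +. idt C W = s" using r s s0 add_cmp[of s r s0] by simp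
 have sr: "s *. r +. idt C W = s" using r s s0 cmp_add[of s r s0] by simp
 \<comment> \<open>\<open>w\<close> is w0 - p i, with v the inverse of w0 and s that of 1 - i v p;
   this is the Woodbury formula.\<close>
 define v' where "v' = v +. v *. p *. s *. i *. v"
 have v': "v' : arr C" "src C v' = X" "tgt C v' = X" using t v s by (auto simp: v'_def)
 let ?d = "p *. s *. i *. v"
 have d: "?d : arr C" "src C ?d = X" "tgt C ?d = X" using t v s by auto
 have "w0 *. v' = idt C X +. ?d"
  using w0 v t s assms(2) cmp_reassoc[OF v(5), of ?d] by (simp add: v'_def cmp_add)
 moreover have "(p *. i) *. v' = ?d"
 proof -
  have "(p *. i) *. v' = p *. (idt C W) *. i *. v +. p *. (r *. s) *. i *. v"
   using t v s W by (simp add: v'_def r_def cmp_add cmp_assoc)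
  also have "\<dots> = p *. (r *. s +. idt C W) *. i *. v"
   using t v s W r by (subst add_commute) (simp_all add: cmp_add add_cmp)
  finally show ?thesis using rs by simp
 qed
 ultimately have "?d +. w *. v' = ?d +. idt C X"
  using v' t d assms(2) by (simp add: w0_def add_cmp add_commute[of "idt C X"])
 then have 1: "w *. v' = idt C X" by (rule add_left_cancel) (use v' t d assms(2) in auto)
 let ?e = "v *. p *. s *. i"
 have e: "?e : arr C" "src C ?e = X" "tgt C ?e = X" using t v s by auto
 have "v' *. w0 = idt C X +. ?e"
  using w0 v t s assms(2) by (simp add: v'_def add_cmp cmp_assoc)
 moreover have "v' *. p *. i = ?e"
 proof -
  have "v' *. p *. i = v *. p *. idt C W *. i +. v *. p *. (s *. r) *. i"
   using t v s W by (simp add: v'_def r_def add_cmp cmp_assoc)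
  also have "\<dots> = v *. p *. (s *. r +. idt C W) *. i"
   using t v s W r by (subst add_commute) (simp_all add: cmp_add add_cmp)
  finally show ?thesis using sr by simp
 qed
 ultimately have "?e +. v' *. w = ?e +. idt C X"
  using v' t e assms(2) by (simp add: w0_def cmp_add add_commute[of "idt C X"])
 then have 2: "v' *. w = idt C X" by (rule add_left_cancel) (use v' t e assms(2) in auto)
 show ?case by (rule is_isoI[of _ v']) (use 1 2 t v' in auto)
qed

text \<open>With no retract among the local objects, the identity can play the part of u in
  \<open>iso_complement_of_thru\<close>; its complement 0 is then invertible, which makes X
  zero.\<close>

lemma retract_of_thru_local:
 assumes "idt C X : thru C H X X" "X : obj C" "~ is_zero C X" "!!W. W : H ==> is_loc C W"
 shows "EX W : H. retract C W X"
proof (rule ccontr)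
 assume "~ ?thesis"
 then have "is_iso C (zro C X X)"
  using iso_complement_of_thru[OF assms(1,2), of "zro C X X"] assms by (auto simp: hom_def)
 then obtain g where "g : arr C" "src C g = X" "tgt C g = X" "g *. zro C X X = idt C X"
  using assms(2) zro(2,3)[OF assms(2,2)] by (metis is_isoE)
 then have "idt C X = zro C X X" using assms(2) by simp
 then show False using assms(2,3) is_zeroI by blast
qed

lemma is_loc_iso:
 assumes "is_loc C X" "isomorphic C Y X" shows "is_loc C Y"
proof -
 obtain f g where f: "f : arr C" "src C f = Y" "tgt C f = X" "g : arr C" "src C g = X" "tgt C g = Y"
  "g *. f = idt C Y" "f *. g = idt C X"
  using assms(2) unfolding isomorphic_def hom_def is_iso_def by auto
 have X: "X : obj C" "Y : obj C" using f by auto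
 have isof: "is_iso C f" "is_iso C g" using f by (auto intro: is_isoI)
 have "~ is_zero C Y"
 proof
  assume "is_zero C Y"
  then have "idt C Y = zro C Y Y" by (rule is_zeroD)
  then have "f *. idt C Y *. g = zro C X X" using f X by simp
  then have "idt C X = zro C X X" using f by simp
  then show False using assms(1) X is_zeroI unfolding is_loc_def by blast
 qed
 moreover have "is_iso C a \<or> is_iso C b"
  if a: "a : arr C" "src C a = Y" "tgt C a = Y" and b: "b : arr C" "src C b = Y" "tgt C b = Y"
  and ab: "a +. b = idt C Y" for a b
 proof -
  have "f *. (a +. b) *. g = idt C X" using ab f by simp
  then have "f *. a *. g +. f *. b *. g = idt C X" using a b f by (simp add: cmp_add add_cmp)
  then have "is_iso C (f *. a *. g) \<or> is_iso C (f *. b *. g)"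
   using is_locD[OF assms(1)] a b f by simp
  moreover have "is_iso C c" if c: "c : arr C" "src C c = Y" "tgt C c = Y" and i: "is_iso C (f *. c *. g)" for c
  proof -
   have "is_iso C (g *. (f *. c *. g) *. f)"
    using c f by (intro is_iso_cmp[OF is_iso_cmp[OF isof(1) i] isof(2)]) auto
   moreover have "g *. (f *. c *. g) *. f = c" using c f cmp_reassoc[OF f(7), of "c"] by (simp add: cmp_assoc)
   ultimately show ?thesis by simp
  qed
  ultimately show ?thesis using a b by blast
 qed
 ultimately show ?thesis unfolding is_loc_def hom_def using X by blast
qed

text \<open>For a decomposition of X the two projectors have sum 1, so one of them is invertible; as
  it annihilates the inclusion of the other summand, that inclusion is zero.\<close>

lemma is_loc_indecomposable:
 assumes "is_loc C X" shows "indecomposable C X"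
proof -
 have X: "X : obj C" "~ is_zero C X" using assms unfolding is_loc_def by auto
 have key: "is_zero C B"
  if "a : hom C A X" "b : hom C B X" "p : hom C X A" "q : hom C X B" "p *. a = idt C A"
   "q *. b = idt C B" "p *. b = zro C B A" and iso: "is_iso C (a *. p)" for a b p q A B
 proof (rule is_zeroI)
  show "B : obj C" using that by (auto simp: hom_def)
  obtain h where h: "h : arr C" "src C h = X" "tgt C h = X" "h *. (a *. p) = idt C X"
   using iso by (rule is_isoE) (use \<open>a : hom C A X\<close> \<open>p : hom C X A\<close> in "auto simp: hom_def")
  have "b = h *. (a *. p) *. b" using that h cmp_reassoc[OF h(4), of b] by (simp add: hom_def)
  also have "\<dots> = zro C B X" using that h by (auto simp: hom_def cmp_assoc)
  finally have "b = zro C B X" .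
  then show "idt C B = zro C B B" using that by (auto simp: hom_def)
 qed
 have "is_zero C A \<or> is_zero C B" if bp: "is_biproduct C [A, B] X" for A B
 proof -
  obtain a b p q where t: "a : hom C A X" "b : hom C B X" "p : hom C X A" "q : hom C X B"
   and e: "p *. a = idt C A" "q *. b = idt C B" "p *. b = zro C B A" "q *. a = zro C A B"
   "a *. p +. b *. q = idt C X" using bp unfolding biproduct2_iff by blast
  have "is_iso C (a *. p) \<or> is_iso C (b *. q)" by (rule is_locD[OF assms e(5)]) (use t in "auto simp: hom_def")
  then show ?thesis using key[OF t e(1-3)] key[OF t(2,1,4,3) e(2,1,4)] by blast
 qed
 then show ?thesis unfolding indecomposable_def using X by blast
qed

text \<open>The premise \<open>comp\<close> asks for complements of retracts. It holds once
  idempotents split, which is established only for the categories considered later.\<close>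

lemma indecomposable_retract:
 assumes "indecomposable C X" "retract C G X" "~ is_zero C G"
  and comp: "!!i p. [|i : hom C G X; p : hom C X G; p *. i = idt C G|] ==>
    EX Y q j. j : hom C Y X & q : hom C X Y & q *. j = idt C Y & q *. i = zro C G Y & p *. j = zro C Y G &
    i *. p +. j *. q = idt C X"
 shows "isomorphic C X G"
proof -
 obtain i p where ip: "i : hom C G X" "p : hom C X G" "p *. i = idt C G"
  using assms(2) unfolding retract_def by blast
 from comp[OF this] obtain Y q j where Y: "j : hom C Y X" "q : hom C X Y" "q *. j = idt C Y"
   "q *. i = zro C G Y" "p *. j = zro C Y G" "i *. p +. j *. q = idt C X" by blast
 have "G : obj C" "Y : obj C" "X : obj C" using ip Y by (auto simp: hom_def)
 then have "is_biproduct C [G, Y] X" unfolding biproduct2_iff using ip Y by blast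
 then have "is_zero C Y" using assms(1,3) unfolding indecomposable_def by blast
 then have "j = zro C Y X" using is_zero_src[of Y j] Y by (auto simp: hom_def)
 then have "i *. p = idt C X" using Y ip \<open>Y : obj C\<close> \<open>X : obj C\<close> by (simp add: hom_def)
 then have "is_iso C p" using ip by (auto simp: hom_def intro: is_isoI[of _ i])
 then show ?thesis unfolding isomorphic_def using ip \<open>G : obj C\<close> \<open>X : obj C\<close> by blast
qed

end

lemma full_subcat_simps [simp]:
 "obj (full_subcat C A) = A" "arr (full_subcat C A) = {f \<in> arr C. src C f : A & tgt C f : A}"
 "src (full_subcat C A) = src C" "tgt (full_subcat C A) = tgt C" "idt (full_subcat C A) = idt C"
 "cmp (full_subcat C A) = cmp C" "zro (full_subcat C A) = zro C" "add (full_subcat C A) = add C"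
 "scl (full_subcat C A) = scl C"
 by (simp_all add: full_subcat_def)

lemma (in precat) precat_full_subcat:
 assumes "A <= obj C" shows "precat (full_subcat C A)"
proof -
 have A: "X : A ==> X : obj C" for X using assms by blast
 show ?thesis
  apply unfold_locales
  apply (simp_all add: A)
       apply (rule cmp_assoc; simp)
      apply (rule add_assoc; simp)
      apply (rule add_commute; simp)
     apply (rule cmp_add; simp)
     apply (rule add_cmp; simp)
    apply (rule scl_add; simp)
    apply (rule add_scl; simp)
   apply (rule scl_scl; simp)
   apply (rule cmp_scl; simp)
  apply (rule scl_cmp; simp)
  done
qed

lemma hom_full_subcat: "hom (full_subcat C A) X Y = (if X : A & Y : A then hom C X Y else {})"
 by (auto simp: hom_def)

lemma thru_full_subcat:
 assumes "X : A" "Y : A" "H <= A" shows "thru (full_subcat C A) H X Y = thru C H X Y"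
proof (intro equalityI subsetI)
 fix f assume "f : thru (full_subcat C A) H X Y"
 then show "f : thru C H X Y"
  by induction (use assms in "auto simp: hom_full_subcat intro: thru.intros split: if_splits")
next
 fix f assume "f : thru C H X Y"
 then show "f : thru (full_subcat C A) H X Y"
 proof induction
  case zero
  then show ?case using thru.zero[of "full_subcat C A" X Y] by simp
 next
  case (step f i W p)
  then have "add (full_subcat C A) f (cmp (full_subcat C A) p i) : thru (full_subcat C A) H X Y"
   by (intro thru.step) (use assms in "auto simp: hom_full_subcat")
  then show ?case by simp
 qed
qed

section \<open>The abelianization\<close>

text \<open>
 Morphisms in the abelianization only depend on the second component of a representing pair, so
 \<open>ab C al g be\<close> is the class of all commuting pairs with second component \<open>g\<close>; \<open>adm C al g be\<close>
 says that there is such a pair.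
\<close>

definition adm :: "('k, 'o, 'a, 'z) lincat_scheme \<Rightarrow> 'a \<Rightarrow> 'a \<Rightarrow> 'a \<Rightarrow> bool" where
 "adm C al g be \<longleftrightarrow> al : arr C & be : arr C & g : arr C & src C g = tgt C al & tgt C g = tgt C be &
   (EX f : arr C. src C f = src C al & tgt C f = src C be & cmp C g al = cmp C be f)"

definition ab :: "('k, 'o, 'a, 'z) lincat_scheme \<Rightarrow> 'a \<Rightarrow> 'a \<Rightarrow> 'a \<Rightarrow> 'a \<times> ('a \<times> 'a) set \<times> 'a" where
 "ab C al g be = (al, square_class C al be (g, g), be)"

text \<open>An admissible arrow represents the zero morphism into the diagram \<open>be\<close>
  exactly when it factors through \<open>be\<close>.\<close>

definition factors :: "('k, 'o, 'a, 'z) lincat_scheme \<Rightarrow> 'a \<Rightarrow> 'a \<Rightarrow> bool" where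
 "factors C be t \<longleftrightarrow> (EX h : arr C. src C h = src C t & tgt C h = src C be & t = cmp C be h)"

lemma square_class_snd: "square_class C al be (f, g) = square_class C al be (g, g)"
 by (simp add: square_class_def)

lemma src_ab [simp]: "src (abelianization C) (ab C al g be) = al"
 and tgt_ab [simp]: "tgt (abelianization C) (ab C al g be) = be"
 and obj_ab [simp]: "obj (abelianization C) = arr C"
 by (simp_all add: abelianization_def ab_def)

context precat begin

abbreviation A where "A \<equiv> abelianization C"

lemma arr_ab_iff: "x : arr A \<longleftrightarrow> (EX al g be. adm C al g be & x = ab C al g be)"
proof
 assume "x : arr A"
 then obtain al f g be where "al : arr C" "be : arr C" "(f, g) : square C al be"
  "x = (al, square_class C al be (f, g), be)"
  by (auto simp: abelianization_def)
 then have "adm C al g be & x = ab C al g be"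
  by (auto simp: adm_def ab_def square_def hom_def square_class_snd[of _ _ _ f])
 then show "EX al g be. adm C al g be & x = ab C al g be" by blast
next
 assume "EX al g be. adm C al g be & x = ab C al g be"
 then obtain al g be f where a: "al : arr C" "be : arr C" "x = ab C al g be" "(f, g) : square C al be"
  by (auto simp: adm_def square_def hom_def)
 then have "square_class C al be (g, g) : square_class C al be ` square C al be"
  by (intro image_eqI[of _ _ "(f, g)"]) (simp_all add: square_class_snd[of _ _ _ f])
 then show "x : arr A" using a by (simp add: abelianization_def ab_def)
qed

lemma arr_abE:
 assumes "x : arr A"
 obtains g where "adm C (src A x) g (tgt A x)" "x = ab C (src A x) g (tgt A x)"
 using assms unfolding arr_ab_iff by auto

lemma arr_abI [simp]: "adm C al g be ==> ab C al g be : arr A"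
 using arr_ab_iff by blast

lemma ab_eqI:
 assumes "adm C al g be" "h : arr C" "src C h = tgt C al" "tgt C h = src C be" "g' = g +. be *. h"
 shows "ab C al g be = ab C al g' be"
proof -
 have t: "al : arr C" "be : arr C" "g : arr C" "src C g = tgt C al" "tgt C g = tgt C be"
  using assms(1) by (auto simp: adm_def)
 have "(EX k : hom C (tgt C al) (src C be). w = g +. be *. k) \<longleftrightarrow>
   (EX k : hom C (tgt C al) (src C be). w = g' +. be *. k)" for w
 proof (intro iffI; elim bexE)
  fix k assume k: "k : hom C (tgt C al) (src C be)" "w = g +. be *. k"
  have "h +. (k +. -.h) = k" using k assms t
   by (simp add: hom_def add_left_commute[of h k] add_neg)
  then have "be *. k = be *. (h +. (k +. -.h))" by simp
  also have "\<dots> = be *. h +. be *. (k +. -.h)"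
   by (rule cmp_add) (use k assms t in "simp_all add: hom_def")
  finally have "w = g +. (be *. h +. be *. (k +. -.h))" using k(2) by simp
  also have "\<dots> = g' +. be *. (k +. -.h)" unfolding assms(5)
   by (rule add_assoc[symmetric]) (use k(1) assms(2-4) t in "simp_all add: hom_def")
  finally have "w = g' +. be *. (k +. -.h)" .
  moreover have "k +. -.h : hom C (tgt C al) (src C be)" using k assms by (simp add: hom_def)
  ultimately show "EX k : hom C (tgt C al) (src C be). w = g' +. be *. k" by blast
 next
  fix k assume k: "k : hom C (tgt C al) (src C be)" "w = g' +. be *. k"
  then have "w = g +. be *. (h +. k)" using assms(2-5) t by (simp add: hom_def cmp_add add_assoc)
  moreover have "h +. k : hom C (tgt C al) (src C be)" using k assms by (simp add: hom_def)
  ultimately show "EX k : hom C (tgt C al) (src C be). w = g +. be *. k" by blast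
 qed
 then show ?thesis unfolding ab_def square_class_def by simp
qed

lemma ab_eqD:
 assumes "ab C al g be = ab C al g' be" "adm C al g' be"
 obtains h where "h : arr C" "src C h = tgt C al" "tgt C h = src C be" "g' = g +. be *. h"
proof -
 obtain f where f: "f : arr C" "src C f = src C al" "tgt C f = src C be" "g' *. al = be *. f"
  and t: "al : arr C" "be : arr C" "g' : arr C" "src C g' = tgt C al" "tgt C g' = tgt C be"
  using assms(2) by (auto simp: adm_def)
 then have "(f, g') : square C al be" by (simp add: square_def hom_def)
 moreover have "zro C (tgt C al) (src C be) : hom C (tgt C al) (src C be)"
  "g' = g' +. be *. zro C (tgt C al) (src C be)" using t by (simp_all add: hom_def)
 ultimately have "(f, g') : square_class C al be (g', g')"
  by (auto simp: square_class_def)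
 then have "(f, g') : square_class C al be (g, g)" using assms(1) by (simp add: ab_def)
 then show ?thesis using that by (auto simp: square_class_def hom_def)
qed

lemma mem_square_class:
 assumes "adm C al g be" "(f', g') : square_class C al be (g, g)"
 shows "adm C al g' be & ab C al g be = ab C al g' be"
proof -
 have "adm C al g' be" using assms by (auto simp: square_class_def square_def adm_def hom_def)
 moreover obtain h where "h : arr C" "src C h = tgt C al" "tgt C h = src C be" "g' = g +. be *. h"
  using assms(2) by (auto simp: square_class_def hom_def)
 ultimately show ?thesis using ab_eqI[OF assms(1)] by blast
qed

lemma square_class_nonempty: "adm C al g be ==> square_class C al be (g, g) ~= {}"
proof -
 assume a: "adm C al g be"
 then have "g +. be *. zro C (tgt C al) (src C be) = g" "zro C (tgt C al) (src C be) : hom C (tgt C al) (src C be)"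
  by (auto simp: adm_def hom_def)
 moreover obtain f where "(f, g) : square C al be" using a by (auto simp: adm_def square_def hom_def)
 ultimately have "(f, g) : square_class C al be (g, g)"
  unfolding square_class_def by (auto intro!: bexI[of _ "zro C (tgt C al) (src C be)"])
 then show ?thesis by blast
qed

lemma admI': "[|al : arr C; be : arr C; g : arr C; src C g = tgt C al; tgt C g = tgt C be;
  f : arr C; src C f = src C al; tgt C f = src C be; g *. al = be *. f|] ==> adm C al g be"
 unfolding adm_def by blast

lemma adm_cmp:
 assumes "adm C al g be" "adm C be g' vga" shows "adm C al (g' *. g) vga"
proof -
 obtain f f' where f: "f : arr C" "src C f = src C al" "tgt C f = src C be" "g *. al = be *. f"
  "f' : arr C" "src C f' = src C be" "tgt C f' = src C vga" "g' *. be = vga *. f'"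
  and t: "al : arr C" "be : arr C" "vga : arr C" "g : arr C" "g' : arr C"
   "src C g = tgt C al" "tgt C g = tgt C be" "src C g' = tgt C be" "tgt C g' = tgt C vga"
  using assms by (auto simp: adm_def)
 have "(g' *. g) *. al = vga *. (f' *. f)"
  using f t cmp_reassoc[OF f(8), of f] by (simp add: cmp_assoc)
 then show ?thesis using f t by (intro admI'[of _ _ _ "f' *. f"]) simp_all
qed

lemma ab_cmp_cong:
 assumes "adm C al g be" "adm C be g' vga" "ab C al g be = ab C al k be" "ab C be g' vga = ab C be k' vga"
  "adm C al k be" "adm C be k' vga"
 shows "ab C al (g' *. g) vga = ab C al (k' *. k) vga"
proof -
 obtain h where h: "h : arr C" "src C h = tgt C al" "tgt C h = src C be" "k = g +. be *. h"
  using assms(3,5) by (rule ab_eqD)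
 obtain h' where h': "h' : arr C" "src C h' = tgt C be" "tgt C h' = src C vga" "k' = g' +. vga *. h'"
  using assms(4,6) by (rule ab_eqD)
 obtain f' where f: "f' : arr C" "src C f' = src C be" "tgt C f' = src C vga" "k' *. be = vga *. f'"
  and t: "al : arr C" "be : arr C" "vga : arr C" "g : arr C" "g' : arr C" "k' : arr C"
   "src C g = tgt C al" "tgt C g = tgt C be" "src C g' = tgt C be" "tgt C g' = tgt C vga"
   "src C k' = tgt C be" "tgt C k' = tgt C vga"
  using assms(1,2,6) by (auto simp: adm_def)
 have "k' *. k = k' *. g +. k' *. be *. h" using h t by (simp add: cmp_add)
 also have "k' *. be *. h = vga *. f' *. h" using cmp_reassoc[OF f(4), of h] h t f by (simp add: cmp_assoc)
 also have "k' *. g = g' *. g +. vga *. h' *. g" using h' t by (simp add: add_cmp cmp_assoc)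
 finally have "k' *. k = g' *. g +. vga *. (h' *. g +. f' *. h)" using h h' t f by (simp add: add_assoc cmp_add)
 then show ?thesis
  using h h' t f by (intro ab_eqI[OF adm_cmp[OF assms(1,2)], of "h' *. g +. f' *. h"]) auto
qed

text \<open>Composition of classes is a union over all representatives. By
  \<open>ab_cmp_cong\<close> every pair of representatives gives the same class, so the union is a
  single class.\<close>

lemma cmp_ab [simp]:
 assumes "adm C al g be" "adm C be g' vga"
 shows "cmp A (ab C be g' vga) (ab C al g be) = ab C al (g' *. g) vga"
proof -
 have "square_class C al vga (f2 *. f1, g2 *. g1) = square_class C al vga (g' *. g, g' *. g)"
  if "(f2, g2) : square_class C be vga (g', g')" "(f1, g1) : square_class C al be (g, g)" for f1 f2 g1 g2
  using ab_cmp_cong[OF assms, of g1 g2] mem_square_class[OF assms(1) that(2)] mem_square_class[OF assms(2) that(1)]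
  by (simp add: ab_def square_class_snd[of _ _ _ "f2 *. f1"])
 then have "(\<Union>(f2, g2) \<in> square_class C be vga (g', g'). \<Union>(f1, g1) \<in> square_class C al be (g, g).
   square_class C al vga (f2 *. f1, g2 *. g1)) = square_class C al vga (g' *. g, g' *. g)"
  using square_class_nonempty[OF assms(1)] square_class_nonempty[OF assms(2)] by fastforce
 then show ?thesis by (simp add: abelianization_def ab_def)
qed

lemma idt_ab: "idt A al = ab C al (idt C (tgt C al)) al"
 by (simp add: abelianization_def ab_def square_class_snd[of _ _ _ "idt C (src C al)"])

lemma zro_ab: "zro A al be = ab C al (zro C (tgt C al) (tgt C be)) be"
 by (simp add: abelianization_def ab_def square_class_snd[of _ _ _ "zro C (src C al) (src C be)"])

lemma adm_idt [simp]: "al : arr C ==> tgt C al = X ==> adm C al (idt C X) al"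
 by (rule admI'[of _ _ _ "idt C (src C al)"]) auto

lemma adm_zro [simp]: "al : arr C ==> be : arr C ==> tgt C al = X ==> tgt C be = Y ==> adm C al (zro C X Y) be"
 by (rule admI'[of _ _ _ "zro C (src C al) (src C be)"]) auto

lemma admI: "[|al : arr C; be : arr C; g : arr C; src C g = tgt C al; tgt C g = tgt C be; factors C be (g *. al)|]
  ==> adm C al g be"
 by (auto simp: adm_def factors_def)

lemma admD: "adm C al g be ==> factors C be (g *. al) & al : arr C & be : arr C & g : arr C & src C g = tgt C al &
  tgt C g = tgt C be"
 by (auto simp: adm_def factors_def)

lemma factorsE:
 assumes "factors C be t"
 obtains h where "h : arr C" "src C h = src C t" "tgt C h = src C be" "t = be *. h"
 using assms unfolding factors_def by blast

lemma factorsE_src: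
 assumes "factors C be t" "src C t = X"
 obtains h where "h : arr C" "src C h = X" "tgt C h = src C be" "t = be *. h"
 using assms unfolding factors_def by blast

lemma factorsI: "[|h : arr C; src C h = src C t; tgt C h = src C be; t = be *. h|] ==> factors C be t"
 unfolding factors_def by blast

lemma factors_zro: "be : arr C ==> X : obj C ==> tgt C be = Y ==> factors C be (zro C X Y)"
 by (rule factorsI[of "zro C X (src C be)"]) auto

lemma factors_self: "be : arr C ==> factors C be be"
 by (rule factorsI[of "idt C (src C be)"]) auto

lemma factors_add:
 assumes "factors C be s" "factors C be t" "be : arr C" "src C s = src C t"
 shows "factors C be (s +. t)"
proof -
 obtain h where h: "h : arr C" "src C h = src C s" "tgt C h = src C be" "s = be *. h" using assms(1) by (rule factorsE)
 obtain k where k: "k : arr C" "src C k = src C t" "tgt C k = src C be" "t = be *. k" using assms(2) by (rule factorsE)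
 show ?thesis by (rule factorsI[of "h +. k"]) (use h k assms in "auto simp: cmp_add")
qed

lemma factors_cmp:
 assumes "factors C be s" "be : arr C" "k : arr C" "src C s = tgt C k" shows "factors C be (s *. k)"
proof -
 obtain h where h: "h : arr C" "src C h = src C s" "tgt C h = src C be" "s = be *. h" using assms(1) by (rule factorsE)
 show ?thesis by (rule factorsI[of "h *. k"]) (use h assms in "auto simp: cmp_assoc")
qed

text \<open>Admissible arrows send relations to relations, the relations of a diagram being what
  factors through its arrow.\<close>

lemma factors_adm:
 assumes "adm C al g be" "factors C al s" shows "factors C be (g *. s)"
proof -
 obtain h where h: "h : arr C" "src C h = src C s" "tgt C h = src C al" "s = al *. h" using assms(2) by (rule factorsE)
 then have "g *. s = (g *. al) *. h" using admD[OF assms(1)] by (simp add: cmp_assoc)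
 moreover have "factors C be ((g *. al) *. h)"
  by (rule factors_cmp) (use h admD[OF assms(1)] in auto)
 ultimately show ?thesis by simp
qed

lemma ab_eq_iff:
 assumes "adm C al g be" "adm C al g' be"
 shows "ab C al g be = ab C al g' be \<longleftrightarrow> factors C be (g' +. -.g)"
proof
 note t = admD[OF assms(1)] admD[OF assms(2)]
 assume "ab C al g be = ab C al g' be"
 from this assms(2) obtain h where h: "h : arr C" "src C h = tgt C al" "tgt C h = src C be" "g' = g +. be *. h"
  by (rule ab_eqD)
 then have "g' +. -.g = be *. h" using t by (simp add: add_commute[of g] add_assoc add_neg)
 moreover have "src C (g' +. -.g) = tgt C al" using t by simp
 ultimately show "factors C be (g' +. -.g)" using h(1-3) by (metis factorsI)
next
 note t = admD[OF assms(1)] admD[OF assms(2)]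
 assume "factors C be (g' +. -.g)"
 moreover have "src C (g' +. -.g) = tgt C al" using t by simp
 ultimately obtain h where h: "h : arr C" "src C h = tgt C al" "tgt C h = src C be" "g' +. -.g = be *. h"
  by (rule factorsE_src)
 have "g' = g +. (g' +. -.g)" using t by (simp add: add_left_commute[of g] add_neg)
 then show "ab C al g be = ab C al g' be" unfolding h(4) using ab_eqI[OF assms(1) h(1-3)] by blast
qed

lemma ab_eq_zro_iff:
 assumes "adm C al g be" shows "ab C al g be = zro A al be \<longleftrightarrow> factors C be g"
proof -
 note t = admD[OF assms]
 have "zro A al be = ab C al g be \<longleftrightarrow> factors C be g"
  unfolding zro_ab using t by (subst ab_eq_iff[OF _ assms]) auto
 then show ?thesis by metis
qed

text \<open>An object is zero iff its identity is the zero morphism, and the identity of the diagram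
  \<open>al\<close> is represented by the identity of \<open>tgt C al\<close>.\<close>

lemma is_zero_ab_iff: "is_zero A al \<longleftrightarrow> al : arr C & split_epi C al"
proof
 assume z: "is_zero A al"
 then have al: "al : arr C" by (simp add: is_zero_def)
 then have "\<exists>!f. f : hom A al al" using z by (simp add: is_zero_def)
 moreover have "idt A al : hom A al al" "zro A al al : hom A al al"
  using al by (simp_all add: hom_def idt_ab zro_ab)
 ultimately have "idt A al = zro A al al" by blast
 then have "factors C al (idt C (tgt C al))" using ab_eq_zro_iff[of al "idt C (tgt C al)" al] al by (simp add: idt_ab)
 moreover have "src C (idt C (tgt C al)) = tgt C al" using al by simp
 ultimately obtain h where "h : arr C" "src C h = tgt C al" "tgt C h = src C al" "idt C (tgt C al) = al *. h"
  by (rule factorsE_src)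
 then show "al : arr C & split_epi C al" unfolding split_epi_def hom_def using al by auto
next
 assume "al : arr C & split_epi C al"
 then obtain s where al: "al : arr C" and s: "s : arr C" "src C s = tgt C al" "tgt C s = src C al" "al *. s = idt C (tgt C al)"
  unfolding split_epi_def hom_def by auto
 have f: "factors C al t" if "t : arr C" "tgt C t = tgt C al" for t
  using that s al cmp_reassoc[OF s(4), of t] by (intro factorsI[of "s *. t"]) auto
 have 1: "x = zro A be al" if "x : hom A be al" for x be
 proof -
  obtain g where "adm C be g al" "x = ab C be g al" using \<open>x : hom A be al\<close> by (auto simp: hom_def elim: arr_abE)
  then show ?thesis using ab_eq_zro_iff f admD by blast
 qed
 have 2: "x = zro A al be" if "x : hom A al be" for x be
 proof -
  obtain g where g: "adm C al g be" "x = ab C al g be" using \<open>x : hom A al be\<close> by (auto simp: hom_def elim: arr_abE)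
  have "factors C be (g *. idt C (tgt C al))" by (rule factors_adm[OF g(1) f]) (use al in auto)
  then have "factors C be g" using admD[OF g(1)] by simp
  then show ?thesis using ab_eq_zro_iff g by blast
 qed
 have "zro A be al : hom A be al" "zro A al be : hom A al be" if "be : arr C" for be
  using al that by (simp_all add: hom_def zro_ab)
 then show "is_zero A al" unfolding is_zero_def using 1 2 al by (metis obj_ab)
qed

lemma is_iso_ab:
 assumes "is_iso A (ab C al g be)" "adm C al g be"
 obtains s where "adm C be s al" "ab C al (s *. g) al = ab C al (idt C (tgt C al)) al"
  "ab C be (g *. s) be = ab C be (idt C (tgt C be)) be"
proof -
 obtain y where y: "y : arr A" "src A y = be" "tgt A y = al"
  "cmp A y (ab C al g be) = idt A al" "cmp A (ab C al g be) y = idt A be"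
  using assms(1) unfolding is_iso_def hom_def by auto
 then obtain s where "adm C be s al" "y = ab C be s al" by (auto elim: arr_abE)
 then show ?thesis using that y assms(2) by (simp add: idt_ab)
qed

lemma is_iso_abI:
 assumes "adm C al g be" "adm C be s al" "ab C al (s *. g) al = ab C al (idt C (tgt C al)) al"
  "ab C be (g *. s) be = ab C be (idt C (tgt C be)) be"
 shows "is_iso A (ab C al g be)"
 unfolding is_iso_def
 by (intro conjI bexI[of _ "ab C be s al"]) (use assms in "simp_all add: hom_def idt_ab")

end

section \<open>Duflo involutions in the abelianization\<close>

context precat begin

lemma split_epiI: "[|s : arr C; src C s = tgt C f; tgt C s = src C f; f *. s = idt C (tgt C f)|] ==> split_epi C f"
 unfolding split_epi_def hom_def by blast

lemma split_epiE:
 assumes "split_epi C f"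
 obtains s where "s : arr C" "src C s = tgt C f" "tgt C s = src C f" "f *. s = idt C (tgt C f)"
 using assms unfolding split_epi_def hom_def by blast

lemma split_epi_iff_factors: "f : arr C ==> split_epi C f \<longleftrightarrow> factors C f (idt C (tgt C f))"
 unfolding split_epi_def factors_def hom_def by auto

lemma split_epi_left:
 assumes "split_epi C (f *. g)" "f : arr C" "g : arr C" "src C f = tgt C g" shows "split_epi C f"
proof -
 obtain s where "s : arr C" "src C s = tgt C (f *. g)" "tgt C s = src C (f *. g)" "(f *. g) *. s = idt C (tgt C (f *. g))"
  using assms(1) by (rule split_epiE)
 then have "s : arr C" "src C s = tgt C f" "tgt C s = src C g" "(f *. g) *. s = idt C (tgt C f)"
  using assms by simp_all
 then show ?thesis using assms by (intro split_epiI[of "g *. s"]) (simp_all add: cmp_assoc)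
qed

text \<open>Two parallel morphisms are compared through the difference of their representatives, so
  a trivial kernel is enough. The converse \<open>mono_factors\<close> tests against projective
  objects and therefore comes after the zero object.\<close>

lemma is_mono_abI:
 assumes m: "adm C al g be"
  and inj: "!!t. [|t : arr C; tgt C t = tgt C al; factors C be (g *. t)|] ==> factors C al t"
 shows "is_mono A (ab C al g be)"
proof -
 note M = admD[OF m]
 have "x = y" if x: "x : arr A" "y : arr A" "src A x = src A y" "tgt A x = al" "tgt A y = al"
  and e: "cmp A (ab C al g be) x = cmp A (ab C al g be) y" for x y
 proof -
  obtain s where s: "adm C (src A x) s al" "x = ab C (src A x) s al" using arr_abE[OF x(1)] x(4) by metis
  obtain t where t: "adm C (src A x) t al" "y = ab C (src A x) t al" using arr_abE[OF x(2)] x(3,5) by metis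
  note S = admD[OF s(1)] and T = admD[OF t(1)]
  have "ab C (src A x) (g *. s) be = ab C (src A x) (g *. t) be"
   using e cmp_ab[OF s(1) m] cmp_ab[OF t(1) m] s(2) t(2) by metis
  then have "factors C be (g *. t +. -.(g *. s))"
   using ab_eq_iff[OF adm_cmp[OF s(1) m] adm_cmp[OF t(1) m]] by simp
  also have "g *. t +. -.(g *. s) = g *. (t +. -.s)" using M S T by (simp add: cmp_add cmp_scl)
  finally have "factors C al (t +. -.s)" using S T by (intro inj) simp_all
  then show ?thesis using ab_eq_iff[OF s(1) t(1)] s(2) t(2) by metis
 qed
 then show ?thesis unfolding is_mono_def using m by simp
qed

text \<open>A class represented by an identity only adds relations to a diagram with the same
  target, so it is a quotient map.\<close>

lemma is_epi_abI:
 assumes "al : arr C" "be : arr C" "tgt C al = X" "tgt C be = X" "adm C al (idt C X) be"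
 shows "is_epi A (ab C al (idt C X) be)"
proof -
 have "x = y" if x: "x : arr A" "y : arr A" "tgt A x = tgt A y" "src A x = be" "src A y = be"
  and e: "cmp A x (ab C al (idt C X) be) = cmp A y (ab C al (idt C X) be)" for x y
 proof -
  let ?vga = "tgt A x"
  obtain s where s: "adm C be s ?vga" "x = ab C be s ?vga" using arr_abE[OF x(1)] x(4) by metis
  obtain t where t: "adm C be t ?vga" "y = ab C be t ?vga" using arr_abE[OF x(2)] x(3,5) by metis
  note S = admD[OF s(1)] and T = admD[OF t(1)]
  have "ab C al (s *. idt C X) ?vga = ab C al (t *. idt C X) ?vga"
   using e cmp_ab[OF assms(5) s(1)] cmp_ab[OF assms(5) t(1)] s(2) t(2) by metis
  then have "factors C ?vga (t *. idt C X +. -.(s *. idt C X))"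
   using ab_eq_iff[OF adm_cmp[OF assms(5) s(1)] adm_cmp[OF assms(5) t(1)]] by simp
  then have "factors C ?vga (t +. -.s)" using S T assms(4) by simp
  then show ?thesis using ab_eq_iff[OF s(1) t(1)] s(2) t(2) by metis
 qed
 then show ?thesis unfolding is_epi_def using assms by simp
qed

end

text \<open>
 \<open>G\<close> is the candidate, \<open>ep\<close> its counit, and \<open>D\<close> a test object: applying an element of the cell to
 \<open>al\<close> gives zero iff every morphism from \<open>D\<close> to the target of \<open>al\<close> factors through \<open>al\<close>. The
 morphism \<open>rh\<close> is a sink map of \<open>G\<close>, so that it represents the simple top of \<open>G\<close>.
\<close>

locale duflo_data = precat C for C :: "('k::field, 'o, 'a, 'z) one_obj_2cat_scheme" +
 fixes L :: "'o set" and D G :: 'o and ep rh :: 'a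
 assumes zero_ex: "EX Z. is_zero C Z"
  and join: "[|x : arr C; y : arr C; tgt C x = tgt C y|] ==>
   EX s i j p q. s : arr C & tgt C s = tgt C x & i : hom C (src C x) (src C s) & j : hom C (src C y) (src C s) &
    p : hom C (src C s) (src C x) & q : hom C (src C s) (src C y) &
    x = cmp C s i & y = cmp C s j & s = add C (cmp C x p) (cmp C y q)"
  and wpull: "[|x : arr C; y : arr C; tgt C x = tgt C y|] ==>
   EX u v. u : arr C & v : arr C & src C u = src C v & tgt C u = src C y & tgt C v = src C x &
    cmp C y u = cmp C x v &
    (ALL u' : arr C. ALL v' : arr C. src C u' = src C v' & tgt C u' = src C y & tgt C v' = src C x &
     cmp C y u' = cmp C x v' \<longrightarrow> factors C u u')"
  and eps: "ep : hom C G (one C)" "ep ~= zro C G (one C)"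
  and G_loc: "is_loc C G"
  and D_one: "!!d. d : hom C D (one C) ==> factors C ep d"
  and G_D: "retract C G D"
  and rho: "rh : arr C" "tgt C rh = G" "~ split_epi C rh"
   "!!u. [|u : arr C; tgt C u = G; ~ split_epi C u|] ==> factors C rh u"
  and L_ne: "G : L"
  and L_zero: "!!F al. [|F : L; al : arr C|] ==>
   is_zero (abelianization C) (lwh C F al) \<longleftrightarrow> (ALL d : hom C D (tgt C al). factors C al d)"
  and L_cell: "left_cell C L"
  and G_retract: "!!X. indecomposable C X ==> retract C G X ==> isomorphic C X G"
begin

section \<open>Factorization criteria for morphisms of the abelianization\<close>

lemma epsD: "ep : arr C" "src C ep = G" "tgt C ep = one C" and one_obj: "one C : obj C" and G_obj: "G : obj C"
 using eps tgt_obj[of ep] src_obj[of ep] unfolding hom_def by auto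

lemma zero_obj: "zero_object C : obj C"
proof -
 have "is_zero C (zero_object C)" unfolding zero_object_def by (rule someI_ex[OF zero_ex])
 then show ?thesis by (simp add: is_zero_def)
qed

lemma proj_obj: "F : obj C ==> proj_obj C F : arr C" "F : obj C ==> tgt C (proj_obj C F) = F"
 "F : obj C ==> src C (proj_obj C F) = zero_object C"
 using zero_obj by (auto simp: proj_obj_def)

lemma factors_proj_obj:
 assumes "F : obj C" "t : arr C" "tgt C t = F"
 shows "factors C (proj_obj C F) t \<longleftrightarrow> t = zro C (src C t) F"
proof
 assume "factors C (proj_obj C F) t"
 then obtain h where h: "h : arr C" "src C h = src C t" "tgt C h = src C (proj_obj C F)" "t = proj_obj C F *. h"
  by (rule factorsE)
 have "t = zro C (zero_object C) F *. h" using h(4) by (simp only: proj_obj_def)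
 also have "\<dots> = zro C (src C h) F" by (rule zro_cmp) (use h(1,3) proj_obj[OF assms(1)] assms(1) in simp_all)
 finally show "t = zro C (src C t) F" using h(2) by simp
next
 assume "t = zro C (src C t) F"
 moreover have "factors C (proj_obj C F) (zro C (src C t) F)"
  using proj_obj[OF assms(1)] assms by (intro factors_zro) simp_all
 ultimately show "factors C (proj_obj C F) t" by metis
qed

text \<open>The source of \<open>proj_obj C F\<close> is zero, so every arrow out of F respects the
  relations; this makes it a test object like a free module.\<close>

lemma adm_proj_obj: "[|F : obj C; be : arr C; g : arr C; src C g = F; tgt C g = tgt C be|] ==> adm C (proj_obj C F) g be"
 using zero_obj proj_obj[of F] by (intro admI) (auto simp: proj_obj_def intro!: factors_zro)

lemma wpullE:
 assumes "x : arr C" "y : arr C" "tgt C x = tgt C y"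
 obtains u v where "u : arr C" "v : arr C" "src C u = src C v" "tgt C u = src C y" "tgt C v = src C x"
  "y *. u = x *. v"
  "!!u' v'. [|u' : arr C; v' : arr C; src C u' = src C v'; tgt C u' = src C y; tgt C v' = src C x;
     y *. u' = x *. v'|] ==> factors C u u'"
proof -
 from wpull[OF assms] obtain u v where uv: "u : arr C" "v : arr C" "src C u = src C v" "tgt C u = src C y"
  "tgt C v = src C x" "y *. u = x *. v" and w: "ALL u' : arr C. ALL v' : arr C. src C u' = src C v' & tgt C u' = src C y &
   tgt C v' = src C x & y *. u' = x *. v' \<longrightarrow> factors C u u'"
  by (elim exE conjE) (rule that)
 show ?thesis by (rule that[OF uv]) (use w in blast)
qed

text \<open>If the composite with t is zero, then t and 0, as morphisms from the projective object
  on \<open>src C t\<close>, become equal after the monomorphism.\<close>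

lemma mono_factors:
 assumes mono: "is_mono A (ab C al g be)" and m: "adm C al g be"
  and t: "t : arr C" "tgt C t = tgt C al" "factors C be (g *. t)"
 shows "factors C al t"
proof -
 note M = admD[OF m]
 let ?P = "proj_obj C (src C t)"
 have P: "?P : arr C" "tgt C ?P = src C t" using proj_obj[of "src C t"] t by auto
 have at: "adm C ?P t al" by (rule adm_proj_obj) (use t M in auto)
 have az: "adm C ?P (zro C (src C t) (tgt C al)) al" using P M by simp
 have "ab C ?P (g *. t) be = zro A ?P be" using ab_eq_zro_iff[OF adm_cmp[OF at m]] t by simp
 also have "\<dots> = ab C ?P (g *. zro C (src C t) (tgt C al)) be" using M P t by (simp add: zro_ab)
 finally have "cmp A (ab C al g be) (ab C ?P t al) = cmp A (ab C al g be) (ab C ?P (zro C (src C t) (tgt C al)) al)"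
  using cmp_ab[OF at m] cmp_ab[OF az m] by simp
 then have "ab C ?P t al = ab C ?P (zro C (src C t) (tgt C al)) al"
  using mono at az unfolding is_mono_def by simp
 also have "\<dots> = zro A ?P al" by (simp add: zro_ab P)
 finally show ?thesis using ab_eq_zro_iff[OF at] by simp
qed

text \<open>The arrow \<open>s\<close> joining \<open>be\<close> and \<open>g\<close> represents the cokernel of \<open>ab C al g be\<close>.\<close>

lemma epi_factors:
 assumes epi: "is_epi A (ab C al g be)" and m: "adm C al g be"
  and t: "t : arr C" "tgt C t = tgt C be"
 obtains h k where "h : arr C" "k : arr C" "src C h = src C t" "src C k = src C t" "tgt C h = src C be"
  "tgt C k = tgt C al" "t = be *. h +. g *. k"
proof -
 note M = admD[OF m]
 have b: "be : arr C" "g : arr C" "tgt C be = tgt C g" using M by simp_all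
 from join[OF this] obtain s i j p q where s0: "s : arr C" "tgt C s = tgt C be"
  and h: "i : hom C (src C be) (src C s)" "j : hom C (src C g) (src C s)" "p : hom C (src C s) (src C be)"
   "q : hom C (src C s) (src C g)"
  and e: "be = s *. i" "g = s *. j" "s = be *. p +. g *. q"
  by (elim exE conjE) (rule that)
 have s: "s : arr C" "tgt C s = tgt C be" "i : arr C" "src C i = src C be" "tgt C i = src C s"
  "j : arr C" "src C j = tgt C al" "tgt C j = src C s"
  and p: "p : arr C" "src C p = src C s" "tgt C p = src C be" "q : arr C" "src C q = src C s" "tgt C q = tgt C al"
  using s0 h M unfolding hom_def by simp_all
 have a: "adm C be (idt C (tgt C be)) s"
  by (rule admI'[of _ _ _ i]) (use s M e(1)[symmetric] in simp_all)
 have z: "adm C be (zro C (tgt C be) (tgt C be)) s" using M s by simp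
 have fg: "factors C s g" by (rule factorsI[of j]) (use s M e(2)[symmetric] in simp_all)
 have "ab C al (idt C (tgt C be) *. g) s = zro A al s"
  using ab_eq_zro_iff[OF adm_cmp[OF m a]] fg M by simp
 also have "\<dots> = ab C al (zro C (tgt C be) (tgt C be) *. g) s" using M s by (simp add: zro_ab)
 finally have "cmp A (ab C be (idt C (tgt C be)) s) (ab C al g be) = cmp A (ab C be (zro C (tgt C be) (tgt C be)) s) (ab C al g be)"
  using cmp_ab[OF m a] cmp_ab[OF m z] by simp
 then have "ab C be (idt C (tgt C be)) s = ab C be (zro C (tgt C be) (tgt C be)) s"
  using epi a z unfolding is_epi_def by simp
 also have "\<dots> = zro A be s" using s by (simp add: zro_ab)
 finally have "factors C s (idt C (tgt C be))" using ab_eq_zro_iff[OF a] by simp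
 moreover have "src C (idt C (tgt C be)) = tgt C be" using M by simp
 ultimately obtain l where l: "l : arr C" "src C l = tgt C be" "tgt C l = src C s" "idt C (tgt C be) = s *. l"
  by (rule factorsE_src)
 have "t = (s *. l) *. t" using t l(4) by (metis idt_cmp)
 also have "\<dots> = s *. (l *. t)" by (rule cmp_assoc) (use t l s in auto)
 also have "\<dots> = (be *. p +. g *. q) *. (l *. t)" using e(3) by simp
 also have "\<dots> = (be *. p) *. (l *. t) +. (g *. q) *. (l *. t)"
  by (rule add_cmp) (use t l s p M in auto)
 also have "\<dots> = be *. (p *. l *. t) +. g *. (q *. l *. t)" using t l s(1,2) p M by (simp add: cmp_assoc)
 finally show ?thesis by (intro that[of "p *. l *. t" "q *. l *. t"]) (use t l s(1,2) p M in simp_all)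
qed

text \<open>Uniqueness in the universal property gives cancellation, once the common composite with
  q is seen to kill x.\<close>

lemma cokernel_epi:
 assumes "is_cokernel A x q" "x : arr A" shows "is_epi A q"
proof -
 have q: "q : arr A" "src A q = tgt A x" "cmp A q x = zro A (src A x) (tgt A q)"
  and uniq: "!!g. [|g : arr A; src A g = tgt A x; cmp A g x = zro A (src A x) (tgt A g)|] ==>
   \<exists>!u. u : hom A (tgt A q) (tgt A g) & cmp A u q = g"
  using assms unfolding is_cokernel_def by auto
 have "f = g" if f: "f : arr A" "g : arr A" "tgt A f = tgt A g" "src A f = tgt A q" "src A g = tgt A q"
  "cmp A f q = cmp A g q" for f g
 proof -
  obtain t where t: "adm C (tgt A x) t (tgt A q)" "q = ab C (tgt A x) t (tgt A q)"
   using arr_abE[OF q(1)] q(2) by metis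
  obtain s where s: "adm C (tgt A q) s (tgt A f)" "f = ab C (tgt A q) s (tgt A f)"
   using arr_abE[OF f(1)] f(4) by metis
  obtain r where r: "adm C (src A x) r (tgt A x)" "x = ab C (src A x) r (tgt A x)"
   using arr_abE[OF assms(2)] by metis
  have fq: "cmp A f q = ab C (tgt A x) (s *. t) (tgt A f)" using cmp_ab[OF t(1) s(1)] t(2) s(2) by metis
  have "ab C (src A x) (t *. r) (tgt A q) = zro A (src A x) (tgt A q)"
   using cmp_ab[OF r(1) t(1)] q(3) r(2) t(2) by metis
  then have "factors C (tgt A q) (t *. r)" using ab_eq_zro_iff[OF adm_cmp[OF r(1) t(1)]] by blast
  then have "factors C (tgt A f) (s *. t *. r)" by (rule factors_adm[OF s(1)])
  then have "factors C (tgt A f) ((s *. t) *. r)" using admD[OF r(1)] admD[OF t(1)] admD[OF s(1)] by (simp add: cmp_assoc)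
  then have "cmp A (cmp A f q) x = zro A (src A x) (tgt A f)"
   using ab_eq_zro_iff[OF adm_cmp[OF r(1) adm_cmp[OF t(1) s(1)]]] cmp_ab[OF r(1) adm_cmp[OF t(1) s(1)]] fq r(2) by metis
  moreover have "cmp A f q : arr A" "src A (cmp A f q) = tgt A x" "tgt A (cmp A f q) = tgt A f"
   using fq adm_cmp[OF t(1) s(1)] by simp_all
  ultimately have "\<exists>!u. u : hom A (tgt A q) (tgt A f) & cmp A u q = cmp A f q" using uniq by metis
  moreover have "f : hom A (tgt A q) (tgt A f)" "g : hom A (tgt A q) (tgt A f)" using f by (auto simp: hom_def)
  ultimately show ?thesis using f(6) by metis
 qed
 then show ?thesis unfolding is_epi_def using q(1) by blast
qed

text \<open>The quotient keeps the target of \<open>be\<close> and replaces its relations by those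
  of \<open>vga\<close>. The premise \<open>fg\<close> says that g becomes zero there,
  \<open>univ\<close> that every morphism killing g respects the new relations.\<close>

lemma cokernel_of_image:
 assumes m: "adm C al g be" and n: "adm C be (idt C (tgt C be)) vga" and t: "tgt C vga = tgt C be"
  and fg: "factors C vga g"
  and univ: "!!h de. [|adm C be h de; factors C de (h *. g)|] ==> factors C de (h *. vga)"
 shows "is_cokernel A (ab C al g be) (ab C be (idt C (tgt C be)) vga)"
proof -
 note M = admD[OF m] and N = admD[OF n]
 let ?q = "ab C be (idt C (tgt C be)) vga"
 have epi: "is_epi A ?q" by (rule is_epi_abI) (use M N n t in auto)
 have 0: "cmp A ?q (ab C al g be) = zro A al vga"
  using ab_eq_zro_iff[OF adm_cmp[OF m n]] cmp_ab[OF m n] M fg by simp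
 have "\<exists>!u. u : hom A vga (tgt A x) & cmp A u ?q = x"
  if x: "x : arr A" "src A x = be" "cmp A x (ab C al g be) = zro A al (tgt A x)" for x
 proof -
  let ?de = "tgt A x"
  obtain h where h: "adm C be h ?de" "x = ab C be h ?de" using arr_abE[OF x(1)] x(2) by metis
  have "ab C al (h *. g) ?de = zro A al ?de" using cmp_ab[OF m h(1)] h(2) x(3) by metis
  then have "factors C ?de (h *. g)" using ab_eq_zro_iff[OF adm_cmp[OF m h(1)]] by simp
  then have "factors C ?de (h *. vga)" using univ[OF h(1)] by simp
  then have a: "adm C vga h ?de" using admD[OF h(1)] N t by (intro admI) simp_all
  have "cmp A (ab C vga h ?de) ?q = x" using cmp_ab[OF n a] admD[OF h(1)] h(2) by simp
  moreover have "ab C vga h ?de : hom A vga ?de" using a by (simp add: hom_def)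
  moreover have "u = u'" if "u : hom A vga ?de" "cmp A u ?q = x" "u' : hom A vga ?de" "cmp A u' ?q = x" for u u'
   using epi that unfolding is_epi_def by (simp add: hom_def)
  ultimately show ?thesis by blast
 qed
 then show ?thesis unfolding is_cokernel_def using m n 0 by simp
qed

text \<open>A section s of g is itself admissible and inverse to g: both \<open>s *. al\<close> and
  s g - 1 become relations after g, and a monomorphism reflects this.\<close>

lemma mono_split_epi_iso:
 assumes mono: "is_mono A (ab C be g al)" and m: "adm C be g al" and sp: "split_epi C g"
 shows "is_iso A (ab C be g al)"
proof -
 note M = admD[OF m]
 obtain s where s: "s : arr C" "src C s = tgt C al" "tgt C s = tgt C be" "g *. s = idt C (tgt C al)"
  using sp M by (auto elim: split_epiE)
 have "g *. s *. al = al" using cmp_reassoc[OF s(4), of al] M s by simp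
 then have "factors C be (s *. al)" using M s factors_self[of al] by (intro mono_factors[OF mono m]) simp_all
 then have a: "adm C al s be" using M s by (intro admI) simp_all
 have "g *. (s *. g +. -.idt C (tgt C be)) = g *. (s *. g) +. -.g" using M s by (simp add: cmp_add cmp_scl)
 also have "g *. (s *. g) = g" using cmp_reassoc[OF s(4), of g] M s by simp
 also have "g +. -.g = zro C (tgt C be) (tgt C al)" using M by (simp add: add_neg)
 finally have "factors C be (s *. g +. -.idt C (tgt C be))"
  using M s factors_zro[of al "tgt C be"] by (intro mono_factors[OF mono m]) simp_all
 then have "ab C be (idt C (tgt C be)) be = ab C be (s *. g) be" using ab_eq_iff[OF adm_idt adm_cmp[OF m a]] M by simp
 then show ?thesis using m a s(4) M by (intro is_iso_abI[of _ _ _ s]) simp_all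
qed

text \<open>A diagram with target G and non-split arrow is a nonzero quotient of the projective
  object of G. The arrow \<open>rh\<close> cuts out its unique maximal subobject, because a proper
  subobject is represented by a non-split arrow, which factors through the sink map.\<close>

lemma top_of_quotient:
 assumes al: "al : arr C" "tgt C al = G" "~ split_epi C al" shows "is_top A al rh"
proof -
 \<comment> \<open>The weak pullback of \<open>rh\<close> along \<open>al\<close>: taking it as
   relations makes \<open>rh\<close> a monomorphism into the diagram \<open>al\<close>.\<close>
 obtain u v where u: "u : arr C" "tgt C u = src C rh" and v: "v : arr C" "src C u = src C v" "tgt C v = src C al"
  and uv: "rh *. u = al *. v"
  and wp: "!!u' v'. [|u' : arr C; v' : arr C; src C u' = src C v'; tgt C u' = src C rh; tgt C v' = src C al;
     rh *. u' = al *. v'|] ==> factors C u u'"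
  using wpullE[of al rh] al rho by metis
 let ?r = "ab C u rh al"
 have r: "adm C u rh al" by (rule admI'[of _ _ _ v]) (use al u v uv rho in simp_all)
 have lift: "factors C u t" if t: "t : arr C" "tgt C t = src C rh" "factors C al (rh *. t)" for t
 proof -
  have "src C (rh *. t) = src C t" using t rho by simp
  with t(3) obtain h where "h : arr C" "src C h = src C t" "tgt C h = src C al" "rh *. t = al *. h" by (rule factorsE_src)
  then show ?thesis using t rho by (intro wp[of t h]) simp_all
 qed
 have r_mono: "is_mono A ?r" by (rule is_mono_abI[OF r]) (use lift u in simp)
 have r_sub: "is_subobject A al ?r" unfolding is_subobject_def using r_mono al by simp
 \<comment> \<open>An inverse would write the identity of G as the sum of an arrow through
   \<open>rh\<close> and one through \<open>al\<close>; since G is local, \<open>rh\<close> or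
   \<open>al\<close> would split.\<close>
 have r_niso: "~ is_iso A ?r"
 proof
  assume "is_iso A ?r"
  then obtain s where s: "adm C al s u" "ab C al (rh *. s) al = ab C al (idt C (tgt C al)) al" using r by (rule is_iso_ab)
  note S = admD[OF s(1)]
  obtain h where h: "h : arr C" "src C h = G" "tgt C h = src C al" "idt C G = rh *. s +. al *. h"
   using ab_eqD[OF s(2)] al by (metis adm_idt)
  have "is_iso C (rh *. s) \<or> is_iso C (al *. h)"
   by (rule is_locD[OF G_loc h(4)[symmetric]]) (use h(1-3) S al rho u in simp_all)
  then have "split_epi C (rh *. s) \<or> split_epi C (al *. h)" unfolding split_epi_def is_iso_def by blast
  then have "split_epi C rh \<or> split_epi C al" using split_epi_left[of rh s] split_epi_left[of al h] h(1-3) S al rho u by metis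
  then show False using rho al by blast
 qed
 have greatest: "sub_le A m ?r" if m: "is_subobject A al m" "~ is_iso A m" for m
 proof -
  let ?be = "src A m"
  have mm: "is_mono A m" "tgt A m = al" using m(1) by (auto simp: is_subobject_def)
  then have "m : arr A" by (simp add: is_mono_def)
  then obtain g where g: "adm C ?be g al" "m = ab C ?be g al" using arr_abE mm(2) by metis
  note GG = admD[OF g(1)]
  have "~ split_epi C g" using mono_split_epi_iso[OF _ g(1)] mm(1) m(2) g(2) by metis
  then have "factors C rh g" using GG al by (intro rho(4)) simp_all
  then obtain t where t: "t : arr C" "src C t = tgt C ?be" "tgt C t = src C rh" "g = rh *. t"
   using GG by (metis factorsE)
  have "factors C al (rh *. t *. ?be)" using GG t(1-3) t(4) cmp_assoc[of rh t ?be] rho by simp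
  then have "factors C u (t *. ?be)" using t(1-3) GG by (intro lift) simp_all
  then have a: "adm C ?be t u" using t(1-3) GG u by (intro admI) simp_all
  have "cmp A ?r (ab C ?be t u) = m" using cmp_ab[OF a r] t(4) g(2) by simp
  then show ?thesis unfolding sub_le_def hom_def using a by (intro bexI[of _ "ab C ?be t u"]) simp_all
 qed
 have r_max: "is_maximal_subobject A al ?r" unfolding is_maximal_subobject_def using r_sub r_niso greatest by blast
 have rad: "is_radical A al ?r" unfolding is_radical_def
 proof (intro conjI allI impI)
  fix m assume m: "is_maximal_subobject A al m"
  then have "sub_le A m ?r" using greatest by (auto simp: is_maximal_subobject_def)
  then show "sub_le A ?r m" using m r_sub r_niso unfolding is_maximal_subobject_def by blast
 qed (use r_sub r_max in blast)+
 have n: "adm C al (idt C (tgt C al)) rh" using al rho G_obj by (intro admI) simp_all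
 have "is_cokernel A ?r (ab C al (idt C (tgt C al)) rh)"
  by (rule cokernel_of_image[OF r n]) (use al rho factors_self in simp_all)
 then show ?thesis unfolding is_top_def using rad by (metis tgt_ab)
qed

text \<open>A subobject of \<open>rh\<close> is given by some g. Either g splits and the subobject
  is everything, or g factors through \<open>rh\<close>, so the inclusion is zero and its source
  must be zero.\<close>

lemma simple_rho: "is_simple A rh"
proof -
 have "is_zero A (src A m) \<or> is_iso A m" if m: "is_subobject A rh m" for m
 proof -
  let ?be = "src A m"
  have mm: "is_mono A m" "tgt A m = rh" using m by (auto simp: is_subobject_def)
  then have "m : arr A" by (simp add: is_mono_def)
  then obtain g where g: "adm C ?be g rh" "m = ab C ?be g rh" using arr_abE mm(2) by metis
  note GG = admD[OF g(1)]
  show ?thesis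
  proof (cases "split_epi C g")
   case True
   then show ?thesis using mono_split_epi_iso[OF _ g(1)] mm(1) g(2) by metis
  next
   case False
   then have "factors C rh g" using GG rho by (intro rho(4)) simp_all
   then have "factors C ?be (idt C (tgt C ?be))"
    using mono_factors[OF _ g(1), of "idt C (tgt C ?be)"] mm(1) g(2) GG by simp
   then show ?thesis using GG split_epi_iff_factors is_zero_ab_iff by simp
  qed
 qed
 moreover have "~ is_zero A rh" using rho by (simp add: is_zero_ab_iff)
 ultimately show ?thesis unfolding is_simple_def using rho by simp
qed

lemma G_proj_not_split: "~ split_epi C (proj_obj C G)"
proof
 assume "split_epi C (proj_obj C G)"
 then have "factors C (proj_obj C G) (idt C G)" using split_epi_iff_factors proj_obj[OF G_obj] by simp
 then have "idt C G = zro C G G" using factors_proj_obj[of G "idt C G"] G_obj by simp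
 then show False using G_loc G_obj is_zeroI unfolding is_loc_def by blast
qed

lemma simple_top_G: "is_simple_top_of C G rh"
 unfolding is_simple_top_of_def using simple_rho top_of_quotient G_proj_not_split proj_obj[OF G_obj] by simp

text \<open>Otherwise every arrow D \<rightarrow> G would factor through \<open>rh\<close>, in
  particular the retraction of D onto G, and \<open>rh\<close> would split.\<close>

lemma L_rho: "F : L ==> ~ is_zero A (lwh C F rh)"
proof
 assume "F : L" "is_zero A (lwh C F rh)"
 then have *: "ALL d : hom C D G. factors C rh d" using L_zero rho by simp
 obtain i p where ip: "i : hom C G D" "p : hom C D G" "p *. i = idt C G" using G_D unfolding retract_def by blast
 then have "factors C rh (p *. i)" using * rho by (intro factors_cmp) (auto simp: hom_def)
 then show False using ip rho split_epi_iff_factors by simp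
qed

theorem is_duflo: "is_duflo_involution C L G"
proof -
 let ?P = "proj_obj C (one C)"
 note P = proj_obj[OF one_obj]
 \<comment> \<open>A weak kernel of \<open>ep\<close>, obtained as a weak pullback along the zero
   arrow into \<open>one C\<close>. With these relations G presents the image K of the counit, and
   \<open>ep\<close> itself represents the inclusion.\<close>
 obtain ka where ka: "ka : arr C" "tgt C ka = G" "ep *. ka = zro C (src C ka) (one C)"
  and wk: "!!t. [|t : arr C; tgt C t = G; ep *. t = zro C (src C t) (one C)|] ==> factors C ka t"
 proof -
  have "tgt C ?P = tgt C ep" using P epsD by simp
  from wpullE[OF P(1) epsD(1) this] obtain u v where u: "u : arr C" "v : arr C" "src C u = src C v"
   "tgt C u = src C ep" "tgt C v = src C ?P" "ep *. u = ?P *. v" and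
   w: "!!u' v'. [|u' : arr C; v' : arr C; src C u' = src C v'; tgt C u' = src C ep; tgt C v' = src C ?P;
     ep *. u' = ?P *. v'|] ==> factors C u u'" by blast
  have "factors C u t" if "t : arr C" "tgt C t = G" "ep *. t = zro C (src C t) (one C)" for t
   using w[of t "zro C (src C t) (zero_object C)"] that zero_obj P one_obj epsD by simp
  moreover have "ep *. u = zro C (src C u) (one C)" 
   unfolding u(6) using u(1-5) zero_obj one_obj P by (simp add: proj_obj_def)
  ultimately show ?thesis using that u(1,4) epsD by blast
 qed
 let ?k = "ab C ka ep ?P"
 have k: "adm C ka ep ?P" using ka epsD P one_obj by (intro admI) (simp_all add: factors_zro)
 have mono: "is_mono A ?k"
  by (rule is_mono_abI[OF k]) (use ka wk epsD one_obj in "simp add: factors_proj_obj")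
 have q: "adm C ?P (idt C (tgt C ?P)) ep" using P epsD one_obj by (intro adm_proj_obj) simp_all
 have cok: "is_cokernel A ?k (ab C ?P (idt C (tgt C ?P)) ep)"
  by (rule cokernel_of_image[OF k q]) (use P epsD factors_self in simp_all)
 \<comment> \<open>An arrow from D to the subquotient lifts, up to relations, along the epimorphism
   to the subobject \<open>src A m\<close>. Mapped on into the quotient \<open>ep\<close> it
   vanishes by the assumption on D, hence it vanishes already in the subobject.\<close>
 have zero: "is_zero A (lwh C F S)"
  if F: "F : L" and S: "is_simple A S" "is_subquotient A ep S" for F S
 proof -
  obtain m p where m: "is_mono A m" "tgt A m = ep" and p: "is_epi A p" "src A p = src A m" "tgt A p = S"
   using S(2) unfolding is_subquotient_def is_subobject_def by blast
  have "m : arr A" "p : arr A" using m(1) p(1) by (simp_all add: is_mono_def is_epi_def)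
  then obtain g t where g: "adm C (src A m) g ep" "m = ab C (src A m) g ep" 
   and t: "adm C (src A m) t S" "p = ab C (src A m) t S"
   using arr_abE m(2) p(2,3) by metis
  note GG = admD[OF g(1)] and T = admD[OF t(1)]
  have "factors C S d" if d: "d : hom C D (tgt C S)" for d
  proof -
   have d': "d : arr C" "tgt C d = tgt C S" "src C d = D" using d by (auto simp: hom_def)
   from p(1) have "is_epi A (ab C (src A m) t S)" using t(2) by simp
   from this t(1) d'(1,2) obtain h l where hl: "h : arr C" "l : arr C" "src C h = D" "src C l = D" "tgt C h = src C S"
     "tgt C l = tgt C (src A m)" "d = S *. h +. t *. l" unfolding d'(3)[symmetric] by (rule epi_factors)
   have "factors C ep (g *. l)" by (rule D_one) (use hl GG epsD in "simp add: hom_def")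
   then have "factors C (src A m) l" using mono_factors[OF _ g(1)] m(1) g(2) hl by simp
   then have "factors C S (t *. l)" by (rule factors_adm[OF t(1)])
   moreover have "factors C S (S *. h)" by (rule factorsI[of h]) (use hl T in simp_all)
   ultimately show ?thesis unfolding hl(7) by (intro factors_add) (use hl T in simp_all)
  qed
  then show ?thesis using L_zero F T by blast
 qed
 have ns: "~ split_epi C ka"
 proof
  assume "split_epi C ka"
  then obtain s where s: "s : arr C" "src C s = G" "tgt C s = src C ka" "ka *. s = idt C G" using ka by (auto elim: split_epiE)
  have "ep = ep *. (ka *. s)" using s(4) epsD by simp
  also have "\<dots> = (ep *. ka) *. s" by (rule cmp_assoc[symmetric]) (use s ka epsD in simp_all)
  finally show False using eps(2) s ka one_obj by simp
 qed
 have "is_top A ka rh" by (rule top_of_quotient) (use ka ns in auto)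
 moreover have "isomorphic A rh rh"
 proof -
  have "is_iso A (ab C rh (idt C G) rh)" using rho G_obj by (intro is_iso_abI[of _ _ _ "idt C G"]) simp_all
  moreover have "ab C rh (idt C G) rh : hom A rh rh" using rho by (simp add: hom_def)
  ultimately show ?thesis unfolding isomorphic_def using rho by auto
 qed
 moreover have "is_subobject A ?P ?k" using mono P by (simp add: is_subobject_def)
 ultimately show ?thesis unfolding is_duflo_involution_def
  apply (intro conjI L_cell is_loc_indecomposable[OF G_loc])
  \<comment> \<open>K and the projective object of G have literally the same top object
    \<open>rh\<close>, which is inserted for both T and LG.\<close>
  apply (rule exI[of _ ?k], rule exI[of _ "ab C ?P (idt C (tgt C ?P)) ep"], rule exI[of _ rh], rule exI[of _ rh])
  using cok zero simple_top_G L_rho by simp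
qed

section \<open>Uniqueness of the Duflo involution\<close>

lemma mono_arrE:
 assumes "is_mono A m" "tgt A m = be"
 obtains al g where "adm C al g be" "m = ab C al g be" "is_mono A (ab C al g be)" "src A m = al"
proof -
 have "m : arr A" using assms by (simp add: is_mono_def)
 then obtain g where "adm C (src A m) g (tgt A m)" "m = ab C (src A m) g (tgt A m)" by (rule arr_abE)
 then show ?thesis using that[of "src A m" g] assms by simp
qed

text \<open>What dies in the cokernel comes from g: the universal property is applied to the
  quotient with relations g. The premise on \<open>src C be\<close> makes the identity compatible
  with these relations.\<close>

lemma cokernel_factors:
 assumes c: "is_cokernel A (ab C al g be) (ab C be q vga)" and g: "adm C al g be" and q: "adm C be q vga"
  and src: "src C be = zero_object C" and t: "t : arr C" "tgt C t = tgt C be" "factors C vga (q *. t)"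
 shows "factors C g t"
proof -
 note GG = admD[OF g] and Q = admD[OF q]
 have b0: "be = zro C (zero_object C) (tgt C be)"
 proof -
  have "is_zero C (zero_object C)" unfolding zero_object_def by (rule someI_ex[OF zero_ex])
  then show ?thesis using is_zero_src[OF _ _ src] GG by blast
 qed
 have a: "adm C be (idt C (tgt C be)) g"
 proof (rule admI)
  show "factors C g (idt C (tgt C be) *. be)"
   using factors_zro[of g "zero_object C" "tgt C be"] zero_obj GG b0 by simp
 qed (use GG in simp_all)
 let ?x = "ab C be (idt C (tgt C be)) g"
 have "cmp A ?x (ab C al g be) = zro A al g"
  using cmp_ab[OF g a] ab_eq_zro_iff[OF adm_cmp[OF g a]] factors_self[of g] GG by simp
 moreover have "?x : arr A" "src A ?x = be" "tgt A ?x = g" using a by simp_all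
 ultimately obtain u where u: "u : hom A vga g" "cmp A u (ab C be q vga) = ?x"
  using c unfolding is_cokernel_def by (metis (no_types, lifting) src_ab tgt_ab)
 then obtain h where h: "adm C vga h g" "u = ab C vga h g" by (auto simp: hom_def elim: arr_abE)
 have "ab C be (h *. q) g = ?x" using u(2) h cmp_ab[OF q h(1)] by simp
 then obtain l where l: "l : arr C" "src C l = tgt C be" "tgt C l = src C g" "idt C (tgt C be) = h *. q +. g *. l"
  using a by (rule ab_eqD)
 note H = admD[OF h(1)]
 have "t = idt C (tgt C be) *. t" using t by simp
 also have "\<dots> = (h *. q) *. t +. (g *. l) *. t"
  unfolding l(4) by (rule add_cmp) (use l(1-3) t(1,2) GG Q H in simp_all)
 also have "\<dots> = h *. (q *. t) +. g *. (l *. t)" using l(1-3) t(1,2) GG Q H by (simp add: cmp_assoc)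
 finally have e: "t = h *. (q *. t) +. g *. (l *. t)" .
 have "factors C g (h *. (q *. t))" by (rule factors_adm[OF h(1) t(3)])
 moreover have "factors C g (g *. (l *. t))" by (rule factors_cmp[OF factors_self]) (use l(1-3) t(1,2) GG in simp_all)
 ultimately have "factors C g (h *. (q *. t) +. g *. (l *. t))" by (rule factors_add) (use l(1-3) t(1,2) GG Q H in simp_all)
 then show ?thesis using e by simp
qed

text \<open>If the counit did not land in the subobject, its image in the quotient would be nonzero
  and have \<open>rh\<close> as a quotient, a simple subquotient that the cell does not
  kill.\<close>

lemma eps_factors:
 assumes m: "adm C ka g (proj_obj C (one C))" and q: "adm C (proj_obj C (one C)) q vga"
  and c: "is_cokernel A (ab C ka g (proj_obj C (one C))) (ab C (proj_obj C (one C)) q vga)"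
  and zero: "!!F S. [|F : L; is_simple A S; is_subquotient A vga S|] ==> is_zero A (lwh C F S)"
 shows "factors C g ep"
proof -
 note P = proj_obj[OF one_obj] and Q = admD[OF q]
 have Qt: "src C q = one C" "q : arr C" "tgt C q = tgt C vga" "vga : arr C" using Q P by simp_all
 have qe: "q *. ep : arr C" "src C (q *. ep) = G" "tgt C (q *. ep) = tgt C vga" using Qt epsD by simp_all
 have "factors C vga (q *. ep)"
 proof (rule ccontr)
  assume nf: "~ factors C vga (q *. ep)"
  from wpullE[OF Qt(4) qe(1) qe(3)[symmetric]] obtain u v where u: "u : arr C" "v : arr C" "src C u = src C v"
   "tgt C u = src C (q *. ep)" "tgt C v = src C vga" "(q *. ep) *. u = vga *. v"
   and w: "!!u' v'. [|u' : arr C; v' : arr C; src C u' = src C v'; tgt C u' = src C (q *. ep); tgt C v' = src C vga;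
     (q *. ep) *. u' = vga *. v'|] ==> factors C u u'" by blast
  have uG: "tgt C u = G" using u(4) qe by simp
  have m: "adm C u (q *. ep) vga" by (rule admI'[of _ _ _ v]) (use u Qt qe uG in simp_all)
  have mono: "is_mono A (ab C u (q *. ep) vga)"
  proof (rule is_mono_abI[OF m])
   fix t assume t: "t : arr C" "tgt C t = tgt C u" "factors C vga ((q *. ep) *. t)"
   have "src C ((q *. ep) *. t) = src C t" using t(1,2) qe uG by simp
   with t(3) obtain h where "h : arr C" "src C h = src C t" "tgt C h = src C vga" "(q *. ep) *. t = vga *. h" by (rule factorsE_src)
   then show "factors C u t" using t(1,2) u(4) by (intro w[of t h]) metis+
  qed
  have "~ split_epi C u"
  proof
   assume "split_epi C u"
   then obtain s where s: "s : arr C" "src C s = G" "tgt C s = src C u" "u *. s = idt C G" using uG by (metis split_epiE)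
   have "q *. ep = (q *. ep) *. (u *. s)" using s(4) qe by simp
   also have "\<dots> = ((q *. ep) *. u) *. s" by (rule cmp_assoc[symmetric]) (use s(1-3) u(1-5) qe in simp_all)
   also have "\<dots> = vga *. (v *. s)" unfolding u(6) by (rule cmp_assoc) (use s(1-3) u(1-5) Qt in simp_all)
   finally have "q *. ep = vga *. (v *. s)" .
   moreover have "v *. s : arr C" "src C (v *. s) = G" "tgt C (v *. s) = src C vga" using s(1-3) u(1-5) by simp_all
   ultimately have "factors C vga (q *. ep)" using qe(2) by (metis factorsI)
   then show False using nf by blast
  qed
  then have "factors C rh u" using u(1) uG by (intro rho(4))
  then have n: "adm C u (idt C G) rh" using u(1) uG rho G_obj by (intro admI) simp_all
  have "is_epi A (ab C u (idt C G) rh)" by (rule is_epi_abI) (use u(1) uG rho n in simp_all)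
  then have "is_subquotient A vga rh" unfolding is_subquotient_def is_subobject_def
   using mono Qt by (intro exI[of _ "ab C u (q *. ep) vga"] exI[of _ "ab C u (idt C G) rh"]) simp
  then show False using zero[OF L_ne simple_rho] L_rho[OF L_ne] by blast
 qed
 then show ?thesis using cokernel_factors[OF c m q] P epsD by simp
qed

lemma iso_not_factors:
 assumes "isomorphic A be vga" "t : arr C" "tgt C t = tgt C vga" "~ factors C vga t"
 obtains g where "adm C vga g be" "~ factors C be (g *. t)"
proof -
 obtain x where x: "x : hom A be vga" "is_iso A x" using assms(1) unfolding isomorphic_def by blast
 then obtain h where h: "adm C be h vga" "x = ab C be h vga" by (auto simp: hom_def elim: arr_abE)
 obtain s where s: "adm C vga s be" "ab C vga (h *. s) vga = ab C vga (idt C (tgt C vga)) vga"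
  using is_iso_ab[OF _ h(1)] x(2) h(2) by metis
 note H = admD[OF h(1)] and S = admD[OF s(1)]
 have "adm C vga (idt C (tgt C vga)) vga" using H by simp
 with s(2) obtain l where l: "l : arr C" "src C l = tgt C vga" "tgt C l = src C vga" "idt C (tgt C vga) = h *. s +. vga *. l"
  by (rule ab_eqD)
 have "~ factors C be (s *. t)"
 proof
  assume "factors C be (s *. t)"
  then have 1: "factors C vga (h *. (s *. t))" by (rule factors_adm[OF h(1)])
  have 2: "factors C vga (vga *. (l *. t))" by (rule factors_cmp[OF factors_self]) (use l(1-3) assms H in simp_all)
  have "t = idt C (tgt C vga) *. t" using assms by simp
  also have "\<dots> = (h *. s) *. t +. (vga *. l) *. t"
   unfolding l(4) by (rule add_cmp) (use l(1-3) assms H S in simp_all)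
  also have "\<dots> = h *. (s *. t) +. vga *. (l *. t)" using l(1-3) assms H S by (simp add: cmp_assoc)
  finally have e: "t = h *. (s *. t) +. vga *. (l *. t)" .
  have "factors C vga (h *. (s *. t) +. vga *. (l *. t))" by (rule factors_add[OF 1 2]) (use l(1-3) assms H S in simp_all)
  then show False using assms(4) e by simp
 qed
 then show ?thesis using that s by blast
qed

text \<open>
 A morphism from \<open>G\<close> to a simple quotient of the projective of \<open>G'\<close> that is nonzero in the
 abelianization lifts along the projection, and so does the projection along it; composing the
 two lifts shows that \<open>G\<close> is a retract of \<open>G'\<close>.
\<close>

lemma retract_of_simple_quotient:
 assumes S: "is_simple A si" and c: "adm C (proj_obj C G') c si" "is_epi A (ab C (proj_obj C G') c si)" and G': "G' : obj C"
  and w: "w : arr C" "src C w = G" "tgt C w = tgt C si" "~ factors C si w"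
 shows "retract C G G'"
proof -
 have si: "si : arr C" using S by (simp add: is_simple_def)
 note P = proj_obj[OF G'] and CC = admD[OF c(1)]
 from wpullE[OF si w(1) w(3)[symmetric]] obtain u v where u: "u : arr C" "v : arr C" "src C u = src C v"
  "tgt C u = src C w" "tgt C v = src C si" "w *. u = si *. v"
  and wp: "!!u' v'. [|u' : arr C; v' : arr C; src C u' = src C v'; tgt C u' = src C w; tgt C v' = src C si;
    w *. u' = si *. v'|] ==> factors C u u'" by blast
 have m: "adm C u w si" by (rule admI'[of _ _ _ v]) (use u si w in simp_all)
 have mono: "is_mono A (ab C u w si)"
 proof (rule is_mono_abI[OF m])
  fix t assume t: "t : arr C" "tgt C t = tgt C u" "factors C si (w *. t)"
  have "src C (w *. t) = src C t" using t(1,2) w u(4) by simp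
  with t(3) obtain h where "h : arr C" "src C h = src C t" "tgt C h = src C si" "w *. t = si *. h" by (rule factorsE_src)
  then show "factors C u t" using t(1,2) u(4) by (intro wp[of t h]) metis+
 qed
 have "~ split_epi C u"
 proof
  assume "split_epi C u"
  then obtain s where s: "s : arr C" "src C s = G" "tgt C s = src C u" "u *. s = idt C G" using u(4) w(2) by (metis split_epiE)
  have "w = w *. (u *. s)" using s(4) w by simp
  also have "\<dots> = (w *. u) *. s" by (rule cmp_assoc[symmetric]) (use s(1-3) u(1-5) w in simp_all)
  also have "\<dots> = si *. (v *. s)" unfolding u(6) by (rule cmp_assoc) (use s(1-3) u(1-5) si in simp_all)
  finally have "w = si *. (v *. s)" .
  moreover have "v *. s : arr C" "src C (v *. s) = G" "tgt C (v *. s) = src C si" using s(1-3) u(1-5) by simp_all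
  ultimately have "factors C si w" using w(2) by (metis factorsI)
  then show False using w(4) by blast
 qed
 then have "~ is_zero A u" by (simp add: is_zero_ab_iff)
 moreover have "is_subobject A si (ab C u w si)" using mono si by (simp add: is_subobject_def)
 ultimately have "is_iso A (ab C u w si)" using S unfolding is_simple_def by (metis src_ab)
 then obtain s where s: "adm C si s u" "ab C si (w *. s) si = ab C si (idt C (tgt C si)) si" using m by (rule is_iso_ab)
 note SS = admD[OF s(1)]
 have "adm C si (idt C (tgt C si)) si" using si by simp
 with s(2) obtain l where l: "l : arr C" "src C l = tgt C si" "tgt C l = src C si" "idt C (tgt C si) = w *. s +. si *. l"
  by (rule ab_eqD)
 have uG: "tgt C u = G" using u(4) w(2) by simp
 have ct: "c : arr C" "src C c = G'" "tgt C c = tgt C si" using CC P by simp_all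
 have st: "s : arr C" "src C s = tgt C si" "tgt C s = G" using SS uG by simp_all
 have "c = idt C (tgt C si) *. c" using ct by simp
 also have "\<dots> = (w *. s) *. c +. (si *. l) *. c"
  unfolding l(4) by (rule add_cmp) (use l(1-3) ct st w si in simp_all)
 also have "\<dots> = w *. (s *. c) +. si *. (l *. c)" using l(1-3) ct st w si by (simp add: cmp_assoc)
 finally have ce: "c = w *. (s *. c) +. si *. (l *. c)" .
 from c(2,1) w(1,3) obtain h a where h: "h : arr C" "a : arr C" "src C h = src C w" "src C a = src C w" "tgt C h = src C si"
  "tgt C a = tgt C (proj_obj C G')" "w = si *. h +. c *. a" by (rule epi_factors)
 have ht: "src C h = G" "src C a = G" "tgt C a = G'" using h w P by simp_all
 let ?b = "s *. c"
 have b: "?b : arr C" "src C ?b = G'" "tgt C ?b = G" using ct st by simp_all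
 have ba: "?b *. a : arr C" "src C (?b *. a) = G" "tgt C (?b *. a) = G" using b h(2) ht by simp_all
 have "c *. a = (w *. ?b +. si *. (l *. c)) *. a" using ce by simp
 also have "\<dots> = w *. (?b *. a) +. si *. (l *. c *. a)" using b h(1,2) ht l(1-3) ct w(1-3) si st by (simp add: add_cmp cmp_assoc)
 finally have ca: "c *. a = w *. (?b *. a) +. si *. (l *. c *. a)" .
 \<comment> \<open>\<open>w *. r\<close> factors through \<open>si\<close>, so an invertible r would
   make w factor as well. Locality of G then leaves \<open>?b *. a\<close> as the invertible
   summand.\<close>
 obtain r where r: "r : arr C" "src C r = G" "tgt C r = G" "?b *. a +. r = idt C G"
  using ex_add[of "?b *. a" "idt C G"] ba G_obj by auto
 have "is_iso C (?b *. a) \<or> is_iso C r" by (rule is_locD[OF G_loc r(4)]) (use ba r in simp_all)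
 moreover have "~ is_iso C r"
 proof
  assume "is_iso C r"
  then obtain r' where r': "r' : arr C" "src C r' = G" "tgt C r' = G" "r *. r' = idt C G" using r by (metis is_isoE)
  have "w *. (?b *. a) +. w *. r = w *. (?b *. a +. r)" by (rule cmp_add[symmetric]) (use w ba r in simp_all)
  also have "\<dots> = w" using r(4) w by simp
  also have "\<dots> = si *. h +. (w *. (?b *. a) +. si *. (l *. c *. a))" using h(7) ca by simp
  also have "\<dots> = w *. (?b *. a) +. si *. (h +. l *. c *. a)"
   using h(1-5) ht w(1-3) ba l(1-3) ct si by (simp add: cmp_add add_left_commute[of "si *. h"])
  finally have "w *. r = si *. (h +. l *. c *. a)"
   by (rule add_left_cancel) (use h(1-5) ht w(1-3) ba r(1-3) l(1-3) ct si in simp_all)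
  moreover have "h +. l *. c *. a : arr C" "src C (h +. l *. c *. a) = src C (w *. r)" "tgt C (h +. l *. c *. a) = src C si"
   using h(1-5) ht w(1-3) r(1-3) l(1-3) ct by simp_all
  ultimately have f: "factors C si (w *. r)" by (metis factorsI)
  have "factors C si ((w *. r) *. r')" by (rule factors_cmp[OF f]) (use si r'(1-3) w r(1-3) in simp_all)
  moreover have "(w *. r) *. r' = w" using cmp_assoc[of w r r'] r' r(1-3) w by simp
  ultimately show False using w(4) by simp
 qed
 ultimately obtain d where d: "d : arr C" "src C d = G" "tgt C d = G" "d *. (?b *. a) = idt C G" using ba by (metis is_isoE)
 have "(d *. ?b) *. a = idt C G" using cmp_assoc[of d ?b a] d b h(2) ht by simp
 moreover have "a : hom C G G'" "d *. ?b : hom C G' G" using d b h(2) ht by (simp_all add: hom_def)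
 ultimately show ?thesis unfolding retract_def by blast
qed

text \<open>Let K be the subobject of the competitor G'. An arrow from D that is nonzero in the
  simple top of G' lifts to K, and its composite into \<open>one C\<close> factors through
  \<open>ep\<close>. As \<open>ep\<close> lands in K, the composite G \<rightarrow> K \<rightarrow>
  top is nonzero too, which makes G a retract of G'.\<close>

theorem duflo_unique:
 assumes "is_duflo_involution C L G'" shows "isomorphic C G' G"
proof -
 let ?P = "proj_obj C (one C)"
 note P = proj_obj[OF one_obj]
 from assms obtain k q T LG where ind: "indecomposable C G'"
  and k: "is_subobject A ?P k" and q: "is_cokernel A k q"
  and zero: "!!F S. [|F : L; is_simple A S; is_subquotient A (tgt A q) S|] ==> is_zero A (lwh C F S)"
  and top: "is_top A (src A k) T" and LG: "is_simple_top_of C G' LG" and iso: "isomorphic A T LG"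
  and nz: "!!F. F : L ==> ~ is_zero A (lwh C F LG)"
  unfolding is_duflo_involution_def by (elim exE conjE) (rule that, blast+)
 have G': "G' : obj C" using ind by (simp add: indecomposable_def)
 note P' = proj_obj[OF G']
 obtain ka g where ka: "adm C ka g ?P" "k = ab C ka g ?P" "is_mono A (ab C ka g ?P)" "src A k = ka"
  using k unfolding is_subobject_def by (metis mono_arrE)
 have "q : arr A" "src A q = tgt A k" using q unfolding is_cokernel_def by simp_all
 then obtain p where p: "adm C ?P p (tgt A q)" "q = ab C ?P p (tgt A q)" using arr_abE ka(2) by (metis tgt_ab)
 note K = admD[OF ka(1)]
 have gt: "g : arr C" "src C g = tgt C ka" "tgt C g = one C" "ka : arr C" using K P by simp_all
 have "factors C g ep" by (rule eps_factors[OF ka(1) p(1) _ zero]) (use q ka(2) p(2) in simp_all)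
 with epsD(2) obtain h where h: "h : arr C" "src C h = G" "tgt C h = tgt C ka" "ep = g *. h" using gt(2) by (metis factorsE)
 have LGs: "is_simple A LG" and LGt: "is_top A (proj_obj C G') LG" using LG unfolding is_simple_top_of_def by simp_all
 have LGa: "LG : arr C" using LGs by (simp add: is_simple_def)
 obtain d where d: "d : hom C D (tgt C LG)" "~ factors C LG d" using nz[OF L_ne] L_zero[OF L_ne LGa] by blast
 then have dt: "d : arr C" "src C d = D" "tgt C d = tgt C LG" by (simp_all add: hom_def)
 obtain f where f: "adm C LG f T" "~ factors C T (f *. d)" using iso_not_factors[OF iso dt(1,3) d(2)] .
 note FF = admD[OF f(1)]
 obtain r y where r: "is_radical A ka r" and y: "is_cokernel A r y" "tgt A y = T" using top ka(4) unfolding is_top_def by blast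
 have rr: "r : arr A" "tgt A r = ka" using r unfolding is_radical_def is_subobject_def is_mono_def by simp_all
 have yy: "y : arr A" "src A y = ka" using y(1) rr(2) unfolding is_cokernel_def by simp_all
 then obtain t where t: "adm C ka t T" "y = ab C ka t T" using arr_abE y(2) by metis
 note TT = admD[OF t(1)]
 have epi: "is_epi A (ab C ka t T)" using cokernel_epi[OF y(1) rr(1)] t(2) by simp
 have fd: "f *. d : arr C" "src C (f *. d) = D" "tgt C (f *. d) = tgt C T" using FF dt by simp_all
 from epi t(1) fd(1,3) obtain z d' where zd: "z : arr C" "d' : arr C" "src C z = src C (f *. d)" "src C d' = src C (f *. d)"
  "tgt C z = src C T" "tgt C d' = tgt C ka" "f *. d = T *. z +. t *. d'" by (rule epi_factors)
 have zt: "src C z = D" "src C d' = D" using zd(3,4) fd(2) by simp_all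
 have th: "t *. h : arr C" "src C (t *. h) = G" "tgt C (t *. h) = tgt C T" using TT h(1-3) by simp_all
 have nth: "~ factors C T (t *. h)"
 proof
  assume fth: "factors C T (t *. h)"
  \<comment> \<open>The arrows d' and h x have the same composite with the inclusion g, so they
    agree in K. If the top kills h, it therefore kills d' too, against the choice of d.\<close>
  have "factors C ep (g *. d')" using gt zd(2,6) zt by (intro D_one) (simp add: hom_def)
  then obtain x where x: "x : arr C" "src C x = src C (g *. d')" "tgt C x = src C ep" "g *. d' = ep *. x" by (rule factorsE)
  have xt: "src C x = D" "tgt C x = G" using x(2,3) gt zd(2,6) zt epsD by simp_all
  have "g *. (d' +. -.(h *. x)) = g *. d' +. -.(g *. h *. x)" using gt zd(2,6) zt h(1-3) x(1) xt by (simp add: cmp_add cmp_scl)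
  also have "g *. h *. x = ep *. x" unfolding h(4) by (rule cmp_assoc[symmetric]) (use gt h(1-3) x(1) xt in simp_all)
  also have "g *. d' +. -.(ep *. x) = zro C D (one C)" unfolding x(4)[symmetric] by (rule add_neg) (use gt zd(2,6) zt in simp_all)
  finally have "factors C ?P (g *. (d' +. -.(h *. x)))" using factors_zro[OF P(1) _ P(2), of D] zd(2) zt src_obj[OF zd(2)] by simp
  then have "factors C ka (d' +. -.(h *. x))" using zd(2,6) zt h(1-3) x(1) xt by (intro mono_factors[OF ka(3,1)]) simp_all
  then have 1: "factors C T (t *. (d' +. -.(h *. x)))" by (rule factors_adm[OF t(1)])
  have 2: "factors C T ((t *. h) *. x)" by (rule factors_cmp[OF fth]) (use TT th x(1) xt in simp_all)
  have "factors C T (t *. (d' +. -.(h *. x)) +. (t *. h) *. x)"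
   by (rule factors_add[OF 1 2]) (use TT zd(2,6) zt h(1-3) x(1) xt in simp_all)
  also have "t *. (d' +. -.(h *. x)) +. (t *. h) *. x = t *. ((d' +. -.(h *. x)) +. h *. x)"
   using TT zd(2,6) zt h(1-3) x(1) xt by (simp add: cmp_add cmp_assoc)
  also have "(d' +. -.(h *. x)) +. h *. x = d'"
   using zd(2,6) zt h(1-3) x(1) xt by (simp add: add_assoc add_commute[of "-.(h *. x)"] add_neg)
  finally have 3: "factors C T (t *. d')" .
  have 4: "factors C T (T *. z)" by (rule factors_cmp[OF factors_self]) (use TT zd(1,5) in simp_all)
  have "factors C T (T *. z +. t *. d')" by (rule factors_add[OF 4 3]) (use TT zd(1-6) in simp_all)
  then show False using f(2) zd(7) by simp
 qed
 have "isomorphic A LG T"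
 proof -
  obtain x x' where x: "x : hom A T LG" "x' : hom A (tgt A x) (src A x)" "cmp A x' x = idt A (src A x)"
   "cmp A x x' = idt A (tgt A x)" using iso unfolding isomorphic_def is_iso_def by blast
  then have "src A x = T" "tgt A x = LG" "x : arr A" by (simp_all add: hom_def)
  with x have "is_iso A x'" unfolding is_iso_def by (intro conjI bexI[of _ x]) (simp_all add: hom_def)
  moreover have "x' : hom A LG T" using x \<open>src A x = T\<close> \<open>tgt A x = LG\<close> by simp
  ultimately show ?thesis using iso unfolding isomorphic_def by blast
 qed
 from iso_not_factors[OF this th(1,3) nth] obtain w where w: "adm C T w LG" "~ factors C LG (w *. (t *. h))" .
 note W = admD[OF w(1)]
 obtain r2 c2 where r2: "is_radical A (proj_obj C G') r2" and c2: "is_cokernel A r2 c2" "tgt A c2 = LG"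
  using LGt unfolding is_top_def by blast
 have r2': "r2 : arr A" "tgt A r2 = proj_obj C G'" using r2 unfolding is_radical_def is_subobject_def is_mono_def by simp_all
 have "c2 : arr A" "src A c2 = proj_obj C G'" using c2(1) r2'(2) unfolding is_cokernel_def by simp_all
 then obtain c where c: "adm C (proj_obj C G') c LG" "c2 = ab C (proj_obj C G') c LG" using arr_abE c2(2) by metis
 have "is_epi A (ab C (proj_obj C G') c LG)" using cokernel_epi[OF c2(1) r2'(1)] c(2) by simp
 then have "retract C G G'"
  by (rule retract_of_simple_quotient[OF LGs c(1) _ G', of "w *. (t *. h)"]) (use W th w(2) in simp_all)
 then show ?thesis using G_retract ind by blast
qed

end

section \<open>Modules over a finite dimensional algebra\<close>

subsection \<open>Abelian groups and modules with a carrier\<close>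

lemma abelian_grp_simps [simp]:
 assumes "abelian_grp M"
 shows "zer M : carr M"
  and "[|x : carr M; y : carr M|] ==> pls M x y : carr M"
  and "x : carr M ==> pls M (zer M) x = x"
  and "x : carr M ==> pls M x (zer M) = x"
 using assms unfolding abelian_grp_def by metis+

lemma abelian_grpI:
 assumes "zer M : carr M" "!!x y. x : carr M ==> y : carr M ==> pls M x y : carr M"
  "!!x y. x : carr M ==> y : carr M ==> pls M x y = pls M y x"
  "!!x y z. x : carr M ==> y : carr M ==> z : carr M ==> pls M (pls M x y) z = pls M x (pls M y z)"
  "!!x. x : carr M ==> pls M (zer M) x = x" "!!x. x : carr M ==> EX y : carr M. pls M x y = zer M"
 shows "abelian_grp M"
 unfolding abelian_grp_def
 apply (intro conjI ballI)
    apply (rule assms(1))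
   apply (rule assms(2); assumption)
   apply (rule assms(3); assumption)
  apply (rule assms(4); assumption)
  apply (rule assms(5); assumption)
 apply (rule assms(6); assumption)
 done

lemma pls_assoc: "[|abelian_grp M; x : carr M; y : carr M; z : carr M|] ==> pls M (pls M x y) z = pls M x (pls M y z)"
 and pls_commute: "[|abelian_grp M; x : carr M; y : carr M|] ==> pls M x y = pls M y x"
 unfolding abelian_grp_def by blast+

lemma pls_left_commute:
 "[|abelian_grp M; x : carr M; y : carr M; z : carr M|] ==> pls M x (pls M y z) = pls M y (pls M x z)"
 by (metis pls_assoc pls_commute)

lemma pls_cancel:
 assumes "pls M x y = pls M x z" "abelian_grp M" "x : carr M" "y : carr M" "z : carr M" shows "y = z"
proof -
 obtain n where n: "n : carr M" "pls M x n = zer M" using assms(2,3) unfolding abelian_grp_def by blast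
 have "y = pls M n (pls M x y)" using n assms pls_left_commute[of M n x y] pls_assoc[of M x n y] by simp
 moreover have "z = pls M n (pls M x z)" using n assms pls_left_commute[of M n x z] pls_assoc[of M x n z] by simp
 ultimately show ?thesis using assms(1) by simp
qed

lemma left_module_grp [simp]: "left_module M ==> abelian_grp M"
 by (simp add: left_module_def)

lemma act_simps [simp]:
 assumes "left_module M"
 shows "x : carr M ==> act M a x : carr M"
  and "x : carr M ==> act M 1 x = x"
  and "x : carr M ==> act M a (act M b x) = act M (a * b) x"
 using assms unfolding left_module_def by metis+

lemma act_add: "[|left_module M; x : carr M|] ==> act M (a + b) x = pls M (act M a x) (act M b x)"
 and act_pls: "[|left_module M; x : carr M; y : carr M|] ==> act M a (pls M x y) = pls M (act M a x) (act M a y)"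
 unfolding left_module_def by blast+

lemma act_zer [simp]:
 assumes "left_module M" shows "act M a (zer M) = zer M"
proof -
 have "pls M (act M a (zer M)) (act M a (zer M)) = pls M (act M a (zer M)) (zer M)"
  using assms act_pls[OF assms, of "zer M" "zer M" a] by simp
 then show ?thesis using pls_cancel assms left_module_grp abelian_grp_simps(1) act_simps(1) by metis
qed

lemma zero_act [simp]:
 assumes "left_module M" "x : carr M" shows "act M 0 x = zer M"
proof -
 have "pls M (act M 0 x) (act M 0 x) = pls M (act M 0 x) (zer M)"
  using assms act_add[OF assms, of 0 0] by simp
 then show ?thesis using pls_cancel assms left_module_grp abelian_grp_simps(1) act_simps(1) by metis
qed

lemma module_homD:
 assumes "module_hom M N f"
 shows "x : carr M ==> f x : carr N"
  and "x : carr M ==> y : carr M ==> f (pls M x y) = pls N (f x) (f y)"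
  and "x : carr M ==> f (act M a x) = act N a (f x)"
 using assms unfolding module_hom_def by auto

lemma module_hom_zer:
 assumes "module_hom M N f" "left_module M" "left_module N" shows "f (zer M) = zer N"
 using module_homD(3)[OF assms(1), of "zer M" 0] module_homD(1)[OF assms(1), of "zer M"] assms(2,3) by simp

lemma finitely_generated_image:
 assumes "finitely_generated M" "module_hom M N f" "left_module M" "left_module N" "f ` carr M = carr N"
 shows "finitely_generated N"
proof -
 obtain S where S: "finite S" "S <= carr M" "!!K. submodule M K ==> S <= K ==> K = carr M"
  using assms(1) unfolding finitely_generated_def by auto
 have "K = carr N" if K: "submodule N K" "f ` S <= K" for K
 proof -
  have "submodule M {x \<in> carr M. f x : K}"
   using K(1) assms module_homD[OF assms(2)] module_hom_zer[OF assms(2-4)] unfolding submodule_def by simp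
  then have "{x \<in> carr M. f x : K} = carr M" using S(2,3) K(2) by blast
  then have "f x : K" if "x : carr M" for x using that by blast
  then have "carr N <= K" unfolding assms(5)[symmetric] by blast
  then show ?thesis using K(1) unfolding submodule_def by blast
 qed
 moreover have "finite (f ` S)" "f ` S <= carr N" using S assms(5) by auto
 ultimately show ?thesis unfolding finitely_generated_def by blast
qed

subsection \<open>Linear spans\<close>

text \<open>Span over the ground field, which acts on a B-module through \<open>sc c 1\<close>.
  Modules are carrier sets, so spans and subspaces (\<open>ksub\<close>) are relative to a
  carrier.\<close>

inductive_set kspan :: "('k \<Rightarrow> 'b::ring_1 \<Rightarrow> 'b) \<Rightarrow> ('b, 'm, 'z) lmod_scheme \<Rightarrow> 'm set \<Rightarrow> 'm set"
 for sc M S where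
 zer: "zer M : kspan sc M S"
| step: "v : kspan sc M S ==> x : S ==> pls M (act M (sc c 1) x) v : kspan sc M S"

definition ksub :: "('k \<Rightarrow> 'b::ring_1 \<Rightarrow> 'b) \<Rightarrow> ('b, 'm, 'z) lmod_scheme \<Rightarrow> 'm set \<Rightarrow> bool" where
 "ksub sc M V \<longleftrightarrow> V <= carr M & zer M : V & (ALL x : V. ALL y : V. pls M x y : V) &
   (ALL c. ALL x : V. act M (sc c 1) x : V)"

lemma kspan_carr: "left_module M ==> S <= carr M ==> v : kspan sc M S ==> v : carr M"
 by (rotate_tac 2, induction rule: kspan.induct) auto

lemma kspan_least: "ksub sc M V ==> S <= V ==> kspan sc M S <= V"
proof
 fix v assume "v : kspan sc M S" and V: "ksub sc M V" "S <= V"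
 then show "v : V" by (induction rule: kspan.induct) (auto simp: ksub_def)
qed

lemma kspan_mono: "S <= T ==> kspan sc M S <= kspan sc M T"
proof
 fix v assume "v : kspan sc M S" and "S <= T"
 then show "v : kspan sc M T" by (induction rule: kspan.induct) (auto intro: kspan.intros)
qed

locale fdalg =
 fixes sc :: "'k::alg_closed_field \<Rightarrow> 'b::ring_1 \<Rightarrow> 'b"
 assumes fd: "fd_algebra sc"
begin

lemma sc_mult [simp]: "sc c x * y = sc c (x * y)" "x * sc c y = sc c (x * y)"
 using fd unfolding fd_algebra_def by metis+

lemma vs: "vector_space sc"
 using fd unfolding fd_algebra_def finite_dimensional_vector_space_def by blast

lemma md: "module sc"
 using vs by (simp add: module_iff_vector_space)

lemma sc_simps [simp]: "sc c (sc d x) = sc (c * d) x" "sc 1 x = x" "sc 0 x = 0" "sc c 0 = 0"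
 using module.scale_scale[OF md] module.scale_one[OF md] module.scale_zero_left[OF md]
  module.scale_zero_right[OF md] by blast+

lemma sc_add: "sc (c + d) x = sc c x + sc d x" "sc c (x + y) = sc c x + sc c y"
 using module.scale_left_distrib[OF md] module.scale_right_distrib[OF md] by blast+

lemma sc_minus [simp]: "sc c (- x) = - sc c x" "sc (- c) x = - sc c x"
 using module.scale_minus_right[OF md] module.scale_minus_left[OF md] by blast+

lemma kspan_ksub:
 assumes M: "left_module M" and S: "S <= carr M" shows "ksub sc M (kspan sc M S)"
proof -
 have c: "v : carr M" if "v : kspan sc M S" for v using kspan_carr[OF M S that] .
 have "pls M v w : kspan sc M S" if "v : kspan sc M S" "w : kspan sc M S" for v w
  using that(1)
 proof induction
  case zer
  then show ?case using that(2) c M by simp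
 next
  case (step v x a)
  then have "pls M (pls M (act M (sc a 1) x) v) w = pls M (act M (sc a 1) x) (pls M v w)"
   using c M S that(2) by (intro pls_assoc) auto
  then show ?case using step kspan.step by metis
 qed
 moreover have "act M (sc a 1) v : kspan sc M S" if "v : kspan sc M S" for a v
  using that
 proof induction
  case zer
  then show ?case using kspan.zer[of M sc S] M by simp
 next
  case (step v x d)
  then have "x : carr M" "v : carr M" using c S by auto
  then have "act M (sc a 1) (pls M (act M (sc d 1) x) v) = pls M (act M (sc (a * d) 1) x) (act M (sc a 1) v)"
   using M by (simp add: act_pls mult.commute)
  then show ?case using step kspan.step by metis
 qed
 ultimately show ?thesis unfolding ksub_def using c kspan.zer by blast
qed

lemma kspan_insert:
 assumes M: "left_module M" and S: "insert x S <= carr M" and v: "v : kspan sc M (insert x S)"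
 shows "EX c w. w : kspan sc M S & v = pls M (act M (sc c 1) x) w"
 using v
proof induction
 case zer
 have "zer M = pls M (act M (sc 0 1) x) (zer M)" using M S by simp
 then show ?case using kspan.zer by blast
next
 case (step v y d)
 then obtain c w where w: "w : kspan sc M S" "v = pls M (act M (sc c 1) x) w" by blast
 have x: "x : carr M" "w : carr M" using S w(1) kspan_carr[OF M] by auto
 show ?case
 proof (cases "y = x")
  case True
  have "pls M (act M (sc d 1) y) v = pls M (act M (sc (d + c) 1) x) w"
   using True w(2) x M by (simp add: sc_add act_add pls_assoc)
  then show ?thesis using w(1) by blast
 next
  case False
  then have y: "y : S" "y : carr M" using step S by auto
  have "pls M (act M (sc d 1) y) v = pls M (act M (sc c 1) x) (pls M (act M (sc d 1) y) w)"
   unfolding w(2) by (rule pls_left_commute) (use x y M in simp_all)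
  then show ?thesis using kspan.step[OF w(1) y(1)] by blast
 qed
qed

text \<open>Each generator contributes one coordinate, prepended to the sequence. This is why
  sequences over the field are a large enough carrier type for all finitely generated
  modules.\<close>

lemma kspan_inj:
 fixes M :: "('b, 'm, 'z) lmod_scheme"
 assumes M: "left_module M" and "finite S" "S <= carr M"
 shows "\<exists>g :: 'm \<Rightarrow> nat \<Rightarrow> 'k. inj_on g (kspan sc M S)"
 using assms(2,3)
proof induction
 case empty
 have "kspan sc M {} <= {zer M}" using kspan_least[of sc M "{zer M}" "{}"] M by (simp add: ksub_def)
 then have "inj_on (%_ _. 0 :: 'k) (kspan sc M {})" by (auto intro!: inj_onI)
 then show ?case by blast
next
 case (insert x S)
 then obtain g :: "'m \<Rightarrow> nat \<Rightarrow> 'k" where g: "inj_on g (kspan sc M S)" by auto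
 have "ALL v : kspan sc M (insert x S). EX p. snd p : kspan sc M S & v = pls M (act M (sc (fst p) 1) x) (snd p)"
  using kspan_insert[OF M insert.prems] by fastforce
 then obtain p where p: "!!v. v : kspan sc M (insert x S) ==> snd (p v) : kspan sc M S &
  v = pls M (act M (sc (fst (p v)) 1) x) (snd (p v))" by metis
 let ?g = "%v. case_nat (fst (p v)) (g (snd (p v)))"
 have "inj_on ?g (kspan sc M (insert x S))"
 proof (rule inj_onI)
  fix v w assume vw: "v : kspan sc M (insert x S)" "w : kspan sc M (insert x S)" "?g v = ?g w"
  have "fst (p v) = fst (p w)" using fun_cong[OF vw(3), of 0] by simp
  moreover have "g (snd (p v)) = g (snd (p w))" using fun_cong[OF vw(3), of "Suc n" for n] by auto
  then have "snd (p v) = snd (p w)" using g p vw(1,2) by (auto dest: inj_onD)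
  ultimately show "v = w" using p[OF vw(1)] p[OF vw(2)] by simp
 qed
 then show ?case by blast
qed

text \<open>Elimination: if V is not inside the span of the remaining generators, a vector v of V
  with nonzero coefficient at x serves as pivot and reduces every other vector to the intersection
  of V with that span.\<close>

lemma ksub_fin:
 assumes M: "left_module M" and "finite S" "S <= carr M" "ksub sc M V" "V <= kspan sc M S"
 shows "EX T. finite T & T <= V & V <= kspan sc M T"
 using assms(2-)
proof (induction arbitrary: V)
 case empty
 then show ?case by blast
next
 case (insert x S)
 have x: "x : carr M" "S <= carr M" using insert by auto
 note ks = kspan_ksub[OF M x(2)]
 let ?V = "V \<inter> kspan sc M S"
 have "ksub sc M ?V" using insert.prems(2) ks unfolding ksub_def by auto
 then obtain T where T: "finite T" "T <= ?V" "?V <= kspan sc M T" using insert.IH[of ?V] x by auto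
 show ?case
 proof (cases "V <= kspan sc M S")
  case True
  then show ?thesis using T by blast
 next
  case False
  then obtain v where v: "v : V" "v \<notin> kspan sc M S" by blast
  then obtain c w where w: "w : kspan sc M S" "v = pls M (act M (sc c 1) x) w"
   using kspan_insert[OF M insert.prems(1)] insert.prems(3) by blast
  have wc: "w : carr M" using kspan_carr[OF M x(2) w(1)] .
  have "c ~= 0" using w v M x wc by auto
  have Vc: "V <= carr M" using insert.prems(2) by (simp add: ksub_def)
  have "V <= kspan sc M (insert v T)"
  proof
   fix u assume u: "u : V"
   then obtain d z where z: "z : kspan sc M S" "u = pls M (act M (sc d 1) x) z"
    using kspan_insert[OF M insert.prems(1)] insert.prems(3) by blast
   have zc: "z : carr M" using kspan_carr[OF M x(2) z(1)] .
   \<comment> \<open>The multiple of v that cancels the x-coordinate d of u; c is the x-coordinate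
     of v.\<close>
   let ?a = "d / c"
   let ?u = "pls M u (act M (sc (- ?a) 1) v)"
   have "?u : V" using insert.prems(2) u v unfolding ksub_def by blast
   moreover have "?u = pls M z (act M (sc (- ?a) 1) w)"
   proof -
    have "act M (sc (- ?a) 1) v = pls M (act M (sc (- d) 1) x) (act M (sc (- ?a) 1) w)"
     using w(2) M x wc \<open>c ~= 0\<close> by (simp add: act_pls)
    then have "?u = pls M (pls M (act M (sc d 1) x) z) (pls M (act M (sc (- d) 1) x) (act M (sc (- ?a) 1) w))"
     using z(2) by simp
    also have "\<dots> = pls M (pls M (act M (sc d 1) x) (act M (sc (- d) 1) x)) (pls M z (act M (sc (- ?a) 1) w))"
     using M x wc zc by (simp add: pls_assoc pls_left_commute[of M z] del: sc_minus)
    also have "pls M (act M (sc d 1) x) (act M (sc (- d) 1) x) = zer M"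
     using M x act_add[OF M x(1), of "sc d 1" "sc (- d) 1"] by simp
    finally show ?thesis using M zc wc by simp
   qed
   moreover have "pls M z (act M (sc (- ?a) 1) w) : kspan sc M S" using ks z(1) w(1) unfolding ksub_def by blast
   ultimately have uT: "?u : kspan sc M T" using T by auto
   have "u = pls M (act M (sc ?a 1) v) ?u"
   proof -
    have vc: "v : carr M" "u : carr M" using Vc v u by auto
    have "pls M (act M (sc ?a 1) v) ?u = pls M u (pls M (act M (sc ?a 1) v) (act M (sc (- ?a) 1) v))"
     using M vc by (intro pls_left_commute) simp_all
    also have "pls M (act M (sc ?a 1) v) (act M (sc (- ?a) 1) v) = zer M"
     using M vc act_add[OF M vc(1), of "sc ?a 1" "sc (- ?a) 1"] by simp
    finally show ?thesis using M vc by simp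
   qed
   moreover have "?u : kspan sc M (insert v T)" using uT kspan_mono[of T "insert v T" sc M] by blast
   ultimately show "u : kspan sc M (insert v T)" using kspan.step[of ?u sc M "insert v T" v ?a] by simp
  qed
  then show ?thesis using T v by (intro exI[of _ "insert v T"]) auto
 qed
qed

lemma basis: obtains Bs where "finite Bs" "module.span sc Bs = UNIV"
proof -
 obtain Bs where "finite_dimensional_vector_space sc Bs" using fd unfolding fd_algebra_def by blast
 then interpret finite_dimensional_vector_space sc Bs .
 show ?thesis using that finite_Basis span_Basis by blast
qed

lemma finitely_generated_kspan:
 assumes M: "left_module M" "finitely_generated M"
 obtains S where "finite S" "S <= carr M" "carr M = kspan sc M S"
proof -
 obtain S where S: "finite S" "S <= carr M" "!!K. submodule M K ==> S <= K ==> K = carr M"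
  using M(2) unfolding finitely_generated_def by auto
 obtain Bs where Bs: "finite Bs" "module.span sc Bs = UNIV" by (rule basis)
 interpret vector_space sc by (rule vs)
 let ?T = "(%(b, s). act M b s) ` (Bs \<times> S)"
 have T: "finite ?T" "?T <= carr M" using Bs S M by auto
 note ks = kspan_ksub[OF M(1) T(2)]
 \<comment> \<open>All elements whose B-multiples lie in the span. This set is a submodule by
   construction, while the span itself is not visibly one.\<close>
 let ?K = "{m \<in> carr M. ALL b. act M b m : kspan sc M ?T}"
 have "submodule M ?K" using M ks unfolding submodule_def ksub_def by (auto simp: act_pls)
 moreover have "act M b s : kspan sc M ?T" if s: "s : S" for s b
 proof -
  have sM: "s : carr M" using s S by auto
  have "b : span Bs" using Bs by simp
  then show ?thesis
  proof (induction rule: span_induct_alt)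
   case base
   then show ?case using ks M sM by (simp add: ksub_def)
  next
   case (step c b y)
   have "act M (sc c b + y) s = pls M (act M (sc c 1) (act M b s)) (act M y s)"
    using M sM by (simp add: act_add)
   moreover have "act M b s : ?T" using step s by auto
   ultimately show ?case using step.IH kspan.step by metis
  qed
 qed
 then have "S <= ?K" using S by auto
 ultimately have "?K = carr M" by (rule S(3))
 then have "m : kspan sc M ?T" if "m : carr M" for m
  using that M(1) by (metis (mono_tags, lifting) act_simps(2) mem_Collect_eq)
 then have "carr M = kspan sc M ?T" using kspan_carr[OF M(1) T(2)] by blast
 then show ?thesis using that T by blast
qed

text \<open>The module structure is transported along an injection into sequences, which need not be
  linear.\<close>

lemma small_copy_ex:
 fixes T :: "('b, 't) lmod"
 assumes T: "left_module T" "finitely_generated T"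
 shows "\<exists>(N :: ('k, 'b) smod) vph. N : SM & module_iso T N vph"
proof -
 obtain S where S: "finite S" "S <= carr T" "carr T = kspan sc T S" using T by (rule finitely_generated_kspan)
 obtain g :: "'t \<Rightarrow> nat \<Rightarrow> 'k" where g: "inj_on g (carr T)" using kspan_inj[OF T(1) S(1,2)] S(3) by auto
 let ?i = "inv_into (carr T) g"
 define N :: "('k, 'b) smod" where "N = \<lparr>carr = g ` carr T, zer = g (zer T),
  pls = (%x y. g (pls T (?i x) (?i y))), act = (%b x. g (act T b (?i x)))\<rparr>"
 have i: "?i (g x) = x" if "x : carr T" for x using g that by simp
 have N_simps: "carr N = g ` carr T" "zer N = g (zer T)"
  "!!x y. x : carr T ==> y : carr T ==> pls N (g x) (g y) = g (pls T x y)"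
  "!!b x. x : carr T ==> act N b (g x) = g (act T b x)"
  using i by (simp_all add: N_def)
 note Tg = left_module_grp[OF T(1)]
 have neg: "EX y : carr T. g (pls T x y) = g (zer T)" if "x : carr T" for x
  using Tg that unfolding abelian_grp_def by metis
 have "abelian_grp N"
  unfolding abelian_grp_def N_simps(1,2) ball_simps bex_simps
  using T(1) Tg neg by (auto simp: N_simps(3) pls_assoc intro: arg_cong[OF pls_commute[OF Tg], of _ _ g])
 then have N: "left_module N"
  unfolding left_module_def N_simps(1) ball_simps using T(1) Tg by (simp add: N_simps(3,4) act_add act_pls)
 have iso: "module_iso T N g" unfolding module_iso_def module_hom_def bij_betw_def
  using T(1) Tg g by (simp add: N_simps Pi_def)
 moreover have "finitely_generated N"
  by (rule finitely_generated_image[OF T(2), of _ g]) (use T N iso in "simp_all add: module_iso_def bij_betw_def")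
 ultimately show ?thesis unfolding small_modules_def using N by blast
qed

lemma small_copy:
 assumes T: "left_module T" "finitely_generated T" and c: "small_copy T = (N :: ('k, 'b) smod, vph)"
 shows "N : SM" "module_iso T N vph"
 using someI_ex[of "%(N :: ('k, 'b) smod, vph). N : SM & module_iso T N vph"] small_copy_ex[OF T] c
 unfolding small_copy_def by auto

end

section \<open>Tensor products\<close>

text \<open>The pure tensor x \<otimes> y as a coset.\<close>

definition tz :: "('x, 'y) abgrp_scheme \<Rightarrow> ('x \<Rightarrow> 'r \<Rightarrow> 'x) \<Rightarrow> ('m, 'z) abgrp_scheme \<Rightarrow> ('r \<Rightarrow> 'm \<Rightarrow> 'm) \<Rightarrow>
  'x \<Rightarrow> 'm \<Rightarrow> ('x \<times> 'm \<Rightarrow>\<^sub>0 int) set" where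
 "tz X ra Y la x y = tensor_coset X ra Y la (frag_of (x, y))"

definition tgrp :: "('x, 'y) abgrp_scheme \<Rightarrow> ('x \<Rightarrow> 'r \<Rightarrow> 'x) \<Rightarrow> ('m, 'z) abgrp_scheme \<Rightarrow> ('r \<Rightarrow> 'm \<Rightarrow> 'm) \<Rightarrow>
  ('x \<times> 'm \<Rightarrow>\<^sub>0 int) set abgrp" where
 "tgrp X ra Y la = \<lparr>carr = tensor_carr X ra Y la, zer = tensor_coset X ra Y la 0, pls = tensor_pls X ra Y la\<rparr>"

definition additive :: "('m, 'y) abgrp_scheme \<Rightarrow> ('n, 'z) abgrp_scheme \<Rightarrow> ('m \<Rightarrow> 'n) \<Rightarrow> bool" where
 "additive X Y f \<longleftrightarrow> (ALL x : carr X. f x : carr Y) & (ALL x : carr X. ALL y : carr X. f (pls X x y) = pls Y (f x) (f y))"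

lemma additive_zer:
 assumes "additive X Y f" "abelian_grp X" "abelian_grp Y" shows "f (zer X) = zer Y"
proof -
 have "pls Y (f (zer X)) (f (zer X)) = f (zer X)" "f (zer X) : carr Y"
  using assms abelian_grp_simps(3)[OF assms(2), of "zer X"] unfolding additive_def by (metis abelian_grp_simps(1))+
 then have "pls Y (f (zer X)) (f (zer X)) = pls Y (f (zer X)) (zer Y)" using assms(3) by simp
 then show ?thesis by (rule pls_cancel) (use assms(3) \<open>f (zer X) : carr Y\<close> in simp_all)
qed

locale tensor_data =
 fixes X :: "('x, 'y) abgrp_scheme" and ra :: "'x \<Rightarrow> 'r \<Rightarrow> 'x" and Y :: "('m, 'z) abgrp_scheme" and la :: "'r \<Rightarrow> 'm \<Rightarrow> 'm"
 assumes X: "abelian_grp X" and Y: "abelian_grp Y"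
  and ra: "x : carr X ==> ra x r : carr X" and la: "y : carr Y ==> la r y : carr Y"
begin

abbreviation "R \<equiv> tensor_relators X ra Y la"
abbreviation coset ("[|_|]") where "coset \<equiv> tensor_coset X ra Y la"
abbreviation "T \<equiv> tgrp X ra Y la"
abbreviation ten (infixl "\<otimes>\<otimes>" 75) where "x \<otimes>\<otimes> y \<equiv> tz X ra Y la x y"

lemma mem_coset: "p : [|q|] \<longleftrightarrow> p - q : group_closure R"
 unfolding tensor_coset_def by (force simp: image_iff algebra_simps)

lemma coset_eq_iff: "[|p|] = [|q|] \<longleftrightarrow> p - q : group_closure R"
proof
 assume "[|p|] = [|q|]"
 moreover have "p : [|p|]" by (simp add: mem_coset)
 ultimately show "p - q : group_closure R" by (simp add: mem_coset)
next
 assume pq: "p - q : group_closure R"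
 have "(s - p : group_closure R) = (s - q : group_closure R)" for s
  using group_closure_add[OF _ pq, of "s - p"] group_closure.diff[OF _ pq, of "s - q"] by auto
 then show "[|p|] = [|q|]" by (auto simp: mem_coset set_eq_iff)
qed

lemma pls_coset: "tensor_pls X ra Y la [|p|] [|q|] = [|p + q|]"
proof -
 have "[|p' + q'|] = [|p + q|]" if "p' : [|p|]" "q' : [|q|]" for p' q'
  using that group_closure_add[of "p' - p" R "q' - q"] by (simp add: mem_coset coset_eq_iff algebra_simps)
 moreover have "p : [|p|]" "q : [|q|]" by (simp_all add: mem_coset)
 ultimately show ?thesis unfolding tensor_pls_def by blast
qed

lemma T_simps: "pls T [|p|] [|q|] = [|p + q|]" "zer T = [|0|]" "carr T = coset ` {p. Poly_Mapping.keys p <= carr X \<times> carr Y}"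
 by (simp_all add: tgrp_def pls_coset tensor_carr_def)

lemma T_grp [simp]: "abelian_grp T"
proof -
 have "Poly_Mapping.keys (p + q) <= carr X \<times> carr Y"
  if "Poly_Mapping.keys p <= carr X \<times> carr Y" "Poly_Mapping.keys q <= carr X \<times> carr Y" for p q :: "'x \<times> 'm \<Rightarrow>\<^sub>0 int"
  using that keys_add[of p q] by blast
 moreover have "EX y : {p. Poly_Mapping.keys p <= carr X \<times> carr Y}. [|x + y|] = [|0|]"
  if "Poly_Mapping.keys x <= carr X \<times> carr Y" for x :: "'x \<times> 'm \<Rightarrow>\<^sub>0 int"
  using that by (intro bexI[of _ "- x"]) simp_all
 ultimately show ?thesis
  unfolding abelian_grp_def T_simps(2,3) ball_simps bex_simps
  by (auto simp: T_simps(1) add_ac)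
qed

lemma relators:
 shows "[|x : carr X; x' : carr X; y : carr Y|] ==> frag_of (pls X x x', y) - frag_of (x, y) - frag_of (x', y) : group_closure R"
  and "[|x : carr X; y : carr Y; y' : carr Y|] ==> frag_of (x, pls Y y y') - frag_of (x, y) - frag_of (x, y') : group_closure R"
  and "[|x : carr X; y : carr Y|] ==> frag_of (ra x r, y) - frag_of (x, la r y) : group_closure R"
 unfolding tensor_relators_def
 by (rule group_closure.base[OF insertI2[OF UnI1[OF UnI1[OF CollectI]]]], blast,
   rule group_closure.base[OF insertI2[OF UnI1[OF UnI2[OF CollectI]]]], blast,
   rule group_closure.base[OF insertI2[OF UnI2[OF CollectI]]], blast)

lemma ten_carr [simp]: "x : carr X ==> y : carr Y ==> x \<otimes>\<otimes> y : carr T"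
 unfolding tz_def T_simps by (auto intro!: imageI)

lemma ten_add_left:
 assumes "x : carr X" "x' : carr X" "y : carr Y" shows "pls X x x' \<otimes>\<otimes> y = pls T (x \<otimes>\<otimes> y) (x' \<otimes>\<otimes> y)"
proof -
 note relators(1)[OF assms]
 then show ?thesis unfolding tz_def T_simps coset_eq_iff by (simp add: algebra_simps)
qed

lemma ten_add_right:
 assumes "x : carr X" "y' : carr Y" "y : carr Y" shows "x \<otimes>\<otimes> pls Y y y' = pls T (x \<otimes>\<otimes> y) (x \<otimes>\<otimes> y')"
proof -
 note relators(2)[OF assms(1,3,2)]
 then show ?thesis unfolding tz_def T_simps coset_eq_iff by (simp add: algebra_simps)
qed

lemma ten_balanced:
 assumes "x : carr X" "y : carr Y" shows "ra x r \<otimes>\<otimes> y = x \<otimes>\<otimes> la r y"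
proof -
 note relators(3)[OF assms]
 then show ?thesis unfolding tz_def coset_eq_iff .
qed

text \<open>An element is an integer combination of pairs. Negative signs are absorbed by replacing
  x with its inverse, so sums of pure tensors suffice. The proof treats p and -p together, which
  carries the difference step of the induction.\<close>

lemma ten_induct [consumes 1, case_names zer ten pls]:
 assumes "t : carr T" "P (zer T)" "!!x y. x : carr X ==> y : carr Y ==> P (x \<otimes>\<otimes> y)"
  "!!s t. s : carr T ==> t : carr T ==> P s ==> P t ==> P (pls T s t)"
 shows "P t"
proof -
 have neg: "[|- frag_of (x, y)|] = n \<otimes>\<otimes> y" if n: "x : carr X" "n : carr X" "y : carr Y" "pls X x n = zer X" for x n y
 proof -
  have "pls T (zer X \<otimes>\<otimes> y) (zer X \<otimes>\<otimes> y) = pls T (zer X \<otimes>\<otimes> y) (zer T)"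
   using ten_add_left[of "zer X" "zer X" y] X n by simp
  then have "zer X \<otimes>\<otimes> y = zer T" by (rule pls_cancel) (use X n T_grp in simp_all)
  then have "pls T (x \<otimes>\<otimes> y) (n \<otimes>\<otimes> y) = [|0|]" using ten_add_left[OF n(1,2,3)] n(4) T_simps(2) by simp
  then have "[|frag_of (x, y) + frag_of (n, y)|] = [|0|]" unfolding tz_def T_simps .
  then have "- (frag_of (x, y) + frag_of (n, y)) : group_closure R"
   unfolding coset_eq_iff by (simp only: diff_zero group_closure_minus_iff)
  then show ?thesis by (simp only: tz_def coset_eq_iff diff_conv_add_uminus minus_add_distrib)
 qed
 obtain p where p: "t = [|p|]" "Poly_Mapping.keys p <= carr X \<times> carr Y" using assms(1) unfolding T_simps by auto
 have "([|p|] : carr T & P [|p|]) & ([|- p|] : carr T & P [|- p|])"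
  using p(2)
 proof (induction p rule: frag_induction)
  case zero
  then show ?case using assms(2) abelian_grp_simps(1)[OF T_grp] by (simp add: T_simps(2))
 next
  case (one z)
  then obtain x y where z: "z = (x, y)" "x : carr X" "y : carr Y" by auto
  obtain n where n: "n : carr X" "pls X x n = zer X" using X z(2) unfolding abelian_grp_def by blast
  have "[|frag_of z|] = x \<otimes>\<otimes> y" "[|- frag_of z|] = n \<otimes>\<otimes> y" using z(1) neg[OF z(2) n(1) z(3) n(2)] by (simp_all add: tz_def)
  then show ?case using assms(3) z n by simp
 next
  case (diff a b)
  have "[|a - b|] = pls T [|a|] [|- b|]" "[|- (a - b)|] = pls T [|b|] [|- a|]" unfolding T_simps by simp_all
  then show ?case using diff assms(4) abelian_grp_simps(2)[OF T_grp] by simp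
 qed
 then show ?thesis using p(1) by simp
qed

text \<open>h extends to the free abelian group on the pairs, and the premises \<open>l\<close>,
  \<open>r\<close> and \<open>b\<close> say that the extension kills the three kinds of
  relators.\<close>

lemma universal:
 assumes G: "abelian_grp G" and h: "!!x y. x : carr X ==> y : carr Y ==> h x y : carr G"
  and l: "!!x x' y. x : carr X ==> x' : carr X ==> y : carr Y ==> h (pls X x x') y = pls G (h x y) (h x' y)"
  and r: "!!x y y'. x : carr X ==> y : carr Y ==> y' : carr Y ==> h x (pls Y y y') = pls G (h x y) (h x y')"
  and b: "!!x y r. x : carr X ==> y : carr Y ==> h (ra x r) y = h x (la r y)"
 obtains H where "additive T G H" "!!x y. x : carr X ==> y : carr Y ==> H (x \<otimes>\<otimes> y) = h x y"
proof -
 let ?S = "carr X \<times> carr Y"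
 let ?G = "monoid.make (carr G) (pls G) (zer G)"
 have cg: "comm_group ?G"
 proof (rule comm_groupI)
  fix x assume x: "x : carrier ?G"
  then have "x : carr G" by (simp add: monoid.defs)
  then obtain y where y: "y : carr G" "pls G x y = zer G" using G unfolding abelian_grp_def by blast
  then have "pls G y x = zer G" using pls_commute[OF G] \<open>x : carr G\<close> by metis
  then show "EX y : carrier ?G. y \<otimes>\<^bsub>?G\<^esub> x = \<one>\<^bsub>?G\<^esub>" using y(1) by (auto simp: monoid.defs)
 next
  fix x y assume "x : carrier ?G" "y : carrier ?G"
  then show "x \<otimes>\<^bsub>?G\<^esub> y = y \<otimes>\<^bsub>?G\<^esub> x" using pls_commute[OF G] by (simp add: monoid.defs)
 qed (use G in "simp_all add: monoid.defs pls_assoc")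
 have im: "(%(x, y). h x y) ` ?S <= carrier ?G" using h by (auto simp: monoid.defs)
 obtain k where kh: "k : Group.hom (free_Abelian_group ?S) ?G" and ko: "!!z. z : ?S ==> k (frag_of z) = (%(x, y). h x y) z"
  by (rule comm_group.free_Abelian_group_universal[OF cg im]) blast
 have k_add: "k (p + q) = pls G (k p) (k q)" and k_c: "k p : carr G"
  if "Poly_Mapping.keys p <= ?S" "Poly_Mapping.keys q <= ?S" for p q
  using kh that by (auto simp: Group.hom_def monoid.defs Pi_iff)
 have k_0: "k 0 = zer G"
 proof -
  have "pls G (k 0) (k 0) = pls G (k 0) (zer G)" using k_add[of 0 0] k_c[of 0 0] G by simp
  then show ?thesis by (rule pls_cancel) (use k_c[of 0 0] G in simp_all)
 qed
 have k_diff: "k (p - q) = zer G" if "Poly_Mapping.keys p <= ?S" "Poly_Mapping.keys q <= ?S" "k p = k q" for p q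
 proof -
  have d: "Poly_Mapping.keys (p - q) <= ?S" using that keys_diff[of p q] by blast
  have "pls G (k q) (k (p - q)) = pls G (k q) (zer G)" using k_add[OF that(2) d] k_c[OF that(2,2)] that(3) G by simp
  then show ?thesis by (rule pls_cancel) (use k_c[OF that(2,2)] k_c[OF d d] G in simp_all)
 qed
 have rel: "Poly_Mapping.keys q <= ?S & k q = zer G" if "q : R" for q
 proof -
  consider x x' y where "q = frag_of (pls X x x', y) - frag_of (x, y) - frag_of (x', y)" "x : carr X" "x' : carr X" "y : carr Y"
   | x y y' where "q = frag_of (x, pls Y y y') - frag_of (x, y) - frag_of (x, y')" "x : carr X" "y' : carr Y" "y : carr Y"
   | x y r where "q = frag_of (ra x r, y) - frag_of (x, la r y)" "x : carr X" "y : carr Y"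
   using \<open>q : R\<close> unfolding tensor_relators_def by blast
  then have "EX p p'. q = p - p' & Poly_Mapping.keys p <= ?S & Poly_Mapping.keys p' <= ?S & k p = k p'"
  proof cases
   case 1
   have s: "Poly_Mapping.keys (frag_of (x, y)) <= ?S" "Poly_Mapping.keys (frag_of (x', y)) <= ?S" using 1 by simp_all
   show ?thesis
    by (rule exI[of _ "frag_of (pls X x x', y)"], rule exI[of _ "frag_of (x, y) + frag_of (x', y)"])
     (use 1 X ko l k_add[OF s] s keys_add[of "frag_of (x, y)" "frag_of (x', y)"] in "auto simp: algebra_simps")
  next
   case 2
   have s: "Poly_Mapping.keys (frag_of (x, y)) <= ?S" "Poly_Mapping.keys (frag_of (x, y')) <= ?S" using 2 by simp_all
   show ?thesis
    by (rule exI[of _ "frag_of (x, pls Y y y')"], rule exI[of _ "frag_of (x, y) + frag_of (x, y')"])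
     (use 2 Y ko r k_add[OF s] s keys_add[of "frag_of (x, y)" "frag_of (x, y')"] in "auto simp: algebra_simps")
  next
   case 3
   show ?thesis
    by (rule exI[of _ "frag_of (ra x r, y)"], rule exI[of _ "frag_of (x, la r y)"])
     (use 3 ko b ra la in simp)
  qed
  then obtain p p' where p: "q = p - p'" "Poly_Mapping.keys p <= ?S" "Poly_Mapping.keys p' <= ?S" "k p = k p'"
   by (elim exE conjE) (rule that)
  have "Poly_Mapping.keys (p - p') <= ?S" using p(2,3) keys_diff[of p p'] by blast
  then show ?thesis unfolding p(1) using k_diff[OF p(2-4)] by blast
 qed
 have cl: "Poly_Mapping.keys q <= ?S & k q = zer G" if "q : group_closure R" for q
  using that
 proof induction
  case (base s)
  then show ?case using rel k_0 by auto
 next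
  case (diff s t)
  then show ?case using k_diff[of s t] keys_diff[of s t] by auto
 qed
 define H where "H t = k (SOME p. p : t & Poly_Mapping.keys p <= ?S)" for t
 have H: "H [|p|] = k p" if p: "Poly_Mapping.keys p <= ?S" for p
 proof -
  have "p : [|p|] & Poly_Mapping.keys p <= ?S" using p by (simp add: mem_coset)
  then have s: "(SOME q. q : [|p|] & Poly_Mapping.keys q <= ?S) : [|p|] & Poly_Mapping.keys (SOME q. q : [|p|] & Poly_Mapping.keys q <= ?S) <= ?S"
   by (rule someI)
  let ?q = "SOME q. q : [|p|] & Poly_Mapping.keys q <= ?S"
  have "?q - p : group_closure R" using s by (simp add: mem_coset)
  then have "k (?q - p) = zer G" "Poly_Mapping.keys (?q - p) <= ?S" using cl by auto
  then have "k (p + (?q - p)) = pls G (k p) (zer G)" using k_add[OF p, of "?q - p"] by metis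
  then have "k ?q = k p" using k_c[OF p p] G by simp
  then show ?thesis by (simp add: H_def)
 qed
 have rep: "EX p. t = [|p|] & Poly_Mapping.keys p <= ?S" if "t : carr T" for t using that unfolding T_simps by blast
 have "additive T G H" unfolding additive_def
 proof (intro conjI ballI)
  fix s assume "s : carr T"
  then show "H s : carr G" using rep H k_c by metis
  fix t assume "t : carr T"
  then obtain p q where pq: "s = [|p|]" "t = [|q|]" "Poly_Mapping.keys p <= ?S" "Poly_Mapping.keys q <= ?S"
   using rep \<open>s : carr T\<close> by metis
  then have "Poly_Mapping.keys (p + q) <= ?S" using keys_add[of p q] by blast
  then show "H (pls T s t) = pls G (H s) (H t)" using pq H k_add by (simp add: T_simps(1))
 qed
 moreover have "H (x \<otimes>\<otimes> y) = h x y" if "x : carr X" "y : carr Y" for x y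
  unfolding tz_def using that ko H by simp
 ultimately show ?thesis by (rule that)
qed

lemma additive_ext:
 assumes "additive T G f" "additive T G g" "abelian_grp G" "!!x y. x : carr X ==> y : carr Y ==> f (x \<otimes>\<otimes> y) = g (x \<otimes>\<otimes> y)"
  "t : carr T"
 shows "f t = g t"
 using assms(5)
proof (induction rule: ten_induct)
 case zer
 then show ?case using additive_zer[OF assms(1) T_grp assms(3)] additive_zer[OF assms(2) T_grp assms(3)] by simp
next
 case (ten x y)
 then show ?case using assms by blast
next
 case (pls s t)
 then show ?case using assms(1,2) unfolding additive_def by simp
qed

end

lemma tensor_map:
 assumes A: "tensor_data X ra Y la" and B: "tensor_data X' ra' Y' la'"
  and u: "additive X X' u" and v: "additive Y Y' v"
  and cu: "!!x r. x : carr X ==> u (ra x r) = ra' (u x) r"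
  and cv: "!!y r. y : carr Y ==> v (la r y) = la' r (v y)"
 shows "additive (tgrp X ra Y la) (tgrp X' ra' Y' la') (tensor_map X' ra' Y' la' u v)"
  and "[|x : carr X; y : carr Y|] ==> tensor_map X' ra' Y' la' u v (tz X ra Y la x y) = tz X' ra' Y' la' (u x) (v y)"
proof -
 interpret A: tensor_data X ra Y la by (rule A)
 interpret B: tensor_data X' ra' Y' la' by (rule B)
 let ?f = "frag_extend (%(x, y). frag_of (u x, v y))"
 have rel: "?f q : group_closure B.R" if "q : A.R" for q
 proof -
  consider x x' y where "q = frag_of (pls X x x', y) - frag_of (x, y) - frag_of (x', y)" "x : carr X" "x' : carr X" "y : carr Y"
   | x y y' where "q = frag_of (x, pls Y y y') - frag_of (x, y) - frag_of (x, y')" "x : carr X" "y' : carr Y" "y : carr Y"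
   | x y r where "q = frag_of (ra x r, y) - frag_of (x, la r y)" "x : carr X" "y : carr Y"
   using \<open>q : A.R\<close> unfolding tensor_relators_def by blast
  then show ?thesis
  proof cases
   case 1
   have "u (pls X x x') = pls X' (u x) (u x')" using u 1 unfolding additive_def by blast
   moreover have "u x : carr X'" "u x' : carr X'" "v y : carr Y'" using u v 1 unfolding additive_def by blast+
   ultimately show ?thesis unfolding 1(1) frag_extend_diff frag_extend_of prod.case using B.relators(1) by simp
  next
   case 2
   have "v (pls Y y y') = pls Y' (v y) (v y')" using v 2 unfolding additive_def by blast
   moreover have "u x : carr X'" "v y : carr Y'" "v y' : carr Y'" using u v 2 unfolding additive_def by blast+
   ultimately show ?thesis unfolding 2(1) frag_extend_diff frag_extend_of prod.case using B.relators(2) by simp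
  next
   case 3
   have "u x : carr X'" "v y : carr Y'" using u v 3 unfolding additive_def by blast+
   then show ?thesis unfolding 3(1) frag_extend_diff frag_extend_of prod.case cu[OF 3(2)] cv[OF 3(3)]
    by (rule B.relators(3))
  qed
 qed
 have cl: "?f q : group_closure B.R" if "q : group_closure A.R" for q
  using that
 proof induction
  case (base s)
  then show ?case using rel by auto
 next
  case (diff s t)
  then show ?case by (simp add: frag_extend_diff group_closure.diff)
 qed
 have val: "tensor_map X' ra' Y' la' u v (A.coset p) = B.coset (?f p)" for p
 proof -
  have "B.coset (?f p') = B.coset (?f p)" if "p' : A.coset p" for p'
   using cl[of "p' - p"] that by (simp add: A.mem_coset B.coset_eq_iff frag_extend_diff)
  moreover have "p : A.coset p" by (simp add: A.mem_coset)
  ultimately show ?thesis unfolding tensor_map_def by blast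
 qed
 have keys: "Poly_Mapping.keys (?f p) <= carr X' \<times> carr Y'" if "Poly_Mapping.keys p <= carr X \<times> carr Y" for p
 proof -
  have "Poly_Mapping.keys (?f p) <= (\<Union>z \<in> Poly_Mapping.keys p. Poly_Mapping.keys ((%(x, y). frag_of (u x, v y)) z))"
   by (rule keys_frag_extend)
  also have "\<dots> <= carr X' \<times> carr Y'" using that u v unfolding additive_def by auto
  finally show ?thesis .
 qed
 show "additive (tgrp X ra Y la) (tgrp X' ra' Y' la') (tensor_map X' ra' Y' la' u v)"
  unfolding additive_def A.T_simps(3) ball_simps B.T_simps(3)
  using keys by (auto simp: val A.T_simps(1) B.T_simps(1) frag_extend_add)
 show "tensor_map X' ra' Y' la' u v (tz X ra Y la x y) = tz X' ra' Y' la' (u x) (v y)"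
  by (simp add: tz_def val)
qed

section \<open>Linear endofunctors\<close>

lemma endo_simps [simp]:
 "obj (endo_2cat C) = {F. lnf C F}" "arr (endo_2cat C) = ntr C"
 "src (endo_2cat C) (F, et, G) = F" "tgt (endo_2cat C) (F, et, G) = G"
 "one (endo_2cat C) = id_endofun C" "hcmp (endo_2cat C) = cef C"
 by (simp_all add: endo_2cat_def)

context precat begin

abbreviation E where "E \<equiv> endo_2cat C"

lemma linD:
 assumes "lnf C F"
 shows "X : obj C ==> fobj F X : obj C"
  and "f : arr C ==> farr F f : arr C"
  and "f : arr C ==> src C (farr F f) = fobj F (src C f)"
  and "f : arr C ==> tgt C (farr F f) = fobj F (tgt C f)"
  and "X : obj C ==> farr F (idt C X) = idt C (fobj F X)"
  and "[|f : arr C; g : arr C; src C g = tgt C f|] ==> farr F (g *. f) = farr F g *. farr F f"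
  and "[|f : arr C; g : arr C; src C f = src C g; tgt C f = tgt C g|] ==> farr F (f +. g) = farr F f +. farr F g"
  and "f : arr C ==> farr F (scl C c f) = scl C c (farr F f)"
 using assms unfolding linear_endofunctor_def by auto

lemma lin_zro:
 assumes "lnf C F" "X : obj C" "Y : obj C"
 shows "farr F (zro C X Y) = zro C (fobj F X) (fobj F Y)"
proof -
 have "farr F (zro C X Y) = farr F (scl C 0 (zro C X Y))" using assms by simp
 also have "\<dots> = scl C 0 (farr F (zro C X Y))" by (rule linD(8)[OF assms(1) zro(1)[OF assms(2,3)]])
 also have "\<dots> = zro C (fobj F X) (fobj F Y)" using linD(1-4)[OF assms(1)] assms by simp
 finally show ?thesis .
qed

lemma linI:
 assumes "fobj F : obj C \<rightarrow>\<^sub>E obj C" "farr F : extensional (arr C)"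
  and "!!f. f : arr C ==> farr F f : arr C & src C (farr F f) = fobj F (src C f) & tgt C (farr F f) = fobj F (tgt C f)"
  and "!!X. X : obj C ==> farr F (idt C X) = idt C (fobj F X)"
  and "!!f g. [|f : arr C; g : arr C; src C g = tgt C f|] ==> farr F (g *. f) = farr F g *. farr F f"
  and "!!f g. [|f : arr C; g : arr C; src C g = src C f; tgt C g = tgt C f|] ==> farr F (f +. g) = farr F f +. farr F g"
  and "!!c f. f : arr C ==> farr F (scl C c f) = scl C c (farr F f)"
 shows "lnf C F"
 using assms unfolding linear_endofunctor_def PiE_def by auto

lemma lin_id: "lnf C (id_endofun C)"
 by (rule linI) (auto simp: id_endofun_def)

lemma lin_comp:
 assumes "lnf C F" "lnf C G" shows "lnf C (cef C F G)"
 by (rule linI) (use linD[OF assms(1)] linD[OF assms(2)] in "auto simp: comp_endofun_def")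

lemma comp_endofun_simps:
 "X : obj C ==> fobj (cef C F G) X = fobj F (fobj G X)"
 "f : arr C ==> farr (cef C F G) f = farr F (farr G f)"
 by (simp_all add: comp_endofun_def)

lemma id_endofun_simps:
 "X : obj C ==> fobj (id_endofun C) X = X" "f : arr C ==> farr (id_endofun C) f = f"
 by (simp_all add: id_endofun_def)

lemma lin_eqI:
 assumes "lnf C F" "lnf C G" "!!X. X : obj C ==> fobj F X = fobj G X"
  "!!f. f : arr C ==> farr F f = farr G f"
 shows "F = G"
proof -
 have "fobj F = fobj G" "farr F = farr G"
  using assms unfolding linear_endofunctor_def by (metis (no_types, lifting) PiE_ext)+
 then show ?thesis by simp
qed

lemma comp_id:
 assumes "lnf C F"
 shows "cef C F (id_endofun C) = F" "cef C (id_endofun C) F = F"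
 using assms lin_comp lin_id linD[OF assms]
 by (auto intro!: lin_eqI simp: comp_endofun_simps id_endofun_simps)

lemma natI:
 assumes "lnf C F" "lnf C G" "et : extensional (obj C)"
  and "!!X. X : obj C ==> et X : arr C & src C (et X) = fobj F X & tgt C (et X) = fobj G X"
  and "!!f. f : arr C ==> farr G f *. et (src C f) = et (tgt C f) *. farr F f"
 shows "(F, et, G) : ntr C"
 using assms unfolding natural_transformations_def hom_def by simp

lemma natD:
 assumes "(F, et, G) : ntr C"
 shows "lnf C F" "lnf C G" "et : extensional (obj C)"
  and "X : obj C ==> et X : arr C" "X : obj C ==> src C (et X) = fobj F X" "X : obj C ==> tgt C (et X) = fobj G X"
  and "f : arr C ==> farr G f *. et (src C f) = et (tgt C f) *. farr F f"
 using assms unfolding natural_transformations_def hom_def by simp_all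

lemma nat_cmp:
 assumes "(F, et, G) : ntr C" "(G, ep, H) : ntr C"
 shows "(F, \<lambda>X \<in> obj C. ep X *. et X, H) : ntr C"
proof (rule natI)
 note 1 = natD[OF assms(1)] and 2 = natD[OF assms(2)]
 fix f assume f: "f : arr C"
 note F = linD[OF 1(1)] and G = linD[OF 1(2)] and H = linD[OF 2(2)]
 have "farr H f *. ep (src C f) *. et (src C f) = (farr H f *. ep (src C f)) *. et (src C f)"
  by (rule cmp_assoc[symmetric]) (use 1 2 f F G H in simp_all)
 also have "\<dots> = (ep (tgt C f) *. farr G f) *. et (src C f)" using 2(7)[OF f] by simp
 also have "\<dots> = ep (tgt C f) *. (farr G f *. et (src C f))"
  by (rule cmp_assoc) (use 1 2 f F G H in simp_all)
 also have "\<dots> = ep (tgt C f) *. (et (tgt C f) *. farr F f)" using 1(7)[OF f] by simp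
 also have "\<dots> = (ep (tgt C f) *. et (tgt C f)) *. farr F f"
  by (rule cmp_assoc[symmetric]) (use 1 2 f F G H in simp_all)
 finally show "farr H f *. (\<lambda>X \<in> obj C. ep X *. et X) (src C f) = (\<lambda>X \<in> obj C. ep X *. et X) (tgt C f) *. farr F f"
  using f by simp
qed (use natD[OF assms(1)] natD[OF assms(2)] in simp_all)

lemma nat_add:
 assumes "(F, et, G) : ntr C" "(F, ep, G) : ntr C"
 shows "(F, \<lambda>X \<in> obj C. et X +. ep X, G) : ntr C"
proof (rule natI)
 note 1 = natD[OF assms(1)] and 2 = natD[OF assms(2)]
 fix f assume f: "f : arr C"
 note F = linD[OF 1(1)] and G = linD[OF 1(2)]
 show "farr G f *. (\<lambda>X \<in> obj C. et X +. ep X) (src C f) = (\<lambda>X \<in> obj C. et X +. ep X) (tgt C f) *. farr F f"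
  using f 1 2 F G by (simp add: cmp_add add_cmp)
qed (use natD[OF assms(1)] natD[OF assms(2)] in simp_all)

lemma nat_scl:
 assumes "(F, et, G) : ntr C"
 shows "(F, \<lambda>X \<in> obj C. scl C c (et X), G) : ntr C"
proof (rule natI)
 note 1 = natD[OF assms(1)]
 fix f assume f: "f : arr C"
 note F = linD[OF 1(1)] and G = linD[OF 1(2)]
 show "farr G f *. (\<lambda>X \<in> obj C. scl C c (et X)) (src C f) = (\<lambda>X \<in> obj C. scl C c (et X)) (tgt C f) *. farr F f"
  using f 1 F G by (simp add: cmp_scl scl_cmp)
qed (use natD[OF assms(1)] in simp_all)

lemma nat_zro:
 assumes "lnf C F" "lnf C G"
 shows "(F, \<lambda>X \<in> obj C. zro C (fobj F X) (fobj G X), G) : ntr C"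
proof (rule natI)
 note F = linD[OF assms(1)] and G = linD[OF assms(2)]
 fix f assume f: "f : arr C"
 then show "farr G f *. (\<lambda>X \<in> obj C. zro C (fobj F X) (fobj G X)) (src C f) = (\<lambda>X \<in> obj C. zro C (fobj F X) (fobj G X)) (tgt C f) *. farr F f"
  using F G by simp
qed (use assms linD[OF assms(1)] linD[OF assms(2)] in simp_all)

lemma nat_idt:
 assumes "lnf C F"
 shows "(F, \<lambda>X \<in> obj C. idt C (fobj F X), F) : ntr C"
proof (rule natI)
 note F = linD[OF assms(1)]
 fix f assume f: "f : arr C"
 then show "farr F f *. (\<lambda>X \<in> obj C. idt C (fobj F X)) (src C f) = (\<lambda>X \<in> obj C. idt C (fobj F X)) (tgt C f) *. farr F f"
  using F by simp
qed (use assms linD[OF assms(1)] in simp_all)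

lemma nat_cases:
 assumes "et : arr E"
 obtains F h G where "et = (F, h, G)" "(F, h, G) : ntr C"
 using assms by (cases et) auto

lemma endo_ops:
 "cmp E (G', ep, H) (F, et, G) = (F, \<lambda>X \<in> obj C. ep X *. et X, H)"
 "add E (F, et, G) (F', ep, G') = (F, \<lambda>X \<in> obj C. et X +. ep X, G)"
 "scl E c (F, et, G) = (F, \<lambda>X \<in> obj C. scl C c (et X), G)"
 "zro E F G = (F, \<lambda>X \<in> obj C. zro C (fobj F X) (fobj G X), G)"
 "idt E F = (F, \<lambda>X \<in> obj C. idt C (fobj F X), F)"
 "lwh E H (F, et, G) = (cef C H F, \<lambda>X \<in> obj C. farr H (et X), cef C H G)"
 by (simp_all add: endo_2cat_def)

lemma ext_eq: "[|f : extensional A'; !!X. X : A' ==> g X = f X|] ==> (\<lambda>X \<in> A'. g X) = f"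
 by (rule extensionalityI[of _ A']) auto

lemma endo_form: "src E f = F ==> tgt E f = G ==> EX h. f = (F, h, G)"
 by (cases f) simp

lemma precat_endo: "precat E"
proof
 fix f assume "f : arr E"
 then show "src E f : obj E" "tgt E f : obj E" by (cases f; auto dest: natD)+
next
 fix F assume "F : obj E"
 then show "idt E F : arr E" "src E (idt E F) = F" "tgt E (idt E F) = F" by (simp_all add: endo_ops nat_idt)
next
 fix f g assume a: "g : arr E" "f : arr E" "src E g = tgt E f"
 then obtain F et G ep H where 1: "f = (F, et, G)" "g = (G, ep, H)" by (cases f; cases g) simp
 then show "cmp E g f : arr E" "src E (cmp E g f) = src E f" "tgt E (cmp E g f) = tgt E g"
  using a nat_cmp by (simp_all add: endo_ops)
 fix c
 have "(F, et, G) : ntr C" "(G, ep, H) : ntr C" using a 1 by simp_all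
 note n = natD[OF this(1)] natD[OF this(2)]
 show "cmp E g (scl E c f) = scl E c (cmp E g f)" "cmp E (scl E c g) f = scl E c (cmp E g f)"
  unfolding 1 endo_ops using n by (simp_all add: cmp_scl scl_cmp cong: restrict_cong)
next
 fix h g f assume a: "h : arr E" "g : arr E" "f : arr E" "src E h = tgt E g" "src E g = tgt E f"
 then obtain F et G ep H de K where 1: "f = (F, et, G)" "g = (G, ep, H)" "h = (H, de, K)"
  using endo_form by metis
 have "(F, et, G) : ntr C" "(G, ep, H) : ntr C"
  "(H, de, K) : ntr C" using a 1 by simp_all
 note n = natD[OF this(1)] natD[OF this(2)] natD[OF this(3)]
 show "cmp E (cmp E h g) f = cmp E h (cmp E g f)"
  unfolding 1 endo_ops using n by (simp add: cmp_assoc cong: restrict_cong)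
next
 fix f X assume a: "f : arr E" "src E f = X"
 then obtain et G where 1: "f = (X, et, G)" "(X, et, G) : ntr C" by (cases f) simp
 show "cmp E f (idt E X) = f" unfolding 1(1) endo_ops using natD[OF 1(2)] by (auto intro!: ext_eq)
next
 fix f X assume a: "f : arr E" "tgt E f = X"
 then obtain et G where 1: "f = (G, et, X)" "(G, et, X) : ntr C" by (cases f) simp
 show "cmp E (idt E X) f = f" unfolding 1(1) endo_ops using natD[OF 1(2)] by (auto intro!: ext_eq)
next
 fix X Y assume "X : obj E" "Y : obj E"
 then show "zro E X Y : arr E" "src E (zro E X Y) = X" "tgt E (zro E X Y) = Y"
  using nat_zro by (simp_all add: endo_ops)
next
 fix f g assume a: "f : arr E" "g : arr E" "src E f = src E g" "tgt E f = tgt E g"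
 then obtain F et G ep where 1: "f = (F, et, G)" "g = (F, ep, G)" using endo_form by metis
 have "(F, et, G) : ntr C" "(F, ep, G) : ntr C" using a 1 by simp_all
 note n = natD[OF this(1)] natD[OF this(2)] nat_add[OF this]
 show "add E f g : arr E" "src E (add E f g) = src E g" "tgt E (add E f g) = tgt E g"
  unfolding 1 endo_ops using n by simp_all
 show "add E f g = add E g f"
  unfolding 1 endo_ops using n(1-14) by (auto intro!: restrict_ext add_commute)
 fix c show "scl E c (add E f g) = add E (scl E c f) (scl E c g)"
  unfolding 1 endo_ops using n(1-14) by (simp add: scl_add cong: restrict_cong)
next
 fix f g h assume a: "f : arr E" "g : arr E" "h : arr E" "src E f = src E g" "tgt E f = tgt E g"
  "src E g = src E h" "tgt E g = tgt E h"
 then obtain F et G ep de where 1: "f = (F, et, G)" "g = (F, ep, G)" "h = (F, de, G)" using endo_form by metis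
 have "(F, et, G) : ntr C" "(F, ep, G) : ntr C" "(F, de, G) : ntr C"
  using a 1 by simp_all
 note n = natD[OF this(1)] natD[OF this(2)] natD[OF this(3)]
 show "add E (add E f g) h = add E f (add E g h)"
  unfolding 1 endo_ops using n by (simp add: add_assoc cong: restrict_cong)
next
 fix f X Y assume a: "f : arr E" "src E f = X" "tgt E f = Y"
 then obtain et where 1: "f = (X, et, Y)" "(X, et, Y) : ntr C" by (cases f) simp
 show "add E (zro E X Y) f = f" unfolding 1(1) endo_ops using natD[OF 1(2)] by (auto intro!: ext_eq)
next
 fix h f g assume a: "h : arr E" "f : arr E" "g : arr E" "src E f = src E g" "tgt E f = tgt E g" "src E h = tgt E g"
 then obtain F et G ep de K where 1: "f = (F, et, G)" "g = (F, ep, G)" "h = (G, de, K)" using endo_form by metis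
 have "(F, et, G) : ntr C" "(F, ep, G) : ntr C" "(G, de, K) : ntr C"
  using a 1 by simp_all
 note n = natD[OF this(1)] natD[OF this(2)] natD[OF this(3)]
 show "cmp E h (add E f g) = add E (cmp E h f) (cmp E h g)"
  unfolding 1 endo_ops using n by (simp add: cmp_add cong: restrict_cong)
next
 fix h f g assume a: "h : arr E" "f : arr E" "g : arr E" "src E f = src E g" "tgt E f = tgt E g" "tgt E h = src E g"
 then obtain F et G ep de K where 1: "f = (F, et, G)" "g = (F, ep, G)" "h = (K, de, F)" using endo_form by metis
 have "(F, et, G) : ntr C" "(F, ep, G) : ntr C" "(K, de, F) : ntr C"
  using a 1 by simp_all
 note n = natD[OF this(1)] natD[OF this(2)] natD[OF this(3)]
 show "cmp E (add E f g) h = add E (cmp E f h) (cmp E g h)"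
  unfolding 1 endo_ops using n by (simp add: add_cmp cong: restrict_cong)
next
 fix f c d assume a: "f : arr E"
 then obtain F et G where 1: "f = (F, et, G)" "(F, et, G) : ntr C" by (cases f) simp
 note n = natD[OF 1(2)]
 show "scl E c f : arr E" "src E (scl E c f) = src E f" "tgt E (scl E c f) = tgt E f"
  unfolding 1(1) endo_ops using nat_scl[OF 1(2)] by simp_all
 show "scl E (c + d) f = add E (scl E c f) (scl E d f)"
  unfolding 1(1) endo_ops using n by (simp add: add_scl cong: restrict_cong)
 show "scl E c (scl E d f) = scl E (c * d) f"
  unfolding 1(1) endo_ops using n by (simp add: scl_scl cong: restrict_cong)
 show "scl E 0 f = zro E (src E f) (tgt E f)"
  unfolding 1(1) endo_ops using n by (simp add: endo_ops cong: restrict_cong)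
 show "scl E 1 f = f" unfolding 1(1) endo_ops using n by (auto intro!: ext_eq)
qed

lemma lwh_arr:
 assumes F: "lnf C F" and n: "et : arr E"
 shows "lwh E F et : arr E" "src E (lwh E F et) = cef C F (src E et)" "tgt E (lwh E F et) = cef C F (tgt E et)"
proof -
 obtain G h H where e: "et = (G, h, H)" and 1: "(G, h, H) : ntr C" using n by (rule nat_cases)
 note d = natD[OF 1]
 have "(cef C F G, \<lambda>X \<in> obj C. farr F (h X), cef C F H) : ntr C"
 proof (rule natI)
  fix f assume f: "f : arr C"
  have "farr F (farr H f) *. farr F (h (src C f)) = farr F (farr H f *. h (src C f))"
   by (rule linD(6)[OF F, symmetric]) (use linD(2,3)[OF d(2) f] d(4,5,6)[of "src C f"] f in simp_all)
  also have "\<dots> = farr F (h (tgt C f)) *. farr F (farr G f)"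
   unfolding d(7)[OF f] by (rule linD(6)[OF F]) (use linD[OF F] linD[OF d(1)] d f in simp_all)
  finally show "farr (cef C F H) f *. (\<lambda>X \<in> obj C. farr F (h X)) (src C f) =
    (\<lambda>X \<in> obj C. farr F (h X)) (tgt C f) *. farr (cef C F G) f"
   using f by (simp add: comp_endofun_simps)
 qed (use d F linD[OF F] lin_comp in "simp_all add: comp_endofun_simps")
 then show "lwh E F et : arr E" "src E (lwh E F et) = cef C F (src E et)" "tgt E (lwh E F et) = cef C F (tgt E et)"
  unfolding e by (simp_all add: endo_ops)
qed

text \<open>Whiskering on the right. It lets a transformation between two functors act on their
  composites with a fixed functor, and \<open>interchange\<close> relates it to
  \<open>lwh\<close>.\<close>

definition rwh :: "('o, 'a) transf \<Rightarrow> ('o, 'a) endofun \<Rightarrow> ('o, 'a) transf" where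
 "rwh et F = (cef C (fst et) F, \<lambda>X \<in> obj C. fst (snd et) (fobj F X), cef C (snd (snd et)) F)"

lemma rwh_arr:
 assumes F: "lnf C F" and n: "et : arr E"
 shows "rwh et F : arr E" "src E (rwh et F) = cef C (src E et) F" "tgt E (rwh et F) = cef C (tgt E et) F"
proof -
 obtain G h H where e: "et = (G, h, H)" and 1: "(G, h, H) : ntr C" using n by (rule nat_cases)
 note d = natD[OF 1]
 have "(cef C G F, \<lambda>X \<in> obj C. h (fobj F X), cef C H F) : ntr C"
 proof (rule natI)
  fix f assume f: "f : arr C"
  show "farr (cef C H F) f *. (\<lambda>X \<in> obj C. h (fobj F X)) (src C f) =
    (\<lambda>X \<in> obj C. h (fobj F X)) (tgt C f) *. farr (cef C G F) f"
   using f d(7)[OF linD(2)[OF F f]] linD(3,4)[OF F f] by (simp add: comp_endofun_simps)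
 qed (use d F linD[OF F] lin_comp in "simp_all add: comp_endofun_simps")
 then show "rwh et F : arr E" "src E (rwh et F) = cef C (src E et) F" "tgt E (rwh et F) = cef C (tgt E et) F"
  unfolding e by (simp_all add: rwh_def)
qed

end

section \<open>The module category and its endofunctors, elementwise\<close>

text \<open>\<open>ap\<close>, \<open>nap\<close> and \<open>fap\<close> are the maps on elements
  underlying a module map, a component of a transformation and the value of a functor on a module
  map. Equalities of arrows are checked on elements through them.\<close>

definition ap :: "('k, 'b) smor \<Rightarrow> (nat \<Rightarrow> 'k) \<Rightarrow> nat \<Rightarrow> 'k" where
 "ap f = fst (snd f)"

definition nap :: "(('k, 'b) smod, ('k, 'b) smor) transf \<Rightarrow> ('k, 'b) smod \<Rightarrow> (nat \<Rightarrow> 'k) \<Rightarrow> nat \<Rightarrow> 'k" where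
 "nap et M = ap (fst (snd et) M)"

definition fap :: "(('k, 'b) smod, ('k, 'b) smor) endofun \<Rightarrow> ('k, 'b) smor \<Rightarrow> (nat \<Rightarrow> 'k) \<Rightarrow> nat \<Rightarrow> 'k" where
 "fap F f = ap (farr F f)"

definition mkarr :: "('k, 'b) smod \<Rightarrow> ((nat \<Rightarrow> 'k) \<Rightarrow> nat \<Rightarrow> 'k) \<Rightarrow> ('k, 'b) smod \<Rightarrow> ('k, 'b) smor" where
 "mkarr M f N = (M, restrict f (carr M), N)"

lemma module_cat_simps [simp]:
 "obj (module_cat sc) = SM" "src (module_cat sc) (M, f, N) = M" "tgt (module_cat sc) (M, f, N) = N"
 by (simp_all add: module_cat_def)

lemma small_modulesD [simp]: "M : SM ==> left_module M" "M : SM ==> finitely_generated M"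
 by (simp_all add: small_modules_def)

lemma module_homI:
 assumes "!!x. x : carr M ==> f x : carr N" "!!x y. x : carr M ==> y : carr M ==> f (pls M x y) = pls N (f x) (f y)"
  "!!a x. x : carr M ==> f (act M a x) = act N a (f x)"
 shows "module_hom M N f"
 using assms unfolding module_hom_def by auto

lemma module_hom_cong:
 assumes "left_module M" "!!x. x : carr M ==> f x = g x" shows "module_hom M N f \<longleftrightarrow> module_hom M N g"
 using assms unfolding module_hom_def Pi_def by simp

context fdalg begin

abbreviation D where "D \<equiv> module_cat sc"
abbreviation E where "E \<equiv> endo_2cat (module_cat sc)"

lemma arr_D_iff: "f : arr D \<longleftrightarrow> src D f : SM & tgt D f : SM &
  ap f : extensional (carr (src D f)) & module_hom (src D f) (tgt D f) (ap f)"
 by (cases f) (simp add: module_cat_def ap_def)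

lemma arr_D_eqI:
 assumes "f : arr D" "g : arr D" "src D f = src D g" "tgt D f = tgt D g"
  "!!x. x : carr (src D g) ==> ap f x = ap g x"
 shows "f = g"
proof -
 have "ap f = ap g"
  by (rule extensionalityI[of _ "carr (src D g)"]) (use assms in "simp_all add: arr_D_iff")
 then show ?thesis using assms(3,4) by (cases f; cases g) (simp add: ap_def)
qed

lemma D_ops:
 "cmp D g f = mkarr (src D f) (%x. ap g (ap f x)) (tgt D g)"
 "idt D M = mkarr M (%x. x) M"
 "zro D M N = mkarr M (%x. zer N) N"
 "add D f g = mkarr (src D f) (%x. pls (tgt D f) (ap f x) (ap g x)) (tgt D f)"
 "scl D c f = mkarr (src D f) (%x. act (tgt D f) (sc c 1) (ap f x)) (tgt D f)"
 by (cases f; cases g; simp add: module_cat_def ap_def mkarr_def)+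

lemma mkarr [simp]:
 "src D (mkarr M f N) = M" "tgt D (mkarr M f N) = N" "x : carr M ==> ap (mkarr M f N) x = f x"
 by (simp_all add: mkarr_def ap_def)

lemma mkarr_arr: "M : SM ==> N : SM ==> module_hom M N f ==> mkarr M f N : arr D"
 unfolding arr_D_iff mkarr using module_hom_cong[of M "ap (mkarr M f N)" f N]
 by (simp add: mkarr_def ap_def)

lemma arr_DD:
 assumes "f : arr D"
 shows "src D f : SM" "tgt D f : SM" "left_module (src D f)" "left_module (tgt D f)"
  and "x : carr (src D f) ==> ap f x : carr (tgt D f)"
  and "x : carr (src D f) ==> y : carr (src D f) ==> ap f (pls (src D f) x y) = pls (tgt D f) (ap f x) (ap f y)"
  and "x : carr (src D f) ==> ap f (act (src D f) a x) = act (tgt D f) a (ap f x)"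
  and "ap f (zer (src D f)) = zer (tgt D f)"
 using assms module_homD[of "src D f" "tgt D f" "ap f"] module_hom_zer[of "src D f" "tgt D f" "ap f"]
 unfolding arr_D_iff by auto

lemma precat_D: "precat D"
proof
 fix f assume "f : arr D" then show "src D f : obj D" "tgt D f : obj D" using arr_DD by simp_all
next
 fix X assume "X : obj D"
 then show "idt D X : arr D" unfolding D_ops by (intro mkarr_arr) (auto simp: module_hom_def)
 show "src D (idt D X) = X" "tgt D (idt D X) = X" by (simp_all add: D_ops)
next
 fix f g assume a: "g : arr D" "f : arr D" "src D g = tgt D f"
 note F = arr_DD[OF a(2)] and G = arr_DD[OF a(1)]
 show c: "cmp D g f : arr D" unfolding D_ops by (rule mkarr_arr) (use F G a(3) in "auto intro!: module_homI")
 show "src D (cmp D g f) = src D f" "tgt D (cmp D g f) = tgt D g" by (simp_all add: D_ops)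
 fix c
 have "scl D c f : arr D" unfolding D_ops by (rule mkarr_arr) (use F in "auto intro!: module_homI simp: act_pls")
 have "scl D c g : arr D" unfolding D_ops by (rule mkarr_arr) (use G in "auto intro!: module_homI simp: act_pls")
 show "cmp D g (scl D c f) = scl D c (cmp D g f)" "cmp D (scl D c g) f = scl D c (cmp D g f)"
  unfolding D_ops mkarr_def using F G a(3) by (auto simp: ap_def intro!: restrict_ext)
next
 fix h g f assume a: "h : arr D" "g : arr D" "f : arr D" "src D h = tgt D g" "src D g = tgt D f"
 show "cmp D (cmp D h g) f = cmp D h (cmp D g f)"
  unfolding D_ops mkarr mkarr_def using a arr_DD(5)[OF a(3)] by (auto simp: ap_def intro!: restrict_ext)
next
 fix f X assume a: "f : arr D" "src D f = X"
 show "cmp D f (idt D X) = f"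
  by (cases f, use a in "auto simp: D_ops mkarr_def ap_def arr_D_iff extensional_def intro!: ext")
next
 fix f X assume a: "f : arr D" "tgt D f = X"
 show "cmp D (idt D X) f = f"
  by (cases f, use a arr_DD(5)[OF a(1)] in "auto simp: D_ops mkarr_def ap_def arr_D_iff extensional_def intro!: ext")
next
 fix X Y assume a: "X : obj D" "Y : obj D"
 then show "zro D X Y : arr D" unfolding D_ops by (intro mkarr_arr module_homI) auto
 show "src D (zro D X Y) = X" "tgt D (zro D X Y) = Y" by (simp_all add: D_ops)
next
 fix f g assume a: "f : arr D" "g : arr D" "src D f = src D g" "tgt D f = tgt D g"
 note F = arr_DD[OF a(1)] and G = arr_DD[OF a(2)]
 show "add D f g : arr D" unfolding D_ops
 proof (rule mkarr_arr[OF F(1,2) module_homI])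
  fix x y assume "x : carr (src D f)" "y : carr (src D f)"
  then show "pls (tgt D f) (ap f (pls (src D f) x y)) (ap g (pls (src D f) x y)) =
    pls (tgt D f) (pls (tgt D f) (ap f x) (ap g x)) (pls (tgt D f) (ap f y) (ap g y))"
   using F G a(3,4) by (simp add: pls_assoc pls_left_commute[of "tgt D g" "ap f y"])
 qed (use F G a(3,4) in "auto simp: act_pls")
 show "src D (add D f g) = src D g" "tgt D (add D f g) = tgt D g" using a by (simp_all add: D_ops)
 show "add D f g = add D g f" unfolding D_ops a(3,4) mkarr_def
  using F G a(3,4) pls_commute[OF left_module_grp[OF G(4)]] by (auto intro!: restrict_ext)
 fix c show "scl D c (add D f g) = add D (scl D c f) (scl D c g)"
  unfolding D_ops mkarr mkarr_def using F G a(3,4) by (auto simp: ap_def act_pls intro!: restrict_ext)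
next
 fix f g h assume a: "f : arr D" "g : arr D" "h : arr D" "src D f = src D g" "tgt D f = tgt D g"
  "src D g = src D h" "tgt D g = tgt D h"
 note F = arr_DD[OF a(1)] and G = arr_DD[OF a(2)] and H = arr_DD[OF a(3)]
 show "add D (add D f g) h = add D f (add D g h)"
  unfolding D_ops mkarr mkarr_def using F G H a(4-) by (auto simp: ap_def pls_assoc intro!: restrict_ext)
next
 fix f X Y assume a: "f : arr D" "src D f = X" "tgt D f = Y"
 show "add D (zro D X Y) f = f"
  by (cases f, use a arr_DD(4,5)[OF a(1)] in "auto simp: D_ops mkarr_def ap_def arr_D_iff extensional_def intro!: ext")
next
 fix h f g assume a: "h : arr D" "f : arr D" "g : arr D" "src D f = src D g" "tgt D f = tgt D g" "src D h = tgt D g"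
 note F = arr_DD[OF a(2)] and G = arr_DD[OF a(3)] and H = arr_DD[OF a(1)]
 show "cmp D h (add D f g) = add D (cmp D h f) (cmp D h g)"
  unfolding D_ops mkarr mkarr_def using F G H a(4-) by (auto simp: ap_def intro!: restrict_ext)
next
 fix h f g assume a: "h : arr D" "f : arr D" "g : arr D" "src D f = src D g" "tgt D f = tgt D g" "tgt D h = src D g"
 note F = arr_DD[OF a(2)] and G = arr_DD[OF a(3)] and H = arr_DD[OF a(1)]
 show "cmp D (add D f g) h = add D (cmp D f h) (cmp D g h)"
  unfolding D_ops mkarr mkarr_def using F G H a(4-) by (auto simp: ap_def intro!: restrict_ext)
next
 fix f c d assume a: "f : arr D"
 note F = arr_DD[OF a]
 show "scl D c f : arr D" unfolding D_ops by (rule mkarr_arr) (use F in "auto intro!: module_homI simp: act_pls")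
 show "src D (scl D c f) = src D f" "tgt D (scl D c f) = tgt D f" by (simp_all add: D_ops)
 show "scl D (c + d) f = add D (scl D c f) (scl D d f)"
  unfolding D_ops mkarr mkarr_def using F by (auto simp: ap_def sc_add act_add intro!: restrict_ext)
 show "scl D c (scl D d f) = scl D (c * d) f"
  unfolding D_ops mkarr mkarr_def using F by (auto simp: ap_def mult.commute intro!: restrict_ext)
 show "scl D 0 f = zro D (src D f) (tgt D f)"
  unfolding D_ops mkarr mkarr_def using F by (auto simp: ap_def intro!: restrict_ext)
 show "scl D 1 f = f"
  by (cases f, use a F(4,5) in "auto simp: D_ops mkarr_def ap_def arr_D_iff extensional_def intro!: ext")
qed

end

text \<open>From here on transformations are handled through \<open>arr E\<close> and
  \<open>nap\<close>; unfolding \<open>arr E\<close> to the set of natural transformations would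
  block the category rules.\<close>

declare endo_simps(2) [simp del]

context fdalg begin

sublocale D: precat "module_cat sc" by (rule precat_D)
sublocale E: precat "endo_2cat (module_cat sc)" by (rule D.precat_endo)

abbreviation lin where "lin \<equiv> lnf (module_cat sc)"

lemma lin_obj: "lin F ==> M : SM ==> fobj F M : SM"
 using D.linD(1)[of F M] by simp

lemma lin_mod: "lin F ==> M : SM ==> left_module (fobj F M)"
 using lin_obj by simp

lemma fap:
 assumes "lin F" "f : arr D"
 shows "x : carr (fobj F (src D f)) ==> fap F f x : carr (fobj F (tgt D f))"
  and "x : carr (fobj F (src D f)) ==> y : carr (fobj F (src D f)) ==>
   fap F f (pls (fobj F (src D f)) x y) = pls (fobj F (tgt D f)) (fap F f x) (fap F f y)"
  and "x : carr (fobj F (src D f)) ==> fap F f (act (fobj F (src D f)) a x) = act (fobj F (tgt D f)) a (fap F f x)"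
  and "fap F f (zer (fobj F (src D f))) = zer (fobj F (tgt D f))"
 using arr_DD(5-8)[OF D.linD(2)[OF assms]] D.linD(3,4)[OF assms] by (simp_all add: fap_def)

lemma fap_cmp:
 assumes "lin F" "f : arr D" "g : arr D" "src D g = tgt D f" "x : carr (fobj F (src D f))"
 shows "fap F (cmp D g f) x = fap F g (fap F f x)"
 using D.linD(6)[OF assms(1-4)] D.linD(3)[OF assms(1,2)] assms(5) by (simp add: fap_def D_ops)

lemma fap_add:
 assumes "lin F" "f : arr D" "g : arr D" "src D f = src D g" "tgt D f = tgt D g" "x : carr (fobj F (src D f))"
 shows "fap F (add D f g) x = pls (fobj F (tgt D f)) (fap F f x) (fap F g x)"
 using D.linD(7)[OF assms(1-5)] D.linD(3,4)[OF assms(1,2)] assms(6) by (simp add: fap_def D_ops)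

lemma fap_scl:
 assumes "lin F" "f : arr D" "x : carr (fobj F (src D f))"
 shows "fap F (scl D c f) x = act (fobj F (tgt D f)) (sc c 1) (fap F f x)"
 using D.linD(8)[OF assms(1,2)] D.linD(3,4)[OF assms(1,2)] assms(3) by (simp add: fap_def D_ops)

lemma fap_idt:
 assumes "lin F" "M : SM" "x : carr (fobj F M)" shows "fap F (idt D M) x = x"
 using D.linD(5)[OF assms(1), of M] assms by (simp add: fap_def D_ops)

lemma arr_E_lin: "et : arr E ==> lin (src E et)" "et : arr E ==> lin (tgt E et)"
 using E.src_obj E.tgt_obj by auto

lemma arr_E_at:
 assumes "et : arr E" "M : SM"
 shows "fst (snd et) M : arr D" "src D (fst (snd et) M) = fobj (src E et) M" "tgt D (fst (snd et) M) = fobj (tgt E et) M"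
proof -
 obtain F h G where e: "et = (F, h, G)" "(F, h, G) : ntr D" using assms(1) by (rule D.nat_cases)
 show "fst (snd et) M : arr D" "src D (fst (snd et) M) = fobj (src E et) M" "tgt D (fst (snd et) M) = fobj (tgt E et) M"
  using D.natD(4-6)[OF e(2), of M] assms(2) e(1) by simp_all
qed

lemma nap:
 assumes "et : arr E" "M : SM"
 shows "x : carr (fobj (src E et) M) ==> nap et M x : carr (fobj (tgt E et) M)"
  and "x : carr (fobj (src E et) M) ==> y : carr (fobj (src E et) M) ==>
   nap et M (pls (fobj (src E et) M) x y) = pls (fobj (tgt E et) M) (nap et M x) (nap et M y)"
  and "x : carr (fobj (src E et) M) ==> nap et M (act (fobj (src E et) M) a x) = act (fobj (tgt E et) M) a (nap et M x)"
  and "nap et M (zer (fobj (src E et) M)) = zer (fobj (tgt E et) M)"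
 using arr_DD(5-8)[OF arr_E_at(1)[OF assms]] arr_E_at(2,3)[OF assms] by (simp_all add: nap_def)

lemma nap_hom: "et : arr E ==> M : SM ==> module_hom (fobj (src E et) M) (fobj (tgt E et) M) (nap et M)"
 using nap by (intro module_homI) blast+

lemma nap_natural:
 assumes "et : arr E" "f : arr D" "x : carr (fobj (src E et) (src D f))"
 shows "nap et (tgt D f) (fap (src E et) f x) = fap (tgt E et) f (nap et (src D f) x)"
proof -
 obtain F h G where e: "et = (F, h, G)" "(F, h, G) : ntr D" using assms(1) by (rule D.nat_cases)
 have x: "x : carr (fobj F (src D f))" using assms(3) e by simp
 have s: "src D f : obj D" using arr_DD(1)[OF assms(2)] by simp
 have "ap (cmp D (farr G f) (h (src D f))) x = ap (farr G f) (ap (h (src D f)) x)"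
  using D.natD(5)[OF e(2) s] x by (simp add: D_ops)
 moreover have "ap (cmp D (h (tgt D f)) (farr F f)) x = ap (h (tgt D f)) (ap (farr F f) x)"
  using D.linD(3)[OF D.natD(1)[OF e(2)] assms(2)] x by (simp add: D_ops)
 ultimately show ?thesis using D.natD(7)[OF e(2) assms(2)] e(1) by (simp add: nap_def fap_def)
qed

lemma E_eqI:
 assumes "et : arr E" "ep : arr E" "src E et = src E ep" "tgt E et = tgt E ep"
  "!!M x. M : SM ==> x : carr (fobj (src E ep) M) ==> nap et M x = nap ep M x"
 shows "et = ep"
proof -
 obtain F h G where e: "et = (F, h, G)" "(F, h, G) : ntr D" using assms(1) by (rule D.nat_cases)
 obtain k where k: "ep = (F, k, G)" using assms(3,4) e(1) by (cases ep) simp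
 have "h = k"
 proof (rule extensionalityI[of _ SM])
  show "h : extensional SM" "k : extensional SM"
   using D.natD(3)[OF e(2)] D.natD(3)[of F k G] assms(2) k by (simp_all add: endo_simps(2))
  fix M :: "('k, 'b) smod" assume M: "M : SM"
  show "h M = k M"
   by (rule arr_D_eqI)
    (use arr_E_at[OF assms(1) M] arr_E_at[OF assms(2) M] assms(5)[OF M] e(1) k in "simp_all add: nap_def")
 qed
 then show ?thesis using e k by simp
qed

lemma nap_ops:
 assumes "M : SM"
 shows "[|et : arr E; ep : arr E; src E ep = tgt E et; x : carr (fobj (src E et) M)|] ==> nap (cmp E ep et) M x = nap ep M (nap et M x)"
  and "[|et : arr E; ep : arr E; src E et = src E ep; tgt E et = tgt E ep; x : carr (fobj (src E et) M)|] ==>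
   nap (add E et ep) M x = pls (fobj (tgt E et) M) (nap et M x) (nap ep M x)"
  and "[|et : arr E; x : carr (fobj (src E et) M)|] ==> nap (scl E c et) M x = act (fobj (tgt E et) M) (sc c 1) (nap et M x)"
  and "[|lin F; x : carr (fobj F M)|] ==> nap (idt E F) M x = x"
  and "[|lin F; lin G; x : carr (fobj F M)|] ==> nap (zro E F G) M x = zer (fobj G M)"
  and "[|et : arr E; x : carr (fobj F (fobj (src E et) M))|] ==> nap (lwh E F et) M x = fap F (fst (snd et) M) x"
  and "nap (D.rwh et F) M x = nap et (fobj F M) x"
proof -
 have *: "src D (fst (snd et) M) = fobj (src E et) M" "tgt D (fst (snd et) M) = fobj (tgt E et) M" if "et : arr E" for et
  using arr_E_at[OF that assms] by simp_all
 show "nap (cmp E ep et) M x = nap ep M (nap et M x)"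
  if "et : arr E" "ep : arr E" "src E ep = tgt E et" "x : carr (fobj (src E et) M)"
  using that assms *[OF that(1)] *[OF that(2)] by (cases et; cases ep) (simp add: D.endo_ops nap_def D_ops)
 show "nap (add E et ep) M x = pls (fobj (tgt E et) M) (nap et M x) (nap ep M x)"
  if "et : arr E" "ep : arr E" "src E et = src E ep" "tgt E et = tgt E ep" "x : carr (fobj (src E et) M)"
  using that assms *[OF that(1)] *[OF that(2)] by (cases et; cases ep) (simp add: D.endo_ops nap_def D_ops)
 show "nap (scl E c et) M x = act (fobj (tgt E et) M) (sc c 1) (nap et M x)"
  if "et : arr E" "x : carr (fobj (src E et) M)"
  using that assms *[OF that(1)] by (cases et) (simp add: D.endo_ops nap_def D_ops)
 show "nap (idt E F) M x = x" if "lin F" "x : carr (fobj F M)"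
  using that assms by (simp add: D.endo_ops nap_def D_ops)
 show "nap (zro E F G) M x = zer (fobj G M)" if "lin F" "lin G" "x : carr (fobj F M)"
  using that assms by (simp add: D.endo_ops nap_def D_ops)
 show "nap (lwh E F et) M x = fap F (fst (snd et) M) x" if "et : arr E" "x : carr (fobj F (fobj (src E et) M))"
  using that assms by (cases et) (simp add: D.endo_ops nap_def fap_def)
 show "nap (D.rwh et F) M x = nap et (fobj F M) x"
  using assms by (simp add: D.rwh_def nap_def)
qed

definition mknt :: "(('k, 'b) smod, ('k, 'b) smor) endofun \<Rightarrow> (('k, 'b) smod \<Rightarrow> (nat \<Rightarrow> 'k) \<Rightarrow> nat \<Rightarrow> 'k) \<Rightarrow>
  (('k, 'b) smod, ('k, 'b) smor) endofun \<Rightarrow> (('k, 'b) smod, ('k, 'b) smor) transf" where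
 "mknt F h G = (F, \<lambda>M \<in> SM. mkarr (fobj F M) (h M) (fobj G M), G)"

lemma mknt:
 assumes "lin F" "lin G" "!!M. M : SM ==> module_hom (fobj F M) (fobj G M) (h M)"
  "!!f x. f : arr D ==> x : carr (fobj F (src D f)) ==> h (tgt D f) (fap F f x) = fap G f (h (src D f) x)"
 shows "mknt F h G : arr E" "src E (mknt F h G) = F" "tgt E (mknt F h G) = G"
  and "M : SM ==> x : carr (fobj F M) ==> nap (mknt F h G) M x = h M x"
proof -
 have a: "mkarr (fobj F M) (h M) (fobj G M) : arr D" if "M : SM" for M
  by (rule mkarr_arr) (use assms lin_obj that in simp_all)
 have "(F, \<lambda>M \<in> SM. mkarr (fobj F M) (h M) (fobj G M), G) : ntr D"
 proof (rule D.natI)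
  fix f assume f: "f : arr D"
  note s = arr_DD(1,2)[OF f]
  have "cmp D (farr G f) (mkarr (fobj F (src D f)) (h (src D f)) (fobj G (src D f))) =
    cmp D (mkarr (fobj F (tgt D f)) (h (tgt D f)) (fobj G (tgt D f))) (farr F f)"
  proof (rule arr_D_eqI)
   fix x assume "x : carr (src D (cmp D (mkarr (fobj F (tgt D f)) (h (tgt D f)) (fobj G (tgt D f))) (farr F f)))"
   then have x: "x : carr (fobj F (src D f))" using D.linD(3)[OF assms(1) f] by (simp add: D_ops)
   then show "ap (cmp D (farr G f) (mkarr (fobj F (src D f)) (h (src D f)) (fobj G (src D f)))) x =
    ap (cmp D (mkarr (fobj F (tgt D f)) (h (tgt D f)) (fobj G (tgt D f))) (farr F f)) x"
    using assms(4)[OF f x] fap(1)[OF assms(1) f x] D.linD(3)[OF assms(1) f] by (simp add: D_ops fap_def)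
  qed (use D.linD(2-4)[OF assms(1) f] D.linD(2-4)[OF assms(2) f] a[OF s(1)] a[OF s(2)] in simp_all)
  then show "cmp D (farr G f) ((\<lambda>M \<in> SM. mkarr (fobj F M) (h M) (fobj G M)) (src D f)) =
    cmp D ((\<lambda>M \<in> SM. mkarr (fobj F M) (h M) (fobj G M)) (tgt D f)) (farr F f)"
   using s by simp
 qed (use assms a in simp_all)
 then show "mknt F h G : arr E" "src E (mknt F h G) = F" "tgt E (mknt F h G) = G"
  by (simp_all add: mknt_def endo_simps(2))
 show "nap (mknt F h G) M x = h M x" if "M : SM" "x : carr (fobj F M)"
  using that by (simp add: mknt_def nap_def)
qed

lemma mknt_ball:
 assumes "lin F" "lin G" "ALL M : SM. module_hom (fobj F M) (fobj G M) (h M)"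
  "ALL f : arr D. ALL x : carr (fobj F (src D f)). h (tgt D f) (fap F f x) = fap G f (h (src D f) x)"
 shows "mknt F h G : arr E" "src E (mknt F h G) = F" "tgt E (mknt F h G) = G"
  and "M : SM ==> x : carr (fobj F M) ==> nap (mknt F h G) M x = h M x"
 by (rule mknt[OF assms(1,2)]; use assms(3,4) in simp)+

definition mkfun :: "(('k, 'b) smod \<Rightarrow> ('k, 'b) smod) \<Rightarrow> (('k, 'b) smor \<Rightarrow> (nat \<Rightarrow> 'k) \<Rightarrow> nat \<Rightarrow> 'k) \<Rightarrow>
  (('k, 'b) smod, ('k, 'b) smor) endofun" where
 "mkfun ob h = \<lparr>fobj = restrict ob SM, farr = (\<lambda>f \<in> arr D. mkarr (ob (src D f)) (h f) (ob (tgt D f)))\<rparr>"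

lemma mkfun_simps:
 "M : SM ==> fobj (mkfun ob h) M = ob M"
 "f : arr D ==> x : carr (ob (src D f)) ==> fap (mkfun ob h) f x = h f x"
 by (simp_all add: mkfun_def fap_def)

lemma lin_mkfun:
 assumes ob: "!!M. M : SM ==> ob M : SM"
  and h: "!!f. f : arr D ==> module_hom (ob (src D f)) (ob (tgt D f)) (h f)"
  and id: "!!M x. M : SM ==> x : carr (ob M) ==> h (idt D M) x = x"
  and cmp: "!!f g x. [|f : arr D; g : arr D; src D g = tgt D f; x : carr (ob (src D f))|] ==> h (cmp D g f) x = h g (h f x)"
  and add: "!!f g x. [|f : arr D; g : arr D; src D g = src D f; tgt D g = tgt D f; x : carr (ob (src D f))|] ==>
   h (add D f g) x = pls (ob (tgt D f)) (h f x) (h g x)"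
  and scl: "!!f c x. [|f : arr D; x : carr (ob (src D f))|] ==> h (scl D c f) x = act (ob (tgt D f)) (sc c 1) (h f x)"
 shows "lin (mkfun ob h)"
proof -
 have a: "mkarr (ob (src D f)) (h f) (ob (tgt D f)) : arr D" if "f : arr D" for f
  using arr_DD(1,2)[OF that] ob h that by (intro mkarr_arr) auto
 have ab: "farr (mkfun ob h) f = mkarr (ob (src D f)) (h f) (ob (tgt D f))" if "f : arr D" for f
  using that by (simp add: mkfun_def)
 have hc: "h f x : carr (ob (tgt D f))" if "f : arr D" "x : carr (ob (src D f))" for f x
  using h[OF that(1)] that(2) by (rule module_homD(1))
 show ?thesis
 proof (rule D.linI)
  show "fobj (mkfun ob h) : obj D \<rightarrow>\<^sub>E obj D" using ob by (simp add: mkfun_def)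
  show "farr (mkfun ob h) : extensional (arr D)" by (simp add: mkfun_def)
  fix f assume f: "f : arr D"
  show "farr (mkfun ob h) f : arr D & src D (farr (mkfun ob h) f) = fobj (mkfun ob h) (src D f) &
    tgt D (farr (mkfun ob h) f) = fobj (mkfun ob h) (tgt D f)"
   using a[OF f] arr_DD(1,2)[OF f] by (simp add: ab[OF f] mkfun_simps)
  fix c
  have s: "scl D c f : arr D" using f by simp
  show "farr (mkfun ob h) (scl D c f) = scl D c (farr (mkfun ob h) f)"
   unfolding ab[OF s] ab[OF f]
  proof (rule arr_D_eqI)
   show "mkarr (ob (src D (scl D c f))) (h (scl D c f)) (ob (tgt D (scl D c f))) : arr D" by (rule a[OF s])
   show "scl D c (mkarr (ob (src D f)) (h f) (ob (tgt D f))) : arr D" using a[OF f] by simp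
   fix x assume "x : carr (src D (scl D c (mkarr (ob (src D f)) (h f) (ob (tgt D f)))))"
   then have "x : carr (ob (src D f))" using a[OF f] by simp
   then show "ap (mkarr (ob (src D (scl D c f))) (h (scl D c f)) (ob (tgt D (scl D c f)))) x =
     ap (scl D c (mkarr (ob (src D f)) (h f) (ob (tgt D f)))) x"
    unfolding D_ops(5)[of c "mkarr (ob (src D f)) (h f) (ob (tgt D f))"] using scl[OF f] f by simp
  qed (use f a[OF f] in simp_all)
 next
  fix M assume "M : obj D"
  then have M: "M : SM" by simp
  then have i: "idt D M : arr D" by simp
  show "farr (mkfun ob h) (idt D M) = idt D (fobj (mkfun ob h) M)"
   unfolding ab[OF i] mkfun_simps(1)[OF M]
  proof (rule arr_D_eqI)
   show "mkarr (ob (src D (idt D M))) (h (idt D M)) (ob (tgt D (idt D M))) : arr D" by (rule a[OF i])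
   fix x assume "x : carr (src D (idt D (ob M)))"
   then have "x : carr (ob M)" using ob[OF M] by simp
   then show "ap (mkarr (ob (src D (idt D M))) (h (idt D M)) (ob (tgt D (idt D M)))) x = ap (idt D (ob M)) x"
    unfolding D_ops(2)[of "ob M"] using id[OF M] M by simp
  qed (use M ob[OF M] in simp_all)
 next
  fix f g assume f: "f : arr D" "g : arr D" "src D g = tgt D f"
  then have c: "cmp D g f : arr D" by simp
  show "farr (mkfun ob h) (cmp D g f) = cmp D (farr (mkfun ob h) g) (farr (mkfun ob h) f)"
   unfolding ab[OF c] ab[OF f(1)] ab[OF f(2)]
  proof (rule arr_D_eqI)
   show "mkarr (ob (src D (cmp D g f))) (h (cmp D g f)) (ob (tgt D (cmp D g f))) : arr D" by (rule a[OF c])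
   show "cmp D (mkarr (ob (src D g)) (h g) (ob (tgt D g))) (mkarr (ob (src D f)) (h f) (ob (tgt D f))) : arr D"
    using a[OF f(1)] a[OF f(2)] f(3) by simp
   fix x assume "x : carr (src D (cmp D (mkarr (ob (src D g)) (h g) (ob (tgt D g))) (mkarr (ob (src D f)) (h f) (ob (tgt D f)))))"
   then have "x : carr (ob (src D f))" using a[OF f(1)] a[OF f(2)] f(3) by simp
   then show "ap (mkarr (ob (src D (cmp D g f))) (h (cmp D g f)) (ob (tgt D (cmp D g f)))) x =
     ap (cmp D (mkarr (ob (src D g)) (h g) (ob (tgt D g))) (mkarr (ob (src D f)) (h f) (ob (tgt D f)))) x"
    unfolding D_ops(1)[of "mkarr (ob (src D g)) (h g) (ob (tgt D g))"] using cmp[OF f] f hc[OF f(1)] by simp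
  qed (use f a[OF f(1)] a[OF f(2)] in simp_all)
 next
  fix f g assume f: "f : arr D" "g : arr D" "src D g = src D f" "tgt D g = tgt D f"
  then have c: "add D f g : arr D" by simp
  show "farr (mkfun ob h) (add D f g) = add D (farr (mkfun ob h) f) (farr (mkfun ob h) g)"
   unfolding ab[OF c] ab[OF f(1)] ab[OF f(2)]
  proof (rule arr_D_eqI)
   show "mkarr (ob (src D (add D f g))) (h (add D f g)) (ob (tgt D (add D f g))) : arr D" by (rule a[OF c])
   show "add D (mkarr (ob (src D f)) (h f) (ob (tgt D f))) (mkarr (ob (src D g)) (h g) (ob (tgt D g))) : arr D"
    using a[OF f(1)] a[OF f(2)] f(3,4) by simp
   fix x assume "x : carr (src D (add D (mkarr (ob (src D f)) (h f) (ob (tgt D f))) (mkarr (ob (src D g)) (h g) (ob (tgt D g)))))"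
   then have "x : carr (ob (src D f))" using a[OF f(1)] a[OF f(2)] f(3,4) by simp
   then show "ap (mkarr (ob (src D (add D f g))) (h (add D f g)) (ob (tgt D (add D f g)))) x =
     ap (add D (mkarr (ob (src D f)) (h f) (ob (tgt D f))) (mkarr (ob (src D g)) (h g) (ob (tgt D g)))) x"
    unfolding D_ops(4)[of "mkarr (ob (src D f)) (h f) (ob (tgt D f))"] using add[OF f] f by simp
  qed (use f a[OF f(1)] a[OF f(2)] in simp_all)
 qed
qed

subsection \<open>Splitting idempotents\<close>

lemma restrict_module:
 assumes M: "left_module M" and p: "module_hom M M p" and idem: "!!x. x : carr M ==> p (p x) = p x"
 shows "left_module (M\<lparr>carr := {x \<in> carr M. p x = x}\<rparr>)"
proof -
 note P = module_homD[OF p] and z = module_hom_zer[OF p M M]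
 have "EX y. y : carr M & p y = y & pls M x y = zer M" if "x : carr M" "p x = x" for x
  using that P(3)[of x "-1"] act_add[OF M that(1), of 1 "-1"] M by (intro exI[of _ "act M (-1) x"]) simp
 then show ?thesis
  unfolding left_module_def abelian_grp_def using M P z
  by (auto simp: act_add act_pls pls_assoc intro: pls_commute)
qed

text \<open>The splitting is pointwise: Y(M) is the submodule of X(M) fixed by the idempotent. It is
  still carried by sequences and is an image of X(M), hence again small.\<close>

lemma idempotent_splits:
 assumes pj: "pj : arr E" "src E pj = X" "tgt E pj = X" "cmp E pj pj = pj"
 obtains Y i p where "i : hom E Y X" "p : hom E X Y" "cmp E p i = idt E Y" "cmp E i p = pj"
proof -
 have X: "lin X" using arr_E_lin(1)[OF pj(1)] pj(2) by simp
 let ?C = "%M. {x \<in> carr (fobj X M). nap pj M x = x}"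
 let ?O = "%M. (fobj X M)\<lparr>carr := ?C M\<rparr>"
 have n: "nap pj M x : ?C M" if "M : SM" "x : carr (fobj X M)" for M x
 proof -
  have "nap (cmp E pj pj) M x = nap pj M (nap pj M x)" by (rule nap_ops(1)) (use that pj in simp_all)
  then show ?thesis using nap(1)[OF pj(1) that(1)] that(2) pj by simp
 qed
 have hom: "module_hom (fobj X M) (fobj X M) (nap pj M)" if "M : SM" for M
  using nap_hom[OF pj(1) that] pj(2,3) by simp
 have om: "left_module (?O M)" if "M : SM" for M
  by (rule restrict_module[OF lin_mod[OF X that] hom[OF that]]) (use n[OF that] in blast)
 have h1: "module_hom (fobj X M) (?O M) (nap pj M)" if "M : SM" for M
  using module_homD[OF hom[OF that]] n[OF that] by (intro module_homI) simp_all
 have fg: "finitely_generated (?O M)" if M: "M : SM" for M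
 proof (rule finitely_generated_image[OF _ h1[OF M]])
  have "x : nap pj M ` carr (fobj X M)" if "x : ?C M" for x using that by (metis (mono_tags, lifting) image_eqI mem_Collect_eq)
  then show "nap pj M ` carr (fobj X M) = carr (?O M)" using n[OF M] by auto
 qed (use lin_obj[OF X M] om[OF M] in simp_all)
 have ob: "?O M : SM" if "M : SM" for M
  using om[OF that] fg[OF that] unfolding small_modules_def by blast
 have nt: "nap pj (tgt D f) (fap X f x) = fap X f (nap pj (src D f) x)" if "f : arr D" "x : carr (fobj X (src D f))" for f x
  using nap_natural[OF pj(1) that(1)] that(2) pj(2,3) by simp
 define Y where "Y = mkfun ?O (fap X)"
 have Y: "lin Y" unfolding Y_def
 proof (rule lin_mkfun)
  fix f assume f: "f : arr D"
  show "module_hom (?O (src D f)) (?O (tgt D f)) (fap X f)"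
   by (rule module_homI) (use fap[OF X f] nt[OF f] in simp_all)
 qed (use ob fap_idt[OF X] fap_cmp[OF X] fap_add[OF X] fap_scl[OF X] in simp_all)
 have Yo: "fobj Y M = ?O M" if "M : SM" for M using that by (simp add: Y_def mkfun_simps)
 have Yf: "fap Y f x = fap X f x" if "f : arr D" "x : carr (fobj Y (src D f))" for f x
  using that Yo[OF arr_DD(1)[OF that(1)]] by (simp add: Y_def mkfun_simps)
 have ih: "ALL M : SM. module_hom (fobj Y M) (fobj X M) (%x. x)"
  using Yo by (auto intro: module_homI)
 have iY: "ALL f : arr D. ALL x : carr (fobj Y (src D f)). fap Y f x = fap X f x" using Yf by blast
 note i = mknt_ball[OF Y X, of "%M x. x", OF ih iY]
 have pn: "nap pj (tgt D f) (fap X f x) = fap Y f (nap pj (src D f) x)" if "f : arr D" "x : carr (fobj X (src D f))" for f x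
  using nt[OF that] Yf[OF that(1), of "nap pj (src D f) x"] n[OF arr_DD(1)[OF that(1)] that(2)] Yo[OF arr_DD(1)[OF that(1)]] by simp
 have ph: "ALL M : SM. module_hom (fobj X M) (fobj Y M) (nap pj M)"
  using Yo h1 by simp
 have pY: "ALL f : arr D. ALL x : carr (fobj X (src D f)). nap pj (tgt D f) (fap X f x) = fap Y f (nap pj (src D f) x)"
  using pn by blast
 note p = mknt_ball[OF X Y, of "nap pj", OF ph pY]
 let ?i = "mknt Y (%M x. x) X" and ?p = "mknt X (nap pj) Y"
 have ih': "nap ?i M x = x" if "M : SM" "x : carr (fobj Y M)" for M x using i(4)[OF that] .
 have ph': "nap ?p M x = nap pj M x" if "M : SM" "x : carr (fobj X M)" for M x using p(4)[OF that] .
 have Yc: "x : carr (fobj X M) & nap pj M x = x" if "M : SM" "x : carr (fobj Y M)" for M x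
  using that by (simp add: Yo)
 have t: "?i : arr E" "src E ?i = Y" "tgt E ?i = X" "?p : arr E" "src E ?p = X" "tgt E ?p = Y"
  by (fact i p)+
 have "cmp E ?p ?i = idt E Y"
 proof (rule E_eqI)
  fix M x assume M: "M : SM" and x: "x : carr (fobj (src E (idt E Y)) M)"
  then have x: "x : carr (fobj Y M)" using Y by simp
  show "nap (cmp E ?p ?i) M x = nap (idt E Y) M x"
   using nap_ops(1)[OF M t(1,4)] nap_ops(4)[OF M Y x] ih'[OF M x] ph'[OF M] Yc[OF M x] t x by simp
 qed (use t Y in simp_all)
 moreover have "cmp E ?i ?p = pj"
 proof (rule E_eqI)
  fix M x assume M: "M : SM" and x: "x : carr (fobj (src E pj) M)"
  then have x: "x : carr (fobj X M)" using pj by simp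
  show "nap (cmp E ?i ?p) M x = nap pj M x"
   using nap_ops(1)[OF M t(4,1)] ih'[OF M, of "nap pj M x"] ph'[OF M x] n[OF M x] Yo[OF M] t x by simp
 qed (use t pj in simp_all)
 ultimately show ?thesis using that t unfolding hom_def by blast
qed

subsection \<open>Direct sums of functors\<close>

text \<open>Interleaving two sequences into one, so that a direct sum of small modules is again
  carried by sequences.\<close>

definition pr :: "(nat \<Rightarrow> 'c) \<Rightarrow> (nat \<Rightarrow> 'c) \<Rightarrow> nat \<Rightarrow> 'c" where
 "pr a b = (%i. if even i then a (i div 2) else b (i div 2))"

definition pr1 :: "(nat \<Rightarrow> 'c) \<Rightarrow> nat \<Rightarrow> 'c" where "pr1 h = (%i. h (2 * i))"
definition pr2 :: "(nat \<Rightarrow> 'c) \<Rightarrow> nat \<Rightarrow> 'c" where "pr2 h = (%i. h (2 * i + 1))"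

lemma pr_simps [simp]: "pr1 (pr a b) = a" "pr2 (pr a b) = b" "pr (pr1 h) (pr2 h) = h"
 by (simp_all add: pr_def pr1_def pr2_def fun_eq_iff)

definition dsum :: "('k, 'b) smod \<Rightarrow> ('k, 'b) smod \<Rightarrow> ('k, 'b) smod" where
 "dsum M N = \<lparr>carr = {h. pr1 h : carr M & pr2 h : carr N}, zer = pr (zer M) (zer N),
   pls = (%h k. pr (pls M (pr1 h) (pr1 k)) (pls N (pr2 h) (pr2 k))),
   act = (%b h. pr (act M b (pr1 h)) (act N b (pr2 h)))\<rparr>"

lemma dsum_simps [simp]:
 "h : carr (dsum M N) \<longleftrightarrow> pr1 h : carr M & pr2 h : carr N" "zer (dsum M N) = pr (zer M) (zer N)"
 "pls (dsum M N) h k = pr (pls M (pr1 h) (pr1 k)) (pls N (pr2 h) (pr2 k))"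
 "act (dsum M N) b h = pr (act M b (pr1 h)) (act N b (pr2 h))"
 by (simp_all add: dsum_def)

lemma dsum_module:
 assumes M: "left_module M" and N: "left_module N" shows "left_module (dsum M N)"
proof -
 have neg: "EX y : carr (dsum M N). pls (dsum M N) x y = zer (dsum M N)" if "x : carr (dsum M N)" for x
 proof -
  have x: "pr1 x : carr M" "pr2 x : carr N" using that by simp_all
  show ?thesis
   using act_add[OF M x(1), of 1 "-1"] act_add[OF N x(2), of 1 "-1"] M N x
   by (intro bexI[of _ "pr (act M (-1) (pr1 x)) (act N (-1) (pr2 x))"]) simp_all
 qed
 have comm: "pls (dsum M N) x y = pls (dsum M N) y x" if "x : carr (dsum M N)" "y : carr (dsum M N)" for x y
  using that M N pls_commute[of M "pr1 x" "pr1 y"] pls_commute[of N "pr2 x" "pr2 y"] by simp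
 have cl: "pls (dsum M N) x y : carr (dsum M N)"
  if "x : carr (dsum M N)" "y : carr (dsum M N)" for x y using that M N by simp_all
 have zl: "pls (dsum M N) (zer (dsum M N)) x = x" if "x : carr (dsum M N)" for x using that M N by simp
 have assoc: "pls (dsum M N) (pls (dsum M N) x y) z = pls (dsum M N) x (pls (dsum M N) y z)"
  if "x : carr (dsum M N)" "y : carr (dsum M N)" "z : carr (dsum M N)" for x y z
  using that M N by (simp add: pls_assoc)
 have zc: "zer (dsum M N) : carr (dsum M N)" using M N by simp
 have g: "abelian_grp (dsum M N)" by (rule abelian_grpI; (rule neg comm cl assoc zc zl; assumption))
 show ?thesis unfolding left_module_def
  using g M N by (simp add: act_add act_pls)
qed

lemma dsum_small:
 assumes M: "M : SM" and N: "N : SM" shows "dsum M N : SM"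
proof -
 have m: "left_module (dsum M N)" using dsum_module M N by simp
 obtain S where S: "finite S" "S <= carr M" "!!K. submodule M K ==> S <= K ==> K = carr M"
  using small_modulesD(2)[OF M] unfolding finitely_generated_def by auto
 obtain T where T: "finite T" "T <= carr N" "!!K. submodule N K ==> T <= K ==> K = carr N"
  using small_modulesD(2)[OF N] unfolding finitely_generated_def by auto
 note Mm = small_modulesD(1)[OF M] and Nm = small_modulesD(1)[OF N]
 let ?U = "(%s. pr s (zer N)) ` S \<union> (%t. pr (zer M) t) ` T"
 have "K = carr (dsum M N)" if K: "submodule (dsum M N) K" "?U <= K" for K
 proof -
  have Kd: "!!h k. h : K ==> k : K ==> pls (dsum M N) h k : K" "!!b h. h : K ==> act (dsum M N) b h : K"
   "zer (dsum M N) : K" "K <= carr (dsum M N)" using K(1) unfolding submodule_def by auto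
  have "submodule M {a \<in> carr M. pr a (zer N) : K}"
   unfolding submodule_def using Mm Nm Kd(3) Kd(1)[of "pr a (zer N)" "pr b (zer N)" for a b] Kd(2)[of "pr a (zer N)" for a] by auto
  then have 1: "{a \<in> carr M. pr a (zer N) : K} = carr M" by (rule S(3)) (use S K in auto)
  have "submodule N {a \<in> carr N. pr (zer M) a : K}"
   unfolding submodule_def using Mm Nm Kd(3) Kd(1)[of "pr (zer M) a" "pr (zer M) b" for a b] Kd(2)[of "pr (zer M) a" for a] by auto
  then have 2: "{a \<in> carr N. pr (zer M) a : K} = carr N" by (rule T(3)) (use T K in auto)
  have "h : K" if h: "h : carr (dsum M N)" for h
  proof -
   have "pls (dsum M N) (pr (pr1 h) (zer N)) (pr (zer M) (pr2 h)) : K" using h 1 2 by (intro Kd(1)) auto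
   then show ?thesis using h Mm Nm by simp
  qed
  then show ?thesis using Kd(4) by blast
 qed
 moreover have "finite ?U" "?U <= carr (dsum M N)" using S T Mm Nm by auto
 ultimately have "finitely_generated (dsum M N)" unfolding finitely_generated_def by blast
 then show ?thesis unfolding small_modules_def using m by blast
qed

lemma biproduct_ex:
 assumes X: "lin X" and Y: "lin Y" shows "EX S. is_biproduct E [X, Y] S"
proof -
 define S where "S = mkfun (%M. dsum (fobj X M) (fobj Y M)) (%f h. pr (fap X f (pr1 h)) (fap Y f (pr2 h)))"
 have S: "lin S" unfolding S_def
 proof (rule lin_mkfun)
  fix f assume f: "f : arr D"
  show "module_hom (dsum (fobj X (src D f)) (fobj Y (src D f))) (dsum (fobj X (tgt D f)) (fobj Y (tgt D f)))
    (%h. pr (fap X f (pr1 h)) (fap Y f (pr2 h)))"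
   by (rule module_homI) (use fap[OF X f] fap[OF Y f] in simp_all)
 qed (use dsum_small[OF lin_obj[OF X] lin_obj[OF Y]] fap_idt[OF X] fap_cmp[OF X] fap_add[OF X] fap_scl[OF X]
   fap_idt[OF Y] fap_cmp[OF Y] fap_add[OF Y] fap_scl[OF Y] in simp_all)
 have So: "fobj S M = dsum (fobj X M) (fobj Y M)" if "M : SM" for M using that by (simp add: S_def mkfun_simps)
 have Sf: "fap S f h = pr (fap X f (pr1 h)) (fap Y f (pr2 h))"
  if "f : arr D" "pr1 h : carr (fobj X (src D f))" "pr2 h : carr (fobj Y (src D f))" for f h
  using that by (simp add: S_def mkfun_simps)
 let ?i = "mknt X (%M x. pr x (zer (fobj Y M))) S" and ?j = "mknt Y (%M x. pr (zer (fobj X M)) x) S"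
 let ?p = "mknt S (%M. pr1) X" and ?q = "mknt S (%M. pr2) Y"
 note Xm = lin_mod[OF X] and Ym = lin_mod[OF Y]
 note small = arr_DD(1,2)
 have i: "module_hom (fobj X M) (fobj S M) (%x. pr x (zer (fobj Y M)))" if "M : SM" for M
  unfolding So[OF that] by (rule module_homI) (use Xm[OF that] Ym[OF that] in simp_all)
 have j: "module_hom (fobj Y M) (fobj S M) (%x. pr (zer (fobj X M)) x)" if "M : SM" for M
  unfolding So[OF that] by (rule module_homI) (use Xm[OF that] Ym[OF that] in simp_all)
 have p: "module_hom (fobj S M) (fobj X M) pr1" "module_hom (fobj S M) (fobj Y M) pr2" if "M : SM" for M
  unfolding So[OF that] by (rule module_homI; use Xm[OF that] Ym[OF that] in simp)+
 have ni: "pr (fap X f x) (zer (fobj Y (tgt D f))) = fap S f (pr x (zer (fobj Y (src D f))))"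
  if "f : arr D" "x : carr (fobj X (src D f))" for f x
  using Sf[OF that(1), of "pr x (zer (fobj Y (src D f)))"] that Ym[OF small(1)[OF that(1)]] fap(4)[OF Y that(1)] by simp
 have nj: "pr (zer (fobj X (tgt D f))) (fap Y f x) = fap S f (pr (zer (fobj X (src D f))) x)"
  if "f : arr D" "x : carr (fobj Y (src D f))" for f x
  using Sf[OF that(1), of "pr (zer (fobj X (src D f))) x"] that Xm[OF small(1)[OF that(1)]] fap(4)[OF X that(1)] by simp
 have np: "pr1 (fap S f x) = fap X f (pr1 x)" "pr2 (fap S f x) = fap Y f (pr2 x)"
  if "f : arr D" "x : carr (fobj S (src D f))" for f x
  using Sf[OF that(1), of x] that(2) So[OF small(1)[OF that(1)]] by simp_all
 have b: "ALL M : SM. module_hom (fobj X M) (fobj S M) (%x. pr x (zer (fobj Y M)))"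
  "ALL M : SM. module_hom (fobj Y M) (fobj S M) (%x. pr (zer (fobj X M)) x)"
  "ALL M : SM. module_hom (fobj S M) (fobj X M) pr1"
  "ALL M : SM. module_hom (fobj S M) (fobj Y M) pr2"
  using i j p by blast+
 have c: "ALL f : arr D. ALL x : carr (fobj X (src D f)). pr (fap X f x) (zer (fobj Y (tgt D f))) = fap S f (pr x (zer (fobj Y (src D f))))"
  "ALL f : arr D. ALL x : carr (fobj Y (src D f)). pr (zer (fobj X (tgt D f))) (fap Y f x) = fap S f (pr (zer (fobj X (src D f))) x)"
  "ALL f : arr D. ALL x : carr (fobj S (src D f)). pr1 (fap S f x) = fap X f (pr1 x)"
  "ALL f : arr D. ALL x : carr (fobj S (src D f)). pr2 (fap S f x) = fap Y f (pr2 x)"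
  using ni nj np by blast+
 note I = mknt_ball[OF X S b(1) c(1)] and J = mknt_ball[OF Y S b(2) c(2)]
  and P = mknt_ball[OF S X b(3) c(3)] and Q = mknt_ball[OF S Y b(4) c(4)]
 have t: "?i : arr E" "src E ?i = X" "tgt E ?i = S" "?j : arr E" "src E ?j = Y" "tgt E ?j = S"
  "?p : arr E" "src E ?p = S" "tgt E ?p = X" "?q : arr E" "src E ?q = S" "tgt E ?q = Y"
  by (rule I J P Q)+
 have n: "nap ?i M x = pr x (zer (fobj Y M))" if "M : SM" "x : carr (fobj X M)" for M x by (rule I(4)[OF that])
 have n2: "nap ?j M x = pr (zer (fobj X M)) x" if "M : SM" "x : carr (fobj Y M)" for M x by (rule J(4)[OF that])
 have n3: "nap ?p M x = pr1 x" "nap ?q M x = pr2 x" if "M : SM" "x : carr (fobj S M)" for M x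
  by (rule P(4)[OF that], rule Q(4)[OF that])
 have 1: "cmp E ?p ?i = idt E X"
 proof (rule E_eqI)
  fix M x assume M: "M : SM" and "x : carr (fobj (src E (idt E X)) M)"
  then have x: "x : carr (fobj X M)" using X by simp
  show "nap (cmp E ?p ?i) M x = nap (idt E X) M x"
   using nap_ops(1)[OF M t(1,7)] nap_ops(4)[OF M X x] n[OF M x] n3(1)[OF M] So[OF M] t x Ym[OF M] by simp
 qed (use t X in simp_all)
 have 2: "cmp E ?q ?j = idt E Y"
 proof (rule E_eqI)
  fix M x assume M: "M : SM" and "x : carr (fobj (src E (idt E Y)) M)"
  then have x: "x : carr (fobj Y M)" using Y by simp
  show "nap (cmp E ?q ?j) M x = nap (idt E Y) M x"
   using nap_ops(1)[OF M t(4,10)] nap_ops(4)[OF M Y x] n2[OF M x] n3(2)[OF M] So[OF M] t x Xm[OF M] by simp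
 qed (use t Y in simp_all)
 have 3: "cmp E ?p ?j = zro E Y X"
 proof (rule E_eqI)
  fix M x assume M: "M : SM" and "x : carr (fobj (src E (zro E Y X)) M)"
  then have x: "x : carr (fobj Y M)" using X Y by simp
  show "nap (cmp E ?p ?j) M x = nap (zro E Y X) M x"
   using nap_ops(1)[OF M t(4,7)] nap_ops(5)[OF M Y X x] n2[OF M x] n3(1)[OF M] So[OF M] t x Xm[OF M] by simp
 qed (use t X Y in simp_all)
 have 4: "cmp E ?q ?i = zro E X Y"
 proof (rule E_eqI)
  fix M x assume M: "M : SM" and "x : carr (fobj (src E (zro E X Y)) M)"
  then have x: "x : carr (fobj X M)" using X Y by simp
  show "nap (cmp E ?q ?i) M x = nap (zro E X Y) M x"
   using nap_ops(1)[OF M t(1,10)] nap_ops(5)[OF M X Y x] n[OF M x] n3(2)[OF M] So[OF M] t x Ym[OF M] by simp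
 qed (use t X Y in simp_all)
 have 5: "add E (cmp E ?i ?p) (cmp E ?j ?q) = idt E S"
 proof (rule E_eqI)
  fix M x assume M: "M : SM" and "x : carr (fobj (src E (idt E S)) M)"
  then have x: "x : carr (fobj S M)" using S by simp
  then have xx: "pr1 x : carr (fobj X M)" "pr2 x : carr (fobj Y M)" using So[OF M] by simp_all
  have a: "nap (cmp E ?i ?p) M x = pr (pr1 x) (zer (fobj Y M))"
   using nap_ops(1)[OF M t(7,1)] n[OF M xx(1)] n3(1)[OF M x] t x by simp
  have b: "nap (cmp E ?j ?q) M x = pr (zer (fobj X M)) (pr2 x)"
   using nap_ops(1)[OF M t(10,4)] n2[OF M xx(2)] n3(2)[OF M x] t x by simp
  have "nap (add E (cmp E ?i ?p) (cmp E ?j ?q)) M x = pls (fobj S M) (nap (cmp E ?i ?p) M x) (nap (cmp E ?j ?q) M x)"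
   using nap_ops(2)[OF M, of "cmp E ?i ?p" "cmp E ?j ?q" x] t x by simp
  then show "nap (add E (cmp E ?i ?p) (cmp E ?j ?q)) M x = nap (idt E S) M x"
   using nap_ops(4)[OF M S x] a b So[OF M] Xm[OF M] Ym[OF M] xx by simp
 qed (use t S in simp_all)
 have "is_biproduct E [X, Y] S"
  unfolding E.biproduct2_iff
  apply (intro conjI)
  using X Y S apply simp_all[3]
  apply (rule exI[of _ ?i], rule exI[of _ ?j], rule exI[of _ ?p], rule exI[of _ ?q])
  using t 1 2 3 4 5 by (simp add: hom_def)
 then show ?thesis by blast
qed

end

section \<open>Tensoring with projective bimodules\<close>

lemma additive_comp: "additive X Y f ==> additive Y Z g ==> additive X Z (%x. g (f x))"
 unfolding additive_def by simp

lemma pls_interchange: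
 assumes "abelian_grp Y" "a : carr Y" "b : carr Y" "c : carr Y" "d : carr Y"
 shows "pls Y (pls Y a b) (pls Y c d) = pls Y (pls Y a c) (pls Y b d)"
 using assms pls_left_commute[of Y b c d] by (simp add: pls_assoc)

lemma additive_pls:
 assumes "additive X Y f" "additive X Y g" "abelian_grp Y" shows "additive X Y (%x. pls Y (f x) (g x))"
 using assms unfolding additive_def by (simp add: pls_interchange)

lemma additive_id: "additive X X (%x. x)"
 unfolding additive_def by simp

lemma abelian_grp_cong: "carr X = carr X' ==> pls X = pls X' ==> zer X = zer X' ==> abelian_grp X = abelian_grp X'"
 unfolding abelian_grp_def by simp

lemma module_hom_additive: "module_hom M N f ==> additive M N f"
 unfolding module_hom_def additive_def by blast

lemma additive_act: "left_module M ==> additive M M (act M b)"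
 unfolding additive_def by (simp add: act_pls)

lemma additiveD: "additive X Y f ==> x : carr X ==> f x : carr Y"
 "additive X Y f ==> x : carr X ==> x' : carr X ==> f (pls X x x') = pls Y (f x) (f x')"
 unfolding additive_def by blast+

lemma (in tensor_data) ten_zer_left: "y : carr Y ==> zer X \<otimes>\<otimes> y = zer T"
proof -
 assume y: "y : carr Y"
 have "additive X T (%x. x \<otimes>\<otimes> y)" unfolding additive_def using y ten_add_left by simp
 then show ?thesis using additive_zer[OF _ X T_grp] by blast
qed

lemma ideal_simps [simp]: "pls (LI e) = (+)" "zer (LI e) = 0" "pls (RI e) = (+)" "zer (RI e) = 0"
 by (simp_all add: left_ideal_of_def right_ideal_of_def)

lemma left_ideal_grp: "abelian_grp (LI e)"
proof (rule abelian_grpI)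
 fix x y assume "x : carr (LI e)" "y : carr (LI e)"
 then obtain a b where "x = a * e" "y = b * e" by (auto simp: left_ideal_of_def)
 then have "x + y = (a + b) * e" by (simp add: distrib_right)
 then show "pls (LI e) x y : carr (LI e)" by (auto simp: left_ideal_of_def)
next
 fix x assume "x : carr (LI e)"
 then obtain a where "x = a * e" by (auto simp: left_ideal_of_def)
 then have "x + (- a) * e = 0" by simp
 then show "EX y : carr (LI e). pls (LI e) x y = zer (LI e)"
  by (intro bexI[of _ "(- a) * e"]) (auto simp: left_ideal_of_def simp del: mult_minus_left)
qed (auto simp: left_ideal_of_def add_ac intro: exI[of _ 0])

lemma right_ideal_grp: "abelian_grp (RI e)"
proof (rule abelian_grpI)
 fix x y assume "x : carr (RI e)" "y : carr (RI e)"
 then obtain a b where "x = e * a" "y = e * b" by (auto simp: right_ideal_of_def)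
 then have "x + y = e * (a + b)" by (simp add: distrib_left)
 then show "pls (RI e) x y : carr (RI e)" by (auto simp: right_ideal_of_def)
next
 fix x assume "x : carr (RI e)"
 then obtain a where "x = e * a" by (auto simp: right_ideal_of_def)
 then have "x + e * (- a) = 0" by simp
 then show "EX y : carr (RI e). pls (RI e) x y = zer (RI e)"
  by (intro bexI[of _ "e * (- a)"]) (auto simp: right_ideal_of_def simp del: mult_minus_right)
qed (auto simp: right_ideal_of_def add_ac intro: exI[of _ 0])

context fdalg begin

abbreviation ra1 :: "'b \<Rightarrow> 'k \<Rightarrow> 'b" where "ra1 \<equiv> %x c. sc c x"
abbreviation XB where "XB e f \<equiv> proj_bimod sc e f"
abbreviation TF :: "'b \<Rightarrow> 'b \<Rightarrow> (('k, 'b) smod, ('k, 'b) smor) endofun" where "TF e f \<equiv> tensor_functor sc (proj_bimod sc e f)"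
abbreviation t1 where "t1 e f \<equiv> tz (LI e) ra1 (RI f) sc"
abbreviation T1 where "T1 e f \<equiv> tgrp (LI e) ra1 (RI f) sc"
abbreviation t2 where "t2 e f M \<equiv> tz (XB e f) (ract (XB e f)) M (act M)"
abbreviation T2 where "T2 e f M \<equiv> tgrp (XB e f) (ract (XB e f)) M (act M)"

text \<open>The element xe \<otimes> f \<otimes> m of Be \<otimes> fB \<otimes>_B M, moved into the
  chosen small copy. Since fb \<otimes> m = f \<otimes> bm, all pure tensors have this form, and
  later arguments describe maps by their values on these elements.\<close>

definition tau :: "'b \<Rightarrow> 'b \<Rightarrow> ('k, 'b) smod \<Rightarrow> 'b \<Rightarrow> (nat \<Rightarrow> 'k) \<Rightarrow> nat \<Rightarrow> 'k" where
 "tau e f M x m = snd (small_copy (bimod_tensor (XB e f) M) :: ('k, 'b) smod \<times> _) (t2 e f M (t1 e f (x * e) f) m)"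

lemma mem_ideals [simp]: "a * e : carr (LI e)" "f * b : carr (RI f)"
 by (auto simp: left_ideal_of_def right_ideal_of_def)

lemma td1: "tensor_data (LI e) ra1 (RI f) sc"
proof
 show "sc r x : carr (LI e)" if "x : carr (LI e)" for x r
  using that by (auto simp: left_ideal_of_def simp flip: sc_mult(1))
 show "sc r x : carr (RI f)" if "x : carr (RI f)" for x r
  using that by (auto simp: right_ideal_of_def simp flip: sc_mult(2))
qed (rule left_ideal_grp right_ideal_grp)+

lemma XB_simps: "carr (XB e f) = carr (T1 e f)" "zer (XB e f) = zer (T1 e f)" "pls (XB e f) = pls (T1 e f)"
 "act (XB e f) b = tensor_map (LI e) ra1 (RI f) sc (%x. b * x) (%y. y)"
 "ract (XB e f) P b = tensor_map (LI e) ra1 (RI f) sc (%x. x) (%y. y * b) P"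
 by (simp_all add: proj_bimod_def tgrp_def Let_def)

lemma XB_grp: "abelian_grp (XB e f)"
 using tensor_data.T_grp[OF td1] abelian_grp_cong[OF XB_simps(1,3,2)] by blast

lemma XB_additive: "additive (XB e f) N h = additive (T1 e f) N h" "additive M (XB e f) g = additive M (T1 e f) g"
 unfolding additive_def XB_simps by blast+

lemma XB_act:
 "additive (XB e f) (XB e f) (act (XB e f) b)"
 "x : carr (LI e) ==> y : carr (RI f) ==> act (XB e f) b (t1 e f x y) = t1 e f (b * x) y"
proof -
 have u: "additive (LI e) (LI e) (%x. b * x)"
  by (auto simp: additive_def left_ideal_of_def distrib_left simp flip: mult.assoc)
 note tm = tensor_map[OF td1 td1 u additive_id[of "RI f"]]
 show "additive (XB e f) (XB e f) (act (XB e f) b)" unfolding XB_additive XB_simps(4) by (rule tm(1)) simp_all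
 show "act (XB e f) b (t1 e f x y) = t1 e f (b * x) y"
  if "x : carr (LI e)" "y : carr (RI f)"
  unfolding XB_simps(4) by (rule tm(2)) (use that in simp_all)
qed

lemma XB_ract:
 "additive (XB e f) (XB e f) (%P. ract (XB e f) P b)"
 "x : carr (LI e) ==> y : carr (RI f) ==> ract (XB e f) (t1 e f x y) b = t1 e f x (y * b)"
proof -
 have v: "additive (RI f) (RI f) (%y. y * b)"
  by (auto simp: additive_def right_ideal_of_def distrib_right mult.assoc)
 note tm = tensor_map[OF td1 td1 additive_id[of "LI e"] v]
 show "additive (XB e f) (XB e f) (%P. ract (XB e f) P b)" unfolding XB_additive XB_simps(5) by (rule tm(1)) simp_all
 show "ract (XB e f) (t1 e f x y) b = t1 e f x (y * b)"
  if "x : carr (LI e)" "y : carr (RI f)"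
  unfolding XB_simps(5) by (rule tm(2)) (use that in simp_all)
qed

lemma XB_ext:
 assumes "additive (XB e f) G g" "additive (XB e f) G h" "abelian_grp G"
  "!!x y. x : carr (LI e) ==> y : carr (RI f) ==> g (t1 e f x y) = h (t1 e f x y)" "t : carr (XB e f)"
 shows "g t = h t"
 by (rule tensor_data.additive_ext[OF td1]) (use assms in "simp_all add: XB_additive XB_simps")

lemma t1_carr: "x : carr (LI e) ==> y : carr (RI f) ==> t1 e f x y : carr (XB e f)"
 unfolding XB_simps by (rule tensor_data.ten_carr[OF td1])

lemma left_ideal_act: "x : carr (LI e) ==> b * x : carr (LI e)"
 by (auto simp: left_ideal_of_def simp flip: mult.assoc)

lemma right_ideal_act: "y : carr (RI f) ==> y * b : carr (RI f)"
 by (auto simp: right_ideal_of_def mult.assoc)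

lemma XB_act_ract:
 assumes "t : carr (XB e f)" shows "act (XB e f) b (ract (XB e f) t r) = ract (XB e f) (act (XB e f) b t) r"
 by (rule XB_ext[OF additive_comp[OF XB_ract(1) XB_act(1)] additive_comp[OF XB_act(1) XB_ract(1)] XB_grp _ assms])
  (simp add: XB_act(2) XB_ract(2) left_ideal_act right_ideal_act)

lemma XB_act_1: "t : carr (XB e f) ==> act (XB e f) 1 t = t"
 by (rule XB_ext[OF XB_act(1) additive_id XB_grp]) (simp_all add: XB_act(2))

lemma XB_act_act: "t : carr (XB e f) ==> act (XB e f) (a * b) t = act (XB e f) a (act (XB e f) b t)"
 by (rule XB_ext[OF XB_act(1) additive_comp[OF XB_act(1) XB_act(1)] XB_grp])
  (simp_all add: XB_act(2) left_ideal_act mult.assoc)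

lemma XB_act_add: 
 assumes "t : carr (XB e f)" shows "act (XB e f) (a + b) t = pls (XB e f) (act (XB e f) a t) (act (XB e f) b t)"
proof (rule XB_ext[OF XB_act(1) additive_pls[OF XB_act(1) XB_act(1) XB_grp] XB_grp _ assms])
 fix x y assume x: "x : carr (LI e)" "y : carr (RI f)"
 have "t1 e f (a * x + b * x) y = pls (T1 e f) (t1 e f (a * x) y) (t1 e f (b * x) y)"
  by (rule tensor_data.ten_add_left[OF td1 left_ideal_act[OF x(1)] left_ideal_act[OF x(1)] x(2), unfolded ideal_simps])
 then show "act (XB e f) (a + b) (t1 e f x y) = pls (XB e f) (act (XB e f) a (t1 e f x y)) (act (XB e f) b (t1 e f x y))"
  using x by (simp add: XB_act(2) XB_simps(3) distrib_right)
qed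

lemma td2:
 assumes "left_module M" shows "tensor_data (XB e f) (ract (XB e f)) M (act M)"
proof
 show "ract (XB e f) x r : carr (XB e f)" if "x : carr (XB e f)" for x r
  by (rule additiveD(1)[OF XB_ract(1) that])
qed (use assms XB_grp in simp_all)

lemma bt_simps:
 "carr (bimod_tensor (XB e f) M) = carr (T2 e f M)" "zer (bimod_tensor (XB e f) M) = zer (T2 e f M)"
 "pls (bimod_tensor (XB e f) M) = pls (T2 e f M)"
 "act (bimod_tensor (XB e f) M) b = tensor_map (XB e f) (ract (XB e f)) M (act M) (act (XB e f) b) (%m. m)"
 by (simp_all add: bimod_tensor_def tgrp_def)

lemma bt_additive: "additive (bimod_tensor (XB e f) M) N h = additive (T2 e f M) N h"
 "additive N (bimod_tensor (XB e f) M) g = additive N (T2 e f M) g"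
 unfolding additive_def bt_simps by blast+

lemma bt_act:
 assumes M: "left_module M"
 shows "additive (T2 e f M) (T2 e f M) (act (bimod_tensor (XB e f) M) b)"
  and "[|t : carr (XB e f); m : carr M|] ==> act (bimod_tensor (XB e f) M) b (t2 e f M t m) = t2 e f M (act (XB e f) b t) m"
proof -
 note tm = tensor_map[OF td2[OF M] td2[OF M] XB_act(1) additive_id[of M]]
 show "additive (T2 e f M) (T2 e f M) (act (bimod_tensor (XB e f) M) b)"
  unfolding bt_simps(4) by (rule tm(1)) (simp_all add: XB_act_ract)
 show "act (bimod_tensor (XB e f) M) b (t2 e f M t m) = t2 e f M (act (XB e f) b t) m" if "t : carr (XB e f)" "m : carr M"
  unfolding bt_simps(4) by (rule tm(2)) (use that in "simp_all add: XB_act_ract")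
qed

lemma bt_grp: "left_module M ==> abelian_grp (T2 e f M)"
 by (rule tensor_data.T_grp[OF td2])

lemma bt_module:
 assumes M: "left_module M" shows "left_module (bimod_tensor (XB e f) M)"
proof -
 note G = bt_grp[OF M, of e f]
 note ext = tensor_data.additive_ext[OF td2[OF M]]
 have g: "abelian_grp (bimod_tensor (XB e f) M)" using G abelian_grp_cong[OF bt_simps(1,3,2)] by blast
 have 1: "act (bimod_tensor (XB e f) M) 1 t = t" if "t : carr (T2 e f M)" for t
  by (rule ext[OF bt_act(1)[OF M] additive_id G _ that]) (simp add: bt_act(2)[OF M] XB_act_1)
 have 2: "act (bimod_tensor (XB e f) M) (a * b) t = act (bimod_tensor (XB e f) M) a (act (bimod_tensor (XB e f) M) b t)"
  if "t : carr (T2 e f M)" for a b t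
  by (rule ext[OF bt_act(1)[OF M] additive_comp[OF bt_act(1)[OF M] bt_act(1)[OF M]] G _ that])
   (simp add: bt_act(2)[OF M] XB_act_act additiveD(1)[OF XB_act(1)])
 have 3: "act (bimod_tensor (XB e f) M) (a + b) t = pls (T2 e f M) (act (bimod_tensor (XB e f) M) a t) (act (bimod_tensor (XB e f) M) b t)"
  if "t : carr (T2 e f M)" for a b t
  by (rule ext[OF bt_act(1)[OF M] additive_pls[OF bt_act(1)[OF M] bt_act(1)[OF M] G] G _ that])
   (simp add: bt_act(2)[OF M] XB_act_add additiveD(1)[OF XB_act(1)] tensor_data.ten_add_left[OF td2[OF M]])
 show ?thesis unfolding left_module_def bt_simps(1,3)
  using g 1 2 3 additiveD[OF bt_act(1)[OF M]] by simp
qed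

context
 fixes e f :: 'b
 assumes idem: "e * e = e" "f * f = f"
begin

lemma f_mem: "f : carr (RI f)"
 using mem_ideals(2)[of f 1] by simp

lemma right_ideal_idem: "y : carr (RI f) ==> f * y = y"
 using idem by (auto simp: right_ideal_of_def simp flip: mult.assoc)

lemma left_ideal_idem: "x : carr (LI e) ==> x * e = x"
 using idem by (auto simp: left_ideal_of_def mult.assoc)

lemma t1_f_carr: "t1 e f (x * e) f : carr (XB e f)"
 by (rule t1_carr) (simp_all add: f_mem)

abbreviation px where "px M x m \<equiv> t2 e f M (t1 e f (x * e) f) m"

context
 fixes M :: "('k, 'b) smod"
 assumes M: "left_module M"
begin

lemma px_carr: "m : carr M ==> px M x m : carr (T2 e f M)"
 by (rule tensor_data.ten_carr[OF td2[OF M] t1_f_carr])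

lemma px_add_left:
 assumes "m : carr M" shows "px M (x + y) m = pls (T2 e f M) (px M x m) (px M y m)"
proof -
 have "t1 e f (x * e + y * e) f = pls (T1 e f) (t1 e f (x * e) f) (t1 e f (y * e) f)"
  by (rule tensor_data.ten_add_left[OF td1 mem_ideals(1) mem_ideals(1) f_mem, unfolded ideal_simps])
 then have "t1 e f ((x + y) * e) f = pls (XB e f) (t1 e f (x * e) f) (t1 e f (y * e) f)"
  by (simp only: distrib_right XB_simps(3))
 then show ?thesis using tensor_data.ten_add_left[OF td2[OF M] t1_f_carr t1_f_carr assms, of x y] by metis
qed

lemma px_add_right: "m : carr M ==> n : carr M ==> px M x (pls M m n) = pls (T2 e f M) (px M x m) (px M x n)"
 by (rule tensor_data.ten_add_right[OF td2[OF M] t1_f_carr])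

text \<open>Since y = f y, the factor y can be pushed across the tensor product over B; hence
  tensors with f in the middle suffice.\<close>

lemma px_ract:
 assumes "m : carr M" "y : carr (RI f)" shows "t2 e f M (t1 e f (x * e) y) m = px M x (act M y m)"
proof -
 have "ract (XB e f) (t1 e f (x * e) f) y = t1 e f (x * e) (f * y)" by (rule XB_ract(2)[OF mem_ideals(1) f_mem])
 then have "ract (XB e f) (t1 e f (x * e) f) y = t1 e f (x * e) y" using right_ideal_idem[OF assms(2)] by metis
 then show ?thesis using tensor_data.ten_balanced[OF td2[OF M] t1_f_carr assms(1), of x y] by metis
qed

lemma px_f: "m : carr M ==> px M x (act M f m) = px M x m"
 by (rule px_ract[OF _ f_mem, symmetric])

lemma px_sc: 
 assumes "m : carr M" shows "px M (sc c x) m = px M x (act M (sc c 1) m)"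
proof -
 have "t1 e f (sc c (x * e)) f = t1 e f (x * e) (sc c f)"
  by (rule tensor_data.ten_balanced[OF td1 mem_ideals(1) f_mem])
 then have "t1 e f (sc c x * e) f = t1 e f (x * e) (sc c f)" by (simp only: sc_mult)
 also have "sc c f = f * sc c 1" by simp
 finally have "px M (sc c x) m = t2 e f M (t1 e f (x * e) (f * sc c 1)) m" by metis
 also have "\<dots> = px M x (act M (f * sc c 1) m)" by (rule px_ract[OF assms mem_ideals(2)])
 also have "f * sc c 1 = sc c 1 * f" by simp
 also have "act M (sc c 1 * f) m = act M f (act M (sc c 1) m)" using assms M by simp
 also have "px M x (act M f (act M (sc c 1) m)) = px M x (act M (sc c 1) m)"
  by (rule px_f) (use assms M in simp)
 finally show ?thesis .
qed

lemma px_act: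
 assumes m: "m : carr M" shows "act (bimod_tensor (XB e f) M) b (px M x m) = px M (b * x) m"
proof -
 have "act (XB e f) b (t1 e f (x * e) f) = t1 e f (b * (x * e)) f" by (rule XB_act(2)[OF mem_ideals(1) f_mem])
 moreover have "act (bimod_tensor (XB e f) M) b (px M x m) = t2 e f M (act (XB e f) b (t1 e f (x * e) f)) m"
  by (rule bt_act(2)[OF M t1_f_carr m])
 ultimately show ?thesis by (simp only: mult.assoc)
qed

lemma px_induct:
 assumes "t : carr (T2 e f M)" and px: "!!x m. m : carr M ==> P (px M x m)"
  and pls: "!!s t. s : carr (T2 e f M) ==> t : carr (T2 e f M) ==> P s ==> P t ==> P (pls (T2 e f M) s t)"
 shows "P t"
 using assms(1)
proof (induction rule: tensor_data.ten_induct[OF td2[OF M], consumes 1, case_names zer ten pls])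
 case zer
 have "px M 0 (zer M) = zer (T2 e f M)"
 proof -
  have "pls (T2 e f M) (px M 0 (zer M)) (px M 0 (zer M)) = pls (T2 e f M) (px M 0 (zer M)) (zer (T2 e f M))"
   using px_add_left[of "zer M" 0 0] px_carr[of "zer M" 0] bt_grp[OF M] M by simp
  then show ?thesis by (rule pls_cancel) (use px_carr[of "zer M" 0] bt_grp[OF M] M in simp_all)
 qed
 then show ?case using px[of "zer M" 0] M by simp
next
 case (ten vxi m)
 have "vxi : carr (T1 e f)" using ten(1) by (simp add: XB_simps)
 then have "vxi : carr (T1 e f) & P (t2 e f M vxi m)"
 proof (induction rule: tensor_data.ten_induct[OF td1, consumes 1, case_names zer ten pls])
  case zer
  have "t2 e f M (zer (XB e f)) m = px M 0 m"
  proof -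
   have "t1 e f (0 * e) f = zer (XB e f)"
    using tensor_data.ten_zer_left[OF td1 f_mem, of e] by (simp add: XB_simps(2))
   then show ?thesis by simp
  qed
  then show ?case using px[OF ten(2), of 0] tensor_data.T_grp[OF td1, of e f] by (simp add: XB_simps(2))
 next
  case (ten x y)
  then have "t2 e f M (t1 e f x y) m = px M x (act M y m)"
   using px_ract[of m y x] left_ideal_idem[of x] \<open>m : carr M\<close> by simp
  then show ?case using px \<open>m : carr M\<close> M ten tensor_data.ten_carr[OF td1] by simp
 next
  case (pls s t)
  have c: "t2 e f M s m : carr (T2 e f M)" "t2 e f M t m : carr (T2 e f M)"
   using tensor_data.ten_carr[OF td2[OF M] _ ten(2)] pls by (simp_all add: XB_simps)
  have "t2 e f M (pls (XB e f) s t) m = pls (T2 e f M) (t2 e f M s m) (t2 e f M t m)"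
   by (rule tensor_data.ten_add_left[OF td2[OF M] _ _ ten(2)]) (use pls in "simp_all add: XB_simps")
  then show ?case using assms(3)[OF c] pls tensor_data.T_grp[OF td1, of e f] by (simp add: XB_simps(3))
 qed
 then show ?case by blast
next
 case (pls s t)
 then show ?case using assms(3) by blast
qed

end

text \<open>\<open>px M x m\<close> is the action of x on \<open>px M 1 m\<close>, and the latter is
  linear in m only over the ground field. So the generators come from a spanning set of M over the
  field, not from generators over B.\<close>

lemma bt_fg:
 fixes M :: "('k, 'b) smod"
 assumes M: "M : SM" shows "finitely_generated (bimod_tensor (XB e f) M)"
proof -
 note Mm = small_modulesD(1)[OF M]
 obtain S where S: "finite S" "S <= carr M" "carr M = kspan sc M S" using finitely_generated_kspan[OF Mm small_modulesD(2)[OF M]] .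
 let ?G = "(%s. px M 1 s) ` S"
 have "N = carr (bimod_tensor (XB e f) M)" if N: "submodule (bimod_tensor (XB e f) M) N" "?G <= N" for N
 proof -
  have Nd: "N <= carr (T2 e f M)" "zer (T2 e f M) : N" "!!s t. s : N ==> t : N ==> pls (T2 e f M) s t : N"
   "!!b s. s : N ==> act (bimod_tensor (XB e f) M) b s : N"
   using N(1) unfolding submodule_def bt_simps(1-3) by blast+
  have px: "px M x m = act (bimod_tensor (XB e f) M) x (px M 1 m)" if "m : carr M" for x m
   using px_act[OF Mm that, of x 1] by simp
  have "px M 1 m : N" if "m : kspan sc M S" for m
   using that
  proof induction
   case zer
   have "px M 1 (zer M) = zer (T2 e f M)"
   proof -
    have "pls (T2 e f M) (px M 1 (zer M)) (px M 1 (zer M)) = pls (T2 e f M) (px M 1 (zer M)) (zer (T2 e f M))"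
     using px_add_right[OF Mm, of "zer M" "zer M" 1] px_carr[OF Mm, of "zer M" 1] bt_grp[OF Mm] Mm by simp
    then show ?thesis by (rule pls_cancel) (use px_carr[OF Mm, of "zer M" 1] bt_grp[OF Mm] Mm in simp_all)
   qed
   then show ?case using Nd(2) by simp
  next
   case (step v s c)
   have c: "s : carr M" "v : carr M" using step S by auto
   have "px M 1 (pls M (act M (sc c 1) s) v) = pls (T2 e f M) (px M (sc c 1) s) (px M 1 v)"
    using px_add_right[OF Mm _ c(2), of "act M (sc c 1) s" 1] px_sc[OF Mm c(1), of c 1] c Mm by simp
   moreover have "px M (sc c 1) s : N" using px[OF c(1), of "sc c 1"] Nd(4) step N(2) by auto
   ultimately show ?case using Nd(3) step by simp
  qed
  then have "px M x m : N" if "m : carr M" for x m using px[OF that] Nd(4) S(3) that by simp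
  then have "t : N" if "t : carr (T2 e f M)" for t using px_induct[OF Mm that, of "%t. t : N"] Nd(3) by blast
  then show ?thesis using Nd(1) by (auto simp: bt_simps)
 qed
 moreover have "finite ?G" "?G <= carr (bimod_tensor (XB e f) M)"
  unfolding bt_simps(1) using S(1) px_carr[OF Mm, of _ 1] S(2) by blast+
 ultimately show ?thesis unfolding finitely_generated_def by blast
qed

text \<open>The universal property is used twice: for fixed m on Be \<otimes> fB with x \<otimes> y
  \<mapsto> h x (ym), and then for the tensor product over B. Balancing over B holds because the
  value depends on y and m only through ym.\<close>

lemma px_universal:
 fixes M :: "('k, 'b) smod"
 assumes M: "left_module M" and N: "left_module N"
  and hc: "!!x m. m : carr M ==> h x m : carr N"
  and hl: "!!x y m. m : carr M ==> h (x + y) m = pls N (h x m) (h y m)"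
  and hr: "!!x m n. m : carr M ==> n : carr M ==> h x (pls M m n) = pls N (h x m) (h x n)"
  and hs: "!!c x m. m : carr M ==> h (sc c x) m = h x (act M (sc c 1) m)"
  and he: "!!x m. m : carr M ==> h (x * e) m = h x m" and hf: "!!x m. m : carr M ==> h x (act M f m) = h x m"
 shows "EX H. additive (T2 e f M) N H & (ALL x. ALL m : carr M. H (px M x m) = h x m)"
proof -
 have ex: "EX K. additive (XB e f) N K & (ALL x : carr (LI e). ALL y : carr (RI f). K (t1 e f x y) = h x (act M y m))"
  if m: "m : carr M" for m
 proof -
  obtain K where "additive (T1 e f) N K" "!!x y. x : carr (LI e) ==> y : carr (RI f) ==> K (t1 e f x y) = h x (act M y m)"
  proof (rule tensor_data.universal[OF td1, where G = N and h = "%x y. h x (act M y m)"])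
   show "h (pls (LI e) x x') (act M y m) = pls N (h x (act M y m)) (h x' (act M y m))" for x x' y
    using hl m M by simp
   show "h x (act M (pls (RI f) y y') m) = pls N (h x (act M y m)) (h x (act M y' m))" for x y y'
    using hr m M by (simp add: act_add)
   show "h (sc r x) (act M y m) = h x (act M (sc r y) m)" for x y r
    using hs[of "act M y m" r x] m M by simp
  qed (use N hc m M in auto)
  then show ?thesis unfolding XB_additive by blast
 qed
 have "EX K. ALL m : carr M. additive (XB e f) N (K m) & (ALL x : carr (LI e). ALL y : carr (RI f). K m (t1 e f x y) = h x (act M y m))"
  by (rule bchoice) (use ex in blast)
 then obtain K where K1: "!!m. m : carr M ==> additive (XB e f) N (K m)"
  and K2: "!!m x y. m : carr M ==> x : carr (LI e) ==> y : carr (RI f) ==> K m (t1 e f x y) = h x (act M y m)"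
  by blast
 have Kr: "K (pls M m n) vxi = pls N (K m vxi) (K n vxi)" if "m : carr M" "n : carr M" "vxi : carr (XB e f)" for m n vxi
  by (rule XB_ext[OF K1 additive_pls[OF K1 K1] _ _ that(3)]) (use that M N K2 hr in "simp_all add: act_pls")
 have Kb: "K m (ract (XB e f) vxi b) = K (act M b m) vxi" if "m : carr M" "vxi : carr (XB e f)" for m vxi b
  by (rule XB_ext[OF additive_comp[OF XB_ract(1) K1] K1 _ _ that(2)])
   (use that M N K2 in "simp_all add: XB_ract(2) right_ideal_act")
 obtain H where H: "additive (T2 e f M) N H" "!!vxi m. vxi : carr (XB e f) ==> m : carr M ==> H (t2 e f M vxi m) = K m vxi"
 proof (rule tensor_data.universal[OF td2[OF M], where G = N and h = "%vxi m. K m vxi"])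
  show "K m vxi : carr N" if "vxi : carr (XB e f)" "m : carr M" for m vxi using additiveD(1)[OF K1] that by blast
  show "K m (pls (XB e f) vxi ze) = pls N (K m vxi) (K m ze)" if "vxi : carr (XB e f)" "ze : carr (XB e f)" "m : carr M" for m vxi ze
   using additiveD(2)[OF K1] that by blast
  show "abelian_grp N" using N by simp
  show "K (pls M m m') vxi = pls N (K m vxi) (K m' vxi)" if "vxi : carr (XB e f)" "m : carr M" "m' : carr M" for m m' vxi
   by (rule Kr[OF that(2,3,1)])
  show "K m (ract (XB e f) vxi r) = K (act M r m) vxi" if "vxi : carr (XB e f)" "m : carr M" for m vxi r
   by (rule Kb[OF that(2,1)])
 qed (rule that)
 have "H (px M x m) = h x m" if m: "m : carr M" for x m
  using H(2)[OF t1_f_carr m, of x] K2[OF m, of "x * e" f] f_mem hf[OF m, of "x * e"] he[OF m, of x] by simp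
 then show ?thesis using H(1) by blast
qed

abbreviation cpo :: "('k, 'b) smod \<Rightarrow> ('k, 'b) smod" where
 "cpo M \<equiv> fst (small_copy (bimod_tensor (XB e f) M))"
abbreviation cpf :: "('k, 'b) smod \<Rightarrow> (('b \<times> 'b \<Rightarrow>\<^sub>0 int) set \<times> (nat \<Rightarrow> 'k) \<Rightarrow>\<^sub>0 int) set \<Rightarrow> nat \<Rightarrow> 'k" where
 "cpf M \<equiv> snd (small_copy (bimod_tensor (XB e f) M) :: ('k, 'b) smod \<times> _)"
abbreviation cpi :: "('k, 'b) smod \<Rightarrow> (nat \<Rightarrow> 'k) \<Rightarrow> (('b \<times> 'b \<Rightarrow>\<^sub>0 int) set \<times> (nat \<Rightarrow> 'k) \<Rightarrow>\<^sub>0 int) set" where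
 "cpi M \<equiv> inv_into (carr (bimod_tensor (XB e f) M)) (cpf M)"

context
 fixes M :: "('k, 'b) smod"
 assumes M: "M : SM"
begin

lemma Mm: "left_module M" using M by simp

lemma cpo: "cpo M : SM" and cpf: "module_iso (bimod_tensor (XB e f) M) (cpo M) (cpf M)"
 using small_copy[OF bt_module[OF Mm] bt_fg[OF M], of "cpo M" "cpf M"] by simp_all

lemma cpf_hom: "module_hom (bimod_tensor (XB e f) M) (cpo M) (cpf M)"
 using cpf by (simp add: module_iso_def)

lemma cpf_bij: "inj_on (cpf M) (carr (T2 e f M))" "cpf M ` carr (T2 e f M) = carr (cpo M)"
 using cpf unfolding module_iso_def bij_betw_def bt_simps(1) by blast+

lemma cpi_cpf: "t : carr (T2 e f M) ==> cpi M (cpf M t) = t"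
 unfolding bt_simps(1) by (rule inv_into_f_f[OF cpf_bij(1)])

lemma cpf_cpi:
 assumes "z : carr (cpo M)" shows "cpi M z : carr (T2 e f M) & cpf M (cpi M z) = z"
proof -
 have "z : cpf M ` carr (T2 e f M)" using assms unfolding cpf_bij(2) .
 then show ?thesis unfolding bt_simps(1) by (intro conjI inv_into_into f_inv_into_f)
qed

lemma tau_px: "tau e f M x m = cpf M (px M x m)"
 by (simp add: tau_def)

lemma cpf_additive: "additive (T2 e f M) (cpo M) (cpf M)"
 using module_hom_additive[OF cpf_hom] unfolding bt_additive .

lemma cpi_additive: "additive (cpo M) (T2 e f M) (cpi M)"
proof -
 have "cpi M (pls (cpo M) y z) = pls (T2 e f M) (cpi M y) (cpi M z)" if "y : carr (cpo M)" "z : carr (cpo M)" for y z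
 proof -
  have "pls (cpo M) y z = cpf M (pls (T2 e f M) (cpi M y) (cpi M z))"
   using additiveD(2)[OF cpf_additive] cpf_cpi that by simp
  then show ?thesis using cpi_cpf[of "pls (T2 e f M) (cpi M y) (cpi M z)"] cpf_cpi that bt_grp[OF Mm] by simp
 qed
 then show ?thesis unfolding additive_def using cpf_cpi by blast
qed

lemma tau_carr: "m : carr M ==> tau e f M x m : carr (cpo M)"
 unfolding tau_px using additiveD(1)[OF cpf_additive px_carr[OF Mm]] .

lemma tau_add_left: "m : carr M ==> tau e f M (x + y) m = pls (cpo M) (tau e f M x m) (tau e f M y m)"
 unfolding tau_px px_add_left[OF Mm] by (rule additiveD(2)[OF cpf_additive px_carr[OF Mm] px_carr[OF Mm]])

lemma tau_add_right: "m : carr M ==> n : carr M ==> tau e f M x (pls M m n) = pls (cpo M) (tau e f M x m) (tau e f M x n)"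
 unfolding tau_px px_add_right[OF Mm] by (rule additiveD(2)[OF cpf_additive px_carr[OF Mm] px_carr[OF Mm]])

lemma tau_sc: "m : carr M ==> tau e f M (sc c x) m = tau e f M x (act M (sc c 1) m)"
 unfolding tau_px px_sc[OF Mm] ..

lemma tau_e: "tau e f M (x * e) m = tau e f M x m"
 unfolding tau_px using idem(1) by (simp add: mult.assoc)

lemma tau_f: "m : carr M ==> tau e f M x (act M f m) = tau e f M x m"
 unfolding tau_px px_f[OF Mm] ..

lemma tau_act: "m : carr M ==> act (cpo M) b (tau e f M x m) = tau e f M (b * x) m"
 unfolding tau_px px_act[OF Mm, symmetric]
 using module_homD(3)[OF cpf_hom, of "px M x m" b] px_carr[OF Mm, of m x] by (simp add: bt_simps)

lemma tau_induct:
 assumes "z : carr (cpo M)" "!!x m. m : carr M ==> P (tau e f M x m)"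
  "!!y z. y : carr (cpo M) ==> z : carr (cpo M) ==> P y ==> P z ==> P (pls (cpo M) y z)"
 shows "P z"
proof -
 have "P (cpf M t)" if "t : carr (T2 e f M)" for t
  using that
 proof (rule px_induct[OF Mm])
  show "P (cpf M (px M x m))" if "m : carr M" for x m using assms(2)[OF that] by (simp add: tau_px)
  show "P (cpf M (pls (T2 e f M) s t))" if "s : carr (T2 e f M)" "t : carr (T2 e f M)" "P (cpf M s)" "P (cpf M t)" for s t
   using that additiveD[OF cpf_additive] assms(3) by simp
 qed
 then show ?thesis using cpf_cpi[OF assms(1)] by metis
qed

lemma tau_ext:
 assumes "additive (cpo M) N g" "additive (cpo M) N h" "!!x m. m : carr M ==> g (tau e f M x m) = h (tau e f M x m)" "z : carr (cpo M)"
 shows "g z = h z"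
 using assms(4)
proof (rule tau_induct[where P = "%z. g z = h z"])
 show "g (tau e f M x m) = h (tau e f M x m)" if "m : carr M" for x m using assms(3)[OF that] .
 fix y z assume "y : carr (cpo M)" "z : carr (cpo M)" "g y = h y" "g z = h z"
 then show "g (pls (cpo M) y z) = h (pls (cpo M) y z)"
  using additiveD(2)[OF assms(1), of y z] additiveD(2)[OF assms(2), of y z] by simp
qed

lemma tau_universal:
 assumes N: "left_module N"
  and hc: "!!x m. m : carr M ==> h x m : carr N"
  and hl: "!!x y m. m : carr M ==> h (x + y) m = pls N (h x m) (h y m)"
  and hr: "!!x m n. m : carr M ==> n : carr M ==> h x (pls M m n) = pls N (h x m) (h x n)"
  and hs: "!!c x m. m : carr M ==> h (sc c x) m = h x (act M (sc c 1) m)"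
  and he: "!!x m. m : carr M ==> h (x * e) m = h x m" and hf: "!!x m. m : carr M ==> h x (act M f m) = h x m"
  and ha: "!!b x m. m : carr M ==> h (b * x) m = act N b (h x m)"
 shows "EX H. module_hom (cpo M) N H & (ALL x. ALL m : carr M. H (tau e f M x m) = h x m)"
proof -
 have "EX H. additive (T2 e f M) N H & (ALL x. ALL m : carr M. H (px M x m) = h x m)"
  by (rule px_universal[OF Mm N]; (rule hc hl hr hs he hf; assumption))
 then obtain H where H: "additive (T2 e f M) N H" "!!x m. m : carr M ==> H (px M x m) = h x m"
  by blast
 let ?H = "%z. H (cpi M z)"
 have a: "additive (cpo M) N ?H" by (rule additive_comp[OF cpi_additive H(1)])
 have v: "?H (tau e f M x m) = h x m" if "m : carr M" for x m
  using cpi_cpf[OF px_carr[OF Mm that]] H(2)[OF that] by (simp add: tau_px)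
 have "?H (act (cpo M) b z) = act N b (?H z)" if "z : carr (cpo M)" for b z
 proof (rule tau_ext[OF additive_comp[OF additive_act a] additive_comp[OF a additive_act[OF N]] _ that])
  show "left_module (cpo M)" using cpo by simp
  show "?H (act (cpo M) b (tau e f M x m)) = act N b (?H (tau e f M x m))" if m: "m : carr M" for x m
   unfolding tau_act[OF m] v[OF m] by (rule ha[OF m])
 qed
 then have "module_hom (cpo M) N ?H" using additiveD[OF a] by (intro module_homI) auto
 then show ?thesis using v by blast
qed

end

lemma TF_obj: "M : SM ==> fobj (TF e f) M = cpo M"
 by (simp add: tensor_functor_def)

definition hTF :: "('k, 'b) smor \<Rightarrow> (nat \<Rightarrow> 'k) \<Rightarrow> nat \<Rightarrow> 'k" where
 "hTF g z = cpf (tgt D g) (tensor_map (XB e f) (ract (XB e f)) (tgt D g) (act (tgt D g)) (%x. x) (ap g) (cpi (src D g) z))"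

lemma TF_mkfun: "TF e f = mkfun cpo hTF"
proof -
 have "farr (TF e f) g = farr (mkfun cpo hTF) g" for g
 proof (cases g)
  case (fields M h N)
  show ?thesis
   by (cases "g : arr D") (simp_all add: fields tensor_functor_def mkfun_def mkarr_def hTF_def[abs_def] ap_def Let_def split: prod.split)
 qed
 moreover have "fobj (TF e f) = fobj (mkfun cpo hTF)" by (simp add: tensor_functor_def mkfun_def)
 ultimately have "fobj (TF e f) = fobj (mkfun cpo hTF)" "farr (TF e f) = farr (mkfun cpo hTF)" by auto
 then show ?thesis by simp
qed

lemma hTF:
 assumes g: "g : arr D"
 shows "additive (cpo (src D g)) (cpo (tgt D g)) (hTF g)"
  and "m : carr (src D g) ==> hTF g (tau e f (src D g) x m) = tau e f (tgt D g) x (ap g m)"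
proof -
 note s = arr_DD(1-4)[OF g]
 have ga: "additive (src D g) (tgt D g) (ap g)" using arr_DD(5,6)[OF g] unfolding additive_def by blast
 note tm = tensor_map[OF td2[OF s(3)] td2[OF s(4)] additive_id[of "XB e f"] ga]
 have tm1: "additive (T2 e f (src D g)) (T2 e f (tgt D g))
   (tensor_map (XB e f) (ract (XB e f)) (tgt D g) (act (tgt D g)) (%x. x) (ap g))"
  by (rule tm(1)) (simp_all add: arr_DD(7)[OF g])
 show "additive (cpo (src D g)) (cpo (tgt D g)) (hTF g)"
  unfolding hTF_def by (rule additive_comp[OF additive_comp[OF cpi_additive[OF s(1)] tm1] cpf_additive[OF s(2)]])
 show "hTF g (tau e f (src D g) x m) = tau e f (tgt D g) x (ap g m)" if m: "m : carr (src D g)"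
 proof -
  have "tensor_map (XB e f) (ract (XB e f)) (tgt D g) (act (tgt D g)) (%x. x) (ap g) (px (src D g) x m) = px (tgt D g) x (ap g m)"
   by (rule tm(2)) (simp_all add: arr_DD(7)[OF g] t1_f_carr m)
  then show ?thesis
   unfolding hTF_def tau_px[OF s(1)] tau_px[OF s(2)] cpi_cpf[OF s(1) px_carr[OF s(3) m]] by simp
 qed
qed

lemma lin_TF: "lin (TF e f)"
 unfolding TF_mkfun
proof (rule lin_mkfun)
 show "cpo M : SM" if "M : SM" for M by (rule cpo[OF that])
next
 fix g assume g: "g : arr D"
 note s = arr_DD(1-4)[OF g]
 have "hTF g (act (cpo (src D g)) b z) = act (cpo (tgt D g)) b (hTF g z)" if "z : carr (cpo (src D g))" for b z
 proof (rule tau_ext[OF s(1) additive_comp[OF additive_act hTF(1)[OF g]] additive_comp[OF hTF(1)[OF g] additive_act] _ that])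
  show "left_module (cpo (src D g))" "left_module (cpo (tgt D g))" using cpo s by simp_all
  show "hTF g (act (cpo (src D g)) b (tau e f (src D g) x m)) = act (cpo (tgt D g)) b (hTF g (tau e f (src D g) x m))"
   if m: "m : carr (src D g)" for x m
   using hTF(2)[OF g m] tau_act[OF s(1) m] tau_act[OF s(2) arr_DD(5)[OF g m]] by simp
 qed
 then show "module_hom (cpo (src D g)) (cpo (tgt D g)) (hTF g)"
  using additiveD[OF hTF(1)[OF g]] by (intro module_homI) auto
 fix c z assume z: "z : carr (cpo (src D g))"
 have cg: "scl D c g : arr D" "src D (scl D c g) = src D g" "tgt D (scl D c g) = tgt D g" using g by simp_all
 have a: "additive (cpo (src D g)) (cpo (tgt D g)) (hTF (scl D c g))" using hTF(1)[OF cg(1)] unfolding cg(2,3) .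
 have lm: "left_module (cpo (tgt D g))" using cpo[OF s(2)] by simp
 show "hTF (scl D c g) z = act (cpo (tgt D g)) (sc c 1) (hTF g z)"
 proof (rule tau_ext[OF s(1) a additive_comp[OF hTF(1)[OF g] additive_act[OF lm]] _ z])
  fix x m assume m: "m : carr (src D g)"
  have "hTF (scl D c g) (tau e f (src D g) x m) = tau e f (tgt D g) x (act (tgt D g) (sc c 1) (ap g m))"
   using hTF(2)[OF cg(1), of m x] m unfolding cg(2,3) by (simp add: D_ops)
  then show "hTF (scl D c g) (tau e f (src D g) x m) = act (cpo (tgt D g)) (sc c 1) (hTF g (tau e f (src D g) x m))"
   using hTF(2)[OF g m] tau_sc[OF s(2) arr_DD(5)[OF g m], of c x] tau_act[OF s(2) arr_DD(5)[OF g m]] by simp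
 qed
next
 fix M z assume M: "M : SM" and z: "z : carr (cpo M)"
 have i: "idt D M : arr D" "src D (idt D M) = M" "tgt D (idt D M) = M" using M by simp_all
 have a: "additive (cpo M) (cpo M) (hTF (idt D M))" using hTF(1)[OF i(1)] unfolding i(2,3) .
 show "hTF (idt D M) z = z"
 proof (rule tau_ext[OF M a additive_id _ z])
  fix x m assume m: "m : carr M"
  show "hTF (idt D M) (tau e f M x m) = tau e f M x m"
   using hTF(2)[OF i(1), of m x] m unfolding i(2,3) by (simp add: D_ops)
 qed
next
 fix h g z assume g: "h : arr D" "g : arr D" "src D g = tgt D h" and z: "z : carr (cpo (src D h))"
 note s = arr_DD(1-4)[OF g(1)]
 have i: "cmp D g h : arr D" "src D (cmp D g h) = src D h" "tgt D (cmp D g h) = tgt D g" using g by simp_all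
 have a: "additive (cpo (src D h)) (cpo (tgt D g)) (hTF (cmp D g h))" using hTF(1)[OF i(1)] unfolding i(2,3) .
 have b: "additive (cpo (tgt D h)) (cpo (tgt D g)) (hTF g)" using hTF(1)[OF g(2)] unfolding g(3) .
 show "hTF (cmp D g h) z = hTF g (hTF h z)"
 proof (rule tau_ext[OF s(1) a additive_comp[OF hTF(1)[OF g(1)] b] _ z])
  fix x m assume m: "m : carr (src D h)"
  show "hTF (cmp D g h) (tau e f (src D h) x m) = hTF g (hTF h (tau e f (src D h) x m))"
   using hTF(2)[OF i(1), of m x] hTF(2)[OF g(1) m] hTF(2)[OF g(2), of "ap h m" x] arr_DD(5)[OF g(1) m] m g(3)
   unfolding i(2,3) by (simp add: D_ops(1))
 qed
next
 fix h g z assume g: "h : arr D" "g : arr D" "src D g = src D h" "tgt D g = tgt D h" and z: "z : carr (cpo (src D h))"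
 note s = arr_DD(1-4)[OF g(1)]
 have i: "add D h g : arr D" "src D (add D h g) = src D h" "tgt D (add D h g) = tgt D h" using g by simp_all
 have a: "additive (cpo (src D h)) (cpo (tgt D h)) (hTF (add D h g))" using hTF(1)[OF i(1)] unfolding i(2,3) .
 have b: "additive (cpo (src D h)) (cpo (tgt D h)) (hTF g)" using hTF(1)[OF g(2)] unfolding g(3,4) .
 have lm: "abelian_grp (cpo (tgt D h))" using cpo[OF s(2)] by simp
 show "hTF (add D h g) z = pls (cpo (tgt D h)) (hTF h z) (hTF g z)"
 proof (rule tau_ext[OF s(1) a additive_pls[OF hTF(1)[OF g(1)] b lm] _ z])
  fix x m assume m: "m : carr (src D h)"
  have "ap g m : carr (tgt D h)" using arr_DD(5)[OF g(2)] m g(3,4) by simp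
  then show "hTF (add D h g) (tau e f (src D h) x m) = pls (cpo (tgt D h)) (hTF h (tau e f (src D h) x m)) (hTF g (tau e f (src D h) x m))"
   using hTF(2)[OF i(1), of m x] hTF(2)[OF g(1) m] hTF(2)[OF g(2), of m x] m g(3,4)
    tau_add_right[OF s(2) arr_DD(5)[OF g(1) m], of "ap g m" x] unfolding i(2,3) by (simp add: D_ops(4))
 qed
qed

lemma fap_TF: "g : arr D ==> m : carr (src D g) ==> fap (TF e f) g (tau e f (src D g) x m) = tau e f (tgt D g) x (ap g m)"
 unfolding TF_mkfun using mkfun_simps(2)[of g "tau e f (src D g) x m" cpo hTF] tau_carr[OF arr_DD(1)] hTF(2) by simp

end

end

context fdalg begin

context
 fixes e f :: 'b and M :: "('k, 'b) smod"
 assumes idem: "e * e = e" "f * f = f" and M: "M : SM"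
begin

lemmas T_obj = TF_obj[OF idem M]
lemmas T_carr = tau_carr[OF idem M, folded T_obj]
 and T_add_left = tau_add_left[OF idem M, folded T_obj]
 and T_add_right = tau_add_right[OF idem M, folded T_obj]
 and T_sc = tau_sc[OF idem M] and T_e = tau_e[OF idem M] and T_f = tau_f[OF idem M]
 and T_act = tau_act[OF idem M, folded T_obj]
 and T_induct = tau_induct[OF idem M, folded T_obj]
 and T_ext = tau_ext[OF idem M, folded T_obj]
 and T_universal = tau_universal[OF idem M, folded T_obj]

text \<open>Without compatibility with the left action of B: the contraction by a linear functional
  is a map of this weaker kind.\<close>

lemma T_universal_additive:
 assumes N: "left_module N"
  and hc: "!!x m. m : carr M ==> h x m : carr N"
  and hl: "!!x y m. m : carr M ==> h (x + y) m = pls N (h x m) (h y m)"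
  and hr: "!!x m n. m : carr M ==> n : carr M ==> h x (pls M m n) = pls N (h x m) (h x n)"
  and hs: "!!c x m. m : carr M ==> h (sc c x) m = h x (act M (sc c 1) m)"
  and he: "!!x m. m : carr M ==> h (x * e) m = h x m" and hf: "!!x m. m : carr M ==> h x (act M f m) = h x m"
 shows "EX H. additive (fobj (TF e f) M) N H & (ALL x. ALL m : carr M. H (tau e f M x m) = h x m)"
proof -
 note Mm = small_modulesD(1)[OF M]
 have "EX H. additive (T2 e f M) N H & (ALL x. ALL m : carr M. H (t2 e f M (t1 e f (x * e) f) m) = h x m)"
  by (rule px_universal[OF idem Mm N]; (rule hc hl hr hs he hf; assumption))
 then obtain H where H: "additive (T2 e f M) N H" "!!x m. m : carr M ==> H (t2 e f M (t1 e f (x * e) f) m) = h x m"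
  by blast
 show ?thesis
 proof (intro exI conjI allI ballI)
  show "additive (fobj (TF e f) M) N (%z. H (inv_into (carr (bimod_tensor (XB e f) M))
    (snd (small_copy (bimod_tensor (XB e f) M) :: ('k, 'b) smod \<times> _)) z))"
   unfolding T_obj by (rule additive_comp[OF cpi_additive[OF idem M] H(1)])
  show "H (inv_into (carr (bimod_tensor (XB e f) M))
    (snd (small_copy (bimod_tensor (XB e f) M) :: ('k, 'b) smod \<times> _)) (tau e f M x m)) = h x m" if m: "m : carr M" for x m
   unfolding tau_px[OF idem M] cpi_cpf[OF idem M px_carr[OF idem Mm m]] by (rule H(2)[OF m])
 qed
qed

end

section \<open>The regular module and a Yoneda lemma\<close>

lemma regular_carr: "carr (LI (1::'b)) = UNIV"
 by (auto simp: left_ideal_of_def)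

lemma regular_act: "act (LI (1::'b)) = (*)"
 by (simp add: left_ideal_of_def)

lemma regular_module: "left_module (LI (1::'b))"
 unfolding left_module_def regular_carr regular_act
 using left_ideal_grp[of 1] by (simp add: distrib_left distrib_right mult.assoc)

lemma regular_fg: "finitely_generated (LI (1::'b))"
proof -
 have "N = UNIV" if "submodule (LI (1::'b)) N" "{1} <= N" for N
 proof -
  have "act (LI (1::'b)) b 1 : N" for b using that unfolding submodule_def by blast
  then show ?thesis unfolding regular_act by auto
 qed
 then show ?thesis unfolding finitely_generated_def regular_carr by (intro exI[of _ "{1}"]) auto
qed

text \<open>\<open>reg\<close> is the small copy of the left module B and \<open>rr\<close> the
  isomorphism onto it; \<open>rr 1\<close> is the free generator.\<close>

definition reg :: "('k, 'b) smod" where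
 "reg = fst (small_copy (LI (1::'b)))"

definition rr :: "'b \<Rightarrow> nat \<Rightarrow> 'k" where
 "rr = snd (small_copy (LI (1::'b)) :: ('k, 'b) smod \<times> _)"

lemma reg [simp]: "reg : SM" and reg_iso: "module_iso (LI 1) reg rr"
 using small_copy[OF regular_module regular_fg, of reg rr] by (simp_all add: reg_def rr_def)

lemma reg_simps [simp]:
 "rr b : carr reg" "rr a = rr b \<longleftrightarrow> a = b" "pls reg (rr a) (rr b) = rr (a + b)" "act reg a (rr b) = rr (a * b)"
proof -
 have h: "module_hom (LI 1) reg rr" and i: "bij_betw rr UNIV (carr reg)"
  using reg_iso unfolding module_iso_def regular_carr by simp_all
 show "rr b : carr reg" "rr a = rr b \<longleftrightarrow> a = b" using i unfolding bij_betw_def by (auto dest: injD)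
 show "pls reg (rr a) (rr b) = rr (a + b)" using module_homD(2)[OF h, of a b] by (simp add: regular_carr)
 show "act reg a (rr b) = rr (a * b)" using module_homD(3)[OF h, of b a] by (simp add: regular_carr regular_act)
qed

lemma reg_cases: 
 assumes "z : carr reg" obtains b where "z = rr b"
 using assms reg_iso unfolding module_iso_def bij_betw_def regular_carr by blast

lemma inv_rr [simp]: "inv_into UNIV rr (rr b) = b"
 by (rule inv_into_f_f) (simp_all add: inj_def)

text \<open>The homomorphism from the regular module that represents the element m.\<close>

definition mh :: "('k, 'b) smod \<Rightarrow> (nat \<Rightarrow> 'k) \<Rightarrow> ('k, 'b) smor" where
 "mh M m = mkarr reg (%z. act M (inv_into UNIV rr z) m) M"

lemma mh:
 assumes "M : SM" "m : carr M"
 shows "mh M m : arr D" "src D (mh M m) = reg" "tgt D (mh M m) = M" "ap (mh M m) (rr b) = act M b m"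
proof -
 have "module_hom reg M (%z. act M (inv_into UNIV rr z) m)"
  by (rule module_homI) (use assms in "auto elim!: reg_cases simp: act_add")
 then show "mh M m : arr D" unfolding mh_def by (intro mkarr_arr) (use assms in simp_all)
qed (use assms in "simp_all add: mh_def")

lemma reg_arr_eqI:
 assumes "g : arr D" "h : arr D" "src D g = reg" "src D h = reg" "tgt D g = tgt D h" "!!b. ap g (rr b) = ap h (rr b)"
 shows "g = h"
 by (rule arr_D_eqI) (use assms in "auto elim: reg_cases")

lemma mh_cmp:
 assumes g: "g : arr D" "m : carr (src D g)"
 shows "cmp D g (mh (src D g) m) = mh (tgt D g) (ap g m)"
proof (rule reg_arr_eqI)
 note s = arr_DD[OF g(1)]
 note 1 = mh[OF s(1) g(2)] and 2 = mh[OF s(2) s(5)[OF g(2)]]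
 show "cmp D g (mh (src D g) m) : arr D" "mh (tgt D g) (ap g m) : arr D"
  "src D (cmp D g (mh (src D g) m)) = reg" "src D (mh (tgt D g) (ap g m)) = reg"
  "tgt D (cmp D g (mh (src D g) m)) = tgt D (mh (tgt D g) (ap g m))" using 1 2 g by simp_all
 show "ap (cmp D g (mh (src D g) m)) (rr b) = ap (mh (tgt D g) (ap g m)) (rr b)" for b
  using 1 2 g s(7)[OF g(2)] by (simp add: D_ops(1))
qed

lemma mh_pls:
 assumes "M : SM" "m : carr M" "n : carr M" shows "mh M (pls M m n) = add D (mh M m) (mh M n)"
proof (rule reg_arr_eqI)
 note 1 = mh[OF assms(1,2)] and 2 = mh[OF assms(1,3)]
 have p: "pls M m n : carr M" using assms by simp
 note 3 = mh[OF assms(1) p]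
 show "mh M (pls M m n) : arr D" "add D (mh M m) (mh M n) : arr D" "src D (mh M (pls M m n)) = reg"
  "src D (add D (mh M m) (mh M n)) = reg" "tgt D (mh M (pls M m n)) = tgt D (add D (mh M m) (mh M n))"
  using 1 2 3 by simp_all
 show "ap (mh M (pls M m n)) (rr b) = ap (add D (mh M m) (mh M n)) (rr b)" for b
  using 1 2 3 assms by (simp add: D_ops(4) act_pls)
qed

lemma mh_scl:
 assumes "M : SM" "m : carr M" shows "mh M (act M (sc c 1) m) = scl D c (mh M m)"
proof (rule reg_arr_eqI)
 have p: "act M (sc c 1) m : carr M" using assms by simp
 note 1 = mh[OF assms] and 3 = mh[OF assms(1) p]
 show "mh M (act M (sc c 1) m) : arr D" "scl D c (mh M m) : arr D" "src D (mh M (act M (sc c 1) m)) = reg"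
  "src D (scl D c (mh M m)) = reg" "tgt D (mh M (act M (sc c 1) m)) = tgt D (scl D c (mh M m))"
  using 1 3 by simp_all
 show "ap (mh M (act M (sc c 1) m)) (rr b) = ap (scl D c (mh M m)) (rr b)" for b
  using 1 3 assms by (simp add: D_ops(5))
qed

lemma mh_one: "mh reg (rr 1) = idt D reg"
proof (rule reg_arr_eqI)
 note 1 = mh[of reg "rr 1"]
 show "mh reg (rr 1) : arr D" "idt D reg : arr D" "src D (mh reg (rr 1)) = reg" "src D (idt D reg) = reg"
  "tgt D (mh reg (rr 1)) = tgt D (idt D reg)" using 1 by simp_all
 show "ap (mh reg (rr 1)) (rr b) = ap (idt D reg) (rr b)" for b using 1 by (simp add: D_ops(2))
qed

text \<open>For F = X \<otimes>_B _ and u \<in> X this is the element u \<otimes> m: the functor is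
  applied to the map b \<mapsto> bm. For a general F the value F(B) thus takes the place of a
  bimodule.\<close>

definition ev :: "(('k, 'b) smod, ('k, 'b) smor) endofun \<Rightarrow> ('k, 'b) smod \<Rightarrow> (nat \<Rightarrow> 'k) \<Rightarrow> (nat \<Rightarrow> 'k) \<Rightarrow> nat \<Rightarrow> 'k" where
 "ev F M m u = fap F (mh M m) u"

context
 fixes F and M :: "('k, 'b) smod" assumes F: "lin F" and M: "M : SM"
begin

lemma ev_carr: "[|m : carr M; u : carr (fobj F reg)|] ==> ev F M m u : carr (fobj F M)"
 unfolding ev_def using fap(1)[OF F mh(1)[OF M], of m u] mh[OF M] by simp

lemma ev_pls: "[|m : carr M; n : carr M; u : carr (fobj F reg)|] ==>
  ev F M (pls M m n) u = pls (fobj F M) (ev F M m u) (ev F M n u)"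
 unfolding ev_def using mh_pls[OF M, of m n] fap_add[OF F mh(1)[OF M] mh(1)[OF M], of m n u] mh[OF M] by simp

lemma ev_scl: "[|m : carr M; u : carr (fobj F reg)|] ==>
  ev F M (act M (sc c 1) m) u = act (fobj F M) (sc c 1) (ev F M m u)"
 unfolding ev_def using mh_scl[OF M, of m c] fap_scl[OF F mh(1)[OF M], of m u c] mh[OF M] by simp

lemma ev_pls_right: "[|m : carr M; u : carr (fobj F reg); v : carr (fobj F reg)|] ==>
  ev F M m (pls (fobj F reg) u v) = pls (fobj F M) (ev F M m u) (ev F M m v)"
 unfolding ev_def using fap(2)[OF F mh(1)[OF M], of m u v] mh[OF M] by simp

end

lemma ev_nat:
 assumes "lin F" "g : arr D" "m : carr (src D g)" "u : carr (fobj F reg)"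
 shows "fap F g (ev F (src D g) m u) = ev F (tgt D g) (ap g m) u"
 unfolding ev_def
 using fap_cmp[OF assms(1) mh(1)[OF arr_DD(1)[OF assms(2)] assms(3)] assms(2), of u]
  mh_cmp[OF assms(2,3)] mh[OF arr_DD(1)[OF assms(2)] assms(3)] assms by simp

lemma ev_one: "[|lin F; u : carr (fobj F reg)|] ==> ev F reg (rr 1) u = u"
 unfolding ev_def using fap_idt[of F reg u] mh_one by simp

lemma nap_ev:
 assumes "et : hom E F G" "M : SM" "m : carr M" "u : carr (fobj F reg)"
 shows "nap et M (ev F M m u) = ev G M m (nap et reg u)"
 using nap_natural[of et "mh M m" u] assms mh[OF assms(2,3)] by (simp add: ev_def hom_def)

lemma hom_lin: "et : hom E F G ==> lin F" "et : hom E F G ==> lin G"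
 using arr_E_lin(1)[of et] arr_E_lin(2)[of et] by (auto simp: hom_def)

abbreviation idf :: "(('k, 'b) smod, ('k, 'b) smor) endofun" where "idf \<equiv> id_endofun D"

lemma idf_obj: "M : SM ==> fobj idf M = M"
 by (simp add: D.id_endofun_simps)

lemma idf_ev: "M : SM ==> m : carr M ==> ev idf M m (rr b) = act M b m"
 using mh[of M m] by (simp add: ev_def fap_def D.id_endofun_simps)

text \<open>A transformation from X to F is determined by its value at v, so evaluation at v embeds
  the transformations into F(B). This bounds their dimension.\<close>

definition generated :: "(('k, 'b) smod, ('k, 'b) smor) endofun \<Rightarrow> (nat \<Rightarrow> 'k) \<Rightarrow> bool" where
 "generated X v \<longleftrightarrow> lin X & v : carr (fobj X reg) &
   (ALL F. ALL et : hom E X F. ALL ep : hom E X F. nap et reg v = nap ep reg v \<longrightarrow> et = ep)"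

lemma generated_id: "generated idf (rr 1)"
 unfolding generated_def
proof (intro conjI allI ballI impI)
 show "lin idf" by (rule D.lin_id)
 show "rr 1 : carr (fobj idf reg)" by (simp add: idf_obj)
 fix F et ep assume h: "et : hom E idf F" "ep : hom E idf F" "nap et reg (rr 1) = nap ep reg (rr 1)"
 show "et = ep"
 proof (rule E_eqI)
  fix M x assume M: "M : SM" and "x : carr (fobj (src E ep) M)"
  then have x: "x : carr M" using h(2) by (simp add: hom_def idf_obj)
  have u: "rr 1 : carr (fobj idf reg)" by (simp add: idf_obj)
  show "nap et M x = nap ep M x"
   using nap_ev[OF h(1) M x u] nap_ev[OF h(2) M x u] idf_ev[OF M x, of 1] x M h(3) by simp
 qed (use h in "simp_all add: hom_def")
qed

context
 fixes e f :: 'b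
 assumes idem: "e * e = e" "f * f = f"
begin

abbreviation "tval et \<equiv> nap et reg (tau e f reg 1 (rr 1))"

text \<open>Naturality along b \<mapsto> bm and linearity in x move every computation to the single
  element \<open>tau e f reg 1 (rr 1)\<close>.\<close>

lemma nap_T:
 assumes h: "et : hom E (TF e f) F" and M: "M : SM" "m : carr M"
 shows "nap et M (tau e f M x m) = act (fobj F M) x (ev F M m (tval et))"
proof -
 note r = T_carr[OF idem reg, of "rr 1" 1, simplified] and c = T_carr[OF idem M]
 have "ev (TF e f) M m (tau e f reg 1 (rr 1)) = tau e f M 1 m"
  unfolding ev_def using fap_TF[OF idem mh(1)[OF M], of "rr 1" 1] mh[OF M] M by simp
 then have "nap et M (tau e f M 1 m) = ev F M m (tval et)" using nap_ev[OF h M r] by simp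
 moreover have "tau e f M x m = act (fobj (TF e f) M) x (tau e f M 1 m)" using T_act[OF idem M, of x 1] by simp
 moreover have "et : arr E" "src E et = TF e f" "tgt E et = F" using h by (simp_all add: hom_def)
 ultimately show ?thesis using nap(3)[OF \<open>et : arr E\<close> M(1), of "tau e f M 1 m" x] c by simp
qed

lemma T_eqI:
 assumes "et : hom E (TF e f) F" "ep : hom E (TF e f) F"
  "!!M x m. M : SM ==> m : carr M ==> nap et M (tau e f M x m) = nap ep M (tau e f M x m)"
 shows "et = ep"
proof (rule E_eqI)
 have h: "et : arr E" "src E et = TF e f" "tgt E et = F" "ep : arr E" "src E ep = TF e f" "tgt E ep = F"
  using assms by (simp_all add: hom_def)
 then show "et : arr E" "ep : arr E" "src E et = src E ep" "tgt E et = tgt E ep" by simp_all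
 fix M z assume M: "M : SM" and "z : carr (fobj (src E ep) M)"
 then have z: "z : carr (fobj (TF e f) M)" using h by simp
 show "nap et M z = nap ep M z"
  by (rule T_ext[OF idem M, of "fobj F M"])
   (use module_hom_additive[OF nap_hom[OF h(1) M]] module_hom_additive[OF nap_hom[OF h(4) M]] h z assms(3)[OF M] in simp_all)
qed

lemma T_val_eqI: "[|et : hom E (TF e f) F; ep : hom E (TF e f) F; tval et = tval ep|] ==> et = ep"
 by (rule T_eqI) (simp_all only: nap_T)

lemma generated_T: "generated (TF e f) (tau e f reg 1 (rr 1))"
 unfolding generated_def using lin_TF[OF idem] T_carr[OF idem reg reg_simps(1)] T_val_eqI by blast

lemma T_hom:
 assumes F: "lin F" and hom: "!!M. M : SM ==> module_hom (fobj (TF e f) M) (fobj F M) (H M)"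
  and nat: "!!g x m. g : arr D ==> m : carr (src D g) ==>
   H (tgt D g) (tau e f (tgt D g) x (ap g m)) = fap F g (H (src D g) (tau e f (src D g) x m))"
 shows "EX et : hom E (TF e f) F. ALL M : SM. ALL z : carr (fobj (TF e f) M). nap et M z = H M z"
proof -
 have n: "H (tgt D g) (fap (TF e f) g z) = fap F g (H (src D g) z)" if g: "g : arr D" and z: "z : carr (fobj (TF e f) (src D g))" for g z
 proof -
  note s = arr_DD(1,2)[OF g]
  have a: "additive (fobj (TF e f) (src D g)) (fobj (TF e f) (tgt D g)) (fap (TF e f) g)"
   "additive (fobj F (src D g)) (fobj F (tgt D g)) (fap F g)"
   unfolding additive_def using fap(1,2)[OF lin_TF[OF idem] g] fap(1,2)[OF F g] by blast+
  show ?thesis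
   by (rule T_ext[OF idem s(1) additive_comp[OF a(1) module_hom_additive[OF hom[OF s(2)]]]
      additive_comp[OF module_hom_additive[OF hom[OF s(1)]] a(2)] _ z])
    (use fap_TF[OF idem g] nat[OF g] in simp)
 qed
 have 1: "ALL M : SM. module_hom (fobj (TF e f) M) (fobj F M) (H M)" using hom by blast
 have 2: "ALL g : arr D. ALL z : carr (fobj (TF e f) (src D g)). H (tgt D g) (fap (TF e f) g z) = fap F g (H (src D g) z)"
  using n by blast
 note m = mknt_ball[OF lin_TF[OF idem] F 1 2]
 show ?thesis by (rule bexI[of _ "mknt (TF e f) H F"]) (use m in "auto simp: hom_def")
qed

text \<open>The existence half of the Yoneda lemma. For F = X \<otimes>_B _ the map is xe \<otimes>
  f \<otimes> m \<mapsto> xeu \<otimes> fm, so only the part euf of u matters; inserting e and f in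
  the formula allows an arbitrary u.\<close>

lemma yoneda_ex:
 assumes F: "lin F" and u: "u : carr (fobj F reg)"
 shows "EX et : hom E (TF e f) F. ALL M : SM. ALL x. ALL m : carr M.
  nap et M (tau e f M x m) = act (fobj F M) (x * e) (ev F M (act M f m) u)"
proof -
 let ?h = "%M x m. act (fobj F M) (x * e) (ev F M (act M f m) u)"
 have "EX H. module_hom (fobj (TF e f) M) (fobj F M) H & (ALL x. ALL m : carr M. H (tau e f M x m) = ?h M x m)"
  if M: "M : SM" for M
 proof (rule T_universal[OF idem M])
  note Fm = lin_mod[OF F M] and Mm = small_modulesD(1)[OF M]
  have c: "ev F M (act M f m) u : carr (fobj F M)" if "m : carr M" for m using ev_carr[OF F M _ u] that Mm by simp
  show "left_module (fobj F M)" by (rule Fm)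
  fix m assume m: "m : carr M"
  show "?h M x m : carr (fobj F M)" for x using c[OF m] Fm by simp
  show "?h M (x + y) m = pls (fobj F M) (?h M x m) (?h M y m)" for x y
   using c[OF m] Fm by (simp add: distrib_right act_add)
  show "?h M (x * e) m = ?h M x m" for x using idem by (simp add: mult.assoc)
  show "?h M x (act M f m) = ?h M x m" for x using m Mm idem by simp
  show "?h M (b * x) m = act (fobj F M) b (?h M x m)" for b x using c[OF m] Fm by (simp add: mult.assoc)
  show "?h M (sc a x) m = ?h M x (act M (sc a 1) m)" for a x
  proof -
   have "act M f (act M (sc a 1) m) = act M (sc a 1) (act M f m)" using m Mm by simp
   then have "ev F M (act M f (act M (sc a 1) m)) u = act (fobj F M) (sc a 1) (ev F M (act M f m) u)"
    using ev_scl[OF F M _ u, of "act M f m" a] m Mm by simp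
   then show ?thesis using c[OF m] Fm by simp
  qed
  fix n x assume n: "n : carr M"
  have "ev F M (act M f (pls M m n)) u = pls (fobj F M) (ev F M (act M f m) u) (ev F M (act M f n) u)"
   using ev_pls[OF F M _ _ u, of "act M f m" "act M f n"] m n Mm by (simp add: act_pls)
  then show "?h M x (pls M m n) = pls (fobj F M) (?h M x m) (?h M x n)"
   using c[OF m] c[OF n] Fm by (simp add: act_pls)
 qed
 then have "ALL M : SM. EX H. module_hom (fobj (TF e f) M) (fobj F M) H & (ALL x. ALL m : carr M. H (tau e f M x m) = ?h M x m)"
  by blast
 from bchoice[OF this] obtain H where H: "!!M. M : SM ==> module_hom (fobj (TF e f) M) (fobj F M) (H M)"
  "!!M x m. M : SM ==> m : carr M ==> H M (tau e f M x m) = ?h M x m" by blast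
 have "EX et : hom E (TF e f) F. ALL M : SM. ALL z : carr (fobj (TF e f) M). nap et M z = H M z"
 proof (rule T_hom[OF F H(1)])
  show "M : SM" if "M : SM" for M :: "('k, 'b) smod" using that .
  fix g x m assume g: "g : arr D" and m: "m : carr (src D g)"
  note s = arr_DD[OF g]
  have fm: "act (src D g) f m : carr (src D g)" using m s by simp
  have "fap F g (?h (src D g) x m) = act (fobj F (tgt D g)) (x * e) (fap F g (ev F (src D g) (act (src D g) f m) u))"
   by (rule fap(3)[OF F g]) (rule ev_carr[OF F s(1) fm u])
  also have "fap F g (ev F (src D g) (act (src D g) f m) u) = ev F (tgt D g) (act (tgt D g) f (ap g m)) u"
   using ev_nat[OF F g fm u] s(7)[OF m] by simp
  finally show "H (tgt D g) (tau e f (tgt D g) x (ap g m)) = fap F g (H (src D g) (tau e f (src D g) x m))"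
   using H(2)[OF s(1) m] H(2)[OF s(2) s(5)[OF m]] by simp
 qed
 then obtain et where et: "et : hom E (TF e f) F" "!!M z. M : SM ==> z : carr (fobj (TF e f) M) ==> nap et M z = H M z"
  by blast
 show ?thesis
 proof (intro bexI[OF _ et(1)] ballI allI)
  fix M :: "('k, 'b) smod" and x m assume M: "M : SM" and m: "m : carr M"
  show "nap et M (tau e f M x m) = ?h M x m" using et(2)[OF M T_carr[OF idem M m]] H(2)[OF M m] by simp
 qed
qed

end

end

section \<open>Additive categories generated by finitely many objects\<close>

inductive_set espan :: "('k, 'o, 'a, 'z) lincat_scheme \<Rightarrow> 'a set \<Rightarrow> 'o \<Rightarrow> 'o \<Rightarrow> 'a set"
 for C U X Y where
 zero: "zro C X Y : espan C U X Y"
| step: "v : espan C U X Y ==> u : U ==> add C (scl C c u) v : espan C U X Y"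

lemma thru_mono: "A <= B ==> thru C A X Y <= thru C B X Y"
proof
 fix f assume "f : thru C A X Y" and "A <= B"
 then show "f : thru C B X Y" by induction (auto intro: thru.intros)
qed

lemma (in precat) espan_hom: "[|v : espan C U X Y; U <= hom C X Y; X : obj C; Y : obj C|] ==> v : hom C X Y"
 by (induction rule: espan.induct) (auto simp: hom_def subset_iff)

lemma espan_full_subcat: "espan (full_subcat C A) U X Y = espan C U X Y"
proof (intro equalityI subsetI)
 fix f assume "f : espan (full_subcat C A) U X Y"
 then show "f : espan C U X Y" by induction (auto intro: espan.intros)
next
 fix f assume "f : espan C U X Y"
 then show "f : espan (full_subcat C A) U X Y"
 proof induction
  case zero
  then show ?case using espan.zero[of "full_subcat C A" X Y U] by simp
 next
  case (step v u c)
  then show ?case using espan.step[of v "full_subcat C A" U X Y u c] by simp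
 qed
qed

locale addcat = precat C for C :: "('k::field, 'o, 'a, 'z) lincat_scheme" +
 assumes zero_ex: "EX Z. is_zero C Z"
  and biproduct_ex: "[|X : obj C; Y : obj C|] ==> EX S. is_biproduct C [X, Y] S"
  and split: "[|pj : hom C X X; cmp C pj pj = pj|] ==>
   EX Y. EX i : hom C Y X. EX p : hom C X Y. cmp C p i = idt C Y & cmp C i p = pj"
begin

lemma biproductE:
 assumes "X : obj C" "Y : obj C"
 obtains S i1 i2 p1 p2 where "is_biproduct C [X, Y] S" "S : obj C" "i1 : arr C" "src C i1 = X" "tgt C i1 = S"
  "i2 : arr C" "src C i2 = Y" "tgt C i2 = S" "p1 : arr C" "src C p1 = S" "tgt C p1 = X"
  "p2 : arr C" "src C p2 = S" "tgt C p2 = Y" "p1 *. i1 = idt C X" "p2 *. i2 = idt C Y"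
  "p1 *. i2 = zro C Y X" "p2 *. i1 = zro C X Y" "i1 *. p1 +. i2 *. p2 = idt C S"
proof -
 obtain S where S: "is_biproduct C [X, Y] S" using biproduct_ex[OF assms] by blast
 then obtain i1 i2 p1 p2 where "S : obj C" "i1 : hom C X S" "i2 : hom C Y S" "p1 : hom C S X" "p2 : hom C S Y"
  "p1 *. i1 = idt C X" "p2 *. i2 = idt C Y" "p1 *. i2 = zro C Y X" "p2 *. i1 = zro C X Y" "i1 *. p1 +. i2 *. p2 = idt C S"
  unfolding biproduct2_iff by blast
 then show ?thesis using S by (intro that[of S i1 i2 p1 p2]) (simp_all add: hom_def)
qed

text \<open>The complement splits the idempotent 1 - i p.\<close>

lemma complement:
 assumes "i : hom C G X" "p : hom C X G" "p *. i = idt C G"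
 shows "EX Y q j. j : hom C Y X & q : hom C X Y & q *. j = idt C Y & q *. i = zro C G Y & p *. j = zro C Y G &
  i *. p +. j *. q = idt C X"
proof -
 have t: "i : arr C" "src C i = G" "tgt C i = X" "p : arr C" "src C p = X" "tgt C p = G"
  using assms(1,2) by (simp_all add: hom_def)
 have o: "G : obj C" "X : obj C" using t src_obj tgt_obj by metis+
 note pi = assms(3)
 define pj where "pj = idt C X +. -.(i *. p)"
 have pj: "pj : arr C" "src C pj = X" "tgt C pj = X" using t o by (simp_all add: pj_def)
 have pe: "p *. pj = zro C X G"
  using t o cmp_reassoc[OF pi t(4) t(4,1)] by (simp add: pj_def cmp_add cmp_scl add_neg)
 have ei: "pj *. i = zro C G X"
  using t o pi by (simp add: pj_def add_cmp scl_cmp cmp_assoc add_neg)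
 have "pj *. pj = pj +. -.(i *. (p *. pj))"
  using pj t o by (subst (1) pj_def) (simp add: add_cmp scl_cmp cmp_assoc)
 then have "pj *. pj = pj" using pe t o pj by simp
 moreover have "pj : hom C X X" using pj by (simp add: hom_def)
 ultimately obtain Y j q where jq: "j : hom C Y X" "q : hom C X Y" "q *. j = idt C Y" "j *. q = pj" using split by blast
 have s: "j : arr C" "src C j = Y" "tgt C j = X" "q : arr C" "src C q = X" "tgt C q = Y"
  using jq(1,2) by (simp_all add: hom_def)
 have Y: "Y : obj C" using s src_obj by metis
 have "q *. pj = q" using cmp_reassoc[OF jq(3) s(4) s(4,1)] s by (simp flip: jq(4))
 then have "q *. i = q *. (pj *. i)" using cmp_assoc[of q pj i] s pj t by simp
 then have 1: "q *. i = zro C G Y" using ei s o by simp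
 have "pj *. j = j" using s jq(3) by (simp add: cmp_assoc flip: jq(4))
 then have "p *. j = (p *. pj) *. j" using s pj t by (simp add: cmp_assoc)
 then have 2: "p *. j = zro C Y G" using pe s o by simp
 have "i *. p +. pj = idt C X"
  unfolding pj_def using t o by (subst add_left_commute) (simp_all add: add_neg)
 then show ?thesis using jq 1 2 by blast
qed

lemma retract_summand:
 assumes "retract C X S" shows "direct_summand C X S"
proof -
 obtain i p where ip: "i : hom C X S" "p : hom C S X" "p *. i = idt C X" using assms unfolding retract_def by blast
 obtain Y q j where "j : hom C Y S" "q : hom C S Y" "q *. j = idt C Y" "q *. i = zro C X Y" "p *. j = zro C Y X"
  "i *. p +. j *. q = idt C S" using complement[OF ip] by blast
 moreover from this have "Y : obj C" using src_obj by (auto simp: hom_def)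
 ultimately show ?thesis unfolding direct_summand_def biproduct2_iff using retract_obj[OF assms] ip by blast
qed

text \<open>The intermediate objects are collected into a biproduct one at a time, with the first
  factors stacked into a column and the second ones into a row.\<close>

lemma thru_biproduct:
 assumes "f : thru C H X Y" "X : obj C" "Y : obj C"
 shows "EX Ws S. EX i : hom C X S. EX p : hom C S Y. set Ws <= H & is_biproduct C Ws S & f = p *. i"
 using assms(1)
proof induction
 case zero
 obtain Z where Z: "is_zero C Z" using zero_ex by blast
 then have "Z : obj C" by (simp add: is_zero_def)
 then show ?case using Z biproduct_Nil[OF Z] assms(2,3)
  by (intro exI[of _ "[]"] exI[of _ Z] bexI[of _ "zro C X Z"] bexI[of _ "zro C Z Y"]) (simp_all add: hom_def)
next
 case (step f i W p)
 then obtain Ws S j q where s: "j : hom C X S" "q : hom C S Y" "set Ws <= H" "is_biproduct C Ws S" "f = q *. j" by blast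
 have t: "i : arr C" "src C i = X" "tgt C i = W" "p : arr C" "src C p = W" "tgt C p = Y"
  "j : arr C" "src C j = X" "tgt C j = S" "q : arr C" "src C q = S" "tgt C q = Y"
  using step s by (simp_all add: hom_def)
 have o: "W : obj C" "S : obj C" using t src_obj tgt_obj by metis+
 obtain T i1 i2 p1 p2 where b: "is_biproduct C [W, S] T" "T : obj C" "i1 : arr C" "src C i1 = W" "tgt C i1 = T"
  "i2 : arr C" "src C i2 = S" "tgt C i2 = T" "p1 : arr C" "src C p1 = T" "tgt C p1 = W"
  "p2 : arr C" "src C p2 = T" "tgt C p2 = S" "p1 *. i1 = idt C W" "p2 *. i2 = idt C S"
  "p1 *. i2 = zro C S W" "p2 *. i1 = zro C W S" using biproductE[OF o] by metis
 let ?i = "i1 *. i +. i2 *. j" and ?p = "p *. p1 +. q *. p2"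
 have "p1 *. ?i = i" "p2 *. ?i = j"
  using t b o cmp_reassoc[OF b(15) t(1)] cmp_reassoc[OF b(16) t(7)] cmp_reassoc[OF b(17) t(7)] cmp_reassoc[OF b(18) t(1)]
  by (simp_all add: cmp_add)
 then have "?p *. ?i = p *. i +. q *. j" using t b by (simp add: add_cmp cmp_assoc)
 then have "f +. p *. i = ?p *. ?i" using t s(5) by (simp add: add_commute[of "q *. j"])
 moreover have "?i : hom C X T" "?p : hom C T Y" using t b by (simp_all add: hom_def)
 moreover have "is_biproduct C (W # Ws) T" by (rule biproduct_Cons[OF s(4) b(1)])
 moreover have "set (W # Ws) <= H" using s(3) step(4) by simp
 ultimately show ?case by blast
qed

text \<open>Trades biproducts and summands for a condition on the identity of X, so that closure
  under composition and retracts becomes a computation in an ideal of arrows.\<close>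

lemma additive_closure_eq:
 assumes "H <= obj C" shows "additive_closure C H = {X \<in> obj C. idt C X : thru C H X X}"
proof (intro equalityI subsetI)
 fix X assume "X : additive_closure C H"
 then obtain Xs S where S: "set Xs <= H" "is_biproduct C Xs S" "direct_summand C X S"
  unfolding additive_closure_def by blast
 have r: "retract C X S" by (rule direct_summand_retract[OF S(3)])
 have "idt C S : thru C H S S" by (rule subsetD[OF thru_mono[OF S(1)] biproduct_thru[OF S(2)]])
 then show "X : {X \<in> obj C. idt C X : thru C H X X}" using retract_thru[OF _ r] retract_obj[OF r] by blast
next
 fix X assume "X : {X \<in> obj C. idt C X : thru C H X X}"
 then have X: "X : obj C" "idt C X : thru C H X X" by auto
 obtain Ws S i p where S: "i : hom C X S" "p : hom C S X" "set Ws <= H" "is_biproduct C Ws S" "idt C X = p *. i"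
  using thru_biproduct[OF X(2,1,1)] by blast
 then have "retract C X S" unfolding retract_def by metis
 then show "X : additive_closure C H" unfolding additive_closure_def using S retract_summand by blast
qed

lemma biproduct_in_closure:
 assumes "is_biproduct C [X, Y] S" "idt C X : thru C H X X" "idt C Y : thru C H Y Y" shows "idt C S : thru C H S S"
proof -
 have o: "S : obj C" using assms(1) unfolding biproduct2_iff by blast
 have "idt C S : thru C {X, Y} S S" using biproduct_thru[OF assms(1)] by simp
 then show ?thesis by (rule thru_trans) (use assms o in auto)
qed

lemma addcat_closure: "addcat (full_subcat C {X \<in> obj C. idt C X : thru C H X X})" (is "addcat (full_subcat C ?A)")
proof -
 interpret S: precat "full_subcat C ?A" by (rule precat_full_subcat) blast
 show ?thesis
 proof unfold_locales
  obtain Z where Z: "is_zero C Z" using zero_ex by blast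
  then have "Z : ?A" using thru.zero[of C Z Z H] by (simp add: is_zero_iff)
  then show "EX Z. is_zero (full_subcat C ?A) Z" using Z by (auto simp: S.is_zero_iff is_zero_iff)
 next
  fix X Y assume "X : obj (full_subcat C ?A)" "Y : obj (full_subcat C ?A)"
  then have XY: "X : ?A" "Y : ?A" by simp_all
  then obtain S where S: "is_biproduct C [X, Y] S" using biproduct_ex by blast
  have "idt C S : thru C H S S" by (rule biproduct_in_closure[OF S]) (use XY in simp_all)
  then have "S : ?A" using S unfolding biproduct2_iff by blast
  then have "is_biproduct (full_subcat C ?A) [X, Y] S"
   using S XY unfolding biproduct2_iff S.biproduct2_iff by (simp add: hom_full_subcat)
  then show "EX S. is_biproduct (full_subcat C ?A) [X, Y] S" by blast
 next
  fix pj X assume "pj : hom (full_subcat C ?A) X X" "cmp (full_subcat C ?A) pj pj = pj"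
  then have X: "X : ?A" "pj : hom C X X" "pj *. pj = pj" by (auto simp: hom_full_subcat split: if_splits)
  obtain Y i p where Y: "i : hom C Y X" "p : hom C X Y" "p *. i = idt C Y" "i *. p = pj" using split[OF X(2,3)] by blast
  have r: "retract C Y X" using Y unfolding retract_def by blast
  have "Y : ?A" using retract_thru[OF _ r] retract_obj[OF r] X(1) by blast
  then show "EX Y. EX i : hom (full_subcat C ?A) Y X. EX p : hom (full_subcat C ?A) X Y.
    cmp (full_subcat C ?A) p i = idt (full_subcat C ?A) Y & cmp (full_subcat C ?A) i p = pj"
   using Y X(1) by (auto simp: hom_full_subcat)
 qed
qed

lemma join:
 assumes "x : arr C" "y : arr C" "tgt C x = tgt C y"
 shows "EX s i j p q. s : arr C & tgt C s = tgt C x & i : hom C (src C x) (src C s) & j : hom C (src C y) (src C s) &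
    p : hom C (src C s) (src C x) & q : hom C (src C s) (src C y) &
    x = cmp C s i & y = cmp C s j & s = add C (cmp C x p) (cmp C y q)"
proof -
 obtain S i1 i2 p1 p2 where b: "S : obj C" "i1 : arr C" "src C i1 = src C x" "tgt C i1 = S"
  "i2 : arr C" "src C i2 = src C y" "tgt C i2 = S" "p1 : arr C" "src C p1 = S" "tgt C p1 = src C x"
  "p2 : arr C" "src C p2 = S" "tgt C p2 = src C y" "p1 *. i1 = idt C (src C x)" "p2 *. i2 = idt C (src C y)"
  "p1 *. i2 = zro C (src C y) (src C x)" "p2 *. i1 = zro C (src C x) (src C y)"
  using biproductE[OF src_obj[OF assms(1)] src_obj[OF assms(2)]] by metis
 let ?s = "x *. p1 +. y *. p2"
 have "?s *. i1 = x" "?s *. i2 = y" using b assms by (simp_all add: add_cmp cmp_assoc)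
 moreover have "?s : arr C" "src C ?s = S" "tgt C ?s = tgt C x" using b assms by simp_all
 ultimately show ?thesis using b
  by (intro exI[of _ ?s] exI[of _ i1] exI[of _ i2] exI[of _ p1] exI[of _ p2]) (simp add: hom_def)
qed

text \<open>The arrows are joined one at a time; P survives because it is closed under the sums that
  occur in a join.\<close>

lemma cover:
 assumes "finite U" "ALL u : U. u : arr C & tgt C u = Y & P u" and Y: "Y : obj C"
  and zero: "!!Z. is_zero C Z ==> P (zro C Z Y)"
  and sum: "!!x y p q. [|x : arr C; tgt C x = Y; y : arr C; tgt C y = Y; p : arr C; tgt C p = src C x;
   q : arr C; tgt C q = src C y; src C p = src C q; P x; P y|] ==> P (x *. p +. y *. q)"
 shows "EX rh : arr C. tgt C rh = Y & P rh & (ALL u : U. factors C rh u)"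
 using assms(1,2)
proof induction
 case empty
 obtain Z where Z: "is_zero C Z" using zero_ex by blast
 then show ?case using zero[OF Z] Y by (intro bexI[of _ "zro C Z Y"]) (simp_all add: is_zero_def)
next
 case (insert x U)
 then obtain y where y: "y : arr C" "tgt C y = Y" "P y" "ALL u : U. factors C y u" by auto
 have x: "x : arr C" "tgt C x = Y" "P x" using insert by auto
 obtain s i j p q where s: "s : arr C" "tgt C s = tgt C x" "i : hom C (src C x) (src C s)" "j : hom C (src C y) (src C s)"
  "p : hom C (src C s) (src C x)" "q : hom C (src C s) (src C y)" "x = s *. i" "y = s *. j" "s = x *. p +. y *. q"
 proof -
  have "tgt C x = tgt C y" using x(2) y(2) by simp
  from join[OF x(1) y(1) this] show ?thesis by (elim exE conjE) (rule that)
 qed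
 have "P (x *. p +. y *. q)" by (rule sum) (use x y s(5,6) in "simp_all add: hom_def")
 then have "P s" using s(9) by simp
 moreover have "factors C s x" by (rule factorsI[of i]) (use s(3,7) in "simp_all add: hom_def")
 moreover have "factors C s u" if u: "u : U" for u
 proof -
  have "factors C y u" using y u by blast
  then obtain h where h: "h : arr C" "src C h = src C u" "tgt C h = src C y" "u = y *. h" by (rule factorsE)
  have j: "j : arr C" "src C j = src C y" "tgt C j = src C s" using s(4) by (simp_all add: hom_def)
  have "(s *. j) *. h = s *. (j *. h)" by (rule cmp_assoc) (use s(1) j h(1,3) in simp_all)
  then have "u = s *. (j *. h)" unfolding s(8)[symmetric] h(4)[symmetric] .
  then show ?thesis by (intro factorsI[of "j *. h"]) (use h(1-3) j in simp_all)
 qed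
 ultimately show ?case using s(1,2) x(2) by (intro bexI[of _ s]) auto
qed

end

text \<open>\<open>span\<close> says that subspaces of the morphism spaces out of a generator are
  finitely spanned. Together with the finiteness of H it yields single arrows through which a whole
  class of arrows factors.\<close>

locale gencat = addcat C for C :: "('k::field, 'o, 'a, 'z) lincat_scheme" +
 fixes H :: "'o set"
 assumes H: "H <= obj C" "finite H"
  and gen: "X : obj C ==> idt C X : thru C H X X"
  and span: "[|W : H; Y : obj C; V <= hom C W Y; zro C W Y : V; ALL u : V. ALL v : V. add C u v : V;
   ALL c. ALL u : V. scl C c u : V|] ==> EX U. finite U & U <= V & V <= espan C U W Y"
begin

lemma factors_scl:
 assumes "factors C be s" "be : arr C" shows "factors C be (scl C c s)"
proof -
 obtain h where h: "h : arr C" "src C h = src C s" "tgt C h = src C be" "s = be *. h" using assms(1) by (rule factorsE)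
 have s: "s : arr C" using h(1,3,4) assms(2) by simp
 show ?thesis by (rule factorsI[of "scl C c h"]) (use h(1-3) s assms cmp_scl[of be h c] h(4)[symmetric] in simp_all)
qed

lemma factors_espan:
 assumes "v : espan C U X Y" "U <= hom C X Y" "X : obj C" "Y : obj C" "ALL u : U. factors C rh u" "rh : arr C" "tgt C rh = Y"
 shows "factors C rh v"
 using assms(1)
proof induction
 case zero
 then show ?case using factors_zro assms by blast
next
 case (step v u c)
 then have "u : hom C X Y" "v : hom C X Y" using assms(2) espan_hom[OF step(1) assms(2-4)] by auto
 then show ?case using step assms by (intro factors_add factors_scl) (simp_all add: hom_def)
qed

lemma factors_thru:
 assumes "f : thru C H X Z" "X : obj C" "t : arr C" "src C t = Z" "rh : arr C" "tgt C rh = tgt C t"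
  "!!W p. W : H ==> p : hom C W Z ==> factors C rh (t *. p)"
 shows "factors C rh (t *. f)"
 using assms(1)
proof induction
 case zero
 have "t *. zro C X Z = zro C X (tgt C t)" using assms(2-4) by simp
 then show ?case using factors_zro[OF assms(5,2,6)] by simp
next
 case (step f i W p)
 have Z: "Z : obj C" using assms(3,4) by auto
 have s: "f : arr C" "src C f = X" "tgt C f = Z" "i : arr C" "src C i = X" "tgt C i = W" "p : arr C" "src C p = W" "tgt C p = Z"
  using step thru_hom[OF step(1) assms(2) Z] by (simp_all add: hom_def)
 have "factors C rh ((t *. p) *. i)"
  by (rule factors_cmp[OF assms(7)[OF step(4,3)] assms(5)]) (use s assms(3,4) in simp_all)
 then have "factors C rh (t *. f +. (t *. p) *. i)" by (intro factors_add step.IH assms(5)) (use s assms(3,4) in simp_all)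
 then show ?case using s assms(3,4) by (simp add: cmp_add cmp_assoc)
qed

lemma factors_all:
 assumes "t : arr C" "rh : arr C" "tgt C rh = tgt C t" "!!W p. W : H ==> p : hom C W (src C t) ==> factors C rh (t *. p)"
 shows "factors C rh t"
 using factors_thru[OF gen[OF src_obj[OF assms(1)]] src_obj[OF assms(1)] assms(1) refl assms(2-4)] assms(1) by simp

text \<open>P describes a subfunctor of the arrows into Y, or at least a class closed under sums and
  precomposition. Finite spanning sets of it on the finitely many generators are joined into one
  arrow, and every object is a summand of a sum of generators. Weak kernels and sink maps are the
  two instances.\<close>

lemma weakly_terminal:
 assumes Y: "Y : obj C"
  and zero: "!!Z. Z : obj C ==> P (zro C Z Y)"
  and sum: "!!x y p q. [|x : arr C; tgt C x = Y; y : arr C; tgt C y = Y; p : arr C; tgt C p = src C x;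
   q : arr C; tgt C q = src C y; src C p = src C q; P x; P y|] ==> P (x *. p +. y *. q)"
  and pre: "!!x p. [|x : arr C; tgt C x = Y; p : arr C; tgt C p = src C x; P x|] ==> P (x *. p)"
 shows "EX rh : arr C. tgt C rh = Y & P rh & (ALL t : arr C. tgt C t = Y & P t \<longrightarrow> factors C rh t)"
proof -
 let ?V = "%W. {u \<in> hom C W Y. P u}"
 have "EX U. finite U & U <= ?V W & ?V W <= espan C U W Y" if W: "W : H" for W
 proof (rule span[OF W Y])
  have o: "W : obj C" using W H by blast
  show "zro C W Y : ?V W" using zero o Y by (simp add: hom_def)
  show "ALL u : ?V W. ALL v : ?V W. u +. v : ?V W"
  proof (intro ballI)
   fix u v assume "u : ?V W" "v : ?V W"
   then show "u +. v : ?V W" using sum[of u v "idt C W" "idt C W"] o by (simp add: hom_def)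
  qed
  show "ALL c. ALL u : ?V W. scl C c u : ?V W"
  proof (intro allI ballI)
   fix c u assume "u : ?V W"
   then show "scl C c u : ?V W" using pre[of u "scl C c (idt C W)"] o cmp_scl[of u "idt C W" c] by (simp add: hom_def)
  qed
 qed blast
 then have "ALL W : H. EX U. finite U & U <= ?V W & ?V W <= espan C U W Y" by blast
 from bchoice[OF this] obtain U where "ALL W : H. finite (U W) & U W <= ?V W & ?V W <= espan C (U W) W Y" ..
 then have U: "finite (U W) & U W <= ?V W & ?V W <= espan C (U W) W Y" if "W : H" for W using that by (rule bspec)
 have Uv: "u : arr C & tgt C u = Y & P u" if "W : H" "u : U W" for W u
 proof -
  have "u : ?V W" using U[OF that(1)] that(2) by blast
  then show ?thesis by (simp add: hom_def)
 qed
 have "EX rh : arr C. tgt C rh = Y & P rh & (ALL u : (\<Union>W \<in> H. U W). factors C rh u)"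
 proof (rule cover[OF _ _ Y])
  show "finite (\<Union>W \<in> H. U W)" using H(2) U by simp
  show "ALL u : (\<Union>W \<in> H. U W). u : arr C & tgt C u = Y & P u" by (intro ballI) (elim UN_E, rule Uv)
  show "P (zro C Z Y)" if "is_zero C Z" for Z using zero that by (simp add: is_zero_def)
 qed (rule sum)
 then obtain rh where r: "rh : arr C" "tgt C rh = Y & P rh & (ALL u : (\<Union>W \<in> H. U W). factors C rh u)" by (rule bexE)
 have rh: "rh : arr C" "tgt C rh = Y" "P rh" "!!W u. W : H ==> u : U W ==> factors C rh u"
  using r by auto
 have "factors C rh t" if t: "t : arr C" "tgt C t = Y" "P t" for t
 proof (rule factors_all[OF t(1) rh(1)])
  show "tgt C rh = tgt C t" using rh t by simp
  fix W p assume W: "W : H" and p: "p : hom C W (src C t)"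
  then have pt: "p : arr C" "src C p = W" "tgt C p = src C t" by (simp_all add: hom_def)
  have "t *. p : ?V W" using pre[OF t(1,2) pt(1,3) t(3)] t pt by (simp add: hom_def)
  then have "t *. p : espan C (U W) W Y" using U[OF W] by blast
  then show "factors C rh (t *. p)"
  proof (rule factors_espan[OF _ _ _ Y _ rh(1,2)])
   show "U W <= hom C W Y" using U[OF W] by blast
   show "W : obj C" using W H by blast
   show "ALL u : U W. factors C rh u" using rh(4)[OF W] by blast
  qed
 qed
 then show ?thesis using rh by blast
qed

lemma weak_kernel:
 assumes si: "si : arr C"
 shows "EX vnu : arr C. tgt C vnu = src C si & si *. vnu = zro C (src C vnu) (tgt C si) &
  (ALL t : arr C. tgt C t = src C si & si *. t = zro C (src C t) (tgt C si) \<longrightarrow> factors C vnu t)"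
proof (rule weakly_terminal)
 let ?P = "%u. si *. u = zro C (src C u) (tgt C si)"
 show "src C si : obj C" using si by simp
 show "?P (zro C Z (src C si))" if "Z : obj C" for Z using si that by simp
 show pre: "?P (x *. p)" if "x : arr C" "tgt C x = src C si" "p : arr C" "tgt C p = src C x" "?P x" for x p
  using cmp_reassoc[OF that(5) that(3) si that(1)] that si by simp
 show "?P (x *. p +. y *. q)" if "x : arr C" "tgt C x = src C si" "y : arr C" "tgt C y = src C si" "p : arr C" "tgt C p = src C x"
   "q : arr C" "tgt C q = src C y" "src C p = src C q" "?P x" "?P y" for x y p q
  using pre[OF that(1,2,5,6,10)] pre[OF that(3,4,7,8,11)] that(1-9) si by (simp add: cmp_add)
qed

lemma weak_pullback:
 assumes "x : arr C" "y : arr C" "tgt C x = tgt C y"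
 shows "EX u v. u : arr C & v : arr C & src C u = src C v & tgt C u = src C y & tgt C v = src C x &
    cmp C y u = cmp C x v &
    (ALL u' : arr C. ALL v' : arr C. src C u' = src C v' & tgt C u' = src C y & tgt C v' = src C x &
     cmp C y u' = cmp C x v' \<longrightarrow> factors C u u')"
proof -
 obtain S i1 i2 p1 p2 where b: "S : obj C" "i1 : arr C" "src C i1 = src C x" "tgt C i1 = S"
  "i2 : arr C" "src C i2 = src C y" "tgt C i2 = S" "p1 : arr C" "src C p1 = S" "tgt C p1 = src C x"
  "p2 : arr C" "src C p2 = S" "tgt C p2 = src C y" "p1 *. i1 = idt C (src C x)" "p2 *. i2 = idt C (src C y)"
  "p1 *. i2 = zro C (src C y) (src C x)" "p2 *. i1 = zro C (src C x) (src C y)"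
  using biproductE[OF src_obj[OF assms(1)] src_obj[OF assms(2)]] by metis
 \<comment> \<open>The weak pullback is a weak kernel of (x, -y) on the biproduct of the two
   sources.\<close>
 let ?si = "x *. p1 +. -.(y *. p2)"
 have si: "?si : arr C" "src C ?si = S" "tgt C ?si = tgt C y" using b assms by simp_all
 obtain vnu where vnu: "vnu : arr C" "tgt C vnu = S" "?si *. vnu = zro C (src C vnu) (tgt C y)"
  and wk: "!!t. [|t : arr C; tgt C t = S; ?si *. t = zro C (src C t) (tgt C y)|] ==> factors C vnu t"
  using weak_kernel[OF si(1)] unfolding si(2,3) by blast
 have eq: "?si *. t = x *. (p1 *. t) +. -.(y *. (p2 *. t))" if "t : arr C" "tgt C t = S" for t
  using that b assms by (simp add: add_cmp scl_cmp cmp_assoc)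
 let ?u = "p2 *. vnu" and ?v = "p1 *. vnu"
 have uv: "?u : arr C" "?v : arr C" "src C ?u = src C ?v" "tgt C ?u = src C y" "tgt C ?v = src C x" "src C ?u = src C vnu"
  using vnu b by simp_all
 have "-.(y *. ?u) +. x *. ?v = -.(y *. ?u) +. y *. ?u"
  using eq[OF vnu(1,2)] vnu(3) uv assms
  by (simp add: add_commute[of "-.(y *. ?u)"] add_neg)
 then have 1: "x *. ?v = y *. ?u" by (rule add_left_cancel) (use uv assms in simp_all)
 have 2: "factors C ?u u'" if "u' : arr C" "v' : arr C" "src C u' = src C v'" "tgt C u' = src C y" "tgt C v' = src C x"
  "y *. u' = x *. v'" for u' v'
 proof -
  let ?t = "i1 *. v' +. i2 *. u'"
  have t: "?t : arr C" "tgt C ?t = S" "src C ?t = src C u'" using that b by simp_all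
  have pt: "p1 *. ?t = v'" "p2 *. ?t = u'"
   using assms(1,2) that b cmp_reassoc[OF b(14) that(2)] cmp_reassoc[OF b(15) that(1)] cmp_reassoc[OF b(16) that(1)] cmp_reassoc[OF b(17) that(2)]
   by (simp_all add: cmp_add)
  have "?si *. ?t = zro C (src C ?t) (tgt C y)" unfolding eq[OF t(1,2)] pt t(3) using that assms by (simp add: add_neg)
  then have "factors C vnu ?t" by (rule wk[OF t(1,2)])
  then obtain h where h: "h : arr C" "src C h = src C u'" "tgt C h = src C vnu" "?t = vnu *. h" using t(3) by (rule factorsE_src)
  have "u' = ?u *. h" using pt(2) h(1,3,4) vnu(1,2) b by (simp add: cmp_assoc)
  then show ?thesis by (intro factorsI[of h]) (use h uv in simp_all)
 qed
 show ?thesis by (intro exI[of _ ?u] exI[of _ ?v]) (use uv 1 2 in auto)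
qed

text \<open>The arrows into G that do not split are closed under sums because G is local; the rest
  is formal.\<close>

lemma sink_map:
 assumes G: "is_loc C G"
 shows "EX rh : arr C. tgt C rh = G & ~ split_epi C rh & (ALL u : arr C. tgt C u = G & ~ split_epi C u \<longrightarrow> factors C rh u)"
proof (rule weakly_terminal)
 show o: "G : obj C" using G by (simp add: is_loc_def)
 show "~ split_epi C (zro C Z G)" if Z: "Z : obj C" for Z
 proof
  assume "split_epi C (zro C Z G)"
  then obtain s where "s : arr C" "src C s = tgt C (zro C Z G)" "tgt C s = src C (zro C Z G)"
   "zro C Z G *. s = idt C (tgt C (zro C Z G))" by (rule split_epiE)
  then have "idt C G = zro C G G" using Z o by simp
  then show False using G is_zeroI[OF o] by (simp add: is_loc_def)
 qed
 show "~ split_epi C (x *. p)" if "x : arr C" "tgt C x = G" "p : arr C" "tgt C p = src C x" "~ split_epi C x" for x p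
  using split_epi_left[OF _ that(1,3)] that(4,5) by metis
 have iso_split: "split_epi C x" if iso: "is_iso C (x *. p *. s)" and "x : arr C" "p : arr C" "s : arr C" "src C x = tgt C p" "src C p = tgt C s" for x p s
 proof -
  obtain g where "g : arr C" "src C g = tgt C (x *. p *. s)" "tgt C g = src C (x *. p *. s)" "(x *. p *. s) *. g = idt C (tgt C (x *. p *. s))"
   by (rule is_isoE[OF iso]) (rule that; assumption)
  then show ?thesis by (intro split_epiI[of "p *. s *. g"]) (use that in "simp_all add: cmp_assoc")
 qed
 show "~ split_epi C (x *. p +. y *. q)" if t: "x : arr C" "tgt C x = G" "y : arr C" "tgt C y = G" "p : arr C" "tgt C p = src C x"
   "q : arr C" "tgt C q = src C y" "src C p = src C q" and n: "~ split_epi C x" "~ split_epi C y" for x y p q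
 proof
  assume "split_epi C (x *. p +. y *. q)"
  then obtain s where "s : arr C" "src C s = tgt C (x *. p +. y *. q)" "tgt C s = src C (x *. p +. y *. q)"
   "(x *. p +. y *. q) *. s = idt C (tgt C (x *. p +. y *. q))" by (rule split_epiE)
  then have s: "s : arr C" "src C s = G" "tgt C s = src C q" "x *. p *. s +. y *. q *. s = idt C G"
   using t by (simp_all add: add_cmp cmp_assoc)
  have "is_iso C (x *. p *. s) \<or> is_iso C (y *. q *. s)" by (rule is_locD[OF G s(4)]) (use t s in simp_all)
  then show False using iso_split[of x p s] iso_split[of y q s] n t s by auto
 qed
qed

end

section \<open>Corner algebras of primitive idempotents are local\<close>

definition corner :: "'b::ring_1 \<Rightarrow> 'b set" where
 "corner e = {x. e * x = x & x * e = x}"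

definition cunit :: "'b::ring_1 \<Rightarrow> 'b \<Rightarrow> bool" where
 "cunit e x \<longleftrightarrow> x : corner e & (EX y : corner e. x * y = e & y * x = e)"

text \<open>The nonunits of the corner algebra; for a primitive idempotent they turn out to be a
  nilpotent ideal.\<close>

definition rad :: "'b::ring_1 \<Rightarrow> 'b set" where
 "rad e = {x \<in> corner e. ~ cunit e x}"

text \<open>A generating set of the p-th power of the radical, without sums. The trailing corner
  factor makes the case p = 0 the whole corner.\<close>

definition radp :: "'b::ring_1 \<Rightarrow> nat \<Rightarrow> 'b set" where
 "radp e p = {prod_list ns * y |ns y. length ns = p & set ns <= rad e & y : corner e}"

lemma cornerD: "x : corner e ==> e * x = x" "x : corner e ==> x * e = x"
 by (simp_all add: corner_def)

lemma corner_mult: "x : corner e ==> y : corner e ==> x * y : corner e"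
 unfolding corner_def by (simp add: mult.assoc) (simp flip: mult.assoc)

lemma corner_diff: "x : corner e ==> y : corner e ==> x - y : corner e"
 and corner_add: "x : corner e ==> y : corner e ==> x + y : corner e"
 unfolding corner_def by (simp_all add: algebra_simps)

context fdalg begin

text \<open>With d the size of a spanning set, d + 1 vectors are dependent, and the vector of least
  index in a relation is a combination of later ones. This is used for the powers of an element and
  for partial products of radical elements.\<close>

lemma chain_relation: "EX d. \<forall>v :: nat \<Rightarrow> 'b. \<exists>k \<le> d. v k : module.span sc (v ` {k<..d})"
proof -
 interpret vector_space sc by (rule vs)
 obtain Bs where Bs: "finite Bs" "span Bs = UNIV" by (rule basis)
 define d where "d = card Bs"
 have "\<exists>k \<le> d. v k : span (v ` {k<..d})" for v :: "nat \<Rightarrow> 'b"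
 proof (rule ccontr)
  assume neg: "~ ?thesis"
  have "j \<le> Suc d \<longrightarrow> independent (v ` {Suc d - j..d}) & card (v ` {Suc d - j..d}) = j" for j
  proof (induction j)
   case 0
   have "{Suc d - 0..d} = {}" by simp
   then show ?case by (simp only: image_empty) (simp add: independent_empty)
  next
   case (Suc j)
   show ?case
   proof
    assume j: "Suc j \<le> Suc d"
    let ?k = "d - j"
    have iv: "{Suc d - Suc j..d} = insert ?k {Suc d - j..d}" "{?k<..d} = {Suc d - j..d}" using j by auto
    have "v ?k \<notin> span (v ` {?k<..d})" using neg by auto
    then have n: "v ?k \<notin> span (v ` {Suc d - j..d})" unfolding iv(2) .
    then have "v ?k \<notin> v ` {Suc d - j..d}" using span_base by blast
    then show "independent (v ` {Suc d - Suc j..d}) & card (v ` {Suc d - Suc j..d}) = Suc j"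
     unfolding iv(1) image_insert using Suc.IH j n by (simp add: independent_insertI)
   qed
  qed
  from this[of "Suc d"] have "independent (v ` {0..d})" "card (v ` {0..d}) = Suc d" by simp_all
  moreover have "card (v ` {0..d}) \<le> card Bs"
   using independent_span_bound[OF Bs(1) calculation(1)] Bs(2) by simp
  ultimately show False by (simp add: d_def)
 qed
 then show ?thesis by blast
qed

text \<open>Horner evaluation at x; multiplied by e it becomes evaluation in the corner algebra,
  whose unit is e.\<close>

definition pev :: "'b \<Rightarrow> 'k poly \<Rightarrow> 'b" where
 "pev x p = fold_coeffs (%a b. sc a 1 + x * b) p 0"

lemma pev_0 [simp]: "pev x 0 = 0"
 by (simp add: pev_def)

lemma pev_pCons [simp]: "pev x (pCons a p) = sc a 1 + x * pev x p"
 by (cases "p = 0"; cases "a = 0") (simp_all add: pev_def)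

lemma pev_add: "pev x (p + q) = pev x p + pev x q"
 by (induction p q rule: poly_induct2) (simp_all add: sc_add distrib_left)

lemma pev_smult: "pev x (smult c p) = sc c (pev x p)"
 by (induction p) (simp_all add: sc_add)

lemma pev_mult: "pev x (p * q) = pev x p * pev x q"
 by (induction p) (simp_all add: pev_add pev_smult distrib_right mult.assoc)

context
 fixes e x :: 'b
 assumes ee: "e * e = e" and x: "x : corner e"
begin

abbreviation P where "P p \<equiv> pev x p * e"

lemma P_e: "e * pev x p = P p"
proof (induction p)
 case (pCons a p)
 have "e * (x * pev x p) = x * (e * pev x p)" using cornerD[OF x] by (simp flip: mult.assoc)
 then show ?case using pCons by (simp add: distrib_left distrib_right mult.assoc)
qed simp

lemma P_mult: "P p * P q = P (p * q)"
 unfolding pev_mult using P_e[of q] ee by (metis mult.assoc)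

lemma P_corner: "P p : corner e"
 using P_e[of p] ee unfolding corner_def by (metis (mono_tags, lifting) mem_Collect_eq mult.assoc)

lemma P_1: "P 1 = e" and P_X: "P [:0, 1:] = x"
 using cornerD[OF x] by (simp_all add: one_pCons)

lemma P_diff: "P (p - q) = P p - P q"
proof -
 have "P (p - q) + P q = P p" by (simp flip: distrib_right pev_add)
 then show ?thesis by (simp add: eq_diff_eq)
qed

text \<open>A dependency among the powers of x with the lowest power isolated. It drives both the
  Fitting argument and the annihilating polynomial.\<close>

lemma power_relation: "EX k q. P ([:0, 1:] ^ k) = P ([:0, 1:] ^ Suc k * q)"
proof -
 interpret vector_space sc by (rule vs)
 let ?v = "%l. P ([:0, 1:] ^ l)"
 obtain d where "\<forall>v :: nat \<Rightarrow> 'b. \<exists>k \<le> d. v k : span (v ` {k<..d})" using chain_relation by blast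
 then obtain k where k: "?v k : span (?v ` {k<..d})" by (elim allE[of _ ?v]) blast
 let ?W = "{P ([:0, 1:] ^ Suc k * q) |q. True}"
 have "subspace ?W"
 proof (rule subspaceI)
  show "0 : ?W" by (auto intro!: exI[of _ 0])
  show "a + b : ?W" if "a : ?W" "b : ?W" for a b
   using that by (auto simp flip: distrib_right pev_add distrib_left)
  show "sc c a : ?W" if a: "a : ?W" for a c
  proof -
   obtain q where "a = P ([:0, 1:] ^ Suc k * q)" using a by blast
   then have "sc c a = P ([:0, 1:] ^ Suc k * smult c q)" by (simp add: pev_smult)
   then show ?thesis by blast
  qed
 qed
 moreover have "?v ` {k<..d} <= ?W"
 proof
  fix y assume "y : ?v ` {k<..d}"
  then obtain l where l: "k < l" "y = ?v l" by auto
  then have "l = Suc k + (l - Suc k)" by simp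
  then have "[:0, 1:] ^ l = [:0, 1:] ^ Suc k * [:0, 1 :: 'k:] ^ (l - Suc k)" by (metis power_add)
  then show "y : ?W" using l(2) by auto
 qed
 ultimately have "?v k : ?W" using k span_minimal by blast
 then show ?thesis by blast
qed

context assumes prim: "primitive_idempotent e"
begin

lemma e_nonzero: "e ~= 0"
 using prim by (simp add: primitive_idempotent_def)

text \<open>Fitting's lemma. From x^k = x^(k+1) q the element g = (xq)^m is an idempotent with x^m =
  x^m g, and primitivity leaves g = 0, where x is nilpotent, or g = e, where x is a unit.\<close>

lemma nonunit_nilpotent:
 assumes "~ cunit e x" shows "EX m. P ([:0, 1:] ^ m) = 0"
proof -
 let ?X = "[:0, 1 :: 'k:]"
 obtain k q where kq: "P (?X ^ k) = P (?X ^ Suc k * q)" using power_relation by blast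
 have step: "P (r * ?X ^ k) = P (r * ?X ^ k * (?X * q))" for r
 proof -
  have "P (r * ?X ^ k) = P r * P (?X ^ k)" by (simp only: P_mult)
  also have "\<dots> = P r * P (?X ^ Suc k * q)" using kq by (simp only:)
  also have "\<dots> = P (r * (?X ^ Suc k * q))" by (rule P_mult)
  also have "r * (?X ^ Suc k * q) = r * ?X ^ k * (?X * q)" by (simp only: power_Suc mult_ac)
  finally show ?thesis .
 qed
 \<comment> \<open>One more than k, so that a factor x can be split off from (xq)^m, leaving x^k q^m
   as the inverse of x in the case g = e.\<close>
 define m where "m = Suc k"
 have it: "P (?X ^ m) = P (?X ^ m * (?X * q) ^ n)" for n
 proof (induction n)
  case (Suc n)
  have "P (?X ^ m * (?X * q) ^ n) = P ((?X * (?X * q) ^ n) * ?X ^ k)" unfolding m_def power_Suc by (simp only: mult_ac)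
  also have "\<dots> = P ((?X * (?X * q) ^ n) * ?X ^ k * (?X * q))" by (rule step)
  also have "(?X * (?X * q) ^ n) * ?X ^ k * (?X * q) = ?X ^ m * (?X * q) ^ Suc n" unfolding m_def power_Suc by (simp only: mult_ac)
  finally show ?case using Suc by (simp only:)
 qed simp
 define g where "g = P ((?X * q) ^ m)"
 have "(?X * q) ^ m * (?X * q) ^ m = ?X ^ m * (?X * q) ^ m * q ^ m" by (simp only: power_mult_distrib mult_ac)
 then have "g * g = P (?X ^ m * (?X * q) ^ m) * P (q ^ m)" unfolding g_def P_mult by (simp only:)
 also have "\<dots> = P (?X ^ m) * P (q ^ m)" unfolding it[of m, symmetric] ..
 also have "\<dots> = g" unfolding P_mult g_def by (simp only: power_mult_distrib)
 finally have gg: "g * g = g" .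
 have gc: "e * g = g" "g * e = g" using cornerD[OF P_corner] unfolding g_def by blast+
 have "g = 0 \<or> e - g = 0"
 proof -
  have "(e - g) * (e - g) = e - g" "g * (e - g) = 0" "(e - g) * g = 0" "e = g + (e - g)"
   using gg gc ee by (simp_all add: algebra_simps)
  then show ?thesis using prim gg unfolding primitive_idempotent_def by blast
 qed
 then show ?thesis
 proof
  assume "g = 0"
  then have "P (?X ^ m) = 0" using it[of m] unfolding P_mult[symmetric] g_def[symmetric] by simp
  then show ?thesis by blast
 next
  assume "e - g = 0"
  then have "g = e" by simp
  let ?y = "P (?X ^ k * q ^ m)"
  have "x * ?y = P (?X * (?X ^ k * q ^ m))" using P_mult[of ?X "?X ^ k * q ^ m"] unfolding P_X .
  also have "?X * (?X ^ k * q ^ m) = (?X * q) ^ m" by (simp only: m_def power_mult_distrib power_Suc mult_ac)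
  finally have 1: "x * ?y = e" using \<open>g = e\<close> by (simp only: g_def)
  have "?y * x = P (?X ^ k * q ^ m * ?X)" using P_mult[of "?X ^ k * q ^ m" ?X] unfolding P_X .
  also have "?X ^ k * q ^ m * ?X = (?X * q) ^ m" by (simp only: m_def power_mult_distrib power_Suc mult_ac)
  finally have 2: "?y * x = e" using \<open>g = e\<close> by (simp only: g_def)
  have "cunit e x" unfolding cunit_def using x 1 2 P_corner by blast
  then show ?thesis using assms by blast
 qed
qed

text \<open>x is annihilated by the nonzero polynomial X^k (1 - Xq). Split off a root c: if x - ce
  is a unit, the remaining factor annihilates x and has smaller degree; otherwise x - ce is
  radical.\<close>

lemma eigenvalue: "EX c. x - sc c e : rad e"
proof -
 let ?X = "[:0, 1 :: 'k:]"
 have e_corner: "e : corner e" using ee by (simp add: corner_def)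
 have main: "p ~= 0 ==> P p = 0 ==> EX c. x - sc c e : rad e" for p
 proof (induction "degree p" arbitrary: p rule: less_induct)
  case less
  show ?case
  proof (cases "degree p = 0")
   case True
   then obtain a where a: "p = [:a:]" by (rule degree_eq_zeroE)
   then have "a ~= 0" "sc a e = 0" using less.prems by simp_all
   then have "e = 0" using sc_simps(1)[of "inverse a" a e] by simp
   then show ?thesis using e_nonzero by simp
  next
   case False
   then obtain c where "poly p c = 0" using alg_closed_imp_poly_has_root[of p] by auto
   then obtain q where q: "p = [:- c, 1:] * q" unfolding poly_eq_0_iff_dvd by (elim dvdE)
   have q0: "q ~= 0" using less.prems(1) q by auto
   have dg: "degree q < degree p"
    unfolding q using q0 by (subst degree_mult_eq) simp_all
   have Pc: "P [:- c, 1:] = x - sc c e" using cornerD[OF x] by (simp add: left_diff_distrib)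
   have z: "(x - sc c e) * P q = 0" using less.prems(2) unfolding q P_mult[symmetric] Pc .
   show ?thesis
   proof (cases "cunit e (x - sc c e)")
    case True
    then obtain y where "y * (x - sc c e) = e" unfolding cunit_def by blast
    then have "P q = y * ((x - sc c e) * P q)" using cornerD(1)[OF P_corner[of q]] by (simp flip: mult.assoc)
    then have "P q = 0" using z by simp
    then show ?thesis using less.hyps[OF dg q0] by blast
   next
    case False
    have "sc c e : corner e" using ee by (simp add: corner_def)
    then show ?thesis using False corner_diff[OF x] unfolding rad_def by blast
   qed
  qed
 qed
 obtain k q where kq: "P (?X ^ k) = P (?X ^ Suc k * q)" using power_relation by blast
 have "?X ^ k * (1 - ?X * q) = ?X ^ k - ?X ^ Suc k * q" by (simp only: right_diff_distrib mult_1_left mult_1_right power_Suc mult_ac)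
 then have "P (?X ^ k * (1 - ?X * q)) = 0" using kq by (simp only: P_diff diff_self)
 moreover have "?X ^ k * (1 - ?X * q) ~= 0"
 proof -
  have "poly (1 - ?X * q) 0 = 1" by simp
  then have "1 - ?X * q ~= 0" by (metis poly_0 zero_neq_one)
  then show ?thesis by simp
 qed
 ultimately show ?thesis using main by blast
qed

end

end

context
 fixes e :: 'b
 assumes prim: "primitive_idempotent e"
begin

lemma prim_idem: "e * e = e" and prim_nonzero: "e ~= 0"
 using prim by (simp_all add: primitive_idempotent_def)

lemma e_corner: "e : corner e" and sc_corner: "x : corner e ==> sc c x : corner e"
 using prim_idem by (simp_all add: corner_def)

lemma radD: "n : rad e ==> n : corner e" "n : rad e ==> e * n = n" "n : rad e ==> n * e = n"
 by (simp_all add: rad_def corner_def)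

lemma rad_nilpotent: 
 assumes "n : rad e" shows "EX m. n ^ m * e = 0"
proof -
 have n: "n : corner e" "~ cunit e n" using assms by (simp_all add: rad_def)
 obtain m where m: "pev n ([:0, 1:] ^ m) * e = 0" using nonunit_nilpotent[OF prim_idem n(1) prim n(2)] by blast
 have "pev n ([:0, 1:] ^ m) = n ^ m" by (induction m) (simp_all add: one_pCons pev_mult)
 then show ?thesis using m by metis
qed

lemma rad_fix:
 assumes "n : rad e" "v * n = v" shows "v = 0"
proof -
 obtain m where m: "n ^ m * e = 0" using rad_nilpotent[OF assms(1)] by blast
 have "v * n ^ j = v" for j by (induction j) (simp_all add: assms(2) flip: mult.assoc)
 moreover have "v * e = v" using radD(3)[OF assms(1)] assms(2) by (metis mult.assoc)
 ultimately have "v = v * (n ^ m * e)" by (simp flip: mult.assoc)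
 then show ?thesis using m by simp
qed

lemma power_corner: "n : corner e ==> e * (n ^ m * e) = n ^ m * e & e * n ^ m = n ^ m * e"
proof (induction m)
 case (Suc m)
 note n = cornerD[OF Suc.prems]
 have 1: "e * n ^ Suc m = n ^ Suc m" using n(1) by (simp flip: mult.assoc)
 have "n * n ^ m = n * (e * n ^ m)" using n(2) by (simp flip: mult.assoc)
 then have "n ^ Suc m * e = n ^ Suc m" using Suc.IH[OF Suc.prems] prim_idem by (simp add: mult.assoc)
 then show ?case using 1 by simp
qed (simp add: prim_idem)

text \<open>If z n = e, then n^(m+1) e = 0 forces n^m e = 0, and descending to m = 0 gives e =
  0.\<close>

lemma rad_not_left: 
 assumes "n : rad e" shows "z * n ~= e"
proof
 assume z: "z * n = e"
 have "n ^ m * e = 0 ==> False" for m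
 proof (induction m)
  case 0
  then show ?case using prim_nonzero by simp
 next
  case (Suc m)
  have "n ^ m * e = z * n * (n ^ m * e)" using z power_corner[OF radD(1)[OF assms]] by simp
  also have "\<dots> = z * (n ^ Suc m * e)" by (simp add: mult.assoc)
  finally show ?case using Suc by simp
 qed
 then show False using rad_nilpotent[OF assms] by blast
qed

lemma rad_not_right: 
 assumes "n : rad e" shows "n * z ~= e"
proof
 assume z: "n * z = e"
 have "n ^ m * e = 0 ==> False" for m
 proof (induction m)
  case 0
  then show ?case using prim_nonzero by simp
 next
  case (Suc m)
  note p = power_corner[OF radD(1)[OF assms]]
  have "n ^ m * e = n ^ m * (n * z)" using z by simp
  also have "\<dots> = n ^ Suc m * e * z" using radD(3)[OF assms] by (simp add: mult.assoc power_commutes) (metis p mult.assoc power_commutes radD(2)[OF assms])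
  finally show ?case using Suc by simp
 qed
 then show False using rad_nilpotent[OF assms] by blast
qed

lemma rad_mult:
 assumes "n : rad e" "y : corner e" shows "y * n : rad e" "n * y : rad e"
proof -
 have "w * (y * n) ~= e" for w using rad_not_left[OF assms(1), of "w * y"] by (simp add: mult.assoc)
 then show "y * n : rad e" using corner_mult[OF assms(2) radD(1)[OF assms(1)]] unfolding rad_def cunit_def by blast
 have "(n * y) * w ~= e" for w using rad_not_right[OF assms(1), of "y * w"] by (simp add: mult.assoc)
 then show "n * y : rad e" using corner_mult[OF radD(1)[OF assms(1)] assms(2)] unfolding rad_def cunit_def by blast
qed

text \<open>If n + n' were a unit, scaling would give r + t = e with r and t radical. When t^(m+1) e
  = 0, multiplying by t^m shows that t^m e is fixed by r, hence zero by \<open>rad_fix\<close>; the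
  descent from nilpotency of t ends in e = 0.\<close>

lemma rad_add:
 assumes n: "n : rad e" "n' : rad e" shows "n + n' : rad e"
proof (rule ccontr)
 assume "n + n' \<notin> rad e"
 then have "cunit e (n + n')" using corner_add[OF radD(1)[OF n(1)] radD(1)[OF n(2)]] by (simp add: rad_def)
 then obtain w where w: "w : corner e" "w * (n + n') = e" unfolding cunit_def by blast
 define r t where "r = w * n" and "t = w * n'"
 have r: "r : rad e" "t : rad e" unfolding r_def t_def using rad_mult(1) n w(1) by blast+
 have rt: "r + t = e" using w(2) by (simp add: r_def t_def distrib_left)
 have "t ^ m * e = 0 ==> False" for m
 proof (induction m)
  case 0
  then show ?case using prim_nonzero by simp
 next
  case (Suc m)
  have "t ^ m * e * r + t ^ m * e * t = t ^ m * e * e" using rt by (metis distrib_left)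
  moreover have "t ^ m * e * t = t ^ Suc m * e" using radD(2,3)[OF r(2)] by (simp add: mult.assoc power_commutes) (metis mult.assoc power_commutes)
  ultimately have "(t ^ m * e) * r = t ^ m * e" using Suc.prems prim_idem by (simp add: mult.assoc)
  then have "t ^ m * e = 0" by (rule rad_fix[OF r(1)])
  then show ?case by (rule Suc.IH)
 qed
 then show False using rad_nilpotent[OF r(2)] by blast
qed

lemma rad_zero: "0 : rad e"
 using prim_nonzero by (auto simp: rad_def corner_def cunit_def)

lemma rad_sc: "n : rad e ==> sc c n : rad e"
 using rad_mult(1)[of n "sc c e"] sc_corner[OF e_corner] radD(2)[of n] by simp

lemma corner_decompose: 
 assumes "x : corner e" obtains c n where "n : rad e" "x = sc c e + n"
 using eigenvalue[OF prim_idem assms prim] by (metis add.commute diff_add_cancel)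

lemma prod_rad: "set ns <= rad e ==> ns ~= [] ==> prod_list ns * e : rad e"
proof (induction ns)
 case (Cons n ns)
 then show ?case using radD rad_mult(2)[of n "prod_list ns * e"] by (cases "ns = []") (auto simp: mult.assoc)
qed simp

lemma prod_corner: 
 assumes "set ns <= rad e" "y : corner e" shows "prod_list ns * y : corner e"
 using assms(1) by (induction ns) (use assms(2) radD(1) corner_mult in "auto simp: mult.assoc")

text \<open>\<open>chain_relation\<close> is applied to the partial products v_k of the list. Later
  ones are v_k times radical elements, so v_k = v_k z with z radical, and v_k = 0 by
  \<open>rad_fix\<close>. The bound d depends only on the algebra.\<close>

lemma rad_prod_zero: "EX d. ALL ns. length ns = d & set ns <= rad e \<longrightarrow> prod_list ns * e = 0"
proof -
 interpret vector_space sc by (rule vs)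
 obtain d where d: "\<forall>v :: nat \<Rightarrow> 'b. \<exists>k \<le> d. v k : span (v ` {k<..d})" using chain_relation by blast
 have "prod_list ns * e = 0" if ns: "length ns = d" "set ns <= rad e" for ns
 proof -
  let ?v = "%k. prod_list (take k ns) * e"
  obtain k where k: "?v k : span (?v ` {k<..d})" using d by (elim allE[of _ ?v]) blast
  have sub: "set (take j (drop k ns)) <= rad e" "set (drop k ns) <= rad e" for j
   using ns(2) set_take_subset[of j "drop k ns"] set_drop_subset[of k ns] by auto
  let ?W = "{?v k * z |z. z : rad e}"
  have "subspace ?W"
  proof (rule subspaceI)
   show "0 : ?W" using rad_zero by force
   show "a + b : ?W" if "a : ?W" "b : ?W" for a b
    using that rad_add by (auto simp flip: distrib_left)
   show "sc c a : ?W" if a: "a : ?W" for a c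
   proof -
    obtain z where "z : rad e" "a = ?v k * z" using a by blast
    then have "sc c a = ?v k * sc c z" "sc c z : rad e" using rad_sc by simp_all
    then show ?thesis by blast
   qed
  qed
  moreover have "?v ` {k<..d} <= ?W"
  proof
   fix y assume "y : ?v ` {k<..d}"
   then obtain l where l: "k < l" "l \<le> d" "y = ?v l" by auto
   let ?t = "take (l - k) (drop k ns)"
   have "take l ns = take k ns @ ?t" using l(1) by (metis less_imp_le le_add_diff_inverse take_add)
   then have y: "y = prod_list (take k ns) * (prod_list ?t * e)" using l(3) by (simp add: mult.assoc)
   have z: "prod_list ?t * e : rad e" by (rule prod_rad[OF sub(1)]) (use l ns in simp)
   have "y = ?v k * (prod_list ?t * e)" unfolding y using radD(2)[OF z] by (metis mult.assoc)
   then show "y : ?W" using z by blast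
  qed
  ultimately have "?v k : ?W" using k span_minimal by blast
  then obtain z where "z : rad e" "?v k * z = ?v k" by auto
  then have z: "?v k = 0" by (rule rad_fix)
  have "prod_list ns * e = prod_list (take k ns @ drop k ns) * e" by simp
  also have "\<dots> = prod_list (take k ns) * (prod_list (drop k ns) * e)" by (simp only: prod_list.append mult.assoc)
  also have "\<dots> = ?v k * (prod_list (drop k ns) * e)"
   using cornerD(1)[OF prod_corner[OF sub(2) e_corner]] by (metis mult.assoc)
  finally show ?thesis using z by simp
 qed
 then show ?thesis by blast
qed

lemma radp_corner: "a : radp e p ==> a : corner e"
 unfolding radp_def using prod_corner by blast

lemma radp_0: "radp e 0 = corner e"
 unfolding radp_def by auto

lemma radp_1: "n : rad e ==> n : radp e 1"
 unfolding radp_def using radD(3) e_corner by (intro CollectI exI[of _ "[n]"] exI[of _ e]) auto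

text \<open>The trailing corner factor of the first product is absorbed into the leading radical
  factor of the second.\<close>

lemma radp_mult:
 assumes "a : radp e p" "b : radp e q" shows "a * b : radp e (p + q)"
proof -
 obtain ns y where a: "a = prod_list ns * y" "length ns = p" "set ns <= rad e" "y : corner e" using assms(1) unfolding radp_def by blast
 obtain ms z where b: "b = prod_list ms * z" "length ms = q" "set ms <= rad e" "z : corner e" using assms(2) unfolding radp_def by blast
 show ?thesis
 proof (cases ms)
  case Nil
  then have "a * b = prod_list ns * (y * z)" "length ns = p + q" using a b by (simp_all add: mult.assoc)
  then show ?thesis unfolding radp_def using a(3) corner_mult[OF a(4) b(4)] by blast
 next
  case (Cons m ms')
  let ?l = "ns @ (y * m) # ms'"
  have "a * b = prod_list ?l * z" "length ?l = p + q" using a b Cons by (simp_all add: mult.assoc)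
  moreover have "set ?l <= rad e" using a b Cons rad_mult(1) by auto
  ultimately show ?thesis unfolding radp_def using b(4) by blast
 qed
qed

lemma radp_zero: "EX d. \<forall>p \<ge> d. radp e p <= {0}"
proof -
 obtain d where d: "!!ns. length ns = d ==> set ns <= rad e ==> prod_list ns * e = 0" using rad_prod_zero by blast
 have "a = 0" if p: "d \<le> p" and a: "a : radp e p" for p a
 proof -
  obtain ns y where ns: "a = prod_list ns * y" "length ns = p" "set ns <= rad e" "y : corner e" using a unfolding radp_def by blast
  have sub: "set (take d ns) <= rad e" "set (drop d ns) <= rad e" using ns(3) set_take_subset[of d ns] set_drop_subset[of d ns] by auto
  have "a = prod_list (take d ns @ drop d ns) * y" using ns(1) by simp
  also have "\<dots> = prod_list (take d ns) * (prod_list (drop d ns) * y)" by (simp only: prod_list.append mult.assoc)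
  also have "\<dots> = prod_list (take d ns) * e * (prod_list (drop d ns) * y)"
   using cornerD(1)[OF prod_corner[OF sub(2) ns(4)]] by (metis mult.assoc)
  also have "\<dots> = 0" using d[OF _ sub(1)] ns(2) p by simp
  finally show ?thesis .
 qed
 then show ?thesis by blast
qed

end

end

section \<open>Whiskering\<close>

context precat begin

lemma lwh_ops:
 assumes F: "lnf C F"
 shows "[|et : arr E; ep : arr E; src E ep = tgt E et|] ==> lwh E F (cmp E ep et) = cmp E (lwh E F ep) (lwh E F et)"
  and "[|et : arr E; ep : arr E; src E et = src E ep; tgt E et = tgt E ep|] ==> lwh E F (add E et ep) = add E (lwh E F et) (lwh E F ep)"
  and "[|lnf C X; lnf C Y|] ==> lwh E F (zro E X Y) = zro E (cef C F X) (cef C F Y)"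
  and "lnf C X ==> lwh E F (idt E X) = idt E (cef C F X)"
proof -
 show "lwh E F (cmp E ep et) = cmp E (lwh E F ep) (lwh E F et)" if t: "et : arr E" "ep : arr E" "src E ep = tgt E et"
 proof -
  obtain G h H where e: "et = (G, h, H)" and 1: "(G, h, H) : ntr C" using t(1) by (rule nat_cases)
  obtain k K where f: "ep = (H, k, K)" and 2: "(H, k, K) : ntr C"
   using t(2,3) e by (cases ep) (auto simp: endo_simps(2))
  show ?thesis unfolding e f endo_ops using linD(6)[OF F natD(4)[OF 1] natD(4)[OF 2]] natD(5)[OF 2] natD(6)[OF 1]
   by (auto intro!: restrict_ext)
 qed
 show "lwh E F (add E et ep) = add E (lwh E F et) (lwh E F ep)"
  if t: "et : arr E" "ep : arr E" "src E et = src E ep" "tgt E et = tgt E ep"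
 proof -
  obtain G h H where e: "et = (G, h, H)" and 1: "(G, h, H) : ntr C" using t(1) by (rule nat_cases)
  obtain k where f: "ep = (G, k, H)" and 2: "(G, k, H) : ntr C"
   using t(2,3,4) e by (cases ep) (auto simp: endo_simps(2))
  show ?thesis unfolding e f endo_ops using linD(7)[OF F natD(4)[OF 1] natD(4)[OF 2]] natD(5,6)[OF 2] natD(5,6)[OF 1]
   by (auto intro!: restrict_ext)
 qed
 show "lwh E F (zro E X Y) = zro E (cef C F X) (cef C F Y)"
  if "lnf C X" "lnf C Y"
  unfolding endo_ops using lin_zro[OF F] linD(1)[OF that(1)] linD(1)[OF that(2)]
  by (auto intro!: restrict_ext simp: comp_endofun_simps)
 show "lwh E F (idt E X) = idt E (cef C F X)" if "lnf C X"
  unfolding endo_ops using linD(5)[OF F] linD(1)[OF that] by (auto intro!: restrict_ext simp: comp_endofun_simps)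
qed

lemma rwh_ops:
 assumes F: "lnf C F"
 shows "[|et : arr E; ep : arr E; src E ep = tgt E et|] ==> rwh (cmp E ep et) F = cmp E (rwh ep F) (rwh et F)"
  and "[|et : arr E; ep : arr E; src E et = src E ep; tgt E et = tgt E ep|] ==> rwh (add E et ep) F = add E (rwh et F) (rwh ep F)"
  and "rwh (zro E X Y) F = zro E (cef C X F) (cef C Y F)"
  and "rwh (idt E X) F = idt E (cef C X F)"
proof -
 note Fo = linD(1)[OF F]
 show "rwh (cmp E ep et) F = cmp E (rwh ep F) (rwh et F)" if "src E ep = tgt E et"
  using that Fo by (cases et; cases ep) (auto simp: rwh_def endo_ops intro!: restrict_ext)
 show "rwh (add E et ep) F = add E (rwh et F) (rwh ep F)"
  if "src E et = src E ep" "tgt E et = tgt E ep"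
  using that Fo by (cases et; cases ep) (auto simp: rwh_def endo_ops intro!: restrict_ext)
 show "rwh (zro E X Y) F = zro E (cef C X F) (cef C Y F)"
  "rwh (idt E X) F = idt E (cef C X F)"
  using Fo by (auto simp: rwh_def endo_ops comp_endofun_simps intro!: restrict_ext)
qed

lemma interchange:
 assumes ka: "ka : arr E" and al: "al : arr E"
 shows "cmp E (rwh ka (tgt E al)) (lwh E (src E ka) al) = cmp E (lwh E (tgt E ka) al) (rwh ka (src E al))"
proof -
 obtain F k G where k: "ka = (F, k, G)" and 1: "(F, k, G) : ntr C" using ka by (rule nat_cases)
 obtain X a Y where a: "al = (X, a, Y)" and 2: "(X, a, Y) : ntr C" using al by (rule nat_cases)
 show ?thesis unfolding k a using natD(7)[OF 1 natD(4)[OF 2]] natD(5,6)[OF 2]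
  by (auto simp: rwh_def endo_ops intro!: restrict_ext)
qed

lemma hom_E_lin: "f : hom E X Y ==> lnf C X & lnf C Y"
 unfolding hom_def by (cases f) (auto simp: endo_simps(2) dest: natD(1,2))

lemma lwh_thru:
 assumes F: "lnf C F" and X: "lnf C X" "lnf C Y" and f: "f : thru E H X Y"
 shows "lwh E F f : thru E (cef C F ` H) (cef C F X) (cef C F Y)"
 using f
proof induction
 case zero
 show ?case unfolding lwh_ops(3)[OF F X] by (rule thru.zero)
next
 case (step f i W p)
 interpret E: precat E by (rule precat_endo)
 have t: "f : hom E X Y" by (rule E.thru_hom[OF step(1)]) (use X in simp_all)
 then have s: "f : arr E" "src E f = X" "tgt E f = Y" "i : arr E" "src E i = X" "tgt E i = W" "p : arr E" "src E p = W" "tgt E p = Y"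
  using step by (simp_all add: hom_def)
 have "lwh E F (add E f (cmp E p i)) = add E (lwh E F f) (cmp E (lwh E F p) (lwh E F i))"
  using lwh_ops(2)[OF F s(1), of "cmp E p i"] lwh_ops(1)[OF F s(4,7)] s E.cmp by simp
 moreover have "lwh E F i : hom E (cef C F X) (cef C F W)" "lwh E F p : hom E (cef C F W) (cef C F Y)"
  using lwh_arr[OF F s(4)] lwh_arr[OF F s(7)] s by (simp_all add: hom_def)
 ultimately show ?case using thru.step[OF step(5)] step(4) by simp
qed

lemma rwh_thru:
 assumes F: "lnf C F" and X: "lnf C X" "lnf C Y" and f: "f : thru E H X Y"
 shows "rwh f F : thru E ((%W. cef C W F) ` H) (cef C X F) (cef C Y F)"
 using f
proof induction
 case zero
 show ?case unfolding rwh_ops(3)[OF F] by (rule thru.zero)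
next
 case (step f i W p)
 interpret E: precat E by (rule precat_endo)
 have t: "f : hom E X Y" by (rule E.thru_hom[OF step(1)]) (use X in simp_all)
 then have s: "f : arr E" "src E f = X" "tgt E f = Y" "i : arr E" "src E i = X" "tgt E i = W" "p : arr E" "src E p = W" "tgt E p = Y"
  using step by (simp_all add: hom_def)
 have "rwh (add E f (cmp E p i)) F = add E (rwh f F) (cmp E (rwh p F) (rwh i F))"
  using rwh_ops(2)[OF F s(1), of "cmp E p i"] rwh_ops(1)[OF F s(4,7)] s E.cmp by simp
 moreover have "rwh i F : hom E (cef C X F) (cef C W F)" "rwh p F : hom E (cef C W F) (cef C Y F)"
  using rwh_arr[OF F s(4)] rwh_arr[OF F s(7)] s by (simp_all add: hom_def)
 ultimately show ?case using thru.step[OF step(5)] step(4) by simp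
qed

end

section \<open>Maps between tensor functors and their composites\<close>

context fdalg begin

abbreviation cf where "cf \<equiv> cef D"

definition lfun :: "('b \<Rightarrow> 'k) \<Rightarrow> bool" where
 "lfun vph \<longleftrightarrow> (ALL x y. vph (x + y) = vph x + vph y) & (ALL c x. vph (sc c x) = c * vph x)"

lemma coordinates:
 "EX Bs vph. finite Bs & (ALL s. lfun (vph s)) & (ALL x. x = (\<Sum>s\<in>Bs. sc (vph s x) s))"
proof -
 obtain Bs where "finite_dimensional_vector_space sc Bs" using fd unfolding fd_algebra_def by blast
 then interpret finite_dimensional_vector_space sc Bs .
 show ?thesis
 proof (intro exI[of _ Bs] exI[of _ "%s x. representation Bs x s"] conjI allI)
  show "finite Bs" by (rule finite_Basis)
  show "lfun (%x. representation Bs x s)" for s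
   unfolding lfun_def by (simp add: representation_add representation_scale independent_Basis span_Basis)
  show "x = (\<Sum>s\<in>Bs. sc (representation Bs x s) s)" for x
   by (rule sum_representation_eq[symmetric]) (simp_all add: independent_Basis span_Basis finite_Basis)
 qed
qed

lemma functional:
 assumes "(e :: 'b) ~= 0" obtains vph where "lfun vph" "vph e = 1"
proof -
 from coordinates obtain Bs vph where B: "finite Bs" "ALL s. lfun (vph s)" "ALL x. x = (\<Sum>s\<in>Bs. sc (vph s x) s)"
  by (elim exE conjE) (rule that)
 obtain s where "vph s e ~= 0"
 proof (rule ccontr)
  assume "~ thesis"
  then have "vph s e = 0" for s using that by blast
  then have "(\<Sum>s\<in>Bs. sc (vph s e) s) = 0" by simp
  then show False using spec[OF B(3), of e] assms by metis
 qed
 then show ?thesis using spec[OF B(2), of s] by (intro that[of "%x. vph s x / vph s e"]) (simp_all add: lfun_def add_divide_distrib)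
qed

context
 fixes e f :: 'b and M :: "('k, 'b) smod"
 assumes idem: "e * e = e" "f * f = f" and M: "M : SM"
begin

lemma T_module: "left_module (fobj (TF e f) M)"
 using lin_mod[OF lin_TF[OF idem] M] .

lemma T_zero_left: 
 assumes "m : carr M" shows "tau e f M 0 m = zer (fobj (TF e f) M)"
 using T_act[OF idem M assms, of 0 0] T_carr[OF idem M assms, of 0] T_module by simp

lemma T_scale: "m : carr M ==> act (fobj (TF e f) M) (sc c 1) (tau e f M x m) = tau e f M x (act M (sc c 1) m)"
 using T_act[OF idem M, of m "sc c 1" x] T_sc[OF idem M, of m c x] by simp

lemma ev_T: "m : carr M ==> ev (TF e f) M m (tau e f reg y (rr b)) = tau e f M y (act M b m)"
 unfolding ev_def using fap_TF[OF idem mh(1)[OF M], of m "rr b" y] mh[OF M] by simp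

end

lemma T_fap: 
 assumes "e * e = e" "f * f = f" "g : arr D" "src D g = M" "tgt D g = N" "m : carr M"
 shows "fap (TF e f) g (tau e f M x m) = tau e f N x (ap g m)"
 using fap_TF[OF assms(1-3), of m x] assms(4-6) by simp

text \<open>A linear functional contracts the first tensor factor of Bc \<otimes> dB \<otimes>_B M.
  The result is natural in M, but not linear over B in general.\<close>

lemma contraction_ex:
 assumes idem: "c * c = c" "d * d = d" and l: "lfun vph"
 obtains L where "!!M. M : SM ==> additive (fobj (TF c d) M) M (L M)"
  and "!!M y m. M : SM ==> m : carr M ==> L M (tau c d M y m) = act M (sc (vph (y * c)) 1) (act M d m)"
proof -
 have "EX H. additive (fobj (TF c d) M) M H & (ALL y. ALL m : carr M. H (tau c d M y m) = act M (sc (vph (y * c)) 1) (act M d m))"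
  if M: "M : SM" for M :: "('k, 'b) smod"
  by (rule T_universal_additive[OF idem M])
   (use M idem l in \<open>simp_all add: lfun_def distrib_right sc_add act_add act_pls mult.assoc mult.commute[of "vph x" for x]\<close>)
 then have "ALL M : SM. EX H. additive (fobj (TF c d) M) M H &
   (ALL y. ALL m : carr M. H (tau c d M y m) = act M (sc (vph (y * c)) 1) (act M d m))" by blast
 from bchoice[OF this] obtain L where "ALL M : SM. additive (fobj (TF c d) M) M (L M) &
   (ALL y. ALL m : carr M. L M (tau c d M y m) = act M (sc (vph (y * c)) 1) (act M d m))" ..
 then show ?thesis by (intro that[of L]) simp_all
qed

lemma contraction_nat:
 assumes idem: "c * c = c" "d * d = d"
  and L: "!!M. M : SM ==> additive (fobj (TF c d) M) M (L M)"
   "!!M y m. M : SM ==> m : carr M ==> L M (tau c d M y m) = act M (sc (vph (y * c)) 1) (act M d m)"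
  and g: "g : arr D" "n : carr (fobj (TF c d) (src D g))"
 shows "L (tgt D g) (fap (TF c d) g n) = ap g (L (src D g) n)"
proof -
 note s = arr_DD[OF g(1)]
 have a: "additive (fobj (TF c d) (src D g)) (fobj (TF c d) (tgt D g)) (fap (TF c d) g)" "additive (src D g) (tgt D g) (ap g)"
  unfolding additive_def using fap(1,2)[OF lin_TF[OF idem] g(1)] s(5,6) by blast+
 show ?thesis
 proof (rule T_ext[OF idem s(1) additive_comp[OF a(1) L(1)[OF s(2)]] additive_comp[OF L(1)[OF s(1)] a(2)] _ g(2)])
  fix y m assume m: "m : carr (src D g)"
  show "L (tgt D g) (fap (TF c d) g (tau c d (src D g) y m)) = ap g (L (src D g) (tau c d (src D g) y m))"
   using fap_TF[OF idem g(1) m, of y] L(2)[OF s(1) m] L(2)[OF s(2) s(5)[OF m]] s(7) m s(3,4) s(5)[OF m] by simp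
 qed
qed

text \<open>The inner factor bBc is contracted by the functional. B acts on x only, which the
  contraction does not touch, so the outcome is a transformation although \<open>L\<close> is not
  one.\<close>

lemma composite_contraction:
 assumes ab: "a * a = a" "b * b = b" and cd: "c * c = c" "d * d = d" and l: "lfun vph"
 shows "EX P : hom E (cf (TF a b) (TF c d)) (TF a d). ALL M : SM. ALL x y. ALL m : carr M.
  nap P M (tau a b (fobj (TF c d) M) x (tau c d M y m)) = tau a d M x (act M (sc (vph (b * y * c)) 1) m)"
proof -
 \<comment> \<open>Composing with left multiplication by b makes \<open>L\<close> insensitive to the
   action of b, as the outer tensor product with bB requires.\<close>
 have l': "lfun (%y. vph (b * y))" using l by (simp add: lfun_def distrib_left)
 obtain L where L: "!!M. M : SM ==> additive (fobj (TF c d) M) M (L M)"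
  "!!M y m. M : SM ==> m : carr M ==> L M (tau c d M y m) = act M (sc (vph (b * (y * c))) 1) (act M d m)"
  using contraction_ex[OF cd l'] by blast
 note ad = ab(1) cd(2)
 let ?N = "fobj (TF c d)"
 have Ns: "?N M : SM" if "M : SM" for M using lin_obj[OF lin_TF[OF cd] that] .
 have LM: "L M n : carr M" if "M : SM" "n : carr (?N M)" for M n using additiveD(1)[OF L(1)] that by blast
 have Ls: "L M (act (?N M) (sc k 1) n) = act M (sc k 1) (L M n)" if M: "M : SM" and n: "n : carr (?N M)" for M n k
 proof (rule T_ext[OF cd M additive_comp[OF additive_act L(1)[OF M]] additive_comp[OF L(1)[OF M] additive_act] _ n])
  show "left_module (?N M)" "left_module M" using Ns[OF M] M by simp_all
  fix y m assume m: "m : carr M"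
  show "L M (act (?N M) (sc k 1) (tau c d M y m)) = act M (sc k 1) (L M (tau c d M y m))"
   using T_act[OF cd M m] L(2)[OF M m] m M l by (simp add: lfun_def mult.commute[of k])
 qed
 have Lb: "L M (act (?N M) b n) = L M n" if M: "M : SM" and n: "n : carr (?N M)" for M n
 proof (rule T_ext[OF cd M additive_comp[OF additive_act L(1)[OF M]] L(1)[OF M] _ n])
  show "left_module (?N M)" using Ns[OF M] by simp
  fix y m assume m: "m : carr M"
  have "b * (b * y * c) = b * (y * c)" using ab(2) by (simp flip: mult.assoc)
  then show "L M (act (?N M) b (tau c d M y m)) = L M (tau c d M y m)"
   using T_act[OF cd M m] L(2)[OF M m] by (simp add: mult.assoc)
 qed
 have "EX H. module_hom (fobj (TF a b) (?N M)) (fobj (TF a d) M) H &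
   (ALL x. ALL n : carr (?N M). H (tau a b (?N M) x n) = tau a d M x (L M n))" if M: "M : SM" for M
 proof (rule T_universal[OF ab Ns[OF M]])
  show "left_module (fobj (TF a d) M)" by (rule T_module[OF ad M])
  fix n assume n: "n : carr (?N M)"
  note Ln = LM[OF M n]
  show "tau a d M x (L M n) : carr (fobj (TF a d) M)" for x by (rule T_carr[OF ad M Ln])
  show "tau a d M (x + y) (L M n) = pls (fobj (TF a d) M) (tau a d M x (L M n)) (tau a d M y (L M n))" for x y by (rule T_add_left[OF ad M Ln])
  show "tau a d M (x * a) (L M n) = tau a d M x (L M n)" for x by (rule T_e[OF ad M])
  show "tau a d M x (L M (act (?N M) b n)) = tau a d M x (L M n)" for x using Lb[OF M n] by simp
  show "tau a d M (z * x) (L M n) = act (fobj (TF a d) M) z (tau a d M x (L M n))" for z x using T_act[OF ad M Ln, of z x] by simp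
  show "tau a d M (sc k x) (L M n) = tau a d M x (L M (act (?N M) (sc k 1) n))" for k x
   using T_sc[OF ad M Ln, of k x] Ls[OF M n, of k] by simp
  fix n' x assume n': "n' : carr (?N M)"
  show "tau a d M x (L M (pls (?N M) n n')) = pls (fobj (TF a d) M) (tau a d M x (L M n)) (tau a d M x (L M n'))"
   using T_add_right[OF ad M Ln LM[OF M n'], of x] additiveD(2)[OF L(1)[OF M] n n'] by simp
 qed
 then have "ALL M : SM. EX H. module_hom (fobj (TF a b) (?N M)) (fobj (TF a d) M) H &
   (ALL x. ALL n : carr (?N M). H (tau a b (?N M) x n) = tau a d M x (L M n))" by blast
 from bchoice[OF this] obtain H where "ALL M : SM. module_hom (fobj (TF a b) (?N M)) (fobj (TF a d) M) (H M) &
   (ALL x. ALL n : carr (?N M). H M (tau a b (?N M) x n) = tau a d M x (L M n))" ..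
 then have H: "module_hom (fobj (TF a b) (?N M)) (fobj (TF a d) M) (H M)"
  "n : carr (?N M) ==> H M (tau a b (?N M) x n) = tau a d M x (L M n)" if "M : SM" for M x n using that by simp_all
 let ?F = "cf (TF a b) (TF c d)"
 have F: "lin ?F" by (rule D.lin_comp[OF lin_TF[OF ab] lin_TF[OF cd]])
 have Fo: "fobj ?F M = fobj (TF a b) (?N M)" if "M : SM" for M using that by (simp add: D.comp_endofun_simps)
 have nat: "H (tgt D g) (fap ?F g z) = fap (TF a d) g (H (src D g) z)" if g: "g : arr D" and z: "z : carr (fobj ?F (src D g))" for g z
 proof -
  note s = arr_DD[OF g]
  have g': "farr (TF c d) g : arr D" "src D (farr (TF c d) g) = ?N (src D g)" "tgt D (farr (TF c d) g) = ?N (tgt D g)"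
   using D.linD(2-4)[OF lin_TF[OF cd] g] by simp_all
  have Ff: "fap ?F g w = fap (TF a b) (farr (TF c d) g) w" for w using g by (simp add: fap_def D.comp_endofun_simps)
  have ad1: "additive (fobj (TF a b) (?N (src D g))) (fobj (TF a b) (?N (tgt D g))) (fap ?F g)"
   using fap(1,2)[OF F g] Fo s(1,2) unfolding additive_def by simp
  have ad2: "additive (fobj (TF a d) (src D g)) (fobj (TF a d) (tgt D g)) (fap (TF a d) g)"
   using fap(1,2)[OF lin_TF[OF ad] g] unfolding additive_def by simp
  show ?thesis
  proof (rule T_ext[OF ab Ns[OF s(1)] additive_comp[OF ad1 module_hom_additive[OF H(1)[OF s(2)]]]
     additive_comp[OF module_hom_additive[OF H(1)[OF s(1)]] ad2]])
   show "z : carr (fobj (TF a b) (?N (src D g)))" using z Fo[OF s(1)] by simp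
   fix x n assume n: "n : carr (?N (src D g))"
   have n': "fap (TF c d) g n : carr (?N (tgt D g))" by (rule fap(1)[OF lin_TF[OF cd] g n])
   have "fap ?F g (tau a b (?N (src D g)) x n) = tau a b (?N (tgt D g)) x (fap (TF c d) g n)"
    unfolding Ff using T_fap[OF ab g' n, of x] by (simp add: fap_def)
   then have "H (tgt D g) (fap ?F g (tau a b (?N (src D g)) x n)) = tau a d (tgt D g) x (L (tgt D g) (fap (TF c d) g n))"
    using H(2)[OF s(2) n'] by simp
   also have "L (tgt D g) (fap (TF c d) g n) = ap g (L (src D g) n)"
    by (rule contraction_nat[where vph = "%y. vph (b * y)", OF cd L g n])
   also have "tau a d (tgt D g) x (ap g (L (src D g) n)) = fap (TF a d) g (tau a d (src D g) x (L (src D g) n))"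
    using fap_TF[OF ad g LM[OF s(1) n]] by simp
   finally show "H (tgt D g) (fap ?F g (tau a b (?N (src D g)) x n)) = fap (TF a d) g (H (src D g) (tau a b (?N (src D g)) x n))"
    using H(2)[OF s(1) n] by simp
  qed
 qed
 have 1: "ALL M : SM. module_hom (fobj ?F M) (fobj (TF a d) M) (H M)" using H(1) Fo by simp
 have 2: "ALL g : arr D. ALL z : carr (fobj ?F (src D g)). H (tgt D g) (fap ?F g z) = fap (TF a d) g (H (src D g) z)" using nat by blast
 note K = mknt_ball[OF F lin_TF[OF ad] 1 2]
 show ?thesis
 proof (rule bexI[of _ "mknt ?F H (TF a d)"], intro ballI allI)
  show "mknt ?F H (TF a d) : hom E ?F (TF a d)" using K(1-3) by (simp add: hom_def)
  fix M :: "('k, 'b) smod" and x y m assume M: "M : SM" and m: "m : carr M"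
  note n = T_carr[OF cd M m, of y]
  have z: "tau a b (?N M) x (tau c d M y m) : carr (fobj ?F M)" using T_carr[OF ab Ns[OF M] n] Fo[OF M] by simp
  have "act M (sc (vph (b * (y * c))) 1) (act M d m) = act M d (act M (sc (vph (b * y * c)) 1) m)"
   using m M by (simp add: mult.assoc)
  then show "nap (mknt ?F H (TF a d)) M (tau a b (?N M) x (tau c d M y m)) = tau a d M x (act M (sc (vph (b * y * c)) 1) m)"
   using K(4)[OF M z] H(2)[OF M n] L(2)[OF M m] T_f[OF ad M, of "act M (sc (vph (b * y * c)) 1) m" x] m M by simp
 qed
qed

text \<open>Opposite to the contraction: a fixed n \<in> F(B) is inserted between the two tensor
  factors.\<close>

lemma composite_insertion:
 assumes ab: "a * a = a" "b * b = b" "f * f = f" and F: "lin F" and n: "n : carr (fobj F reg)"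
 shows "EX I : hom E (TF a f) (cf (TF a b) F). ALL M : SM. ALL x. ALL m : carr M.
  nap I M (tau a f M x m) = tau a b (fobj F M) x (ev F M (act M f m) n)"
proof -
 let ?F = "cf (TF a b) F"
 have lF: "lin ?F" by (rule D.lin_comp[OF lin_TF[OF ab(1,2)] F])
 have Fo: "fobj ?F M = fobj (TF a b) (fobj F M)" if "M : SM" for M using that by (simp add: D.comp_endofun_simps)
 have Fs: "fobj F M : SM" if "M : SM" for M using lin_obj[OF F that] .
 have u: "tau a b (fobj F reg) 1 n : carr (fobj ?F reg)" using T_carr[OF ab(1,2) Fs[OF reg] n] Fo by simp
 obtain I where I: "I : hom E (TF a f) ?F" "ALL M : SM. ALL x. ALL m : carr M.
  nap I M (tau a f M x m) = act (fobj ?F M) (x * a) (ev ?F M (act M f m) (tau a b (fobj F reg) 1 n))"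
  using yoneda_ex[OF ab(1,3) lF u] by blast
 show ?thesis
 proof (intro bexI[OF _ I(1)] ballI allI)
  fix M :: "('k, 'b) smod" and x m assume M: "M : SM" and m: "m : carr M"
  have fm: "act M f m : carr M" using m M by simp
  note h = mh[OF M fm]
  have g: "farr F (mh M (act M f m)) : arr D" "src D (farr F (mh M (act M f m))) = fobj F reg" "tgt D (farr F (mh M (act M f m))) = fobj F M"
   using D.linD(2-4)[OF F h(1)] h by simp_all
  have "ev ?F M (act M f m) (tau a b (fobj F reg) 1 n) = tau a b (fobj F M) 1 (ev F M (act M f m) n)"
   using T_fap[OF ab(1,2) g n, of 1] h(1) by (simp add: ev_def fap_def D.comp_endofun_simps)
  moreover have "ev F M (act M f m) n : carr (fobj F M)" by (rule ev_carr[OF F M fm n])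
  ultimately show "nap I M (tau a f M x m) = tau a b (fobj F M) x (ev F M (act M f m) n)"
   using I(2) M m Fo[OF M] T_act[OF ab(1,2) Fs[OF M], of "ev F M (act M f m) n" "x * a" 1] T_e[OF ab(1,2) Fs[OF M]] by simp
 qed
qed

text \<open>Right multiplication on Be and left multiplication on fB, that is, the element of eBe'
  \<otimes> f'Bf given by a and c.\<close>

lemma mu_ex:
 assumes ef: "e * e = e" "f * f = f" and ef': "e' * e' = e'" "f' * f' = f'"
 shows "EX et : hom E (TF e f) (TF e' f'). ALL M : SM. ALL x. ALL m : carr M.
  nap et M (tau e f M x m) = tau e' f' M (x * e * a) (act M (c * f) m)"
proof -
 have u: "tau e' f' reg a (rr c) : carr (fobj (TF e' f') reg)" by (rule T_carr[OF ef' reg]) simp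
 obtain et where et: "et : hom E (TF e f) (TF e' f')" "ALL M : SM. ALL x. ALL m : carr M.
  nap et M (tau e f M x m) = act (fobj (TF e' f') M) (x * e) (ev (TF e' f') M (act M f m) (tau e' f' reg a (rr c)))"
  using yoneda_ex[OF ef lin_TF[OF ef'] u] by blast
 show ?thesis
 proof (intro bexI[OF _ et(1)] ballI allI)
  fix M :: "('k, 'b) smod" and x m assume M: "M : SM" and m: "m : carr M"
  show "nap et M (tau e f M x m) = tau e' f' M (x * e * a) (act M (c * f) m)"
   using et(2) M m ev_T[OF ef' M, of "act M f m" a c] T_act[OF ef' M, of "act M (c * f) m" "x * e" a] by simp
 qed
qed

end

section \<open>The 1-morphisms\<close>

context fdalg begin

lemma T_zero_right:
 assumes "e * e = e" "f * f = f" "M : SM" shows "tau e f M x (zer M) = zer (fobj (TF e f) M)"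
proof -
 have z: "zer M : carr M" using assms(3) by simp
 show ?thesis
  using T_scale[OF assms z, of 0 x] T_carr[OF assms z, of x] T_module[OF assms] assms(3) by simp
qed

text \<open>Ba \<otimes> bB \<otimes>_B Bc \<otimes> dB is a sum of copies of Ba \<otimes> dB, as
  many as the dimension of bBc. The proof uses a basis of B instead: contracting with a coordinate
  functional and reinserting the basis vector, summed over the basis, is the identity.\<close>

lemma composite_T_thru:
 assumes ab: "a * a = a" "b * b = b" and cd: "c * c = c" "d * d = d"
 shows "idt E (cf (TF a b) (TF c d)) : thru E {TF a d} (cf (TF a b) (TF c d)) (cf (TF a b) (TF c d))"
proof -
 let ?F = "cf (TF a b) (TF c d)" and ?N = "fobj (TF c d)"
 note ad = ab(1) cd(2)
 have F: "lin ?F" by (rule D.lin_comp[OF lin_TF[OF ab] lin_TF[OF cd]])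
 have Fo: "fobj ?F M = fobj (TF a b) (?N M)" if "M : SM" for M using that by (simp add: D.comp_endofun_simps)
 have Ns: "?N M : SM" if "M : SM" for M using lin_obj[OF lin_TF[OF cd] that] .
 have zc: "tau a b (?N M) x (tau c d M y m) : carr (fobj ?F M)" if "M : SM" "m : carr M" for M x y m
  using T_carr[OF ab Ns[OF that(1)] T_carr[OF cd that]] Fo[OF that(1)] by simp
 from coordinates obtain Bs vph where B: "finite Bs" "ALL s. lfun (vph s)" "ALL x. x = (\<Sum>s\<in>Bs. sc (vph s x) s)"
  by (elim exE conjE) (rule that)
 \<comment> \<open>The partial sum over S of the maps that contract with the coordinate of s and
   reinsert s. That the coordinates of byc recover byc is needed only at the end, for S =
   Bs.\<close>
 have "EX vth : thru E {TF a d} ?F ?F. ALL M : SM. ALL x y. ALL m : carr M.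
  nap vth M (tau a b (?N M) x (tau c d M y m)) = tau a b (?N M) x (tau c d M (\<Sum>s\<in>S. sc (vph s (b * y * c)) s) m)"
  if "finite S" for S
  using that
 proof induction
  case empty
  show ?case
  proof (intro bexI[OF _ thru.zero] ballI allI)
   fix M :: "('k, 'b) smod" and x y m assume M: "M : SM" and m: "m : carr M"
   show "nap (zro E ?F ?F) M (tau a b (?N M) x (tau c d M y m)) =
     tau a b (?N M) x (tau c d M (\<Sum>s\<in>{}. sc (vph s (b * y * c)) s) m)"
    using nap_ops(5)[OF M F F zc[OF M m]] T_zero_left[OF cd M m] T_zero_right[OF ab Ns[OF M]] Fo[OF M] by simp
  qed
 next
  case (insert s S)
  then obtain vth where vth: "vth : thru E {TF a d} ?F ?F" "!!M x y m. M : SM ==> m : carr M ==>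
   nap vth M (tau a b (?N M) x (tau c d M y m)) = tau a b (?N M) x (tau c d M (\<Sum>s\<in>S. sc (vph s (b * y * c)) s) m)" by blast
  obtain P where P: "P : hom E ?F (TF a d)" "!!M x y m. M : SM ==> m : carr M ==>
   nap P M (tau a b (?N M) x (tau c d M y m)) = tau a d M x (act M (sc (vph s (b * y * c)) 1) m)"
   using composite_contraction[OF ab cd spec[OF B(2), of s]] by blast
  have n: "tau c d reg s (rr 1) : carr (?N reg)" by (rule T_carr[OF cd reg]) simp
  obtain I where I: "I : hom E (TF a d) ?F" "!!M x m. M : SM ==> m : carr M ==>
   nap I M (tau a d M x m) = tau a b (?N M) x (ev (TF c d) M (act M d m) (tau c d reg s (rr 1)))"
   using composite_insertion[OF ab cd(2) lin_TF[OF cd] n] by blast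
  have t: "vth : arr E" "src E vth = ?F" "tgt E vth = ?F" "P : arr E" "src E P = ?F" "tgt E P = TF a d"
   "I : arr E" "src E I = TF a d" "tgt E I = ?F"
   using E.thru_hom[OF vth(1)] F P(1) I(1) by (simp_all add: hom_def)
  show ?case
  proof (intro bexI[OF _ thru.step[OF vth(1) P(1) I(1)]] ballI allI)
   fix M :: "('k, 'b) smod" and x y m assume M: "M : SM" and m: "m : carr M"
   let ?k = "vph s (b * y * c)" and ?z = "tau a b (?N M) x (tau c d M y m)" and ?S = "\<Sum>s\<in>S. sc (vph s (b * y * c)) s"
   have km: "act M (sc ?k 1) m : carr M" using m M by simp
   have dk: "act M d (act M (sc ?k 1) m) : carr M" using m M by simp
   have z: "?z : carr (fobj (src E P) M)" using zc[OF M m] t by simp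
   have z': "?z : carr (fobj (src E vth) M)" using zc[OF M m] t by simp
   have "nap (cmp E I P) M ?z = nap I M (nap P M ?z)" by (rule nap_ops(1)[OF M t(4,7) _ z]) (use t in simp)
   also have "\<dots> = nap I M (tau a d M x (act M (sc ?k 1) m))" using P(2)[OF M m] by simp
   also have "\<dots> = tau a b (?N M) x (ev (TF c d) M (act M d (act M (sc ?k 1) m)) (tau c d reg s (rr 1)))" by (rule I(2)[OF M km])
   also have "ev (TF c d) M (act M d (act M (sc ?k 1) m)) (tau c d reg s (rr 1)) = tau c d M s (act M 1 (act M d (act M (sc ?k 1) m)))"
    by (rule ev_T[OF cd M dk])
   also have "act M 1 (act M d (act M (sc ?k 1) m)) = act M d (act M (sc ?k 1) m)" using dk M by simp
   also have "tau c d M s (act M d (act M (sc ?k 1) m)) = tau c d M s (act M (sc ?k 1) m)" by (rule T_f[OF cd M km])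
   also have "\<dots> = tau c d M (sc ?k s) m" by (rule T_sc[OF cd M m, symmetric])
   finally have 1: "nap (cmp E I P) M ?z = tau a b (?N M) x (tau c d M (sc ?k s) m)" .
   have "nap (add E vth (cmp E I P)) M ?z = pls (fobj ?F M) (nap vth M ?z) (nap (cmp E I P) M ?z)"
    using nap_ops(2)[OF M t(1) _ _ _ z', of "cmp E I P"] t by simp
   also have "\<dots> = pls (fobj (TF a b) (?N M)) (tau a b (?N M) x (tau c d M ?S m)) (tau a b (?N M) x (tau c d M (sc ?k s) m))"
    unfolding 1 vth(2)[OF M m] Fo[OF M] ..
   also have "\<dots> = tau a b (?N M) x (pls (?N M) (tau c d M ?S m) (tau c d M (sc ?k s) m))"
    by (rule T_add_right[OF ab Ns[OF M] T_carr[OF cd M m] T_carr[OF cd M m], symmetric])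
   also have "pls (?N M) (tau c d M ?S m) (tau c d M (sc ?k s) m) = tau c d M (?S + sc ?k s) m"
    by (rule T_add_left[OF cd M m, symmetric])
   also have "?S + sc ?k s = (\<Sum>s\<in>insert s S. sc (vph s (b * y * c)) s)" using insert by simp
   finally show "nap (add E vth (cmp E I P)) M ?z = tau a b (?N M) x (tau c d M (\<Sum>s\<in>insert s S. sc (vph s (b * y * c)) s) m)" .
  qed simp
 qed
 from this[OF B(1)] obtain vth where vth: "vth : thru E {TF a d} ?F ?F" "!!M x y m. M : SM ==> m : carr M ==>
   nap vth M (tau a b (?N M) x (tau c d M y m)) = tau a b (?N M) x (tau c d M (\<Sum>s\<in>Bs. sc (vph s (b * y * c)) s) m)" by blast
 have t: "vth : arr E" "src E vth = ?F" "tgt E vth = ?F" using E.thru_hom[OF vth(1)] F by (simp_all add: hom_def)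
 have 2: "nap vth M (tau a b (?N M) x (tau c d M y m)) = tau a b (?N M) x (tau c d M y m)" if M: "M : SM" and m: "m : carr M" for M x y m
 proof -
  have "tau c d M (b * y * c) m = act (?N M) b (tau c d M y m)" using T_act[OF cd M m] T_e[OF cd M, of "b * y" m] by simp
  then show ?thesis
   using vth(2)[OF M m] spec[OF B(3), of "b * y * c", symmetric] T_f[OF ab Ns[OF M] T_carr[OF cd M m]] by simp
 qed
 have "vth = idt E ?F"
 proof (rule E_eqI)
  fix M z assume M: "M : SM" and "z : carr (fobj (src E (idt E ?F)) M)"
  then have z: "z : carr (fobj (TF a b) (?N M))" using F Fo by simp
  have advth: "additive (fobj (TF a b) (?N M)) (fobj (TF a b) (?N M)) (nap vth M)"
   using module_hom_additive[OF nap_hom[OF t(1) M]] t Fo[OF M] by simp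
  have "nap vth M z = z"
  proof (rule T_ext[OF ab Ns[OF M] advth additive_id _ z])
   fix x n assume n: "n : carr (?N M)"
   have at: "additive (?N M) (fobj (TF a b) (?N M)) (tau a b (?N M) x)"
    unfolding additive_def using T_carr[OF ab Ns[OF M]] T_add_right[OF ab Ns[OF M]] by blast
   show "nap vth M (tau a b (?N M) x n) = tau a b (?N M) x n"
    by (rule T_ext[OF cd M additive_comp[OF at advth] at _ n]) (rule 2[OF M])
  qed
  then show "nap vth M z = nap (idt E ?F) M z" using nap_ops(4)[OF M F] z Fo[OF M] by simp
 qed (use t F in simp_all)
 then show ?thesis using vth(1) by simp
qed

text \<open>Right multiplication by 1, written as the sum of the idempotents, on the first tensor
  factor; the summand of i factors through Be_i \<otimes> fB.\<close>

lemma T_split_thru: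
 assumes fin: "finite I" and ei: "!!i. i : I ==> e i * e i = e i" and one: "(\<Sum>i\<in>I. e i) = 1" and f: "f * f = f"
 shows "idt E (TF 1 f) : thru E ((%i. TF (e i) f) ` I) (TF 1 f) (TF 1 f)"
proof -
 have i1: "1 * 1 = (1 :: 'b)" by simp
 note T1 = i1 f
 let ?H = "(%i. TF (e i) f) ` I"
 have "EX vth : thru E ?H (TF 1 f) (TF 1 f). ALL M : SM. ALL x. ALL m : carr M.
  nap vth M (tau 1 f M x m) = tau 1 f M (x * (\<Sum>i\<in>S. e i)) m" if "finite S" "S <= I" for S
  using that
 proof induction
  case empty
  show ?case
  proof (intro bexI[OF _ thru.zero] ballI allI)
   fix M :: "('k, 'b) smod" and x m assume M: "M : SM" and m: "m : carr M"
   show "nap (zro E (TF 1 f) (TF 1 f)) M (tau 1 f M x m) = tau 1 f M (x * (\<Sum>i\<in>{}. e i)) m"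
    using nap_ops(5)[OF M lin_TF[OF T1] lin_TF[OF T1] T_carr[OF T1 M m]] T_zero_left[OF T1 M m] by simp
  qed
 next
  case (insert i S)
  then obtain vth where vth: "vth : thru E ?H (TF 1 f) (TF 1 f)" "!!M x m. M : SM ==> m : carr M ==>
   nap vth M (tau 1 f M x m) = tau 1 f M (x * (\<Sum>i\<in>S. e i)) m" by blast
  have ii: "i : I" "e i * e i = e i" using insert ei by auto
  note Ti = ii(2) f
  obtain P where P: "P : hom E (TF 1 f) (TF (e i) f)" "!!M x m. M : SM ==> m : carr M ==>
   nap P M (tau 1 f M x m) = tau (e i) f M (x * 1 * e i) (act M (f * f) m)"
   using mu_ex[OF T1 Ti, of "e i" f] by blast
  obtain J where J: "J : hom E (TF (e i) f) (TF 1 f)" "!!M x m. M : SM ==> m : carr M ==>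
   nap J M (tau (e i) f M x m) = tau 1 f M (x * e i * 1) (act M (f * f) m)"
   using mu_ex[OF Ti T1, of 1 f] by blast
  have t: "vth : arr E" "src E vth = TF 1 f" "tgt E vth = TF 1 f" "P : arr E" "src E P = TF 1 f" "tgt E P = TF (e i) f"
   "J : arr E" "src E J = TF (e i) f" "tgt E J = TF 1 f"
   using E.thru_hom[OF vth(1)] lin_TF[OF T1] P(1) J(1) by (simp_all add: hom_def)
  show ?case
  proof (intro bexI[OF _ thru.step[OF vth(1) P(1) J(1)]] ballI allI)
   fix M :: "('k, 'b) smod" and x m assume M: "M : SM" and m: "m : carr M"
   let ?z = "tau 1 f M x m" and ?S = "\<Sum>i\<in>S. e i"
   have z: "?z : carr (fobj (src E P) M)" "?z : carr (fobj (src E vth) M)" using T_carr[OF T1 M m] t by simp_all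
   have fm: "act M f m : carr M" using m M by simp
   have "nap (cmp E J P) M ?z = nap J M (nap P M ?z)" by (rule nap_ops(1)[OF M t(4,7) _ z(1)]) (use t in simp)
   also have "\<dots> = nap J M (tau (e i) f M (x * e i) (act M f m))" using P(2)[OF M m] f by simp
   also have "\<dots> = tau 1 f M (x * e i) (act M f m)" using J(2)[OF M fm] ii fm M m f by (simp add: mult.assoc)
   also have "\<dots> = tau 1 f M (x * e i) m" by (rule T_f[OF T1 M m])
   finally have 1: "nap (cmp E J P) M ?z = tau 1 f M (x * e i) m" .
   have "nap (add E vth (cmp E J P)) M ?z = pls (fobj (TF 1 f) M) (nap vth M ?z) (nap (cmp E J P) M ?z)"
    using nap_ops(2)[OF M t(1) _ _ _ z(2), of "cmp E J P"] t by simp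
   also have "\<dots> = tau 1 f M (x * ?S + x * e i) m" unfolding 1 vth(2)[OF M m] by (rule T_add_left[OF T1 M m, symmetric])
   also have "x * ?S + x * e i = x * (\<Sum>i\<in>insert i S. e i)" using insert by (simp add: distrib_left add.commute)
   finally show "nap (add E vth (cmp E J P)) M ?z = tau 1 f M (x * (\<Sum>i\<in>insert i S. e i)) m" .
  qed (use ii in blast)
 qed
 from this[OF fin subset_refl] obtain vth where vth: "vth : thru E ?H (TF 1 f) (TF 1 f)" "!!M x m. M : SM ==> m : carr M ==>
   nap vth M (tau 1 f M x m) = tau 1 f M (x * (\<Sum>i\<in>I. e i)) m" by blast
 have h: "vth : hom E (TF 1 f) (TF 1 f)" using E.thru_hom[OF vth(1)] lin_TF[OF T1] by simp
 have "vth = idt E (TF 1 f)"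
  by (rule T_eqI[OF T1 h]) (use vth(2) one lin_TF[OF T1] nap_ops(4)[OF _ lin_TF[OF T1]] T_carr[OF T1] in "simp_all add: hom_def")
 then show ?thesis using vth(1) by simp
qed

text \<open>Both maps are multiplications by e and f. The premises \<open>c\<close> make the
  composite on Be \<otimes> fB the identity.\<close>

lemma T_retract:
 assumes ef: "e * e = e" "f * f = f" and ef': "e' * e' = e'" "f' * f' = f'" and c: "e * e' = e" "f' * f = f"
 shows "retract E (TF e f) (TF e' f')"
proof -
 obtain I where I: "I : hom E (TF e f) (TF e' f')" "!!M x m. M : SM ==> m : carr M ==>
   nap I M (tau e f M x m) = tau e' f' M (x * e * e) (act M (f * f) m)" using mu_ex[OF ef ef', of e f] by blast
 obtain P where P: "P : hom E (TF e' f') (TF e f)" "!!M x m. M : SM ==> m : carr M ==>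
   nap P M (tau e' f' M x m) = tau e f M (x * e' * e) (act M (f * f') m)" using mu_ex[OF ef' ef, of e f] by blast
 have t: "I : arr E" "src E I = TF e f" "tgt E I = TF e' f'" "P : arr E" "src E P = TF e' f'" "tgt E P = TF e f"
  using I(1) P(1) by (simp_all add: hom_def)
 have "cmp E P I = idt E (TF e f)"
 proof (rule T_eqI[OF ef])
  show "cmp E P I : hom E (TF e f) (TF e f)" "idt E (TF e f) : hom E (TF e f) (TF e f)" using t lin_TF[OF ef] by (simp_all add: hom_def)
  fix M :: "('k, 'b) smod" and x m assume M: "M : SM" and m: "m : carr M"
  note z = T_carr[OF ef M m, of x]
  have fm: "act M f m : carr M" using m M by simp
  have "nap (cmp E P I) M (tau e f M x m) = nap P M (nap I M (tau e f M x m))" by (rule nap_ops(1)[OF M t(1,4)]) (use t z in simp_all)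
  also have "\<dots> = nap P M (tau e' f' M (x * e) (act M f m))" using I(2)[OF M m] ef by (simp add: mult.assoc)
  also have "\<dots> = tau e f M (x * e * e' * e) (act M (f * f') (act M f m))" by (rule P(2)[OF M fm])
  also have "x * e * e' * e = x * e" using c ef by (simp add: mult.assoc)
  also have "act M (f * f') (act M f m) = act M f m" using c ef m M by (simp add: mult.assoc)
  also have "tau e f M (x * e) (act M f m) = tau e f M x m" using T_e[OF ef M] T_f[OF ef M m] by simp
  finally show "nap (cmp E P I) M (tau e f M x m) = nap (idt E (TF e f)) M (tau e f M x m)"
   using nap_ops(4)[OF M lin_TF[OF ef] z] by simp
 qed
 then show ?thesis unfolding retract_def using I(1) P(1) by blast
qed

lemma addcat_E: "addcat E"
proof unfold_locales
 have o: "lin idf" by (rule D.lin_id)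
 \<comment> \<open>A zero object is obtained by splitting the idempotent 0 of the identity
   functor.\<close>
 let ?z = "zro E idf idf"
 have z: "?z : arr E" "src E ?z = idf" "tgt E ?z = idf" "cmp E ?z ?z = ?z" using o by simp_all
 from idempotent_splits[OF z] obtain Y i p where Y: "i : hom E Y idf" "p : hom E idf Y" "cmp E p i = idt E Y" "cmp E i p = ?z" .
 have t: "i : arr E" "src E i = Y" "tgt E i = idf" "p : arr E" "src E p = idf" "tgt E p = Y" using Y by (simp_all add: hom_def)
 have Yo: "Y : obj E" using t E.src_obj by metis
 have "cmp E p (cmp E (cmp E i p) i) = cmp E (cmp E p i) (cmp E p i)" using t by (simp add: E.cmp_assoc)
 then have "idt E Y = zro E Y Y" unfolding Y(3,4) using t Yo o by simp
 then show "EX Z. is_zero E Z" using E.is_zeroI[OF Yo] by blast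
 show "EX S. is_biproduct E [X, Y] S" if "X : obj E" "Y : obj E" for X Y using biproduct_ex that by simp
 show "EX Y. EX i : hom E Y X. EX p : hom E X Y. cmp E p i = idt E Y & cmp E i p = pj"
  if h: "pj : hom E X X" "cmp E pj pj = pj" for pj X
 proof -
  have t: "pj : arr E" "src E pj = X" "tgt E pj = X" using h by (simp_all add: hom_def)
  show ?thesis by (rule idempotent_splits[OF t h(2)]) blast
 qed
qed

sublocale EA: addcat "endo_2cat (module_cat sc)" by (rule addcat_E)

definition gens :: "(('k, 'b) smod, ('k, 'b) smor) endofun set" where "gens = {idf, TF 1 1}"

abbreviation OM where "OM \<equiv> one_morphisms sc"

lemma one_idem: "1 * 1 = (1 :: 'b)" by simp

lemmas lin_T1 = lin_TF[OF one_idem one_idem]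

lemma gens_obj: "gens <= obj E"
 unfolding gens_def using D.lin_id lin_T1 by simp

lemma OM_eq: "OM = {X \<in> obj E. idt E X : thru E gens X X}"
 unfolding one_morphisms_def gens_def[symmetric] by (rule EA.additive_closure_eq[OF gens_obj])

lemma OM_lin: "X : OM ==> lin X" and OM_thru: "X : OM ==> idt E X : thru E gens X X"
 by (simp_all add: OM_eq)

lemma OM_I: "lin X ==> idt E X : thru E H X X ==> H <= OM ==> X : OM"
 unfolding OM_eq using E.thru_trans[of "idt E X" H X X gens] by auto

lemma OM_retract: "retract E X Y ==> Y : OM ==> X : OM"
 using E.retract_thru[of Y gens X] E.retract_obj[of X Y] by (simp add: OM_eq)

lemma thru_self: "lin X ==> X : H ==> idt E X : thru E H X X"
 using E.thru_factor[of "idt E X" X X "idt E X" X H] by (simp add: hom_def)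

lemma gens_OM: "gens <= OM"
 using thru_self gens_obj by (auto simp: OM_eq)

lemma OM_id: "idf : OM" and OM_T1: "TF 1 1 : OM"
 using gens_OM by (simp_all add: gens_def)

lemma OM_T: "e * e = e ==> f * f = f ==> TF e f : OM"
 by (rule OM_retract[OF T_retract OM_T1]) simp_all

lemma lwh_id_thru:
 assumes F: "lin F" and Y: "Y : OM" shows "idt E (cf F Y) : thru E {F, cf F (TF 1 1)} (cf F Y) (cf F Y)"
 using D.lwh_thru[OF F OM_lin[OF Y] OM_lin[OF Y] OM_thru[OF Y]] D.lwh_ops(4)[OF F OM_lin[OF Y]] D.comp_id(1)[OF F]
 by (simp add: gens_def)

lemma rwh_id_thru:
 assumes F: "lin F" and X: "X : OM" shows "idt E (cf X F) : thru E {F, cf (TF 1 1) F} (cf X F) (cf X F)"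
 using D.rwh_thru[OF F OM_lin[OF X] OM_lin[OF X] OM_thru[OF X]] D.rwh_ops(4)[OF F] D.comp_id(2)[OF F]
 by (simp add: gens_def)

text \<open>Y is built from the identity and B \<otimes> B, so the composite is built from Ba
  \<otimes> bB and Ba \<otimes> bB \<otimes>_B B \<otimes> B, and the latter reduces to copies of Ba
  \<otimes> B.\<close>

lemma composite_left_thru:
 assumes ab: "a * a = a" "b * b = b" and Y: "Y : OM"
 shows "idt E (cf (TF a b) Y) : thru E {TF a b, TF a 1} (cf (TF a b) Y) (cf (TF a b) Y)"
proof (rule E.thru_trans[OF lwh_id_thru[OF lin_TF[OF ab] Y]])
 show "cf (TF a b) Y : obj E" "cf (TF a b) Y : obj E" using D.lin_comp[OF lin_TF[OF ab] OM_lin[OF Y]] by simp_all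
 fix W assume "W : {TF a b, cf (TF a b) (TF 1 1)}"
 then show "idt E W : thru E {TF a b, TF a 1} W W"
  using thru_self[OF lin_TF[OF ab]] composite_T_thru[OF ab one_idem one_idem] thru_mono[of "{TF a 1}" "{TF a b, TF a 1}" E W W] by auto
qed

lemma composite_right_thru:
 assumes cd: "c * c = c" "d * d = d" and X: "X : OM"
 shows "idt E (cf X (TF c d)) : thru E {TF c d, TF 1 d} (cf X (TF c d)) (cf X (TF c d))"
proof (rule E.thru_trans[OF rwh_id_thru[OF lin_TF[OF cd] X]])
 show "cf X (TF c d) : obj E" "cf X (TF c d) : obj E" using D.lin_comp[OF OM_lin[OF X] lin_TF[OF cd]] by simp_all
 fix W assume "W : {TF c d, cf (TF 1 1) (TF c d)}"
 then show "idt E W : thru E {TF c d, TF 1 d} W W"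
  using thru_self[OF lin_TF[OF cd]] composite_T_thru[OF one_idem one_idem cd] thru_mono[of "{TF 1 d}" "{TF c d, TF 1 d}" E W W] by auto
qed

lemma OM_comp:
 assumes X: "X : OM" and Y: "Y : OM" shows "cf X Y : OM"
proof (rule OM_I[OF _ rwh_id_thru[OF OM_lin[OF Y] X]])
 show "lin (cf X Y)" by (rule D.lin_comp[OF OM_lin[OF X] OM_lin[OF Y]])
 have "cf (TF 1 1) Y : OM"
  by (rule OM_I[OF _ composite_left_thru[OF one_idem one_idem Y]]) (use D.lin_comp[OF lin_T1 OM_lin[OF Y]] OM_T1 in simp_all)
 then show "{Y, cf (TF 1 1) Y} <= OM" using Y by simp
qed

lemma CB_simps [simp]:
 "obj (CB sc) = OM" "arr (CB sc) = {f \<in> arr E. src E f : OM & tgt E f : OM}"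
 "src (CB sc) = src E" "tgt (CB sc) = tgt E" "idt (CB sc) = idt E" "cmp (CB sc) = cmp E" "zro (CB sc) = zro E"
 "add (CB sc) = add E" "scl (CB sc) = scl E" "one (CB sc) = idf" "hcmp (CB sc) = cf" "lwh (CB sc) = lwh E"
 unfolding CB_def full_subcat_simps by (simp_all add: full_subcat_def endo_2cat_def)

lemma hom_CB: "hom (CB sc) X Y = (if X : OM & Y : OM then hom E X Y else {})"
 unfolding CB_def by (rule hom_full_subcat)

lemma thru_CB: "X : OM ==> Y : OM ==> H <= OM ==> thru (CB sc) H X Y = thru E H X Y"
 unfolding CB_def by (rule thru_full_subcat)

text \<open>Evaluation at v embeds the transformations linearly into Y(B), which is finite
  dimensional; a finite spanning set of the image of V is lifted back.\<close>

lemma generated_span: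
 assumes X: "generated X v" and Y: "lin Y" and V: "V <= hom E X Y" "zro E X Y : V"
  "ALL u : V. ALL v : V. add E u v : V" "ALL c. ALL u : V. scl E c u : V"
 shows "EX U. finite U & U <= V & V <= espan E U X Y"
proof -
 let ?f = "%et. nap et reg v" and ?N = "fobj Y reg"
 have Xl: "lin X" and v: "v : carr (fobj X reg)" using X by (simp_all add: generated_def)
 have inj: "et = ep" if "et : hom E X Y" "ep : hom E X Y" "?f et = ?f ep" for et ep using X that unfolding generated_def by blast
 have N: "?N : SM" using lin_obj[OF Y reg] .
 obtain S where S: "finite S" "S <= carr ?N" "carr ?N = kspan sc ?N S"
  using finitely_generated_kspan[OF small_modulesD(1)[OF N] small_modulesD(2)[OF N]] .
 have f: "?f et : carr ?N" "?f (scl E c et) = act ?N (sc c 1) (?f et)" if "et : hom E X Y" for et c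
  using that nap(1)[of et reg v] nap_ops(3)[of reg et v c] v by (simp_all add: hom_def)
 have fz: "?f (zro E X Y) = zer ?N" by (rule nap_ops(5)[OF reg Xl Y v])
 have fa: "?f (add E et ep) = pls ?N (?f et) (?f ep)" if "et : hom E X Y" "ep : hom E X Y" for et ep
  using that nap_ops(2)[of reg et ep v] v by (simp add: hom_def)
 have "ksub sc ?N (?f ` V)"
  unfolding ksub_def
 proof (intro conjI ballI allI)
  show "?f ` V <= carr ?N" by (rule image_subsetI) (rule f(1)[OF subsetD[OF V(1)]])
  show "zer ?N : ?f ` V" by (rule image_eqI[where f = ?f, OF _ V(2)]) (rule fz[symmetric])
  show "pls ?N x y : ?f ` V" if xy: "x : ?f ` V" "y : ?f ` V" for x y
  proof -
   obtain et ep where h: "et : V" "ep : V" "x = ?f et" "y = ?f ep" using xy by blast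
   have "pls ?N x y = ?f (add E et ep)"
    unfolding h(3,4) by (rule fa[OF subsetD[OF V(1) h(1)] subsetD[OF V(1) h(2)], symmetric])
   then show ?thesis using imageI[of "add E et ep" V ?f] bspec[OF bspec[OF V(3) h(1)] h(2)] by (simp only:)
  qed
  show "act ?N (sc c 1) x : ?f ` V" if x: "x : ?f ` V" for c x
  proof -
   obtain et where h: "et : V" "x = ?f et" using x by (rule imageE)
   have "act ?N (sc c 1) x = ?f (scl E c et)" unfolding h(2) by (rule f(2)[OF subsetD[OF V(1) h(1)], symmetric])
   then show ?thesis using imageI[of "scl E c et" V ?f] bspec[OF spec[OF V(4)] h(1), of c] by (simp only:)
  qed
 qed
 moreover have "?f ` V <= kspan sc ?N S" unfolding S(3)[symmetric] by (rule image_subsetI) (rule f(1)[OF subsetD[OF V(1)]])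
 ultimately have "EX T. finite T & T <= ?f ` V & ?f ` V <= kspan sc ?N T"
  by (rule ksub_fin[OF small_modulesD(1)[OF N] S(1,2)])
 then obtain T where T: "finite T" "T <= ?f ` V" "?f ` V <= kspan sc ?N T" by (elim exE conjE)
 from finite_subset_image[OF T(1,2)] obtain U where U: "U <= V" "finite U" "T = ?f ` U" by (elim exE conjE) (rule that)
 have Uh: "U <= hom E X Y" using U V by blast
 have o: "X : obj E" "Y : obj E" using Xl Y by simp_all
 have "EX et : espan E U X Y. ?f et = t" if "t : kspan sc ?N T" for t
  using that
 proof induction
  case zer
  show ?case by (rule bexI[OF _ espan.zero]) (rule fz)
 next
  case (step w x c)
  have "x : ?f ` U" using step(2) U(3) by (simp only:)
  then obtain u where u: "x = ?f u" "u : U" by (rule imageE)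
  obtain et where et: "et : espan E U X Y" "?f et = w" using step(3) by (rule bexE)
  note h = et u(2,1)
  have uh: "u : hom E X Y" "et : hom E X Y" by (rule subsetD[OF Uh h(3)]) (rule E.espan_hom[OF h(1) Uh o])
  have sh: "scl E c u : hom E X Y" using uh by (simp add: hom_def)
  show ?case by (rule bexI[OF _ espan.step[OF h(1,3), of c]]) (use fa[OF sh uh(2)] f(2)[OF uh(1)] h in simp)
 qed
 note lift = this
 have "et : espan E U X Y" if et: "et : V" for et
 proof -
  from lift[OF subsetD[OF T(3) imageI[OF et]]] obtain ep where ep: "ep : espan E U X Y" "?f ep = ?f et" by (rule bexE)
  have "ep = et" by (rule inj[OF E.espan_hom[OF ep(1) Uh o] subsetD[OF V(1) et] ep(2)])
  then show ?thesis using ep(1) by simp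
 qed
 then show ?thesis using U(1,2) by blast
qed

lemma gens_generated: 
 assumes "W : gens" obtains v where "generated W v"
 using assms generated_id generated_T[OF one_idem one_idem] unfolding gens_def by blast

lemma gencat_CB: "gencat (CB sc) gens"
proof -
 have "addcat (full_subcat E OM)" unfolding OM_eq by (rule EA.addcat_closure)
 then interpret C: addcat "CB sc" unfolding CB_def .
 show ?thesis
 proof unfold_locales
  show "gens <= obj (CB sc)" using gens_OM by simp
  show "finite gens" by (simp add: gens_def)
  show "idt (CB sc) X : thru (CB sc) gens X X" if "X : obj (CB sc)" for X
   using that thru_CB[of X X gens] gens_OM OM_thru[of X] by simp
  fix W Y V assume W: "W : gens" and Y: "Y : obj (CB sc)"
   and V: "V <= hom (CB sc) W Y" "zro (CB sc) W Y : V" "ALL u : V. ALL v : V. add (CB sc) u v : V" "ALL c. ALL u : V. scl (CB sc) c u : V"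
  obtain v where v: "generated W v" by (rule gens_generated[OF W])
  have "EX U. finite U & U <= V & V <= espan E U W Y"
  proof (rule generated_span[OF v])
   show "lin Y" using Y OM_lin by simp
   show "V <= hom E W Y" using V(1) by (auto simp: hom_CB split: if_splits)
   show "zro E W Y : V" "ALL u : V. ALL v : V. add E u v : V" "ALL c. ALL u : V. scl E c u : V" using V(2-4) by simp_all
  qed
  then show "EX U. finite U & U <= V & V <= espan (CB sc) U W Y" unfolding CB_def espan_full_subcat .
 qed
qed

sublocale C: gencat "CB sc" gens by (rule gencat_CB)

lemma retract_CB: "retract (CB sc) X Y \<longleftrightarrow> retract E X Y & Y : OM"
proof
 assume "retract (CB sc) X Y"
 then show "retract E X Y & Y : OM" unfolding retract_def by (auto simp: hom_CB split: if_splits)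
next
 assume r: "retract E X Y & Y : OM"
 then have "X : OM" using OM_retract by blast
 then show "retract (CB sc) X Y" using r unfolding retract_def by (auto simp: hom_CB)
qed

lemma is_loc_CB:
 assumes "is_loc E X" "X : OM" shows "is_loc (CB sc) X"
proof -
 have iso: "is_iso (CB sc) a" if "is_iso E a" "src E a = X" "tgt E a = X" for a
  using that assms(2) by (auto simp: is_iso_def hom_CB)
 have "~ is_zero (CB sc) X" using assms unfolding is_loc_def C.is_zero_iff E.is_zero_iff by simp
 moreover have "is_iso (CB sc) a \<or> is_iso (CB sc) b"
  if "a : hom (CB sc) X X" "b : hom (CB sc) X X" "add (CB sc) a b = idt (CB sc) X" for a b
 proof -
  have t: "a : arr E" "src E a = X" "tgt E a = X" "b : arr E" "src E b = X" "tgt E b = X"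
   using that(1,2) assms(2) unfolding hom_CB by (simp_all add: hom_def)
  have "is_iso E a \<or> is_iso E b" by (rule E.is_locD[OF assms(1) _ t]) (use that(3) in simp)
  then show ?thesis using iso t by blast
 qed
 ultimately show ?thesis using assms(2) unfolding is_loc_def by simp
qed

end

section \<open>Endomorphisms of tensor functors\<close>

text \<open>Passing from an error r to -r r: repeated, this inverts 1 plus a nilpotent endomorphism
  without a geometric series.\<close>

lemma (in precat) unipotent:
 assumes "r : hom C X X"
 shows "(idt C X +. r) *. (idt C X +. -.r) = idt C X +. -.(r *. r)"
  and "(idt C X +. -.r) *. (idt C X +. r) = idt C X +. -.(r *. r)"
proof -
 have r: "r : arr C" "src C r = X" "tgt C r = X" and X: "X : obj C" using assms src_obj by (auto simp: hom_def)
 have 1: "-.r +. (r +. -.(r *. r)) = -.(r *. r)" "r +. (-.r +. -.(r *. r)) = -.(r *. r)"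
  using r X add_neg[of r X X] by (simp_all add: add_assoc[symmetric] add_commute[of "-.r" r])
 show "(idt C X +. r) *. (idt C X +. -.r) = idt C X +. -.(r *. r)"
  using r X 1 by (simp add: add_cmp cmp_add cmp_scl scl_add add_assoc)
 have "(idt C X +. -.r) *. (idt C X +. r) = (idt C X +. -.r) +. (r +. -.(r *. r))"
  using r X by (subst cmp_add) (simp_all add: add_cmp scl_cmp)
 then show "(idt C X +. -.r) *. (idt C X +. r) = idt C X +. -.(r *. r)"
  using r X 1 by (simp add: add_assoc)
qed

context fdalg begin

text \<open>The elementary endomorphisms a \<otimes> c of bidegree (p, q) for the powers of the two
  radicals.\<close>

definition MU :: "'b \<Rightarrow> 'b \<Rightarrow> nat \<Rightarrow> nat \<Rightarrow> (('k, 'b) smod, ('k, 'b) smor) transf set" where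
 "MU e f p q = {et \<in> hom E (TF e f) (TF e f). EX a : radp e p. EX c : radp f q.
   ALL M : SM. ALL x. ALL m : carr M. nap et M (tau e f M x m) = tau e f M (x * a) (act M c m)}"

text \<open>The filtration of the endomorphism ring by total radical degree. Composition adds
  degrees and a late enough term is zero, so the first term consists of nilpotent maps.\<close>

inductive_set J :: "'b \<Rightarrow> 'b \<Rightarrow> nat \<Rightarrow> (('k, 'b) smod, ('k, 'b) smor) transf set" for e f k where
 zero: "zro E (TF e f) (TF e f) : J e f k"
| step: "et : MU e f p q ==> k \<le> p + q ==> ze : J e f k ==> add E et ze : J e f k"

lemma radp_sc: "y : radp e p ==> primitive_idempotent e ==> sc c y : radp e p"
 unfolding radp_def using sc_corner by (auto, metis sc_mult(2))

context
 fixes e f :: 'b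
 assumes pe: "primitive_idempotent e" and pf: "primitive_idempotent f"
begin

lemmas ef = prim_idem[OF pe] prim_idem[OF pf]
abbreviation "TT \<equiv> TF e f"
abbreviation "tt \<equiv> tau e f"
lemmas linT = lin_TF[OF ef]

lemma MU_hom: "et : MU e f p q ==> et : hom E TT TT"
 by (simp add: MU_def)

lemma MU_I:
 assumes "et : hom E TT TT" "a : radp e p" "c : radp f q"
  "!!M x m. M : SM ==> m : carr M ==> nap et M (tt M x m) = tt M (x * a) (act M c m)"
 shows "et : MU e f p q"
 using assms unfolding MU_def by blast

lemma MU_ex:
 assumes "a : radp e p" "c : radp f q"
 shows "EX et : MU e f p q. ALL M : SM. ALL x. ALL m : carr M. nap et M (tt M x m) = tt M (x * a) (act M c m)"
proof -
 have a: "x * e * a = x * a" for x using cornerD(1)[OF radp_corner[OF pe assms(1)]] by (simp add: mult.assoc)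
 have c: "c * f = c" by (rule cornerD(2)[OF radp_corner[OF pf assms(2)]])
 obtain et where et: "et : hom E TT TT" "ALL M : SM. ALL x. ALL m : carr M.
   nap et M (tt M x m) = tt M (x * e * a) (act M (c * f) m)" using mu_ex[OF ef ef, of a c] by blast
 have 1: "nap et M (tt M x m) = tt M (x * a) (act M c m)" if "M : SM" "m : carr M" for M x m
  using et(2) that a c by simp
 then show ?thesis using MU_I[OF et(1) assms] by blast
qed

lemma hom_TD:
 assumes "et : hom E TT TT" shows "et : arr E" "src E et = TT" "tgt E et = TT"
 using assms by (simp_all add: hom_def)

lemma J_hom: "et : J e f k ==> et : hom E TT TT"
proof (induction rule: J.induct)
 case zero
 then show ?case using linT by (simp add: hom_def)
next
 case (step et p q ze)
 then show ?case using hom_TD[OF MU_hom[OF step(1)]] hom_TD[OF step(4)] by (simp add: hom_def)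
qed

lemma J_add:
 assumes "et : J e f k" "ze : J e f k" shows "add E et ze : J e f k"
 using assms(1)
proof induction
 case zero
 then show ?case using assms(2) hom_TD[OF J_hom[OF assms(2)]] by simp
next
 case (step vmu p q et)
 have "add E (add E vmu et) ze = add E vmu (add E et ze)"
  by (rule E.add_assoc) (use hom_TD[OF MU_hom[OF step(1)]] hom_TD[OF J_hom[OF step(3)]] hom_TD[OF J_hom[OF assms(2)]] in simp_all)
 then show ?case using J.step[OF step(1,2,4)] by simp
qed

lemma MU_J: "et : MU e f p q ==> k \<le> p + q ==> et : J e f k"
 using J.step[OF _ _ J.zero, of et e f p q k] hom_TD[OF MU_hom, of et p q] by simp

lemma J_mono: "et : J e f l ==> k \<le> l ==> et : J e f k"
 by (induction rule: J.induct) (auto intro: J.intros)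

lemma MU_cmp:
 assumes "et : MU e f p q" "ze : MU e f p' q'" shows "cmp E et ze : MU e f (p' + p) (q + q')"
proof -
 obtain a c where 1: "a : radp e p" "c : radp f q"
  "!!M x m. M : SM ==> m : carr M ==> nap et M (tt M x m) = tt M (x * a) (act M c m)" using assms(1) unfolding MU_def by blast
 obtain a' c' where 2: "a' : radp e p'" "c' : radp f q'"
  "!!M x m. M : SM ==> m : carr M ==> nap ze M (tt M x m) = tt M (x * a') (act M c' m)" using assms(2) unfolding MU_def by blast
 note t = hom_TD[OF MU_hom[OF assms(1)]] hom_TD[OF MU_hom[OF assms(2)]]
 show ?thesis
 proof (rule MU_I)
  show "cmp E et ze : hom E TT TT" using t by (simp add: hom_def)
  show "a' * a : radp e (p' + p)" by (rule radp_mult[OF pe 2(1) 1(1)])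
  show "c * c' : radp f (q + q')" by (rule radp_mult[OF pf 1(2) 2(2)])
  fix M :: "('k, 'b) smod" and x m assume M: "M : SM" and m: "m : carr M"
  have "nap (cmp E et ze) M (tt M x m) = nap et M (nap ze M (tt M x m))"
   by (rule nap_ops(1)[OF M]) (use t T_carr[OF ef M m] in simp_all)
  also have "\<dots> = nap et M (tt M (x * a') (act M c' m))" using 2(3)[OF M m] by simp
  also have "\<dots> = tt M (x * a' * a) (act M c (act M c' m))" by (rule 1(3)[OF M]) (use m M in simp)
  finally show "nap (cmp E et ze) M (tt M x m) = tt M (x * (a' * a)) (act M (c * c') m)" using m M by (simp add: mult.assoc)
 qed
qed

lemma MU_J_cmp:
 assumes "et : MU e f p q" "k \<le> p + q" "ze : J e f l" shows "cmp E et ze : J e f (k + l)"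
 using assms(3)
proof induction
 case zero
 note t = hom_TD[OF MU_hom[OF assms(1)]]
 have "cmp E et (zro E TT TT) = zro E TT TT" using t linT E.cmp_zro[of et TT TT] by simp
 then show ?case using J.zero by simp
next
 case (step vmu p' q' ze)
 note t = hom_TD[OF MU_hom[OF assms(1)]] hom_TD[OF MU_hom[OF step(1)]] hom_TD[OF J_hom[OF step(3)]]
 have "cmp E et (add E vmu ze) = add E (cmp E et vmu) (cmp E et ze)" using t by (simp add: E.cmp_add)
 moreover have "k + l \<le> p' + p + (q + q')" using assms(2) step(2) by simp
 ultimately show ?case using J.step[OF MU_cmp[OF assms(1) step(1)] _ step(4)] by simp
qed

lemma J_cmp:
 assumes "et : J e f k" "ze : J e f l" shows "cmp E et ze : J e f (k + l)"
 using assms(1)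
proof induction
 case zero
 note t = hom_TD[OF J_hom[OF assms(2)]]
 have "cmp E (zro E TT TT) ze = zro E TT TT" using t linT E.zro_cmp[of ze TT TT] by simp
 then show ?case using J.zero by simp
next
 case (step vmu p q et)
 note t = hom_TD[OF MU_hom[OF step(1)]] hom_TD[OF J_hom[OF step(3)]] hom_TD[OF J_hom[OF assms(2)]]
 have "cmp E (add E vmu et) ze = add E (cmp E vmu ze) (cmp E et ze)" using t by (simp add: E.add_cmp)
 then show ?case using J_add[OF MU_J_cmp[OF step(1,2) assms(2)] step(4)] by simp
qed

lemma MU_scl:
 assumes "et : MU e f p q" shows "scl E c et : MU e f p q"
proof -
 obtain a d where 1: "a : radp e p" "d : radp f q"
  "!!M x m. M : SM ==> m : carr M ==> nap et M (tt M x m) = tt M (x * a) (act M d m)" using assms unfolding MU_def by blast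
 note t = hom_TD[OF MU_hom[OF assms]]
 show ?thesis
 proof (rule MU_I[OF _ radp_sc[OF 1(1) pe, of c] 1(2)])
  show "scl E c et : hom E TT TT" using t by (simp add: hom_def)
  fix M :: "('k, 'b) smod" and x m assume M: "M : SM" and m: "m : carr M"
  have dm: "act M d m : carr M" using m M by simp
  have "nap (scl E c et) M (tt M x m) = act (fobj TT M) (sc c 1) (nap et M (tt M x m))"
   using nap_ops(3)[OF M t(1), of "tt M x m" c] T_carr[OF ef M m] t by simp
  also have "\<dots> = act (fobj TT M) (sc c 1) (tt M (x * a) (act M d m))" using 1(3)[OF M m] by simp
  also have "\<dots> = tt M (sc c 1 * (x * a)) (act M d m)" by (rule T_act[OF ef M dm])
  finally show "nap (scl E c et) M (tt M x m) = tt M (x * sc c a) (act M d m)" by simp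
 qed
qed

lemma J_scl: "et : J e f k ==> scl E c et : J e f k"
proof (induction rule: J.induct)
 case zero
 then show ?case using linT J.zero by simp
next
 case (step vmu p q et)
 have "scl E c (add E vmu et) = add E (scl E c vmu) (scl E c et)"
  by (rule E.scl_add) (use hom_TD[OF MU_hom[OF step(1)]] hom_TD[OF J_hom[OF step(3)]] in simp_all)
 then show ?case using J.step[OF MU_scl[OF step(1)] step(2,4)] by simp
qed

text \<open>A total degree of d1 + d2 forces one of the two factors into a vanishing power.\<close>

lemma J_zero: "EX d. J e f d <= {zro E TT TT}"
proof -
 obtain d1 where d1: "!!p. p \<ge> d1 ==> radp e p <= {0}" using radp_zero[OF pe] by blast
 obtain d2 where d2: "!!p. p \<ge> d2 ==> radp f p <= {0}" using radp_zero[OF pf] by blast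
 have MU0: "vmu = zro E TT TT" if mu: "vmu : MU e f p q" and pq: "d1 + d2 \<le> p + q" for vmu p q
 proof -
  obtain a c where 1: "a : radp e p" "c : radp f q"
   "!!M x m. M : SM ==> m : carr M ==> nap vmu M (tt M x m) = tt M (x * a) (act M c m)" using mu unfolding MU_def by blast
  have "d1 \<le> p \<or> d2 \<le> q" using pq by linarith
  then have ac: "a = 0 \<or> c = 0" using d1 d2 1 by blast
  show ?thesis
  proof (rule T_eqI[OF ef MU_hom[OF mu]])
   show "zro E TT TT : hom E TT TT" using linT by (simp add: hom_def)
   fix M :: "('k, 'b) smod" and x m assume M: "M : SM" and m: "m : carr M"
   have "tt M (x * a) (act M c m) = zer (fobj TT M)"
    using ac T_zero_left[OF ef M, of "act M c m"] T_zero_right[OF ef M] m M by auto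
   then show "nap vmu M (tt M x m) = nap (zro E TT TT) M (tt M x m)"
    using 1(3)[OF M m] nap_ops(5)[OF M linT linT T_carr[OF ef M m]] by simp
  qed
 qed
 have "et = zro E TT TT" if "et : J e f (d1 + d2)" for et
  using that
 proof induction
  case (step vmu p q ze)
  then show ?case using MU0[OF step(1,2)] linT by simp
 qed simp
 then show ?thesis by blast
qed

text \<open>Cut a and c down to the corners and write a' = k e + n, c' = l f + n' with n and n'
  radical. Then a' \<otimes> c' = kl (e \<otimes> f) + e \<otimes> k n' + n \<otimes> c', and the
  last two terms have degree at least 1.\<close>

lemma mu_decompose:
 "EX et : hom E TT TT. (EX k. EX ze : J e f 1. et = add E (scl E k (idt E TT)) ze) &
  (ALL M : SM. ALL x. ALL m : carr M. nap et M (tt M x m) = tt M (x * e * a) (act M (c * f) m))"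
proof -
 define a' c' where "a' = e * a * e" and "c' = f * c * f"
 have cc: "a' : corner e" "c' : corner f"
  using ef unfolding a'_def c'_def corner_def by (simp_all add: mult.assoc) (simp_all flip: mult.assoc)
 obtain k n where n: "n : rad e" "a' = sc k e + n" by (rule corner_decompose[OF pe cc(1)])
 obtain l n' where n': "n' : rad f" "c' = sc l f + n'" by (rule corner_decompose[OF pf cc(2)])
 have "e : radp e 0" "c' : radp f 0" using radp_0[OF pe] radp_0[OF pf] e_corner[OF pe] cc by simp_all
 obtain vmu1 where vmu1: "vmu1 : MU e f 0 1"
  "!!M x m. M : SM ==> m : carr M ==> nap vmu1 M (tt M x m) = tt M (x * e) (act M (sc k n') m)"
  using MU_ex[OF \<open>e : radp e 0\<close> radp_1[OF pf rad_sc[OF pf n'(1), of k]]] by blast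
 obtain vmu2 where vmu2: "vmu2 : MU e f 1 0"
  "!!M x m. M : SM ==> m : carr M ==> nap vmu2 M (tt M x m) = tt M (x * n) (act M c' m)"
  using MU_ex[OF radp_1[OF pe n(1)] \<open>c' : radp f 0\<close>] by blast
 define ze where "ze = add E vmu1 vmu2"
 have ze: "ze : J e f 1" unfolding ze_def by (rule J_add[OF MU_J[OF vmu1(1)] MU_J[OF vmu2(1)]]) simp_all
 note t = hom_TD[OF MU_hom[OF vmu1(1)]] hom_TD[OF MU_hom[OF vmu2(1)]] hom_TD[OF J_hom[OF ze]]
 define si where "si = scl E (k * l) (idt E TT)"
 have s: "si : arr E" "src E si = TT" "tgt E si = TT" using linT by (simp_all add: si_def)
 show ?thesis
 proof (intro bexI[of _ "add E si ze"] conjI ballI allI)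
  show "add E si ze : hom E TT TT" using s t by (simp add: hom_def)
  show "EX k. EX ze' : J e f 1. add E si ze = add E (scl E k (idt E TT)) ze'" using ze unfolding si_def by blast
  fix M :: "('k, 'b) smod" and x m assume M: "M : SM" and m: "m : carr M"
  have Mm: "left_module M" using M by simp
  note z = T_carr[OF ef M m]
  let ?p = "pls (fobj TT M)" and ?c = "act M c' m"
  have cm: "?c : carr M" using m M by simp
  have g: "abelian_grp (fobj TT M)" using T_module[OF ef M] by simp
  have n1: "nap si M (tt M x m) = tt M x (act M (sc (k * l) 1) m)"
   unfolding si_def using nap_ops(3)[OF M, of "idt E TT" "tt M x m" "k * l"] nap_ops(4)[OF M linT z] linT z T_scale[OF ef M m] by simp
  have n2: "nap ze M (tt M x m) = ?p (tt M (x * e) (act M (sc k n') m)) (tt M (x * n) ?c)"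
   unfolding ze_def using nap_ops(2)[OF M t(1,4)] t z vmu1(2)[OF M m] vmu2(2)[OF M m] by simp
  have lhs: "nap (add E si ze) M (tt M x m) =
    ?p (tt M x (act M (sc (k * l) 1) m)) (?p (tt M (x * e) (act M (sc k n') m)) (tt M (x * n) ?c))"
   using nap_ops(2)[OF M s(1) t(7)] s t z n1 n2 by simp
  have "tt M (x * e * a) (act M (c * f) m) = tt M (x * a') ?c"
  proof -
   have "x * a' = x * e * a * e" by (simp add: a'_def mult.assoc)
   moreover have "act M f (act M (c * f) m) = ?c" using m Mm by (simp add: c'_def mult.assoc)
   ultimately show ?thesis using T_e[OF ef M, of "x * e * a"] T_f[OF ef M, of "act M (c * f) m" "x * e * a"] m Mm by simp
  qed
  also have "x * a' = sc k (x * e) + x * n" unfolding n(2) by (simp add: distrib_left)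
  also have "tt M (sc k (x * e) + x * n) ?c = ?p (tt M (sc k (x * e)) ?c) (tt M (x * n) ?c)" by (rule T_add_left[OF ef M cm])
  also have "tt M (sc k (x * e)) ?c = tt M (x * e) (act M (sc k 1) ?c)" by (rule T_sc[OF ef M cm])
  also have "act M (sc k 1) ?c = pls M (act M (sc (k * l) f) m) (act M (sc k n') m)"
   unfolding n'(2) using m Mm by (simp add: sc_add(2) act_add act_pls mult.commute[of k])
  also have "tt M (x * e) (pls M (act M (sc (k * l) f) m) (act M (sc k n') m)) =
    ?p (tt M (x * e) (act M (sc (k * l) f) m)) (tt M (x * e) (act M (sc k n') m))"
   by (rule T_add_right[OF ef M]) (use m Mm in simp_all)
  also have "tt M (x * e) (act M (sc (k * l) f) m) = tt M x (act M (sc (k * l) 1) m)"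
   using T_e[OF ef M, of x] T_f[OF ef M, of "act M (sc (k * l) 1) m" x] m Mm by simp
  also have "?p (?p (tt M x (act M (sc (k * l) 1) m)) (tt M (x * e) (act M (sc k n') m))) (tt M (x * n) ?c) =
    ?p (tt M x (act M (sc (k * l) 1) m)) (?p (tt M (x * e) (act M (sc k n') m)) (tt M (x * n) ?c))"
   by (rule pls_assoc[OF g]) (use T_carr[OF ef M] m Mm cm in simp_all)
  finally show "nap (add E si ze) M (tt M x m) = tt M (x * e * a) (act M (c * f) m)" using lhs by simp
 qed
qed

text \<open>An endomorphism is determined by its value at the generator, and that value is a sum of
  pure tensors. Induction over it reduces the claim to the elementary maps of
  \<open>mu_decompose\<close>.\<close>

lemma decompose:
 assumes et: "et : hom E TT TT" shows "EX k. EX ze : J e f 1. et = add E (scl E k (idt E TT)) ze"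
proof -
 let ?P = "%et. EX k. EX ze : J e f 1. et = add E (scl E k (idt E TT)) ze"
 \<comment> \<open>\<open>?Q z\<close> says that the Yoneda map of z has the required decomposition.
   Unlike the claim about one endomorphism it can be proved by induction over sums in z.\<close>
 let ?Q = "%z. EX et : hom E TT TT. ?P et & (ALL M : SM. ALL x. ALL m : carr M.
  nap et M (tt M x m) = act (fobj TT M) (x * e) (ev TT M (act M f m) z))"
 have z: "tval e f et : carr (fobj TT reg)"
  using nap(1)[OF hom_TD(1)[OF et] reg] T_carr[OF ef reg reg_simps(1)] hom_TD[OF et] by simp
 have "?Q (tval e f et)"
  using z
 proof (rule T_induct[OF ef reg])
  fix a m0 assume "m0 : carr reg"
  then obtain c where c: "m0 = rr c" by (rule reg_cases)
  obtain vmu where vmu: "vmu : hom E TT TT" "?P vmu"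
   "!!M x m. M : SM ==> m : carr M ==> nap vmu M (tt M x m) = tt M (x * e * a) (act M (c * f) m)"
   using mu_decompose[of a c] by blast
  show "?Q (tt reg a m0)"
  proof (intro bexI[OF _ vmu(1)] conjI ballI allI)
   show "?P vmu" by (rule vmu(2))
   fix M :: "('k, 'b) smod" and x m assume M: "M : SM" and m: "m : carr M"
   have fm: "act M f m : carr M" "act M c (act M f m) : carr M" using m M by simp_all
   show "nap vmu M (tt M x m) = act (fobj TT M) (x * e) (ev TT M (act M f m) (tt reg a m0))"
    unfolding vmu(3)[OF M m] c ev_T[OF ef M fm(1)] T_act[OF ef M fm(2)] using m M by simp
  qed
 next
  fix y z assume yz: "y : carr (fobj TT reg)" "z : carr (fobj TT reg)" and Qy: "?Q y" and Qz: "?Q z"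
  obtain vmu where vmu: "vmu : hom E TT TT" "?P vmu" "!!M x m. M : SM ==> m : carr M ==>
   nap vmu M (tt M x m) = act (fobj TT M) (x * e) (ev TT M (act M f m) y)" using Qy by blast
  obtain vnu where vnu: "vnu : hom E TT TT" "?P vnu" "!!M x m. M : SM ==> m : carr M ==>
   nap vnu M (tt M x m) = act (fobj TT M) (x * e) (ev TT M (act M f m) z)" using Qz by blast
  obtain k ze where k: "ze : J e f 1" "vmu = add E (scl E k (idt E TT)) ze" using vmu(2) by blast
  obtain l vxi where l: "vxi : J e f 1" "vnu = add E (scl E l (idt E TT)) vxi" using vnu(2) by blast
  note t = hom_TD[OF J_hom[OF k(1)]] hom_TD[OF J_hom[OF l(1)]]
  have "add E vmu vnu = add E (scl E (k + l) (idt E TT)) (add E ze vxi)"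
   unfolding k(2) l(2) using t linT E.add_left_commute[of ze "scl E l (idt E TT)" vxi] by (simp add: E.add_scl E.add_assoc)
  then have P: "?P (add E vmu vnu)" using J_add[OF k(1) l(1)] by blast
  show "?Q (pls (fobj TT reg) y z)"
  proof (intro bexI[of _ "add E vmu vnu"] conjI ballI allI P)
   note h = hom_TD[OF vmu(1)] hom_TD[OF vnu(1)]
   show "add E vmu vnu : hom E TT TT" using h by (simp add: hom_def)
   fix M :: "('k, 'b) smod" and x m assume M: "M : SM" and m: "m : carr M"
   have fm: "act M f m : carr M" using m M by simp
   note c = ev_carr[OF linT M fm yz(1)] ev_carr[OF linT M fm yz(2)]
   have "nap (add E vmu vnu) M (tt M x m) = pls (fobj TT M) (nap vmu M (tt M x m)) (nap vnu M (tt M x m))"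
    using nap_ops(2)[OF M h(1,4)] h T_carr[OF ef M m] by simp
   then show "nap (add E vmu vnu) M (tt M x m) = act (fobj TT M) (x * e) (ev TT M (act M f m) (pls (fobj TT reg) y z))"
    unfolding ev_pls_right[OF linT M fm yz] act_pls[OF T_module[OF ef M] c] vmu(3)[OF M m] vnu(3)[OF M m] .
  qed
 qed
 then obtain vmu where vmu: "vmu : hom E TT TT" "?P vmu" "!!M x m. M : SM ==> m : carr M ==>
   nap vmu M (tt M x m) = act (fobj TT M) (x * e) (ev TT M (act M f m) (tval e f et))" by blast
 have "et = vmu"
 proof (rule T_eqI[OF ef et vmu(1)])
  fix M :: "('k, 'b) smod" and x m assume M: "M : SM" and m: "m : carr M"
  have fm: "act M f m : carr M" using m M by simp
  have "tt M x m = tt M (x * e) (act M f m)" using T_e[OF ef M] T_f[OF ef M m] by simp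
  then have "nap et M (tt M x m) = nap et M (tt M (x * e) (act M f m))" by (rule arg_cong)
  also have "\<dots> = nap vmu M (tt M x m)" unfolding vmu(3)[OF M m] by (rule nap_T[OF ef et M fm])
  finally show "nap et M (tt M x m) = nap vmu M (tt M x m)" .
 qed
 then show ?thesis using vmu(2) by simp
qed

text \<open>After division by k, a left and a right inverse are improved step by step: at stage d
  the errors lie in term d + 1 of the filtration, which is zero for large d.\<close>

lemma nonzero_scalar_iso:
 assumes k: "k ~= 0" and ze: "ze : J e f 1" shows "is_iso E (add E (scl E k (idt E TT)) ze)"
proof -
 let ?i = "idt E TT"
 let ?et = "add E (scl E k ?i) ze"
 note t = hom_TD[OF J_hom[OF ze]]
 have i: "?i : arr E" "src E ?i = TT" "tgt E ?i = TT" using linT by simp_all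
 have e: "?et : arr E" "src E ?et = TT" "tgt E ?et = TT" using t i by simp_all
 have "EX g : hom E TT TT. EX h : hom E TT TT. EX r : J e f (Suc d). EX s : J e f (Suc d). cmp E ?et g = add E ?i r & cmp E h ?et = add E ?i s" for d
 proof (induction d)
  case 0
  let ?g = "scl E (1 / k) ?i"
  have "cmp E ?et ?g = add E ?i (scl E (1 / k) ze)" "cmp E ?g ?et = add E ?i (scl E (1 / k) ze)"
   using t i k by (simp_all add: E.add_cmp E.cmp_add E.cmp_scl E.scl_cmp E.scl_scl E.scl_add)
  moreover have "?g : hom E TT TT" using i by (simp add: hom_def)
  moreover have "scl E (1 / k) ze : J e f (Suc 0)" using J_scl[OF ze] by simp
  ultimately show ?case by blast
 next
  case (Suc d)
  then obtain g h r s where gh: "g : hom E TT TT" "h : hom E TT TT" and rs: "r : J e f (Suc d)" "s : J e f (Suc d)"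
   and eq: "cmp E ?et g = add E ?i r" "cmp E h ?et = add E ?i s" by blast
  note g = hom_TD[OF gh(1)] hom_TD[OF gh(2)] and r = hom_TD[OF J_hom[OF rs(1)]] hom_TD[OF J_hom[OF rs(2)]]
  let ?g = "cmp E g (add E ?i (scl E (-1) r))" and ?h = "cmp E (add E ?i (scl E (-1) s)) h"
  have "cmp E ?et ?g = cmp E (cmp E ?et g) (add E ?i (scl E (-1) r))" by (rule E.cmp_assoc[symmetric]) (use e g r i in simp_all)
  then have 1: "cmp E ?et ?g = add E ?i (scl E (-1) (cmp E r r))" unfolding eq E.unipotent(1)[OF J_hom[OF rs(1)]] .
  have "cmp E ?h ?et = cmp E (add E ?i (scl E (-1) s)) (cmp E h ?et)" by (rule E.cmp_assoc) (use e g r i in simp_all)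
  then have 2: "cmp E ?h ?et = add E ?i (scl E (-1) (cmp E s s))" unfolding eq E.unipotent(2)[OF J_hom[OF rs(2)]] .
  have "scl E (-1) (cmp E r r) : J e f (Suc (Suc d))" "scl E (-1) (cmp E s s) : J e f (Suc (Suc d))"
   using J_mono[OF J_scl[OF J_cmp[OF rs(1) rs(1)]]] J_mono[OF J_scl[OF J_cmp[OF rs(2) rs(2)]]] by simp_all
  moreover have "?g : hom E TT TT" "?h : hom E TT TT" using g r i by (simp_all add: hom_def)
  ultimately show ?case using 1 2 by blast
 qed
 note ex = this
 obtain d where d: "J e f d <= {zro E TT TT}" using J_zero by blast
 obtain g h r s where gh: "g : hom E TT TT" "h : hom E TT TT" and rs: "r : J e f (Suc d)" "s : J e f (Suc d)"
  and eq: "cmp E ?et g = add E ?i r" "cmp E h ?et = add E ?i s" using ex[of d] by blast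
 have "r = zro E TT TT" "s = zro E TT TT" using J_mono[OF rs(1), of d] J_mono[OF rs(2), of d] d by auto
 then have eq: "cmp E ?et g = ?i" "cmp E h ?et = ?i" using eq i by simp_all
 note g = hom_TD[OF gh(1)] hom_TD[OF gh(2)]
 have "cmp E (cmp E h ?et) g = cmp E h (cmp E ?et g)" by (rule E.cmp_assoc) (use e g in simp_all)
 then have "g = h" unfolding eq using g by simp
 show ?thesis by (rule E.is_isoI[OF e(1) g(1)]) (use e g eq \<open>g = h\<close> in simp_all)
qed

text \<open>A functional with value 1 at e contracts e \<otimes> f \<otimes> 1 to f, which is not
  0.\<close>

lemma T_nonzero: "~ is_zero E TT"
proof
 assume "is_zero E TT"
 then have id: "idt E TT = zro E TT TT" by (rule E.is_zeroD)
 have r1: "rr 1 : carr reg" by simp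
 note z = T_carr[OF ef reg r1, of e]
 have "tt reg e (rr 1) = zer (fobj TT reg)"
  using nap_ops(4)[OF reg linT z] nap_ops(5)[OF reg linT linT z] id by simp
 moreover obtain vph where vph: "lfun vph" "vph e = 1" by (rule functional[OF prim_nonzero[OF pe]])
 obtain L where L: "additive (fobj TT reg) reg (L reg)"
  "!!y m. m : carr reg ==> L reg (tt reg y m) = act reg (sc (vph (y * e)) 1) (act reg f m)"
  using contraction_ex[OF ef vph(1)] reg by metis
 have "L reg (zer (fobj TT reg)) = zer reg"
  by (rule additive_zer[OF L(1)]) (use T_module[OF ef reg] small_modulesD(1)[OF reg] in simp_all)
 moreover have "zer reg = rr 0" using zero_act[of reg "rr 1"] small_modulesD(1)[OF reg] by simp
 ultimately have "rr f = rr 0" using L(2)[OF r1, of e] vph(2) ef by simp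
 then show False using prim_nonzero[OF pf] by simp
qed

text \<open>If the scalar part of a is nonzero, a is invertible; otherwise b = 1 - a has scalar part
  1.\<close>

lemma T_local: "is_loc E TT"
 unfolding is_loc_def
proof (intro conjI ballI impI T_nonzero)
 show "TT : obj E" using linT by simp
 fix a b assume a: "a : hom E TT TT" and b: "b : hom E TT TT" and ab: "add E a b = idt E TT"
 obtain k ze where k: "ze : J e f 1" "a = add E (scl E k (idt E TT)) ze" using decompose[OF a] by blast
 note t = hom_TD[OF J_hom[OF k(1)]] hom_TD[OF a] hom_TD[OF b]
 have i: "idt E TT : arr E" "src E (idt E TT) = TT" "tgt E (idt E TT) = TT" using linT by simp_all
 show "is_iso E a \<or> is_iso E b"
 proof (cases "k = 0")
  case True
  then have "a = ze" using k(2) t i by simp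
  have "add E a b = add E a (add E (scl E 1 (idt E TT)) (scl E (-1) ze))"
   unfolding ab unfolding \<open>a = ze\<close> using t i E.add_left_commute[of ze "idt E TT" "scl E (-1) ze"] E.add_neg[of ze TT TT] by simp
  then have "b = add E (scl E 1 (idt E TT)) (scl E (-1) ze)" by (rule E.add_left_cancel) (use t i in simp_all)
  then show ?thesis using nonzero_scalar_iso[OF _ J_scl[OF k(1)], of 1 "-1"] by simp
 next
  case False
  then show ?thesis using nonzero_scalar_iso[OF _ k(1)] k(2) by simp
 qed
qed

end

end

section \<open>Left cells and Duflo involutions of the projective bimodule 2-category\<close>

lemma (in precat) thru_factors:
 assumes "f : thru C H X Z" "X : obj C" "rh : arr C" "tgt C rh = Z" "!!W p. W : H ==> p : hom C W Z ==> factors C rh p"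
 shows "factors C rh f"
 using assms(1)
proof induction
 case zero
 show ?case by (rule factors_zro[OF assms(3,2,4)])
next
 case (step f i W p)
 have Z: "Z : obj C" using assms(3,4) by auto
 have s: "f : arr C" "src C f = X" "tgt C f = Z" "i : arr C" "src C i = X" "tgt C i = W" "p : arr C" "src C p = W" "tgt C p = Z"
  using step thru_hom[OF step(1) assms(2) Z] by (simp_all add: hom_def)
 have "factors C rh (p *. i)" by (rule factors_cmp[OF assms(5)[OF step(4,3)] assms(3)]) (use s in simp_all)
 then show ?case by (intro factors_add step.IH assms(3)) (use s in simp_all)
qed

lemma (in precat) lwh_retract:
 assumes F: "lnf C F" and r: "retract E X Y"
 shows "retract E (cef C F X) (cef C F Y)"
proof -
 obtain i p where ip: "i : hom E X Y" "p : hom E Y X" "cmp E p i = idt E X" using r unfolding retract_def by blast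
 have t: "i : arr E" "src E i = X" "tgt E i = Y" "p : arr E" "src E p = Y" "tgt E p = X" using ip by (simp_all add: hom_def)
 have X: "lnf C X" using hom_E_lin[OF ip(1)] by blast
 have "cmp E (lwh E F p) (lwh E F i) = idt E (cef C F X)"
  using lwh_ops(1)[OF F t(1,4)] lwh_ops(4)[OF F X] t ip(3) by simp
 moreover have "lwh E F i : hom E (cef C F X) (cef C F Y)" "lwh E F p : hom E (cef C F Y) (cef C F X)"
  using lwh_arr[OF F t(1)] lwh_arr[OF F t(4)] t by (simp_all add: hom_def)
 ultimately show ?thesis unfolding retract_def by blast
qed

context fdalg begin

text \<open>By the interchange law F(al) is a retract of G(al) as an arrow, and a section of the
  latter induces one of the former.\<close>

lemma split_epi_retract:
 assumes r: "retract E F G" and al: "al : arr E" and s: "split_epi E (lwh E G al)"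
 shows "split_epi E (lwh E F al)"
proof -
 obtain i p where ip: "i : hom E F G" "p : hom E G F" "cmp E p i = idt E F" using r unfolding retract_def by blast
 have t: "i : arr E" "src E i = F" "tgt E i = G" "p : arr E" "src E p = G" "tgt E p = F" using ip by (simp_all add: hom_def)
 have FG: "lin F" "lin G" using hom_lin[OF ip(1)] by blast+
 let ?X = "src E al" and ?Y = "tgt E al"
 have XY: "lin ?X" "lin ?Y" using arr_E_lin[OF al] .
 note lF = D.lwh_arr[OF FG(1) al] and lG = D.lwh_arr[OF FG(2) al]
 note rp = D.rwh_arr[OF XY(1) t(4)] D.rwh_arr[OF XY(2) t(4)] D.rwh_arr[OF XY(2) t(1)]
 obtain s' where s': "s' : arr E" "src E s' = tgt E (lwh E G al)" "tgt E s' = src E (lwh E G al)" "cmp E (lwh E G al) s' = idt E (tgt E (lwh E G al))"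
  using s by (rule E.split_epiE)
 have s'': "src E s' = cf G ?Y" "tgt E s' = cf G ?X" "cmp E (lwh E G al) s' = idt E (cf G ?Y)" using s' lG by simp_all
 have nat: "cmp E (D.rwh p ?Y) (lwh E G al) = cmp E (lwh E F al) (D.rwh p ?X)" using D.interchange[OF t(4) al] t by simp
 let ?s = "cmp E (D.rwh p ?X) (cmp E s' (D.rwh i ?Y))"
 have "cmp E (lwh E F al) ?s = cmp E (cmp E (lwh E F al) (D.rwh p ?X)) (cmp E s' (D.rwh i ?Y))"
  by (rule E.cmp_assoc[symmetric]) (use lF rp s' s'' t in simp_all)
 also have "\<dots> = cmp E (D.rwh p ?Y) (cmp E (lwh E G al) (cmp E s' (D.rwh i ?Y)))"
  unfolding nat[symmetric] by (rule E.cmp_assoc) (use lF lG rp s' s'' t in simp_all)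
 also have "cmp E (lwh E G al) (cmp E s' (D.rwh i ?Y)) = cmp E (cmp E (lwh E G al) s') (D.rwh i ?Y)"
  by (rule E.cmp_assoc[symmetric]) (use lG rp s' s'' t in simp_all)
 also have "\<dots> = D.rwh i ?Y" unfolding s''(3) using rp t by simp
 also have "cmp E (D.rwh p ?Y) (D.rwh i ?Y) = idt E (cf F ?Y)"
  using D.rwh_ops(1)[OF XY(2) t(1,4)] t ip(3) D.rwh_ops(4)[OF XY(2), of F] by simp
 finally show ?thesis by (intro E.split_epiI[of ?s]) (use lF rp s' s'' t in simp_all)
qed

text \<open>Insert b and contract with a functional that is 1 at b.\<close>

lemma composite_retract:
 assumes a: "a * a = a" and b: "b * b = b" "b ~= 0" and d: "d * d = d"
 shows "retract E (TF a d) (cf (TF a b) (TF b d))"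
proof -
 note ab = a b(1) and bd = b(1) d and ad = a d
 let ?N = "fobj (TF b d)" and ?F = "cf (TF a b) (TF b d)"
 obtain vph where vph: "lfun vph" "vph b = 1" by (rule functional[OF b(2)])
 obtain P where P: "P : hom E ?F (TF a d)" "!!M x y m. M : SM ==> m : carr M ==>
   nap P M (tau a b (?N M) x (tau b d M y m)) = tau a d M x (act M (sc (vph (b * y * b)) 1) m)"
  using composite_contraction[OF ab bd vph(1)] by blast
 have n: "tau b d reg b (rr 1) : carr (?N reg)" by (rule T_carr[OF bd reg]) simp
 obtain I where I: "I : hom E (TF a d) ?F" "!!M x m. M : SM ==> m : carr M ==>
   nap I M (tau a d M x m) = tau a b (?N M) x (ev (TF b d) M (act M d m) (tau b d reg b (rr 1)))"
  using composite_insertion[OF ab d lin_TF[OF bd] n] by blast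
 have t: "P : arr E" "src E P = ?F" "tgt E P = TF a d" "I : arr E" "src E I = TF a d" "tgt E I = ?F"
  using P(1) I(1) by (simp_all add: hom_def)
 have "cmp E P I = idt E (TF a d)"
 proof (rule T_eqI[OF ad])
  show "cmp E P I : hom E (TF a d) (TF a d)" "idt E (TF a d) : hom E (TF a d) (TF a d)" using t lin_TF[OF ad] by (simp_all add: hom_def)
  fix M :: "('k, 'b) smod" and x m assume M: "M : SM" and m: "m : carr M"
  have dm: "act M d m : carr M" using m M by simp
  note z = T_carr[OF ad M m, of x]
  have "nap (cmp E P I) M (tau a d M x m) = nap P M (nap I M (tau a d M x m))" by (rule nap_ops(1)[OF M t(4,1)]) (use t z in simp_all)
  also have "\<dots> = nap P M (tau a b (?N M) x (tau b d M b (act M d m)))"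
   unfolding I(2)[OF M m] ev_T[OF bd M dm] using m M by simp
  also have "\<dots> = tau a d M x (act M (sc (vph (b * b * b)) 1) (act M d m))" by (rule P(2)[OF M dm])
  also have "\<dots> = tau a d M x m" using b vph(2) dm M m T_f[OF ad M m] by simp
  finally show "nap (cmp E P I) M (tau a d M x m) = nap (idt E (TF a d)) M (tau a d M x m)"
   using nap_ops(4)[OF M lin_TF[OF ad] z] by simp
 qed
 then show ?thesis unfolding retract_def using I(1) P(1) by blast
qed

text \<open>h amounts to an element u of dY(B). The section lifts c \<otimes> d \<otimes> u along
  G(al) to some z, and a functional with value 1 at c contracts z to an element w of X(B) with al(w)
  = u. The Yoneda map of w gives the factorization.\<close>

lemma split_epi_imp_factors:
 assumes c: "c * c = c" "c ~= 0" and d: "d * d = d" and al: "al : arr E" and s: "split_epi E (lwh E (TF c d) al)"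
  and h: "h : hom E (TF d 1) (tgt E al)"
 shows "factors E al h"
proof -
 note cd = c(1) d and d1 = d one_idem
 let ?G = "TF c d" and ?X = "src E al" and ?Y = "tgt E al"
 have XY: "lin ?X" "lin ?Y" using arr_E_lin[OF al] .
 note lG = D.lwh_arr[OF lin_TF[OF cd] al]
 obtain s' where s': "s' : arr E" "src E s' = tgt E (lwh E ?G al)" "tgt E s' = src E (lwh E ?G al)" "cmp E (lwh E ?G al) s' = idt E (tgt E (lwh E ?G al))"
  using s by (rule E.split_epiE)
 have s'': "src E s' = cf ?G ?Y" "tgt E s' = cf ?G ?X" "cmp E (lwh E ?G al) s' = idt E (cf ?G ?Y)" using s' lG by simp_all
 have Yr: "fobj ?Y reg : SM" and Xr: "fobj ?X reg : SM" using lin_obj XY by simp_all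
 have lY: "lin (cf ?G ?Y)" by (rule D.lin_comp[OF lin_TF[OF cd] XY(2)])
 have o: "fobj (cf ?G ?Y) reg = fobj ?G (fobj ?Y reg)" "fobj (cf ?G ?X) reg = fobj ?G (fobj ?X reg)"
  by (simp_all add: D.comp_endofun_simps)
 let ?v = "tau d 1 reg 1 (rr 1)"
 define u where "u = nap h reg ?v"
 have ht: "h : arr E" "src E h = TF d 1" "tgt E h = ?Y" using h by (simp_all add: hom_def)
 have v: "?v : carr (fobj (TF d 1) reg)" by (rule T_carr[OF d1 reg]) simp
 have dv: "act (fobj (TF d 1) reg) d ?v = ?v" using T_act[OF d1 reg, of "rr 1" d 1] T_e[OF d1 reg, of 1 "rr 1"] by simp
 have u: "u : carr (fobj ?Y reg)" unfolding u_def using nap(1)[OF ht(1) reg] v ht by simp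
 have du: "act (fobj ?Y reg) d u = u" unfolding u_def using nap(3)[OF ht(1) reg, of ?v d] v ht dv by simp
 let ?y = "tau c d (fobj ?Y reg) c u"
 have y: "?y : carr (fobj (cf ?G ?Y) reg)" unfolding o by (rule T_carr[OF cd Yr u])
 define z where "z = nap s' reg ?y"
 have z: "z : carr (fobj ?G (fobj ?X reg))" unfolding z_def using nap(1)[OF s'(1) reg] s'' y o by simp
 define g where "g = fst (snd al) reg"
 have g: "g : arr D" "src D g = fobj ?X reg" "tgt D g = fobj ?Y reg" unfolding g_def using arr_E_at[OF al reg] .
 have na: "nap al reg = ap g" by (simp add: nap_def g_def)
 have "nap (cmp E (lwh E ?G al) s') reg ?y = nap (lwh E ?G al) reg z"
  unfolding z_def by (rule nap_ops(1)[OF reg s'(1) lG(1)]) (use s'' lG y in simp_all)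
 then have "nap (lwh E ?G al) reg z = ?y" unfolding s''(3) using nap_ops(4)[OF reg lY y] by simp
 then have gz: "fap ?G g z = ?y" using nap_ops(6)[OF reg al z] by (simp add: g_def)
 obtain vph where vph: "lfun vph" "vph c = 1" by (rule functional[OF c(2)])
 obtain L where L: "!!M. M : SM ==> additive (fobj (TF c d) M) M (L M)"
  "!!M y m. M : SM ==> m : carr M ==> L M (tau c d M y m) = act M (sc (vph (y * c)) 1) (act M d m)"
  using contraction_ex[OF cd vph(1)] by blast
 define w where "w = L (fobj ?X reg) z"
 have w: "w : carr (fobj ?X reg)" unfolding w_def by (rule additiveD(1)[OF L(1)[OF Xr] z])
 have "L (tgt D g) (fap ?G g z) = ap g (L (src D g) z)"
  by (rule contraction_nat[where vph = vph, OF cd L g(1)]) (use z g in simp_all)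
 then have aw: "nap al reg w = u" unfolding gz g w_def na using L(2)[OF Yr u, of c] c vph(2) du u Yr by simp
 obtain k where k: "k : hom E (TF d 1) ?X" "ALL M : SM. ALL x. ALL m : carr M.
   nap k M (tau d 1 M x m) = act (fobj ?X M) (x * d) (ev ?X M (act M 1 m) w)" using yoneda_ex[OF d1 XY(1) w] by blast
 have kt: "k : arr E" "src E k = TF d 1" "tgt E k = ?X" using k(1) by (simp_all add: hom_def)
 have kv: "nap k reg ?v = act (fobj ?X reg) d w" using k(2) ev_one[OF XY(1) w] by simp
 have "h = cmp E al k"
 proof (rule T_val_eqI[OF d1 h])
  show "cmp E al k : hom E (TF d 1) ?Y" using kt al by (simp add: hom_def)
  have "nap (cmp E al k) reg ?v = nap al reg (nap k reg ?v)" by (rule nap_ops(1)[OF reg kt(1) al]) (use kt v in simp_all)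
  also have "\<dots> = act (fobj ?Y reg) d u" unfolding kv using nap(3)[OF al reg w] aw by simp
  finally show "nap h reg ?v = nap (cmp E al k) reg ?v" using du by (simp add: u_def)
 qed
 then show ?thesis using kt ht by (intro E.factorsI[of k]) simp_all
qed

text \<open>The premise \<open>fac\<close> says that dY(B) lies in the image of X(B), so G(al) is
  surjective at B. Transformations out of Bc \<otimes> fB \<otimes> _ therefore lift along G(al).
  The composite of G and Y is built from such functors, so its identity lifts, which is a
  section.\<close>

lemma factors_imp_split_epi:
 assumes c: "c * c = c" and d: "d * d = d" and al: "al : arr E" and Y: "tgt E al : OM"
  and fac: "!!h. h : hom E (TF d 1) (tgt E al) ==> factors E al h"
 shows "split_epi E (lwh E (TF c d) al)"
proof -
 note cd = c d and d1 = d one_idem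
 let ?G = "TF c d" and ?X = "src E al" and ?Y = "tgt E al"
 let ?l = "lwh E ?G al"
 have XY: "lin ?X" "lin ?Y" using arr_E_lin[OF al] .
 note lG = D.lwh_arr[OF lin_TF[OF cd] al]
 have Yr: "fobj ?Y reg : SM" and Xr: "fobj ?X reg : SM" using lin_obj XY by simp_all
 have o: "fobj (cf ?G ?Y) reg = fobj ?G (fobj ?Y reg)" "fobj (cf ?G ?X) reg = fobj ?G (fobj ?X reg)"
  by (simp_all add: D.comp_endofun_simps)
 define g where "g = fst (snd al) reg"
 have g: "g : arr D" "src D g = fobj ?X reg" "tgt D g = fobj ?Y reg" unfolding g_def using arr_E_at[OF al reg] .
 have na: "nap al reg = ap g" by (simp add: nap_def g_def)
 let ?v = "tau d 1 reg 1 (rr 1)"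
 have v: "?v : carr (fobj (TF d 1) reg)" by (rule T_carr[OF d1 reg]) simp
 have img: "EX w : carr (fobj ?X reg). ap g w = act (fobj ?Y reg) d u" if u: "u : carr (fobj ?Y reg)" for u
 proof -
  obtain h where h: "h : hom E (TF d 1) ?Y" "ALL M : SM. ALL x. ALL m : carr M.
   nap h M (tau d 1 M x m) = act (fobj ?Y M) (x * d) (ev ?Y M (act M 1 m) u)" using yoneda_ex[OF d1 XY(2) u] by blast
  have hv: "nap h reg ?v = act (fobj ?Y reg) d u" using h(2) ev_one[OF XY(2) u] by simp
  have ht: "h : arr E" "src E h = TF d 1" using h(1) by (simp_all add: hom_def)
  obtain k where k: "k : arr E" "src E k = TF d 1" "tgt E k = ?X" "h = cmp E al k"
   using fac[OF h(1)] ht(2) by (rule E.factorsE_src)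
  have "nap (cmp E al k) reg ?v = nap al reg (nap k reg ?v)" by (rule nap_ops(1)[OF reg k(1) al]) (use k(2,3) v in simp_all)
  then have "ap g (nap k reg ?v) = act (fobj ?Y reg) d u" unfolding k(4)[symmetric] hv na by (rule sym)
  moreover have "nap k reg ?v : carr (fobj ?X reg)" using nap(1)[OF k(1) reg] k(2,3) v by simp
  ultimately show ?thesis by blast
 qed
 have onto: "EX z' : carr (fobj ?G (fobj ?X reg)). fap ?G g z' = z" if "z : carr (fobj ?G (fobj ?Y reg))" for z
  using that
 proof (rule T_induct[OF cd Yr])
  fix x u assume u: "u : carr (fobj ?Y reg)"
  obtain w where w: "w : carr (fobj ?X reg)" "ap g w = act (fobj ?Y reg) d u" using img[OF u] by blast
  have "fap ?G g (tau c d (fobj ?X reg) x w) = tau c d (fobj ?Y reg) x u"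
   using T_fap[OF cd g w(1), of x] w(2) T_f[OF cd Yr u, of x] by simp
  then show "EX z' : carr (fobj ?G (fobj ?X reg)). fap ?G g z' = tau c d (fobj ?Y reg) x u" using T_carr[OF cd Xr w(1)] by blast
 next
  fix y z assume "EX z' : carr (fobj ?G (fobj ?X reg)). fap ?G g z' = y" "EX z' : carr (fobj ?G (fobj ?X reg)). fap ?G g z' = z"
  then obtain y' z' where yz: "y' : carr (fobj ?G (fobj ?X reg))" "fap ?G g y' = y" "z' : carr (fobj ?G (fobj ?X reg))" "fap ?G g z' = z" by blast
  have "fap ?G g (pls (fobj ?G (fobj ?X reg)) y' z') = pls (fobj ?G (fobj ?Y reg)) y z"
   using fap(2)[OF lin_TF[OF cd] g(1), of y' z'] yz g by simp
  moreover have "pls (fobj ?G (fobj ?X reg)) y' z' : carr (fobj ?G (fobj ?X reg))" using yz T_module[OF cd Xr] by simp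
  ultimately show "EX z' : carr (fobj ?G (fobj ?X reg)). fap ?G g z' = pls (fobj ?G (fobj ?Y reg)) y z" by blast
 qed
 \<comment> \<open>Needed for f = d and f = 1, the two functors from which
   \<open>composite_left_thru\<close> builds the composite.\<close>
 have lift: "factors E ?l t" if f: "f * f = f" and t: "t : hom E (TF c f) (cf ?G ?Y)" for t f
 proof -
  note cf' = c f
  let ?w = "tau c f reg 1 (rr 1)" and ?r = "act reg f (rr 1)"
  have lX: "lin (cf ?G ?X)" by (rule D.lin_comp[OF lin_TF[OF cd] XY(1)])
  have tt: "t : arr E" "src E t = TF c f" "tgt E t = cf ?G ?Y" using t by (simp_all add: hom_def)
  have w: "?w : carr (fobj (TF c f) reg)" by (rule T_carr[OF cf' reg]) simp
  have r: "?r : carr reg" by simp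
  have tw: "nap t reg ?w : carr (fobj ?G (fobj ?Y reg))" using nap(1)[OF tt(1) reg] w tt o by simp
  obtain z' where z': "z' : carr (fobj ?G (fobj ?X reg))" "fap ?G g z' = nap t reg ?w" using onto[OF tw] by blast
  have z'': "z' : carr (fobj (cf ?G ?X) reg)" using z'(1) o by simp
  obtain k where k: "k : hom E (TF c f) (cf ?G ?X)" "ALL M : SM. ALL x. ALL m : carr M.
   nap k M (tau c f M x m) = act (fobj (cf ?G ?X) M) (x * c) (ev (cf ?G ?X) M (act M f m) z')" using yoneda_ex[OF cf' lX z''] by blast
  have kt: "k : arr E" "src E k = TF c f" "tgt E k = cf ?G ?X" using k(1) by (simp_all add: hom_def)
  have kw: "nap k reg ?w = act (fobj (cf ?G ?X) reg) (1 * c) (ev (cf ?G ?X) reg ?r z')" using k(2) by simp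
  have lh: "?l : hom E (cf ?G ?X) (cf ?G ?Y)" using lG by (simp add: hom_def)
  have lz: "nap ?l reg z' = nap t reg ?w" using nap_ops(6)[OF reg al z'(1)] z'(2) by (simp add: g_def)
  have ec: "ev (cf ?G ?X) reg ?r z' : carr (fobj (cf ?G ?X) reg)" by (rule ev_carr[OF lX reg r z''])
  have "t = cmp E ?l k"
  proof (rule T_val_eqI[OF cf' t])
   show "cmp E ?l k : hom E (TF c f) (cf ?G ?Y)" using kt lG by (simp add: hom_def)
   have "nap (cmp E ?l k) reg ?w = nap ?l reg (nap k reg ?w)" by (rule nap_ops(1)[OF reg kt(1) lG(1)]) (use kt lG w in simp_all)
   also have "\<dots> = act (fobj (cf ?G ?Y) reg) (1 * c) (nap ?l reg (ev (cf ?G ?X) reg ?r z'))"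
    unfolding kw using nap(3)[OF lG(1) reg, of "ev (cf ?G ?X) reg ?r z'" "1 * c"] ec lG by simp
   also have "nap ?l reg (ev (cf ?G ?X) reg ?r z') = ev (cf ?G ?Y) reg ?r (nap t reg ?w)"
    unfolding nap_ev[OF lh reg r z''] lz ..
   also have "act (fobj (cf ?G ?Y) reg) (1 * c) (ev (cf ?G ?Y) reg ?r (nap t reg ?w)) = nap t reg (tau c f reg (1 * c) ?r)"
    by (rule nap_T[OF cf' t reg r, symmetric])
   also have "tau c f reg (1 * c) ?r = ?w" unfolding T_e[OF cf' reg] by (rule T_f[OF cf' reg]) simp
   finally show "nap t reg ?w = nap (cmp E ?l k) reg ?w" by (rule sym)
  qed
  then show ?thesis using kt tt lG by (intro E.factorsI[of k]) simp_all
 qed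
 have "factors E ?l (idt E (cf ?G ?Y))"
 proof (rule E.thru_factors[OF composite_left_thru[OF cd Y]])
  show "cf ?G ?Y : obj E" using D.lin_comp[OF lin_TF[OF cd] XY(2)] by simp
  show "factors E ?l p" if "W : {TF c d, TF c 1}" "p : hom E W (cf ?G ?Y)" for W p
   using that lift[OF d, of p] lift[OF one_idem, of p] by auto
 qed (use lG in simp_all)
 then show ?thesis using E.split_epi_iff_factors[OF lG(1)] lG by simp
qed

lemma factors_CB:
 assumes al: "al : arr (CB sc)" and t: "src E t : OM" shows "factors (CB sc) al t \<longleftrightarrow> factors E al t"
proof
 assume "factors E al t"
 then obtain h where h: "h : arr E" "src E h = src E t" "tgt E h = src E al" "t = cmp E al h" by (rule E.factorsE)
 have "h : arr (CB sc)" using h(1-3) al t by simp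
 then show "factors (CB sc) al t" by (rule C.factorsI) (use h(2-4) in "simp_all only: CB_simps")
next
 assume "factors (CB sc) al t"
 then obtain h where h: "h : arr (CB sc)" "src (CB sc) h = src (CB sc) t" "tgt (CB sc) h = src (CB sc) al" "t = cmp (CB sc) al h"
  by (rule C.factorsE)
 have "h : arr E" using h(1) by simp
 then show "factors E al t" by (rule E.factorsI) (use h(2-4) in "simp_all only: CB_simps")
qed

lemma split_epi_CB:
 assumes "al : arr (CB sc)" shows "split_epi (CB sc) al \<longleftrightarrow> split_epi E al"
 using assms by (simp add: split_epi_def hom_CB)

section \<open>The left cell of the j-th idempotent and its Duflo data\<close>

context
 fixes e :: "nat \<Rightarrow> 'b" and n j :: nat
 assumes cii: "complete_irredundant_idempotents n e" and j: "j : {1..n}"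
begin

lemma prim: "i : {1..n} ==> primitive_idempotent (e i)" and idem: "i : {1..n} ==> e i * e i = e i"
 and nonzero: "i : {1..n} ==> e i ~= 0" and sum_e: "(\<Sum>i\<in>{1..n}. e i) = 1"
 using cii unfolding complete_irredundant_idempotents_def primitive_idempotent_def by simp_all

abbreviation "GG i \<equiv> TF (e i) (e j)"
abbreviation "LL \<equiv> L_cell sc n e j"

lemma LL_eq: "LL = {F. EX i : {1..n}. isomorphic (CB sc) F (GG i)}"
 by (simp add: L_cell_def G_mor_def)

lemma GG_OM: "i : {1..n} ==> GG i : OM"
 using OM_T idem j by simp

lemma GG_loc: "i : {1..n} ==> is_loc (CB sc) (GG i)"
 using is_loc_CB T_local prim j GG_OM by simp

lemma indec_retract:
 assumes "indecomposable (CB sc) X" "retract (CB sc) G X" "~ is_zero (CB sc) G" shows "isomorphic (CB sc) X G"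
 by (rule C.indecomposable_retract[OF assms C.complement])

lemma GG_nonzero: "i : {1..n} ==> ~ is_zero (CB sc) (GG i)"
 using GG_loc unfolding is_loc_def by blast

lemma left_geI:
 assumes "H : OM" "F : OM" "retract E X (cf H F)" shows "left_ge (CB sc) X F"
proof -
 have "retract (CB sc) X (cf H F)" using assms OM_comp by (simp add: retract_CB)
 then have "direct_summand (CB sc) X (hcmp (CB sc) H F)" using C.retract_summand by simp
 then show ?thesis unfolding left_ge_def using assms(1) by auto
qed

text \<open>Every composite of H with G_jj is a summand of a sum of G_ij, as B is the sum of the
  Be_i. Some G_ij is therefore a retract of X, and indecomposability makes it all of X.\<close>

lemma left_ge_imp_LL:
 assumes ind: "indecomposable (CB sc) X" and ge: "left_ge (CB sc) X (GG j)" shows "X : LL"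
proof -
 obtain H where H: "H : OM" "direct_summand (CB sc) X (cf H (GG j))" using ge unfolding left_ge_def by auto
 have r: "retract (CB sc) X (cf H (GG j))" by (rule C.direct_summand_retract[OF H(2)])
 note ej = idem[OF j]
 have X: "X : OM" "~ is_zero (CB sc) X" using ind unfolding indecomposable_def by simp_all
 let ?H = "GG ` {1..n}"
 have "idt E (cf H (GG j)) : thru E ?H (cf H (GG j)) (cf H (GG j))"
 proof (rule E.thru_trans[OF composite_right_thru[OF ej ej H(1)]])
  show "cf H (GG j) : obj E" "cf H (GG j) : obj E" using OM_lin[OF OM_comp[OF H(1) GG_OM[OF j]]] by simp_all
  fix W assume "W : {TF (e j) (e j), TF 1 (e j)}"
  then show "idt E W : thru E ?H W W"
   using thru_self[of "GG j" ?H] lin_TF[OF ej ej] j T_split_thru[of "{1..n}" e "e j"] idem sum_e by auto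
 qed
 then have "idt E X : thru E ?H X X" using E.retract_thru r unfolding retract_CB by blast
 then have "idt (CB sc) X : thru (CB sc) ?H X X" using thru_CB[OF X(1,1), of ?H] image_subsetI[of "{1..n}" GG OM, OF GG_OM] by simp
 then have "EX W : ?H. retract (CB sc) W X"
 proof (rule C.retract_of_thru_local)
  show "X : obj (CB sc)" using X(1) by simp
  show "~ is_zero (CB sc) X" by (rule X(2))
  show "is_loc (CB sc) W" if "W : ?H" for W using that by (elim imageE) (simp only: GG_loc)
 qed
 then obtain i where i: "i : {1..n}" "retract (CB sc) (GG i) X" by blast
 show ?thesis unfolding LL_eq using indec_retract[OF ind i(2) GG_nonzero[OF i(1)]] i(1) by blast
qed

lemma LL_OM: "F : LL ==> F : OM"
 unfolding LL_eq using C.isomorphic_obj by fastforce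

lemma LL_retract:
 assumes "F : LL" obtains i where "i : {1..n}" "retract E F (GG i)" "retract E (GG i) F"
proof -
 obtain i where i: "i : {1..n}" "isomorphic (CB sc) F (GG i)" using assms unfolding LL_eq by blast
 show ?thesis
  by (rule that[OF i(1)]) (use C.isomorphic_retract[OF i(2)] C.isomorphic_retract[OF C.isomorphic_sym[OF i(2)]] in "simp_all add: retract_CB")
qed

lemma GG_LL: "GG j : LL"
 unfolding LL_eq using j C.isomorphic_refl[of "GG j"] GG_OM[OF j] by auto

lemma LL_indecomposable: "F : LL ==> indecomposable (CB sc) F"
 unfolding LL_eq using C.is_loc_iso[OF GG_loc] C.is_loc_indecomposable by blast

text \<open>G_ij is a summand of G_ij after G_jj, and G_jj one of G_ji after G_ij; both are
  instances of \<open>composite_retract\<close>.\<close>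

lemma left_cell_LL: "left_cell (CB sc) LL"
 unfolding left_cell_def
proof (intro exI[of _ "GG j"] conjI equalityI subsetI)
 note ej = idem[OF j]
 show "indecomposable (CB sc) (GG j)" by (rule LL_indecomposable[OF GG_LL])
 fix X assume X: "X : LL"
 obtain i where i: "i : {1..n}" "retract E X (GG i)" "retract E (GG i) X" by (rule LL_retract[OF X])
 note ei = idem[OF i(1)]
 have 1: "left_ge (CB sc) X (GG j)"
  by (rule left_geI[OF OM_T[OF ei ej] GG_OM[OF j] E.retract_trans[OF i(2) composite_retract[OF ei ej nonzero[OF j] ej]]])
 have 2: "left_ge (CB sc) (GG j) X"
  by (rule left_geI[OF OM_T[OF ej ei] LL_OM[OF X] E.retract_trans[OF composite_retract[OF ej ei nonzero[OF i(1)] ej] D.lwh_retract[OF lin_TF[OF ej ei] i(3)]]])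
 show "X : {G. indecomposable (CB sc) G & left_ge (CB sc) G (GG j) & left_ge (CB sc) (GG j) G}"
  using LL_indecomposable[OF X] 1 2 by blast
next
 fix X assume "X : {G. indecomposable (CB sc) G & left_ge (CB sc) G (GG j) & left_ge (CB sc) (GG j) G}"
 then show "X : LL" using left_ge_imp_LL by blast
qed

text \<open>F is exchanged for an isomorphic G_ij, to which the two factorization criteria apply;
  the test functor does not depend on i.\<close>

lemma LL_zero:
 assumes F: "F : LL" and al: "al : arr (CB sc)"
 shows "is_zero (abelianization (CB sc)) (lwh (CB sc) F al) \<longleftrightarrow> (ALL d : hom (CB sc) (TF (e j) 1) (tgt (CB sc) al). factors (CB sc) al d)"
proof -
 obtain i where i: "i : {1..n}" "retract E F (GG i)" "retract E (GG i) F" by (rule LL_retract[OF F])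
 note ei = idem[OF i(1)] and ej = idem[OF j]
 have a: "al : arr E" "src E al : OM" "tgt E al : OM" using al by simp_all
 have FO: "F : OM" by (rule LL_OM[OF F])
 have D1: "TF (e j) 1 : OM" by (rule OM_T[OF ej one_idem])
 have l: "lwh E F al : arr (CB sc)"
  using D.lwh_arr[OF OM_lin[OF FO] a(1)] OM_comp[OF FO a(2)] OM_comp[OF FO a(3)] by simp
 have "is_zero (abelianization (CB sc)) (lwh (CB sc) F al) \<longleftrightarrow> split_epi (CB sc) (lwh E F al)" using C.is_zero_ab_iff[of "lwh E F al"] l by simp
 also have "\<dots> \<longleftrightarrow> split_epi E (lwh E F al)" by (rule split_epi_CB[OF l])
 also have "\<dots> \<longleftrightarrow> split_epi E (lwh E (GG i) al)" using split_epi_retract[OF i(2) a(1)] split_epi_retract[OF i(3) a(1)] by blast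
 also have "\<dots> \<longleftrightarrow> (ALL d : hom E (TF (e j) 1) (tgt E al). factors E al d)"
  using split_epi_imp_factors[OF ei nonzero[OF i(1)] ej a(1)] factors_imp_split_epi[OF ei ej a(1,3)] by blast
 also have "\<dots> \<longleftrightarrow> (ALL d : hom (CB sc) (TF (e j) 1) (tgt (CB sc) al). factors (CB sc) al d)"
 proof -
  have "factors (CB sc) al d \<longleftrightarrow> factors E al d" if "d : hom E (TF (e j) 1) (tgt E al)" for d
   by (rule factors_CB[OF al]) (use that D1 in "simp add: hom_def")
  then show ?thesis using D1 a by (simp add: hom_CB)
 qed
 finally show ?thesis .
qed

text \<open>The counit is the multiplication xe_j \<otimes> e_j \<otimes> m \<mapsto> xe_jm, the
  Yoneda map of e_j. An arrow from Be_j \<otimes> _ to the identity sends xe_j \<otimes> m to xe_jbm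
  for some b in B, so it is this multiplication after xe_j \<otimes> m \<mapsto> xe_j \<otimes> e_j
  \<otimes> bm.\<close>

lemma counit_ex:
 "EX ep : hom E (GG j) idf. ep ~= zro E (GG j) idf & (ALL d : hom E (TF (e j) 1) idf. factors E ep d)"
proof -
 note ej = idem[OF j]
 note jj = ej ej and j1 = ej one_idem
 have u: "rr (e j) : carr (fobj idf reg)" by (simp add: idf_obj)
 obtain ep where ep: "ep : hom E (GG j) idf" "ALL M : SM. ALL x. ALL m : carr M.
  nap ep M (tau (e j) (e j) M x m) = act (fobj idf M) (x * e j) (ev idf M (act M (e j) m) (rr (e j)))"
  using yoneda_ex[OF jj D.lin_id u] by blast
 have epv: "nap ep M (tau (e j) (e j) M x m) = act M (x * e j) m" if M: "M : SM" and m: "m : carr M" for M x m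
 proof -
  have c: "act M (e j) m : carr M" using m M by simp
  show ?thesis using ep(2) M m idf_obj[OF M] idf_ev[OF M c] ej by (simp add: mult.assoc)
 qed
 have ept: "ep : arr E" "src E ep = GG j" "tgt E ep = idf" using ep(1) by (simp_all add: hom_def)
 have "ep ~= zro E (GG j) idf"
 proof
  assume z: "ep = zro E (GG j) idf"
  have r1: "rr 1 : carr reg" by simp
  have "nap ep reg (tau (e j) (e j) reg 1 (rr 1)) = zer (fobj idf reg)"
   unfolding z by (rule nap_ops(5)[OF reg lin_TF[OF jj] D.lin_id T_carr[OF jj reg r1]])
  then have "rr (e j) = zer reg" using epv[OF reg r1, of 1] idf_obj[OF reg] by simp
  also have "zer reg = rr 0" using zero_act[of reg "rr 1"] small_modulesD(1)[OF reg] by simp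
  finally show False using nonzero[OF j] by simp
 qed
 moreover have "factors E ep d" if d: "d : hom E (TF (e j) 1) idf" for d
 proof -
  have dt: "d : arr E" "src E d = TF (e j) 1" "tgt E d = idf" using d by (simp_all add: hom_def)
  let ?v = "tau (e j) 1 reg 1 (rr 1)"
  have "nap d reg ?v : carr (fobj idf reg)" using nap(1)[OF dt(1) reg] dt T_carr[OF j1 reg reg_simps(1)] by simp
  then have "nap d reg ?v : carr reg" using idf_obj[OF reg] by simp
  then obtain b where b: "nap d reg ?v = rr b" by (rule reg_cases)
  obtain k where k: "k : hom E (TF (e j) 1) (GG j)" "!!M x m. M : SM ==> m : carr M ==>
   nap k M (tau (e j) 1 M x m) = tau (e j) (e j) M (x * e j * e j) (act M (b * 1) m)" using mu_ex[OF j1 jj, of "e j" b] by blast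
  have kt: "k : arr E" "src E k = TF (e j) 1" "tgt E k = GG j" using k(1) by (simp_all add: hom_def)
  have "d = cmp E ep k"
  proof (rule T_eqI[OF j1 d])
   show "cmp E ep k : hom E (TF (e j) 1) idf" using kt ept by (simp add: hom_def)
   fix M :: "('k, 'b) smod" and x m assume M: "M : SM" and m: "m : carr M"
   have bm: "act M b m : carr M" using m M by simp
   have "nap d M (tau (e j) 1 M x m) = nap d M (tau (e j) 1 M (x * e j) m)" unfolding T_e[OF j1 M] ..
   also have "\<dots> = act (fobj idf M) (x * e j) (ev idf M m (rr b))" unfolding nap_T[OF j1 d M m, of "x * e j"] b ..
   also have "\<dots> = act M (x * e j) (act M b m)" unfolding idf_obj[OF M] idf_ev[OF M m] ..
   finally have 1: "nap d M (tau (e j) 1 M x m) = act M (x * e j) (act M b m)" .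
   have "nap (cmp E ep k) M (tau (e j) 1 M x m) = nap ep M (nap k M (tau (e j) 1 M x m))"
    by (rule nap_ops(1)[OF M kt(1) ept(1)]) (use kt ept T_carr[OF j1 M m] in simp_all)
   also have "\<dots> = nap ep M (tau (e j) (e j) M (x * e j * e j) (act M b m))" unfolding k(2)[OF M m] mult_1_right ..
   also have "\<dots> = act M (x * e j * e j * e j) (act M b m)" by (rule epv[OF M bm])
   also have "x * e j * e j * e j = x * e j" using ej by (simp add: mult.assoc)
   finally show "nap d M (tau (e j) 1 M x m) = nap (cmp E ep k) M (tau (e j) 1 M x m)" using 1 by simp
  qed
  then show ?thesis using kt dt ept by (intro E.factorsI[of k]) simp_all
 qed
 ultimately show ?thesis using ep(1) by blast
qed

lemma duflo_data_CB: "EX ep rh. duflo_data (CB sc) LL (TF (e j) 1) (GG j) ep rh"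
proof -
 note ej = idem[OF j]
 obtain ep where ep: "ep : hom E (GG j) idf" "ep ~= zro E (GG j) idf" "!!d. d : hom E (TF (e j) 1) idf ==> factors E ep d"
  using counit_ex by blast
 obtain rh where rh: "rh : arr (CB sc)" "tgt (CB sc) rh = GG j" "~ split_epi (CB sc) rh"
  "!!u. u : arr (CB sc) ==> tgt (CB sc) u = GG j ==> ~ split_epi (CB sc) u ==> factors (CB sc) rh u"
  using C.sink_map[OF GG_loc[OF j]] by blast
 have D1: "TF (e j) 1 : OM" by (rule OM_T[OF ej one_idem])
 have epC: "ep : hom (CB sc) (GG j) idf" using ep(1) GG_OM[OF j] OM_id by (simp add: hom_CB)
 have "duflo_data (CB sc) LL (TF (e j) 1) (GG j) ep rh"
 proof (unfold_locales)
  show "EX Z. is_zero (CB sc) Z" by (rule C.zero_ex)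
  show "ep : hom (CB sc) (GG j) (one (CB sc))" using epC by simp
  show "ep ~= zro (CB sc) (GG j) (one (CB sc))" using ep(2) by simp
  show "is_loc (CB sc) (GG j)" by (rule GG_loc[OF j])
  show "factors (CB sc) ep d" if "d : hom (CB sc) (TF (e j) 1) (one (CB sc))" for d
  proof -
   have d: "d : hom E (TF (e j) 1) idf" using that D1 OM_id by (simp add: hom_CB)
   have "factors (CB sc) ep d \<longleftrightarrow> factors E ep d"
    by (rule factors_CB) (use epC d D1 GG_OM[OF j] OM_id in "simp_all add: hom_def")
   then show ?thesis using ep(3)[OF d] by simp
  qed
  show "retract (CB sc) (GG j) (TF (e j) 1)"
   unfolding retract_CB using T_retract[OF ej ej ej one_idem] ej D1 by simp
  show "GG j : LL" by (rule GG_LL)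
  show "left_cell (CB sc) LL" by (rule left_cell_LL)
  show "isomorphic (CB sc) X (GG j)" if "indecomposable (CB sc) X" "retract (CB sc) (GG j) X" for X
   by (rule indec_retract[OF that GG_nonzero[OF j]])
  show "is_zero (abelianization (CB sc)) (lwh (CB sc) F al) \<longleftrightarrow> (ALL d : hom (CB sc) (TF (e j) 1) (tgt (CB sc) al). factors (CB sc) al d)"
   if "F : LL" "al : arr (CB sc)" for F al by (rule LL_zero[OF that])
 qed (fact rh C.join C.weak_pullback)+
 then show ?thesis by blast
qed

end

end

theorem theorem14:
  fixes sc :: "'k::alg_closed_field \<Rightarrow> 'b::ring_1 \<Rightarrow> 'b"
    and e :: "nat \<Rightarrow> 'b" and n j :: nat
  assumes "fd_algebra sc"
    and "basic_algebra TYPE('b)"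
    and "connected_algebra TYPE('b)"
    and "complete_irredundant_idempotents n e"
    and "1 \<le> j" and "j \<le> n"
  shows "left_cell (CB sc) (L_cell sc n e j) \<and>
    G_mor sc e j j \<in> L_cell sc n e j \<and>
    is_duflo_involution (CB sc) (L_cell sc n e j) (G_mor sc e j j) \<and>
    (\<forall>G. is_duflo_involution (CB sc) (L_cell sc n e j) G \<longrightarrow> isomorphic (CB sc) G (G_mor sc e j j))"
proof -
  interpret fdalg sc by unfold_locales (rule assms(1))
  have j: "j \<in> {1..n}" using assms(5,6) by simp
  obtain ep rh where "duflo_data (CB sc) (L_cell sc n e j) (TF (e j) 1) (TF (e j) (e j)) ep rh"
    using duflo_data_CB[OF assms(4) j] by blast
  then interpret duflo_data "CB sc" "L_cell sc n e j" "TF (e j) 1" "TF (e j) (e j)" ep rh .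
  show ?thesis unfolding G_mor_def using left_cell_LL[OF assms(4) j] GG_LL[OF assms(4) j] is_duflo duflo_unique by blast
qed

end
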